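(* Let $q\ge 5$ be an integer and let $K_q=P(3,-3,q)$ be the 3-stranded pretzel knot. Then the Khovanov homology of $K_q$ with coefficients in $\mathbb{Q}$ is \begin{align*} Kh^0(K_q) &= \mathbb{Q}_{(-1)} \oplus \mathbb{Q}_{(1)},\\ Kh^i(K_q) &= 0 \quad (0 < i \leq q-4),\\ Kh^{q-3}(K_q) &= \mathbb{Q}_{(1+2(q-4))},\\ Kh^{q-2}(K_q) &= \mathbb{Q}_{(5+2(q-4))},\\ Kh^{q-1}(K_q) &= \mathbb{Q}_{(5+2(q-4))},\\ Kh^{q}(K_q) &= \mathbb{Q}_{(7+2(q-4))} \oplus \mathbb{Q}_{(9+2(q-4))},\\ Kh^{q+1}(K_q) &= \mathbb{Q}_{(11+2(q-4))},\\ Kh^{q+2}(K_q) &= \mathbb{Q}_{(11+2(q-4))},\\ Kh^{q+3}(K_q) &= \mathbb{Q}_{(15+2(q-4))}, \end{align*} and $Kh^j(K_q)=0$ for all other values of $j$. (Equalities are isomorphisms of graded $\mathbb{Q}$-vector spaces.)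
   Context: **Smoothings.** The $0$-smoothing of a crossing joins the two regions swept out when the overstrand is rotated counterclockwise until it meets the understrand; the $1$-smoothing is the other one. (For a positive crossing of an oriented link the $0$-smoothing is the oriented one.) **Pretzel links.** For integers $a_1,a_2,a_3$, $P(a_1,a_2,a_3)$ is the link with the standard pretzel diagram: three vertical two-strand columns placed side by side, the $i$-th consisting of $|a_i|$ crossings (half twists) stacked vertically, with the top right end of each column joined to the top left end of the next (cyclically) and likewise at the bottom. The sign of $a_i$ determines the handedness of the twists: in a column with $a_i>0$ the $0$-smoothing of each crossing is the horizontal one (a cup above a cap, cutting the column into an upper and a lower part) and the $1$-smoothing is the vertical one; in a column with $a_i<0$ the roles are exchanged. With this convention the $q$ crossings of the third column of $P(3,-3,q)$ ($q>0$) are positive crossings. **Khovanov homology.** Let $R$ be a commutative ring (here $R=\mathbb{Q}$) and let $A$ be the free graded $R$-module on $\mathbf{1}$ (quantum grading $1$) and $\mathbf{X}$ (quantum grading $-1$); quantum gradings add under tensor product. Subscripts in parentheses denote quantum gradings: $R_{(k)}$ is a copy of $R$ in quantum grading $k$, and $\{k\}$ shifts quantum grading up by $k$. Define $m:A\otimes A\to A$ by $m(\mathbf 1\otimes\mathbf 1)=\mathbf 1$, $m(\mathbf 1\otimes\mathbf X)=m(\mathbf X\otimes\mathbf 1)=\mathbf X$, $m(\mathbf X\otimes\mathbf X)=0$, and $\Delta:A\to A\otimes A$ by $\Delta(\mathbf 1)=\mathbf 1\otimes\mathbf X+\mathbf X\otimes\mathbf 1$, $\Delta(\mathbf X)=\mathbf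 X\otimes\mathbf X$. For an oriented link diagram $D$ with $n$ ordered crossings, each $v\in\{0,1\}^n$ gives a complete smoothing $D_v$, a collection of $k_v$ disjoint circles; let $w(v)$ be the number of $1$'s in $v$ and assign to $v$ the module $A^{\otimes k_v}\{w(v)\}$. Each edge of the cube (changing one $0$ to a $1$) is assigned $m$ or $\Delta$ on the factors of the circles that merge or split (identity on the others), with signs inserted so that all squares anticommute. Let $\overline{CKh}^i(D)=\bigoplus_{w(v)=i}A^{\otimes k_v}\{w(v)\}$ with differential the sum of the edge maps. Let $n_+,n_-$ be the numbers of positive and negative crossings of $D$. The Khovanov homology is $Kh^i(D)=H^{i+n_-}(\overline{CKh}(D))\{n_+-2n_-\}$, a quantum-graded module for each homological degree $i$; up to isomorphism it is a link invariant. *)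

theory Defs
  imports Complex_Main "HOL-Library.FuncSet" "HOL-Library.Function_Algebras"
    "HOL-Library.Set_Algebras"
begin

section \<open>Link diagrams\<close>

text \<open>
  A link diagram is cut at finitely many marked points into crossings and crossingless arcs.
  A crossing is the tuple of its four endpoints in counterclockwise order, starting with an
  endpoint of the understrand, so that (a, b, c, d) has understrand from a to c and overstrand
  from d to b.  An arc is the pair of its endpoints.
\<close>

record 'p diagram =
  crossings :: "('p \<times> 'p \<times> 'p \<times> 'p) list"
  arcs :: "('p \<times> 'p) list"

abbreviation n_crossings :: "'p diagram \<Rightarrow> nat" where
  "n_crossings D \<equiv> length (crossings D)"

definition points :: "'p diagram \<Rightarrow> 'p set" where
  "points D = (\<Union>(a, b, c, d) \<in> set (crossings D). {a, b, c, d})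
     \<union> (\<Union>(p, q) \<in> set (arcs D). {p, q})"

datatype strand = Under nat | Over nat | Arc nat

definition strands :: "'p diagram \<Rightarrow> strand set" where
  "strands D = Under ` {..<n_crossings D} \<union> Over ` {..<n_crossings D}
     \<union> Arc ` {..<length (arcs D)}"

fun strand_ends :: "'p diagram \<Rightarrow> strand \<Rightarrow> 'p \<times> 'p" where
  "strand_ends D (Under k) = (case crossings D ! k of (a, b, c, d) \<Rightarrow> (a, c))"
| "strand_ends D (Over k) = (case crossings D ! k of (a, b, c, d) \<Rightarrow> (d, b))"
| "strand_ends D (Arc k) = arcs D ! k"

text \<open>
  An orientation tells for each strand whether it is traversed from the first to the second
  component of \<^const>\<open>strand_ends\<close>.  Every point is then the start of exactly one strand and
  the end of exactly one strand; in particular exactly two strand ends meet at each point.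
\<close>

definition strand_start :: "'p diagram \<Rightarrow> (strand \<Rightarrow> bool) \<Rightarrow> strand \<Rightarrow> 'p" where
  "strand_start D \<omega> s = (if \<omega> s then fst (strand_ends D s) else snd (strand_ends D s))"

definition strand_end :: "'p diagram \<Rightarrow> (strand \<Rightarrow> bool) \<Rightarrow> strand \<Rightarrow> 'p" where
  "strand_end D \<omega> s = (if \<omega> s then snd (strand_ends D s) else fst (strand_ends D s))"

definition orientation :: "'p diagram \<Rightarrow> (strand \<Rightarrow> bool) \<Rightarrow> bool" where
  "orientation D \<omega> \<longleftrightarrow>
     bij_betw (strand_start D \<omega>) (strands D) (points D) \<and>
     bij_betw (strand_end D \<omega>) (strands D) (points D)"

text \<open>
  Rotating an overstrand directed from d to b counterclockwise until it meets the understrand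
  gives the direction from a to c, so a crossing directed this way is positive; reversing
  exactly one of the two strands makes it negative.
\<close>

definition n_pos :: "'p diagram \<Rightarrow> (strand \<Rightarrow> bool) \<Rightarrow> nat" where
  "n_pos D \<omega> = card {k. k < n_crossings D \<and> \<omega> (Over k) = \<omega> (Under k)}"

definition n_neg :: "'p diagram \<Rightarrow> (strand \<Rightarrow> bool) \<Rightarrow> nat" where
  "n_neg D \<omega> = card {k. k < n_crossings D \<and> \<omega> (Over k) \<noteq> \<omega> (Under k)}"

section \<open>Complete smoothings\<close>

text \<open>
  A vertex of the cube is represented by the set v of the indices of its 1-smoothed crossings.
  The regions swept out by rotating the overstrand of (a, b, c, d) counterclockwise lie between
  the ends b, c and between the ends d, a; joining them leaves the curves ab and cd.
\<close>

fun smoothing_joins :: "bool \<Rightarrow> 'p \<times> 'p \<times> 'p \<times> 'p \<Rightarrow> ('p \<times> 'p) set" where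
  "smoothing_joins False (a, b, c, d) = {(a, b), (c, d)}"
| "smoothing_joins True (a, b, c, d) = {(a, d), (b, c)}"

definition joins :: "'p diagram \<Rightarrow> nat set \<Rightarrow> ('p \<times> 'p) set" where
  "joins D v = set (arcs D) \<union>
     (\<Union>k<n_crossings D. smoothing_joins (k \<in> v) (crossings D ! k))"

text \<open>A circle is represented by the set of marked points it passes through.\<close>

definition circles :: "'p diagram \<Rightarrow> nat set \<Rightarrow> 'p set set" where
  "circles D v = points D // (joins D v \<union> (joins D v)\<inverse>)\<^sup>*"

section \<open>The Khovanov complex\<close>

datatype gen = One | X

fun gen_deg :: "gen \<Rightarrow> int" where
  "gen_deg One = 1"
| "gen_deg X = -1"

text \<open>
  On generators, the product and the coproduct are sums of distinct generators; the following
  are the sets of their summands.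
\<close>

fun mult_terms :: "gen \<Rightarrow> gen \<Rightarrow> gen set" where
  "mult_terms One One = {One}"
| "mult_terms One X = {X}"
| "mult_terms X One = {X}"
| "mult_terms X X = {}"

fun comult_terms :: "gen \<Rightarrow> (gen \<times> gen) set" where
  "comult_terms One = {(One, X), (X, One)}"
| "comult_terms X = {(X, X)}"

text \<open>
  The module at the vertex v is the tensor product of one copy of A for each circle; its basis
  consists of the labellings of the circles by generators.  The direct sum over all vertices is
  represented by the functions from pairs (v, x) to \<open>rat\<close> which vanish outside \<open>gens D\<close>.
\<close>

definition labellings :: "'p diagram \<Rightarrow> nat set \<Rightarrow> ('p set \<Rightarrow> gen) set" where
  "labellings D v = circles D v \<rightarrow>\<^sub>E UNIV"

type_synonym 'p cube_gen = "nat set \<times> ('p set \<Rightarrow> gen)"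
type_synonym 'p chain = "'p cube_gen \<Rightarrow> rat"

definition gens :: "'p diagram \<Rightarrow> 'p cube_gen set" where
  "gens D = Sigma (Pow {..<n_crossings D}) (labellings D)"

text \<open>Quantum degree, including the shift by w(v):\<close>

definition quantum_deg :: "'p diagram \<Rightarrow> 'p cube_gen \<Rightarrow> int" where
  "quantum_deg D = (\<lambda>(v, x). (\<Sum>C\<in>circles D v. gen_deg (x C)) + int (card v))"

text \<open>
  The coefficient of the labelling y in the image of the labelling x under the unsigned edge
  map from v to w: circles in both smoothings keep their labels, and the remaining ones
  either merge (two into one) or split (one into two).
\<close>

definition edge_coeff ::
  "'p diagram \<Rightarrow> nat set \<Rightarrow> nat set \<Rightarrow> ('p set \<Rightarrow> gen) \<Rightarrow> ('p set \<Rightarrow> gen) \<Rightarrow> rat" where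
  "edge_coeff D v w x y = of_bool (
     (\<forall>C \<in> circles D v \<inter> circles D w. x C = y C) \<and>
     ((\<exists>A B C. A \<noteq> B \<and> circles D v - circles D w = {A, B} \<and> circles D w - circles D v = {C}
         \<and> y C \<in> mult_terms (x A) (x B)) \<or>
      (\<exists>A B C. B \<noteq> C \<and> circles D v - circles D w = {A} \<and> circles D w - circles D v = {B, C}
         \<and> (y B, y C) \<in> comult_terms (x A))))"

text \<open>The usual signs: the number of 1-smoothed crossings preceding the one that changes.\<close>

definition edge_sign :: "nat set \<Rightarrow> nat \<Rightarrow> rat" where
  "edge_sign v k = (-1) ^ card {j \<in> v. j < k}"

definition khov_diff :: "'p diagram \<Rightarrow> 'p chain \<Rightarrow> 'p chain" where
  "khov_diff D f = (\<lambda>(w, y).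
     if (w, y) \<in> gens D
     then \<Sum>k\<in>w. \<Sum>x\<in>labellings D (w - {k}).
            edge_sign (w - {k}) k * edge_coeff D (w - {k}) w x y * f (w - {k}, x)
     else 0)"

definition chains :: "'p diagram \<Rightarrow> int \<Rightarrow> int \<Rightarrow> 'p chain set" where
  "chains D i j = {f. \<forall>s. f s \<noteq> 0 \<longrightarrow>
     s \<in> gens D \<and> int (card (fst s)) = i \<and> quantum_deg D s = j}"

definition cycles :: "'p diagram \<Rightarrow> int \<Rightarrow> int \<Rightarrow> 'p chain set" where
  "cycles D i j = {f \<in> chains D i j. khov_diff D f = 0}"

definition boundaries :: "'p diagram \<Rightarrow> int \<Rightarrow> int \<Rightarrow> 'p chain set" where
  "boundaries D i j = khov_diff D ` chains D (i - 1) j"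

section \<open>Khovanov homology as a graded rational vector space\<close>

definition scale_fun :: "rat \<Rightarrow> ('a \<Rightarrow> rat) \<Rightarrow> 'a \<Rightarrow> rat" where
  "scale_fun r f = (\<lambda>s. r * f s)"

text \<open>
  The quotient Z / B is the set of cosets of B; it is isomorphic to V if there is a bijection
  to V which is linear for the operations induced from representatives.
\<close>

definition cosets :: "('a \<Rightarrow> rat) set \<Rightarrow> ('a \<Rightarrow> rat) set \<Rightarrow> ('a \<Rightarrow> rat) set set" where
  "cosets Z B = (\<lambda>z. z +o B) ` Z"

definition quotient_iso ::
  "('a \<Rightarrow> rat) set \<Rightarrow> ('a \<Rightarrow> rat) set \<Rightarrow> ('b \<Rightarrow> rat) set \<Rightarrow> bool" where
  "quotient_iso Z B V \<longleftrightarrow> (\<exists>\<phi>. bij_betw \<phi> (cosets Z B) V \<and>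
     (\<forall>z\<in>Z. \<forall>z'\<in>Z. \<phi> ((z + z') +o B) = \<phi> (z +o B) + \<phi> (z' +o B)) \<and>
     (\<forall>r. \<forall>z\<in>Z. \<phi> (scale_fun r z +o B) = scale_fun r (\<phi> (z +o B))))"

text \<open>
  The part in quantum grading j of the direct sum of one copy of the rationals in quantum
  grading k for each entry k of the list ks:
\<close>

definition graded_sum :: "int list \<Rightarrow> int \<Rightarrow> (nat \<Rightarrow> rat) set" where
  "graded_sum ks j = {f. \<forall>n. f n \<noteq> 0 \<longrightarrow> n < length ks \<and> ks ! n = j}"

text \<open>
  \<open>Kh_iso D \<omega> i ks\<close>: the Khovanov homology of D in homological degree i is isomorphic, as a
  graded vector space, to the direct sum of the rationals in the quantum gradings ks.
\<close>

definition Kh_iso :: "'p diagram \<Rightarrow> (strand \<Rightarrow> bool) \<Rightarrow> int \<Rightarrow> int list \<Rightarrow> bool" where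
  "Kh_iso D \<omega> i ks \<longleftrightarrow> (\<forall>j.
     let i' = i + int (n_neg D \<omega>);
         j' = j - (int (n_pos D \<omega>) - 2 * int (n_neg D \<omega>))
     in quotient_iso (cycles D i' j') (boundaries D i' j') (graded_sum ks j))"

section \<open>Pretzel links\<close>

text \<open>
  The marked point \<open>(i, k, r)\<close> is the left (\<open>r = False\<close>) or right (\<open>r = True\<close>) point of
  column i at level k, counted from the top; crossing k of a column lies between the levels
  k and k + 1.  The counterclockwise order is chosen such that the 0-smoothing is the
  horizontal one for a > 0 and the vertical one for a < 0.
\<close>

type_synonym ppoint = "nat \<times> nat \<times> bool"

definition pretzel_crossing ::
  "int \<Rightarrow> nat \<Rightarrow> nat \<Rightarrow> ppoint \<times> ppoint \<times> ppoint \<times> ppoint" where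
  "pretzel_crossing a i k =
     (let tl = (i, k, False); tr = (i, k, True); bl = (i, Suc k, False); br = (i, Suc k, True)
      in if a > 0 then (tr, tl, bl, br) else (tl, bl, br, tr))"

definition pretzel_column :: "int \<Rightarrow> nat \<Rightarrow> (ppoint \<times> ppoint \<times> ppoint \<times> ppoint) list" where
  "pretzel_column a i = map (pretzel_crossing a i) [0..<nat \<bar>a\<bar>]"

definition pretzel :: "int \<Rightarrow> int \<Rightarrow> int \<Rightarrow> ppoint diagram" where
  "pretzel a b c =
     \<lparr>crossings = pretzel_column a 0 @ pretzel_column b 1 @ pretzel_column c 2,
      arcs =
        [((0, 0, True), (1, 0, False)),
         ((1, 0, True), (2, 0, False)),
         ((2, 0, True), (0, 0, False)),
         ((0, nat \<bar>a\<bar>, True), (1, nat \<bar>b\<bar>, False)),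
         ((1, nat \<bar>b\<bar>, True), (2, nat \<bar>c\<bar>, False)),
         ((2, nat \<bar>c\<bar>, True), (0, nat \<bar>a\<bar>, False))]\<rparr>"

subsection \<open>P(3, -3, q) is orientable\<close>

lemma bij_betw_if_subset_image:
  assumes "finite A" "B \<subseteq> f ` A" "card A = card B"
  shows "bij_betw f A B"
proof -
  have "B = f ` A"
    using assms(2) card_image_le[OF assms(1), of f] assms(1,3) by (intro card_seteq) auto
  then show ?thesis
    using assms by (auto simp: bij_betw_def intro: eq_card_imp_inj_on)
qed

lemma crossings_pretzel_nth:
  "k < 3 \<Longrightarrow> crossings (pretzel 3 (-3) (int m)) ! k = pretzel_crossing 3 0 k"
  "3 \<le> k \<Longrightarrow> k < 6 \<Longrightarrow> crossings (pretzel 3 (-3) (int m)) ! k = pretzel_crossing (-3) 1 (k - 3)"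
  "6 \<le> k \<Longrightarrow> k < 6 + m \<Longrightarrow> crossings (pretzel 3 (-3) (int m)) ! k = pretzel_crossing m 2 (k - 6)"
  by (auto simp: pretzel_def pretzel_column_def nth_append)

lemma points_pretzel:
  "points (pretzel 3 (-3) (int m)) = {0} \<times> {..3} \<times> UNIV \<union> {1} \<times> {..3} \<times> UNIV \<union> {2} \<times> {..m} \<times> UNIV"
  (is "?P = ?Q")
proof
  show "?P \<subseteq> ?Q"
    by (auto simp: points_def pretzel_def pretzel_column_def pretzel_crossing_def Let_def
        split: if_splits)
  have c: "pretzel_crossing 3 0 k \<in> set (crossings (pretzel 3 (-3) (int m)))" if "k < 3" for k
    using that by (simp add: pretzel_def pretzel_column_def)
  have d: "pretzel_crossing (-3) 1 k \<in> set (crossings (pretzel 3 (-3) (int m)))" if "k < 3" for k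
    using that by (simp add: pretzel_def pretzel_column_def)
  have e: "pretzel_crossing m 2 k \<in> set (crossings (pretzel 3 (-3) (int m)))" if "k < m" for k
    using that by (simp add: pretzel_def pretzel_column_def)
  have mem: "{a, b, c, d} \<subseteq> ?P" if "(a, b, c, d) \<in> set (crossings (pretzel 3 (-3) (int m)))" for a b c d
    using UN_upper[OF that, of "\<lambda>(a, b, c, d). {a, b, c, d}"] by (auto simp: points_def)
  have 0: "(0, k, s) \<in> ?P" "(0, Suc k, s) \<in> ?P" if "k < 3" for k s
    using mem[OF c[OF that, unfolded pretzel_crossing_def Let_def, simplified]]
    by (cases s; simp)+
  have 1: "(1, k, s) \<in> ?P" "(1, Suc k, s) \<in> ?P" if "k < 3" for k s
    using mem[OF d[OF that, unfolded pretzel_crossing_def Let_def, simplified]]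
    by (cases s; simp)+
  have "((2, k, True), (2, k, False), (2, Suc k, False), (2, Suc k, True))
      \<in> set (crossings (pretzel 3 (-3) (int m)))" if "k < m" for k
    using e[OF that] that by (simp add: pretzel_crossing_def)
  then have 2: "(2, k, s) \<in> ?P" "(2, Suc k, s) \<in> ?P" if "k < m" for k s
    using mem that by (cases s; force)+
  have 3: "(2, 0, s) \<in> ?P" for s
    by (cases s) (simp_all add: points_def pretzel_def)
  have "(0, k, s) \<in> ?P" if "k \<le> 3" for k s
    using that 0(1)[of 0 s] 0(2)[of "k - 1" s] by (cases k) simp_all
  moreover have "(1, k, s) \<in> ?P" if "k \<le> 3" for k s
    using that 1(1)[of 0 s] 1(2)[of "k - 1" s] by (cases k) simp_all
  moreover have "(2, k, s) \<in> ?P" if "k \<le> m" for k s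
    using that 3[of s] 2(2)[of "k - 1" s] by (cases k) simp_all
  ultimately show "?Q \<subseteq> ?P" by blast
qed

lemma card_points_pretzel: "card (points (pretzel 3 (-3) (int m))) = 2 * (6 + m) + 6"
  unfolding points_pretzel
  by (subst card_Un_disjoint; (subst card_Un_disjoint)?; auto simp: card_cartesian_product)

lemma n_crossings_pretzel: "n_crossings (pretzel 3 (-3) (int m)) = 6 + m"
  by (simp add: pretzel_def pretzel_column_def)

lemma n_arcs_pretzel: "length (arcs (pretzel a b c)) = 6"
  by (simp add: pretzel_def)

lemma strands_pretzel:
  "strands (pretzel 3 (-3) (int m)) = Under ` {..<6+m} \<union> Over ` {..<6+m} \<union> Arc ` {..<6}"
  unfolding strands_def n_crossings_pretzel n_arcs_pretzel ..

lemma card_strands_pretzel: "card (strands (pretzel 3 (-3) (int m))) = 2 * (6 + m) + 6"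
  unfolding strands_pretzel
  by (subst card_Un_disjoint; (subst card_Un_disjoint)?; auto simp: card_image inj_on_def)

text \<open>
  Here ev tells whether q is even.  If so, both strands of the first column run downwards and
  both strands of the second column upwards; otherwise, and always in the third column, the
  two strands of a column are antiparallel.
\<close>

fun std_orient :: "bool \<Rightarrow> strand \<Rightarrow> bool" where
  "std_orient ev (Under k) = (if ev then k < 3 \<or> 6 \<le> k \<and> odd k else odd k)"
| "std_orient ev (Over k) = (if ev then 6 \<le> k \<and> odd k else if 3 \<le> k \<and> k < 6 then even k else odd k)"
| "std_orient ev (Arc k) = (if ev then k \<in> {1, 2, 3} else True)"

lemma strand_end_conv_start: "strand_end D \<omega> = strand_start D (\<lambda>s. \<not> \<omega> s)"
  by (auto simp: strand_end_def strand_start_def fun_eq_iff)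

lemma points_subset_starts:
  fixes m :: nat and r :: bool
  defines "D \<equiv> pretzel 3 (-3) (int m)"
  defines "s \<equiv> strand_start D (\<lambda>x. std_orient (even m) x = r)"
  shows "points D \<subseteq> s ` strands D"
proof -
  have ends:
    "strand_ends D (Under k) = (if k < 3 then ((0, k, True), (0, Suc k, False))
       else if k < 6 then ((1, k - 3, False), (1, Suc (k - 3), True))
       else ((2, k - 6, True), (2, Suc (k - 6), False)))"
    "strand_ends D (Over k) = (if k < 3 then ((0, Suc k, True), (0, k, False))
       else if k < 6 then ((1, k - 3, True), (1, Suc (k - 3), False))
       else ((2, Suc (k - 6), True), (2, k - 6, False)))" if "k < 6 + m" for k
    using that crossings_pretzel_nth[of k m]
    by (auto simp: D_def pretzel_crossing_def Let_def)
  have arcs: "strand_ends D (Arc 0) = ((0, 0, True), (1, 0, False))"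
     "strand_ends D (Arc (Suc 0)) = ((1, 0, True), (2, 0, False))"
     "strand_ends D (Arc 2) = ((2, 0, True), (0, 0, False))"
     "strand_ends D (Arc 3) = ((0, 3, True), (1, 3, False))"
     "strand_ends D (Arc 4) = ((1, 3, True), (2, m, False))"
     "strand_ends D (Arc 5) = ((2, m, True), (0, 3, False))"
    by (simp_all add: D_def pretzel_def)
  define I where "I = s ` strands D"
  have U: "s (Under k) \<in> I" "s (Over k) \<in> I" if "k < 6 + m" for k
    using that by (simp_all add: I_def D_def strands_pretzel)
  have A: "s (Arc k) \<in> I" if "k < 6" for k
    using that by (auto simp: I_def D_def strands_pretzel)
  have s_eq: "s x = (if std_orient (even m) x = r then fst (strand_ends D x) else snd (strand_ends D x))" for x
    by (simp add: s_def strand_start_def)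
  note A6 = A[of 0] A[of 1] A[of 2] A[of 3] A[of 4] A[of 5]
  note [simp del] = strand_ends.simps
  have "(0, k, b) \<in> I" if "k \<le> 3" for k b
  proof (cases "even m")
    case True
    consider "k < 3" "r" | j where "k = Suc j" "j < 3" "\<not> r"
      | "k = 3" "r" | "k = 0" "\<not> r"
      using \<open>k \<le> 3\<close> by (metis Suc_le_eq le_less not0_implies_Suc)
    then show ?thesis
    proof cases
      case 1
      then show ?thesis
        using True U[of k] by (cases b; simp add: s_eq ends arcs)
    next
      case (2 j)
      then show ?thesis
        using True U[of j] by (cases b; simp add: s_eq ends arcs)
    next
      case 3
      then show ?thesis
        using True A6 by (cases b; simp add: s_eq ends arcs)
    next
      case 4
      then show ?thesis
        using True A6 by (cases b; simp add: s_eq ends arcs)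
    qed
  next
    case False
    consider "k < 3" "(odd k = b) = r" | j where "k = Suc j" "j < 3" "(odd k = b) \<noteq> r"
      | "k = 3" "(odd k = b) = r" | "k = 0" "(odd k = b) \<noteq> r"
      using \<open>k \<le> 3\<close> by (metis Suc_le_eq le_less not0_implies_Suc)
    then show ?thesis
    proof cases
      case 1
      then show ?thesis
        using False U[of k] by (cases b; cases r; simp add: s_eq ends arcs)
    next
      case (2 j)
      then show ?thesis
        using False U[of j] by (cases b; cases r; simp add: s_eq ends arcs)
    next
      case 3
      then show ?thesis
        using False A6 by (cases b; cases r; simp add: s_eq ends arcs)
    next
      case 4
      then show ?thesis
        using False A6 by (cases b; cases r; simp add: s_eq ends arcs)
    qed
  qed
  moreover have "(1, k, b) \<in> I" if "k \<le> 3" for k b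
  proof (cases "even m")
    case True
    consider "k < 3" "\<not> r" | j where "k = Suc j" "j < 3" "r"
      | "k = 3" "\<not> r" | "k = 0" "r"
      using \<open>k \<le> 3\<close> by (metis Suc_le_eq le_less not0_implies_Suc)
    then show ?thesis
    proof cases
      case 1
      then show ?thesis
        using True U[of "3 + k"] by (cases b; simp add: s_eq ends arcs)
    next
      case (2 j)
      then show ?thesis
        using True U[of "3 + j"] by (cases b; simp add: s_eq ends arcs)
    next
      case 3
      then show ?thesis
        using True A6 by (cases b; simp add: s_eq ends arcs)
    next
      case 4
      then show ?thesis
        using True A6 by (cases b; simp add: s_eq ends arcs)
    qed
  next
    case False
    consider "k < 3" "(odd k = b) = r" | j where "k = Suc j" "j < 3" "(odd k = b) \<noteq> r"
      | "k = 3" "(odd k = b) = r" | "k = 0" "(odd k = b) \<noteq> r"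
      using \<open>k \<le> 3\<close> by (metis Suc_le_eq le_less not0_implies_Suc)
    then show ?thesis
    proof cases
      case 1
      then show ?thesis
        using False U[of "3 + k"] by (cases b; cases r; simp add: s_eq ends arcs)
    next
      case (2 j)
      then show ?thesis
        using False U[of "3 + j"] by (cases b; cases r; simp add: s_eq ends arcs)
    next
      case 3
      then show ?thesis
        using False A6 by (cases b; cases r; simp add: s_eq ends arcs)
    next
      case 4
      then show ?thesis
        using False A6 by (cases b; cases r; simp add: s_eq ends arcs)
    qed
  qed
  moreover have "(2, k, b) \<in> I" if "k \<le> m" for k b
  proof -
    consider "k < m" "(odd k = b) = r" | j where "k = Suc j" "j < m" "(odd k = b) \<noteq> r"
      | "k = m" "(odd k = b) = r" | "k = 0" "(odd k = b) \<noteq> r"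
      using \<open>k \<le> m\<close> by (metis Suc_le_eq le_less not0_implies_Suc)
    then show ?thesis
    proof cases
      case 1
      then show ?thesis
        using U[of "6 + k"] by (cases r; cases b; cases "even k")
          (auto simp: s_eq ends split: if_splits)
    next
      case (2 j)
      then show ?thesis
        using U[of "6 + j"] by (cases r; cases b; cases "even j")
          (auto simp: s_eq ends split: if_splits)
    next
      case 3
      then show ?thesis
        using A6 by (cases r; cases b; cases "even m") (auto simp: s_eq arcs)
    next
      case 4
      then show ?thesis
        using A6 by (cases r; cases b; cases "even m") (auto simp: s_eq arcs)
    qed
  qed
  ultimately show ?thesis
    unfolding I_def [symmetric] unfolding D_def points_pretzel by auto
qed

lemma orientation_std_orient: "orientation (pretzel 3 (-3) (int m)) (std_orient (even m))"
proof -
  have f: "finite (strands (pretzel 3 (-3) (int m)))" by (simp add: strands_pretzel)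
  have *: "bij_betw (strand_start (pretzel 3 (-3) (int m)) (\<lambda>x. std_orient (even m) x = r))
          (strands (pretzel 3 (-3) (int m))) (points (pretzel 3 (-3) (int m)))" for r
    by (intro bij_betw_if_subset_image f points_subset_starts)
       (simp add: card_strands_pretzel card_points_pretzel)
  show ?thesis
    unfolding orientation_def strand_end_conv_start using *[of True] *[of False] by simp
qed

corollary pretzel_orientable:
  assumes "q \<ge> 0"
  shows "\<exists>\<omega>. orientation (pretzel 3 (-3) q) \<omega>"
  using orientation_std_orient[of "nat q"] assms by auto

end

theory Submission
  imports Defs
begin

text \<open>
  Complete smoothings are compared through the sets of points on circles labelled X, so that the
  Khovanov complex becomes a based complex of subsets. If some crossing of the third column is
  smoothed horizontally, the circles outside the column are those of the link obtained by
  smoothing the whole column horizontally; if none is, they are those of the link with a vertical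
  third column. Both links are read off a fixed diagram with seven crossings, whose rational
  homology is certified by explicit nonsingular triangular minors and cycle-cocycle pairings.

  The horizontal part is filtered by the position k of the lowest horizontal crossing. Merging a
  circle labelled One is invertible, which cancels in each layer all generators except those whose
  first k crossings are horizontal and whose inner circles are labelled X, a shifted copy of the
  seven-crossing complex. Consecutive layers cancel by the difference or the sum of the actions of
  X at the top and the bottom of the column, and the first layer cancels against the vertical part
  by the saddle. Each step gives an upper bound for the Betti numbers; the remaining classes are
  isolated or adjacent pairs, and the pairs survive because a cycle of the vertical subcomplex
  pairs nontrivially with one of its cocycles while the quotient has no homology one degree below.
\<close>

text \<open>Long exact sequences enter only through ranks. Lower bounds for the ranks of the
  differentials bound the Betti numbers from above and add up along a filtration; a connecting map
  is accounted for by one cycle of the quotient that does not extend to a cycle. One per quantum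
  degree is enough, because the links behind the model are small. A horizontally closed column joins
  3 and -3 half twists to a two-component unlink, with homology the tensor square of A in a single
  homological degree. The points 0 and 15 lie on different components, so consecutive layers are
  linked by the sum or difference of the two actions of X, of rank one in each of two quantum
  degrees; the sign follows the parity of the number of horizontal crossings, so one cocycle has to
  detect both. A vertical column gives the square knot (trefoil plus mirror image), with ten
  classes. The bound 5 on q enters at the end: for q = 4 the unnormalized bidegrees (3, 4 - q) and
  (q, q - 4) would share quantum degree 0 in adjacent homological degrees, where the rank bounds
  could not exclude that they cancel.\<close>

abbreviation (input) iff_ascii :: "bool => bool => bool" (infixr "<->" 25) where
  "A <-> B \<equiv> A = B"

section \<open>Ranks of submatrices\<close>

interpretation vs: vector_space "scale_fun :: rat => ('a => rat) => 'a => rat"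
  by unfold_locales (auto simp: scale_fun_def fun_eq_iff algebra_simps)

interpretation vsp: vector_space_pair
  "scale_fun :: rat => ('a => rat) => 'a => rat" "scale_fun :: rat => ('b => rat) => 'b => rat"
  by unfold_locales

abbreviation lin :: "(('a => rat) => ('b => rat)) => bool" where
  "lin \<equiv> Vector_Spaces.linear scale_fun scale_fun"

definition supp_on :: "'a set => ('a => rat) set" where
  "supp_on P = {f. \<forall>x. x \<notin> P --> f x = 0}"

definition unit_vec :: "'a => 'a => rat" where
  "unit_vec p = (\<lambda>x. of_bool (x = p))"

lemma linI:
  assumes "\<And>f g. T (f + g) = T f + T g" "\<And>r f. T (scale_fun r f) = scale_fun r (T f)"
  shows "lin T"
  using assms by (simp add: Vector_Spaces.linear_iff vs.vector_space_axioms)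

lemma subspace_supp_on: "vs.subspace (supp_on P)"
  by (auto simp: vs.subspace_def supp_on_def scale_fun_def)

lemma sum_apply: "(\<Sum>i\<in>I. f i) x = (\<Sum>i\<in>I. f i (x :: 'a) :: rat)"
  by (induction I rule: infinite_finite_induct) auto

lemma supp_on_expand:
  assumes "finite P" "f \<in> supp_on P"
  shows "f = (\<Sum>p\<in>P. scale_fun (f p) (unit_vec p))"
proof
  fix x
  have "(\<Sum>p\<in>P. scale_fun (f p) (unit_vec p)) x = (\<Sum>p\<in>P. f p * of_bool (x = p))"
    by (simp add: sum_apply scale_fun_def unit_vec_def)
  also have "\<dots> = f x"
    using assms by (auto simp: supp_on_def of_bool_def if_distrib sum.delta' cong: if_cong)
  finally show "f x = (\<Sum>p\<in>P. scale_fun (f p) (unit_vec p)) x" ..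
qed

lemma supp_on_span: "finite P ==> supp_on P \<subseteq> vs.span (unit_vec ` P)"
  by (rule subsetI, subst supp_on_expand, assumption, assumption)
     (intro vs.span_sum vs.span_scale vs.span_base imageI)

lemma unit_vec_in: "p \<in> P ==> unit_vec p \<in> supp_on P"
  by (auto simp: supp_on_def unit_vec_def)

lemma inj_unit_vec: "inj_on unit_vec P"
  by (auto simp: inj_on_def unit_vec_def fun_eq_iff)

lemma independent_unit_vec: assumes "finite P" shows "vs.independent (unit_vec ` P)"
proof (rule vs.independent_if_scalars_zero)
  fix f x assume 0: "(\<Sum>x\<in>unit_vec ` P. scale_fun (f x) x) = 0" and "x \<in> unit_vec ` P"
  then obtain p where p: "p \<in> P" "x = unit_vec p" by auto
  have "0 = (\<Sum>x\<in>P. scale_fun (f (unit_vec x)) (unit_vec x)) p"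
    using 0 by (simp add: sum.reindex[OF inj_unit_vec] del: sum_apply)
  also have "\<dots> = (\<Sum>x\<in>P. f (unit_vec x) * of_bool (p = x))"
    by (simp add: sum_apply scale_fun_def unit_vec_def)
  also have "\<dots> = f x" using p assms
    by (auto simp: of_bool_def if_distrib sum.delta' cong: if_cong)
  finally show "f x = 0" ..
qed (use assms in simp)

lemma dim_supp_on: assumes "finite P" shows "vs.dim (supp_on P) = card P"
proof (rule vs.dim_unique[of "unit_vec ` P"])
  show "unit_vec ` P \<subseteq> supp_on P" by (auto intro: unit_vec_in)
  show "card (unit_vec ` P) = card P" by (rule card_image[OF inj_unit_vec])
qed (use assms supp_on_span independent_unit_vec in auto)

text \<open>\<open>vs.dim\<close> is informative only in finite dimension. Support in the finite set
  \<open>P\<close> provides this: the unit vectors of \<open>P\<close> span, so independent sets are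
  finite.\<close>

lemma fd_basis:
  assumes "finite P" "V \<subseteq> supp_on P"
  obtains B where "finite B" "B \<subseteq> V" "vs.independent B" "V \<subseteq> vs.span B" "card B = vs.dim V"
proof -
  obtain B where B: "B \<subseteq> V" "vs.independent B" "V \<subseteq> vs.span B" "card B = vs.dim V"
    using vs.basis_exists by blast
  have "B \<subseteq> vs.span (unit_vec ` P)" using B(1) assms supp_on_span by blast
  then have "finite B" using vs.independent_span_bound[of "unit_vec ` P" B] B(2) assms by auto
  with B that show ?thesis by blast
qed

lemma dim_mono_fd:
  assumes "finite P" "W \<subseteq> supp_on P" "V \<subseteq> vs.span W"
  shows "vs.dim V \<le> vs.dim W"
proof -
  obtain B where B: "finite B" "B \<subseteq> W" "vs.independent B" "W \<subseteq> vs.span B" "card B = vs.dim W"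
    using fd_basis[OF assms(1,2)] by blast
  have "vs.span W \<subseteq> vs.span B" using B(4) vs.span_mono vs.span_span by blast
  then have "V \<subseteq> vs.span B" using assms(3) by blast
  then show ?thesis using B vs.dim_le_card[of V B] by simp
qed

text \<open>A basis \<open>B\<close> of the kernel is extended to a basis \<open>C\<close> of
  \<open>V\<close>. Then \<open>T\<close> is injective on the span of \<open>C - B\<close>, and the
  images of the vectors in \<open>C - B\<close> form a basis of the image of
  \<open>V\<close>.\<close>

lemma rank_nullity:
  fixes T :: "('a => rat) => ('b => rat)"
  assumes "finite P" "V \<subseteq> supp_on P" "vs.subspace V" "lin T"
  shows "vs.dim V = vs.dim (T ` V) + vs.dim {v \<in> V. T v = 0}"
proof -
  interpret T: Vector_Spaces.linear scale_fun scale_fun T by fact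
  let ?K = "{v \<in> V. T v = 0}"
  have "?K \<subseteq> supp_on P" using assms(2) by auto
  then obtain B where B: "finite B" "B \<subseteq> ?K" "vs.independent B" "?K \<subseteq> vs.span B" "card B = vs.dim ?K"
    using fd_basis[OF assms(1)] by blast
  obtain C where C: "B \<subseteq> C" "C \<subseteq> V" "vs.independent C" "V \<subseteq> vs.span C"
    using vs.maximal_independent_subset_extend[of B V] B by blast
  have "C \<subseteq> vs.span (unit_vec ` P)" using C(2) assms(1,2) supp_on_span by blast
  then have fC: "finite C" using vs.independent_span_bound[of "unit_vec ` P" C] C(3) assms(1) by auto
  have dV: "vs.dim V = card C" using C vs.basis_card_eq_dim by metis
  have spC: "vs.span C \<subseteq> V" using C(2) assms(3) vs.span_minimal by blast
  have disj: "v = 0" if vC: "v \<in> vs.span (C - B)" "T v = 0" for v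
  proof -
    have "v \<in> V" using that(1) spC vs.span_mono[of "C - B" C] by auto
    then have "v \<in> vs.span B" using that(2) B(4) by auto
    then obtain f where f: "v = (\<Sum>b\<in>B. scale_fun (f b) b)"
      using vs.span_finite[OF B(1)] by auto
    obtain g where g: "v = (\<Sum>b\<in>C - B. scale_fun (g b) b)"
      using vC(1) unfolding vs.span_finite[OF finite_Diff[OF fC], of B] by auto
    \<comment> \<open>The expansions of \<open>v\<close> over \<open>B\<close> and over
      \<open>C - B\<close> are subtracted; independence of \<open>C\<close> then makes all
      coefficients vanish.\<close>
    define h where "h = (\<lambda>c. if c \<in> B then f c else - g c)"
    have "(\<Sum>c\<in>C. scale_fun (h c) c) = (\<Sum>c\<in>C-B. scale_fun (h c) c) + (\<Sum>c\<in>B. scale_fun (h c) c)"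
      by (rule sum.subset_diff[OF C(1) fC])
    also have "(\<Sum>c\<in>B. scale_fun (h c) c) = v" unfolding f by (rule sum.cong) (auto simp: h_def)
    also have "(\<Sum>c\<in>C-B. scale_fun (h c) c) = - v"
      unfolding g sum_negf[symmetric] by (rule sum.cong) (auto simp: h_def scale_fun_def)
    finally have "(\<Sum>c\<in>C. scale_fun (h c) c) = 0" by (simp add: zero_fun_def)
    then have "\<forall>c\<in>C. h c = 0" using vs.independentD[OF C(3) fC subset_refl] by blast
    then have "f b = 0" if "b \<in> B" for b using C(1) that by (force simp: h_def)
    then show "v = 0" unfolding f by (intro sum.neutral) (auto simp: scale_fun_def)
  qed
  have inj: "inj_on T (vs.span (C - B))"
    unfolding inj_on_def
  proof (intro ballI impI)
    fix x y assume "x \<in> vs.span (C - B)" "y \<in> vs.span (C - B)" "T x = T y"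
    then have "x - y = 0" by (intro disj vs.span_diff) (auto simp: T.diff)
    then show "x = y" by simp
  qed
  have ind: "vs.independent (T ` (C - B))"
    using vsp.linear_independent_injective_image[OF assms(4), of "C - B"]
    by (meson C(3) Diff_subset inj vs.independent_mono)
  have TV: "T ` V \<subseteq> vs.span (T ` (C - B))"
  proof
    fix y assume "y \<in> T ` V"
    then obtain v where v: "v \<in> V" "y = T v" by auto
    obtain f where f: "v = (\<Sum>b\<in>C. scale_fun (f b) b)"
      using v(1) C(4) vs.span_finite[OF fC] by auto
    have "y = (\<Sum>b\<in>C. scale_fun (f b) (T b))"
      unfolding v f by (simp add: T.sum T.scale)
    also have "\<dots> = (\<Sum>b\<in>C - B. scale_fun (f b) (T b))"
      by (rule sum.mono_neutral_right) (use fC B(2) in auto)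
    also have "\<dots> \<in> vs.span (T ` (C - B))"
      by (intro vs.span_sum vs.span_scale vs.span_base) auto
    finally show "y \<in> vs.span (T ` (C - B))" .
  qed
  have "vs.dim (T ` V) = card (T ` (C - B))"
    using vs.basis_card_eq_dim[of "T ` (C - B)" "T ` V"] TV ind C(2) image_mono[of "C - B" V T]
    by (metis Diff_subset subset_trans)
  also have "\<dots> = card (C - B)"
    by (rule card_image, rule inj_on_subset[OF inj]) (auto intro: vs.span_base)
  finally show ?thesis
    using dV B(1,5) C(1) card_mono[OF fC C(1)] by (simp add: card_Diff_subset)
qed

lemma dim_insert_span:
  assumes "finite P" "W \<subseteq> supp_on P" "vs.subspace W" "y \<notin> W"
  shows "vs.dim (insert y W) = vs.dim W + 1"
proof -
  obtain B where B: "finite B" "B \<subseteq> W" "vs.independent B" "W \<subseteq> vs.span B" "card B = vs.dim W"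
    using fd_basis[OF assms(1,2)] by blast
  have "vs.span B \<subseteq> W" using B(2) assms(3) vs.span_minimal by blast
  then have "y \<notin> vs.span B" using assms(4) by auto
  then have "vs.independent (insert y B)" using B(3) vs.independent_insertI by blast
  moreover have "insert y W \<subseteq> vs.span (insert y B)"
    using B(4) vs.span_mono[of B "insert y B"] by (auto intro: vs.span_base)
  ultimately have "card (insert y B) = vs.dim (insert y W)"
    using B(2) by (intro vs.basis_card_eq_dim) auto
  then show ?thesis using B assms(4) by (metis Suc_eq_plus1 card_insert_disjoint subsetD)
qed

definition app :: "('a => 'b => rat) => 'a set => 'b set => ('a => rat) => 'b => rat" where
  "app M P Q f = (\<lambda>q. if q \<in> Q then \<Sum>p\<in>P. f p * M p q else 0)"

text \<open>Rows and columns are selected by the sets \<open>P\<close> and \<open>Q\<close> instead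
  of forming submatrices, so that a single matrix serves all degrees and all pieces of a
  filtration.\<close>

definition rk :: "('a => 'b => rat) => 'a set => 'b set => nat" where
  "rk M P Q = vs.dim (app M P Q ` supp_on P)"

lemma app_add: "app M P Q (f + g) = app M P Q f + app M P Q g"
  by (auto simp: app_def fun_eq_iff sum.distrib algebra_simps)

lemma app_scale: "app M P Q (scale_fun r f) = scale_fun r (app M P Q f)"
  by (auto simp: app_def fun_eq_iff scale_fun_def sum_distrib_left algebra_simps)

lemma lin_app: "lin (app M P Q)"
  by (rule linI) (simp_all add: app_add app_scale)

lemma app_supp_on [simp]: "app M P Q f \<in> supp_on Q"
  by (auto simp: app_def supp_on_def)

lemma app_image_supp_on [simp]: "app M P Q ` S \<subseteq> supp_on Q"
  by auto

lemma subspace_lin_image: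
  assumes "lin T" "vs.subspace V" shows "vs.subspace (T ` V)"
proof -
  interpret T: Vector_Spaces.linear scale_fun scale_fun T by fact
  show ?thesis by (rule T.subspace_image) (rule assms)
qed

lemma subspace_app: "vs.subspace (app M P Q ` supp_on P)"
  by (rule subspace_lin_image[OF lin_app subspace_supp_on])

lemma subspace_kernel: "vs.subspace {f \<in> supp_on P. app M P Q f = 0}"
  using subspace_supp_on[of P]
  by (auto simp: vs.subspace_def app_add app_scale) (auto simp: app_def scale_fun_def fun_eq_iff)

lemma dim_kernel:
  assumes "finite P"
  shows "card P = rk M P Q + vs.dim {f \<in> supp_on P. app M P Q f = 0}"
  using rank_nullity[OF assms subset_refl subspace_supp_on lin_app[of M P Q]] dim_supp_on[OF assms]
  by (simp add: rk_def)

lemma rk_plus_rk_le: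
  assumes "finite O'" "finite P"
    and dd: "\<And>f. f \<in> supp_on O' ==> app M P Q (app M O' P f) = 0"
  shows "rk M O' P + rk M P Q \<le> card P"
proof -
  have "vs.dim (app M O' P ` supp_on O') \<le> vs.dim {f \<in> supp_on P. app M P Q f = 0}"
    using dd by (intro dim_mono_fd[OF assms(2)]) (auto intro!: vs.span_base simp: app_supp_on)
  then show ?thesis using dim_kernel[OF assms(2), of M Q] by (simp add: rk_def)
qed

text \<open>The functional \<open>c\<close> kills the image of the incoming map but not the cycle
  \<open>z\<close>, so \<open>z\<close> is no boundary and the kernel exceeds the image by at least
  one dimension.\<close>

lemma rk_pairing:
  assumes "finite O'" "finite P"
    and dd: "\<And>f. f \<in> supp_on O' ==> app M P Q (app M O' P f) = 0"
    and z: "z \<in> supp_on P" "app M P Q z = 0"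
    and c: "\<And>o'. o' \<in> O' ==> (\<Sum>p\<in>P. M o' p * c p) = 0"
    and cz: "(\<Sum>p\<in>P. z p * c p) \<noteq> 0"
  shows "rk M O' P + rk M P Q + 1 \<le> card P"
proof -
  let ?I = "app M O' P ` supp_on O'"
  have "z \<notin> ?I"
  proof
    assume "z \<in> ?I"
    then obtain f where f: "z = app M O' P f" by auto
    have "(\<Sum>p\<in>P. z p * c p) = (\<Sum>p\<in>P. \<Sum>o'\<in>O'. f o' * (M o' p * c p))"
      unfolding f by (intro sum.cong refl) (simp add: app_def sum_distrib_right mult.assoc)
    also have "\<dots> = (\<Sum>o'\<in>O'. f o' * (\<Sum>p\<in>P. M o' p * c p))"
      by (subst sum.swap) (simp add: sum_distrib_left)
    also have "\<dots> = 0" by (simp add: c)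
    finally show False using cz by simp
  qed
  then have "vs.dim (insert z ?I) = rk M O' P + 1"
    using dim_insert_span[OF assms(2) app_image_supp_on subspace_app] by (simp add: rk_def)
  moreover have "vs.dim (insert z ?I) \<le> vs.dim {f \<in> supp_on P. app M P Q f = 0}"
    using dd z by (intro dim_mono_fd[OF assms(2)]) (auto intro!: vs.span_base simp: app_supp_on)
  ultimately show ?thesis using dim_kernel[OF assms(2), of M Q] by simp
qed

lemma app_Un:
  assumes "finite P1" "finite P2" "P1 \<inter> P2 = {}" "f \<in> supp_on P1" "g \<in> supp_on P2"
  shows "app M (P1 \<union> P2) Q (f + g) = app M P1 Q f + app M P2 Q g"
proof
  fix q
  have "(\<Sum>p\<in>P1 \<union> P2. (f + g) p * M p q) = (\<Sum>p\<in>P1. (f + g) p * M p q) + (\<Sum>p\<in>P2. (f + g) p * M p q)"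
    by (rule sum.union_disjoint) (use assms in auto)
  also have "(\<Sum>p\<in>P1. (f + g) p * M p q) = (\<Sum>p\<in>P1. f p * M p q)"
    by (rule sum.cong) (use assms in \<open>auto simp: supp_on_def\<close>)
  also have "(\<Sum>p\<in>P2. (f + g) p * M p q) = (\<Sum>p\<in>P2. g p * M p q)"
    by (rule sum.cong) (use assms in \<open>auto simp: supp_on_def\<close>)
  finally show "app M (P1 \<union> P2) Q (f + g) q = (app M P1 Q f + app M P2 Q g) q"
    by (simp add: app_def)
qed

lemma zero_supp_on [simp]: "0 \<in> supp_on P"
  by (simp add: supp_on_def)

lemma supp_on_mono: "P \<subseteq> P' ==> supp_on P \<subseteq> supp_on P'"
  by (auto simp: supp_on_def)

definition restr :: "'a set => ('a => rat) => 'a => rat" where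
  "restr P f = (\<lambda>x. if x \<in> P then f x else 0)"

lemma lin_restr: "lin (restr P)"
  by (rule linI) (auto simp: restr_def fun_eq_iff scale_fun_def)

lemma restr_supp_on [simp]: "restr P f \<in> supp_on P"
  by (simp add: restr_def supp_on_def)

lemma restr_Un: "P1 \<inter> P2 = {} ==> f \<in> supp_on (P1 \<union> P2) ==> f = restr P1 f + restr P2 f"
  by (auto simp: restr_def supp_on_def fun_eq_iff)

lemma app_zero_matrix:
  "(\<And>p q. p \<in> P ==> q \<in> Q ==> M p q = 0) ==> app M P Q f = 0"
  by (auto simp: app_def fun_eq_iff)

lemma restr_app: "Q' \<subseteq> Q ==> restr Q' (app M P Q f) = app M P Q' f"
  by (auto simp: app_def restr_def fun_eq_iff)

lemma app_restr_Un:
  "app M P (Q1 \<union> Q2) f = app M P Q1 f + restr (Q2 - Q1) (app M P Q2 f)"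
  by (auto simp: app_def restr_def fun_eq_iff)

lemma app_in_sub:
  assumes "\<forall>p\<in>P1. \<forall>q\<in>Q2. M p q = 0"
  shows "app M P1 (Q1 \<union> Q2) f = app M P1 Q1 f"
  using app_zero_matrix[of P1 Q2 M f] assms
  by (auto simp: app_restr_Un restr_def fun_eq_iff)

text \<open>Rank-nullity for the restriction to \<open>Q2\<close>, applied to the image of the whole
  matrix: as the block from \<open>P1\<close> to \<open>Q2\<close> vanishes, this restriction maps
  onto the image of the block from \<open>P2\<close> to \<open>Q2\<close>, and \<open>W\<close> lies
  in its kernel.\<close>

lemma rk_block_aux:
  assumes fin: "finite P1" "finite P2" "finite Q1" "finite Q2"
    and dj: "P1 \<inter> P2 = {}" "Q1 \<inter> Q2 = {}"
    and z: "\<forall>p\<in>P1. \<forall>q\<in>Q2. M p q = 0"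
    and W: "W \<subseteq> {v \<in> app M (P1 \<union> P2) (Q1 \<union> Q2) ` supp_on (P1 \<union> P2). restr Q2 v = 0}"
  shows "vs.dim W + rk M P2 Q2 \<le> rk M (P1 \<union> P2) (Q1 \<union> Q2)"
proof -
  let ?I = "app M (P1 \<union> P2) (Q1 \<union> Q2) ` supp_on (P1 \<union> P2)"
  have fQ: "finite (Q1 \<union> Q2)" using fin by simp
  have sub: "?I \<subseteq> supp_on (Q1 \<union> Q2)" by (auto simp: app_supp_on)
  have "restr Q2 ` ?I = app M P2 Q2 ` supp_on P2"
  proof (intro equalityI subsetI)
    fix y assume "y \<in> restr Q2 ` ?I"
    then obtain f where f: "f \<in> supp_on (P1 \<union> P2)" "y = restr Q2 (app M (P1 \<union> P2) (Q1 \<union> Q2) f)" by auto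
    have "y = app M (P1 \<union> P2) Q2 (restr P1 f + restr P2 f)"
      using f restr_Un[OF dj(1) f(1)] by (simp add: restr_app)
    also have "\<dots> = app M P2 Q2 (restr P2 f)"
      using z by (subst app_Un) (auto simp: fin dj app_zero_matrix)
    finally show "y \<in> app M P2 Q2 ` supp_on P2" by auto
  next
    fix y assume "y \<in> app M P2 Q2 ` supp_on P2"
    then obtain f where f: "f \<in> supp_on P2" "y = app M P2 Q2 f" by auto
    have "y = app M (P1 \<union> P2) Q2 (0 + f)"
      using f by (subst app_Un) (auto simp: fin dj app_def fun_eq_iff)
    also have "\<dots> = restr Q2 (app M (P1 \<union> P2) (Q1 \<union> Q2) f)" by (simp add: restr_app)
    finally show "y \<in> restr Q2 ` ?I" using f supp_on_mono[of P2 "P1 \<union> P2"] by blast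
  qed
  then have "rk M (P1 \<union> P2) (Q1 \<union> Q2) = rk M P2 Q2 + vs.dim {v \<in> ?I. restr Q2 v = 0}"
    using rank_nullity[OF fQ sub subspace_app lin_restr, of Q2] by (simp add: rk_def)
  moreover have "vs.dim W \<le> vs.dim {v \<in> ?I. restr Q2 v = 0}"
    by (rule dim_mono_fd[OF fQ]) (use sub W in \<open>auto intro: vs.span_base\<close>)
  ultimately show ?thesis by simp
qed

lemma app_sub_image:
  assumes fin: "finite P1" "finite P2" and dj: "P1 \<inter> P2 = {}"
    and z: "\<forall>p\<in>P1. \<forall>q\<in>Q2. M p q = 0"
    and f: "f \<in> supp_on P1"
  shows "app M (P1 \<union> P2) (Q1 \<union> Q2) f = app M P1 Q1 f"
proof -
  have "app M (P1 \<union> P2) (Q1 \<union> Q2) (f + 0) = app M P1 (Q1 \<union> Q2) f"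
    using f by (subst app_Un) (auto simp: fin dj app_def fun_eq_iff)
  then show ?thesis using app_in_sub[OF z] by simp
qed

lemma app_sub_image_kernel:
  assumes fin: "finite P1" "finite P2" and dj: "P1 \<inter> P2 = {}" "Q1 \<inter> Q2 = {}"
    and z: "\<forall>p\<in>P1. \<forall>q\<in>Q2. M p q = 0"
  shows "app M P1 Q1 ` supp_on P1
    \<subseteq> {v \<in> app M (P1 \<union> P2) (Q1 \<union> Q2) ` supp_on (P1 \<union> P2). restr Q2 v = 0}"
proof
  fix y assume "y \<in> app M P1 Q1 ` supp_on P1"
  then obtain f where f: "f \<in> supp_on P1" "y = app M P1 Q1 f" by auto
  have "y = app M (P1 \<union> P2) (Q1 \<union> Q2) f" using app_sub_image[OF fin dj(1) z f(1)] f by simp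
  moreover have "restr Q2 y = 0" using dj by (auto simp: f app_def restr_def fun_eq_iff)
  ultimately show "y \<in> {v \<in> app M (P1 \<union> P2) (Q1 \<union> Q2) ` supp_on (P1 \<union> P2). restr Q2 v = 0}"
    using f supp_on_mono[of P1 "P1 \<union> P2"] by blast
qed

lemma rk_block:
  assumes fin: "finite P1" "finite P2" "finite Q1" "finite Q2"
    and dj: "P1 \<inter> P2 = {}" "Q1 \<inter> Q2 = {}"
    and z: "\<forall>p\<in>P1. \<forall>q\<in>Q2. M p q = 0"
  shows "rk M P1 Q1 + rk M P2 Q2 \<le> rk M (P1 \<union> P2) (Q1 \<union> Q2)"
  using rk_block_aux[OF fin dj z app_sub_image_kernel[OF fin(1,2) dj z]] by (simp add: rk_def)

text \<open>A nonzero connecting map adds to the rank. The image of \<open>f\<close> has no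
  component in \<open>Q2\<close>; if it were an image from \<open>P1\<close>, subtracting a preimage
  would turn \<open>f\<close> into a cycle of the whole, against \<open>ext\<close>.\<close>

lemma rk_block_Suc:
  assumes fin: "finite P1" "finite P2" "finite Q1" "finite Q2"
    and dj: "P1 \<inter> P2 = {}" "Q1 \<inter> Q2 = {}"
    and z: "\<forall>p\<in>P1. \<forall>q\<in>Q2. M p q = 0"
    and f: "f \<in> supp_on P2" "app M P2 Q2 f = 0"
    and ext: "\<And>g. g \<in> supp_on P1 ==> app M (P1 \<union> P2) (Q1 \<union> Q2) (g + f) \<noteq> 0"
  shows "rk M P1 Q1 + rk M P2 Q2 + 1 \<le> rk M (P1 \<union> P2) (Q1 \<union> Q2)"
proof -
  let ?J = "app M P1 Q1 ` supp_on P1"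
  let ?y = "app M (P1 \<union> P2) (Q1 \<union> Q2) f"
  have "?y \<notin> ?J"
  proof
    assume "?y \<in> ?J"
    then obtain g where g: "g \<in> supp_on P1" "?y = app M P1 Q1 g" by auto
    have "app M (P1 \<union> P2) (Q1 \<union> Q2) (scale_fun (- 1) g + f) = 0"
      unfolding app_add app_scale app_sub_image[OF fin(1,2) dj(1) z g(1)]
      unfolding g(2)
      by (auto simp: scale_fun_def fun_eq_iff)
    then show False using ext[of "scale_fun (- 1) g"] g(1) vs.subspace_scale[OF subspace_supp_on]
      by blast
  qed
  then have "vs.dim (insert ?y ?J) = rk M P1 Q1 + 1"
    using dim_insert_span[OF fin(3), of ?J ?y] subspace_app by (auto simp: rk_def app_supp_on)
  moreover have "restr Q2 ?y = 0"
  proof -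
    have "restr Q2 ?y = app M (P1 \<union> P2) Q2 (0 + f)" by (simp add: restr_app)
    also have "\<dots> = app M P1 Q2 0 + app M P2 Q2 f" by (rule app_Un) (auto simp: fin dj f)
    finally show ?thesis using f by (auto simp: app_def fun_eq_iff)
  qed
  then have sub: "insert ?y ?J \<subseteq> {v \<in> app M (P1 \<union> P2) (Q1 \<union> Q2) ` supp_on (P1 \<union> P2). restr Q2 v = 0}"
    using app_sub_image_kernel[OF fin(1,2) dj z] supp_on_mono[of P2 "P1 \<union> P2"] f(1)
    by (simp add: subset_iff)
  ultimately show ?thesis using rk_block_aux[OF fin dj z sub] by simp
qed

text \<open>The rank is bounded from above by bounding the kernel from below: it contains the kernel
  on the subcomplex \<open>P1\<close>, and its projection to \<open>P2\<close> contains the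
  projections of boundaries, which fill the image of the block from \<open>O2\<close> to
  \<open>P2\<close>.\<close>

lemma rk_le_sub_quotient:
  assumes fin: "finite O1" "finite O2" "finite P1" "finite P2"
    and dj: "P1 \<inter> P2 = {}" "O1 \<inter> O2 = {}"
    and z: "\<forall>p\<in>P1. \<forall>q\<in>Q2. M p q = 0"
    and dd: "\<And>f. f \<in> supp_on (O1 \<union> O2) ==>
      app M (P1 \<union> P2) (Q1 \<union> Q2) (app M (O1 \<union> O2) (P1 \<union> P2) f) = 0"
  shows "rk M (P1 \<union> P2) (Q1 \<union> Q2) + rk M O2 P2 \<le> rk M P1 Q1 + card P2"
proof -
  let ?K = "{f \<in> supp_on (P1 \<union> P2). app M (P1 \<union> P2) (Q1 \<union> Q2) f = 0}"
  have fP: "finite (P1 \<union> P2)" using fin by simp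
  have 1: "card (P1 \<union> P2) = rk M (P1 \<union> P2) (Q1 \<union> Q2) + vs.dim ?K"
    by (rule dim_kernel[OF fP])
  have 2: "vs.dim ?K = vs.dim (restr P2 ` ?K) + vs.dim {v \<in> ?K. restr P2 v = 0}"
    by (rule rank_nullity[OF fP _ subspace_kernel lin_restr]) auto
  have 3: "card P1 = rk M P1 Q1 + vs.dim {f \<in> supp_on P1. app M P1 Q1 f = 0}"
    by (rule dim_kernel[OF fin(3)])
  have "{f \<in> supp_on P1. app M P1 Q1 f = 0} \<subseteq> {v \<in> ?K. restr P2 v = 0}"
    using app_sub_image[OF fin(3,4) dj(1) z] dj(1) supp_on_mono[of P1 "P1 \<union> P2"]
    by (auto simp: restr_def supp_on_def fun_eq_iff)
  then have 4: "vs.dim {f \<in> supp_on P1. app M P1 Q1 f = 0} \<le> vs.dim {v \<in> ?K. restr P2 v = 0}"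
    by (intro dim_mono_fd[OF fP]) (auto intro: vs.span_base)
  have "app M O2 P2 ` supp_on O2 \<subseteq> restr P2 ` ?K"
  proof
    fix y assume "y \<in> app M O2 P2 ` supp_on O2"
    then obtain f where f: "f \<in> supp_on O2" "y = app M O2 P2 f" by auto
    have "y = app M (O1 \<union> O2) P2 (0 + f)"
      using f by (subst app_Un) (auto simp: fin dj app_def fun_eq_iff)
    also have "\<dots> = restr P2 (app M (O1 \<union> O2) (P1 \<union> P2) f)" by (simp add: restr_app)
    finally show "y \<in> restr P2 ` ?K"
      using dd[of f] f(1) supp_on_mono[of O2 "O1 \<union> O2"] app_supp_on[of M "O1 \<union> O2" "P1 \<union> P2" f] by blast
  qed
  then have 5: "rk M O2 P2 \<le> vs.dim (restr P2 ` ?K)"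
    unfolding rk_def using supp_on_mono[of P2 "P1 \<union> P2"]
    by (intro dim_mono_fd[OF fP]) (auto intro: vs.span_base simp: subset_iff)
  have "card (P1 \<union> P2) = card P1 + card P2" by (rule card_Un_disjoint) (use fin dj in auto)
  then show ?thesis using 1 2 3 4 5 by linarith
qed

text \<open>Each new image is independent of the earlier ones, since it is nonzero at its own pivot
  \<open>q k\<close>, where all earlier images vanish.\<close>

lemma rk_triangular:
  assumes fin: "finite P" "finite Q"
    and f: "\<And>i. i < n ==> f i \<in> supp_on P" and q: "\<And>i. i < n ==> q i \<in> Q"
    and nz: "\<And>i. i < n ==> app M P Q (f i) (q i) \<noteq> 0"
    and tri: "\<And>i j. i < j ==> j < n ==> app M P Q (f i) (q j) = 0"
  shows "n \<le> rk M P Q"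
proof -
  have "k \<le> n ==> k \<le> vs.dim ((\<lambda>i. app M P Q (f i)) ` {..<k})" for k
  proof (induction k)
    case (Suc k)
    let ?S = "(\<lambda>i. app M P Q (f i)) ` {..<k}"
    have sp: "vs.span ?S \<subseteq> supp_on Q"
      by (rule vs.span_minimal[OF _ subspace_supp_on]) (auto simp: app_supp_on)
    have "vs.span ?S \<subseteq> {g. g (q k) = 0}"
      using Suc.prems by (intro vs.span_minimal) (auto simp: vs.subspace_def scale_fun_def tri)
    then have ni: "app M P Q (f k) \<notin> vs.span ?S" using nz[of k] Suc.prems by auto
    have "k + 1 \<le> vs.dim (vs.span ?S) + 1" using Suc by simp
    also have "\<dots> = vs.dim (insert (app M P Q (f k)) (vs.span ?S))"
      using dim_insert_span[OF fin(2) sp vs.subspace_span ni] by simp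
    also have "\<dots> \<le> vs.dim (insert (app M P Q (f k)) ?S)"
    proof (rule dim_mono_fd[OF fin(2)])
      show "insert (app M P Q (f k)) ?S \<subseteq> supp_on Q" by (auto simp: app_supp_on)
      show "insert (app M P Q (f k)) (vs.span ?S) \<subseteq> vs.span (insert (app M P Q (f k)) ?S)"
        using vs.span_mono[of ?S "insert (app M P Q (f k)) ?S"] by (auto intro: vs.span_base)
    qed
    finally show ?case by (simp add: lessThan_Suc)
  qed simp
  from this[of n] have "n \<le> vs.dim ((\<lambda>i. app M P Q (f i)) ` {..<n})" by simp
  also have "\<dots> \<le> rk M P Q"
    unfolding rk_def using f
    by (intro dim_mono_fd[OF fin(2)]) (auto intro!: vs.span_base simp: app_supp_on)
  finally show ?thesis .
qed

lemma rk_transport: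
  assumes fin: "finite P" "finite Q"
    and \<phi>: "bij_betw \<phi> P P'" and \<psi>: "bij_betw \<psi> Q Q'"
    and M: "\<And>p q. p \<in> P ==> q \<in> Q ==> M' (\<phi> p) (\<psi> q) = M p q"
  shows "rk M' P' Q' = rk M P Q"
proof -
  define S where "S f = (\<lambda>q. if q \<in> Q then f (\<psi> q) else 0)" for f :: "'d => rat"
  have lS: "lin S" by (rule linI) (auto simp: S_def fun_eq_iff scale_fun_def)
  let ?I = "app M' P' Q' ` supp_on P'"
  have fin': "finite Q'" using \<psi> fin(2) bij_betw_finite by blast
  have app: "S (app M' P' Q' f) = app M P Q (\<lambda>p. if p \<in> P then f (\<phi> p) else 0)" for f
  proof
    fix q
    have "(\<Sum>p\<in>P'. f p * M' p (\<psi> q)) = (\<Sum>p\<in>P. f (\<phi> p) * M' (\<phi> p) (\<psi> q))"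
      by (rule sum.reindex_bij_betw[OF \<phi>, symmetric])
    then show "S (app M' P' Q' f) q = app M P Q (\<lambda>p. if p \<in> P then f (\<phi> p) else 0) q"
      using \<psi> M by (auto simp: S_def app_def bij_betw_def intro!: sum.cong)
  qed
  have SI: "S ` ?I = app M P Q ` supp_on P"
  proof (intro equalityI subsetI)
    fix y assume "y \<in> S ` ?I"
    then obtain f where "y = S (app M' P' Q' f)" by auto
    then show "y \<in> app M P Q ` supp_on P" unfolding app by (auto simp: supp_on_def)
  next
    fix y assume "y \<in> app M P Q ` supp_on P"
    then obtain g where g: "g \<in> supp_on P" "y = app M P Q g" by auto
    define f where "f x = (if x \<in> P' then g (inv_into P \<phi> x) else 0)" for x
    have "(\<lambda>p. if p \<in> P then f (\<phi> p) else 0) = g"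
      using g(1) \<phi> by (auto simp: f_def supp_on_def fun_eq_iff bij_betw_def)
    then have "y = S (app M' P' Q' f)" using app[of f] g by simp
    moreover have "f \<in> supp_on P'" by (auto simp: f_def supp_on_def)
    ultimately show "y \<in> S ` ?I" by blast
  qed
  have "{v \<in> ?I. S v = 0} = {0}"
  proof -
    have "v = 0" if "v \<in> ?I" "S v = 0" for v
    proof
      fix x show "v x = 0 x"
      proof (cases "x \<in> Q'")
        case True
        then obtain q where "q \<in> Q" "x = \<psi> q" using \<psi> by (auto simp: bij_betw_def)
        then show ?thesis using fun_cong[OF that(2), of q] by (simp add: S_def)
      next
        case False
        then show ?thesis using that(1) by (auto simp: app_def)
      qed
    qed
    moreover have "0 \<in> ?I" using subspace_app vs.subspace_0 by blast
    moreover have "S 0 = 0" by (auto simp: S_def)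
    ultimately show ?thesis by auto
  qed
  then have "vs.dim {v \<in> ?I. S v = 0} = 0"
    using vs.dim_le_card[of "{0}" "{}"] by (simp add: vs.span_empty)
  then show ?thesis
    using rank_nullity[OF fin' _ subspace_app lS, of M' P' Q'] SI by (auto simp: rk_def app_supp_on)
qed

lemma rk_mono:
  assumes "finite P" "finite Q" "P' \<subseteq> P" "Q' \<subseteq> Q"
  shows "rk M P' Q' \<le> rk M P Q"
proof -
  have 1: "rk M P' Q' \<le> rk M P' Q"
  proof -
    have "restr Q' ` app M P' Q ` supp_on P' = app M P' Q' ` supp_on P'"
      using assms(4) by (simp add: image_image restr_app)
    then show ?thesis
      using rank_nullity[OF assms(2) _ subspace_app lin_restr, of M P' Q Q'] by (auto simp: rk_def app_supp_on)
  qed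
  have "app M P' Q ` supp_on P' \<subseteq> app M P Q ` supp_on P"
  proof
    fix y assume "y \<in> app M P' Q ` supp_on P'"
    then obtain f where f: "f \<in> supp_on P'" "y = app M P' Q f" by auto
    have "(\<Sum>p\<in>P. f p * M p q) = (\<Sum>p\<in>P'. f p * M p q)" for q
      by (rule sum.mono_neutral_right) (use assms f in \<open>auto simp: supp_on_def\<close>)
    then have "y = app M P Q f" by (auto simp: f app_def)
    then show "y \<in> app M P Q ` supp_on P" using f assms(3) supp_on_mono by blast
  qed
  then have "rk M P' Q \<le> rk M P Q"
    unfolding rk_def
    by (intro dim_mono_fd[OF assms(2)] order_trans[OF _ vs.span_superset]) simp_all
  with 1 show ?thesis by simp
qed

section \<open>Bounds for Betti numbers of based complexes\<close>

text \<open>Here \<open>m i\<close> is a guaranteed rank, so \<open>c i\<close> bounds the i-th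
  Betti number from above. Using one function \<open>m\<close> for both neighbouring differentials
  says more than the inequality: any excess of \<open>c\<close> over the Betti numbers comes in
  equal amounts in two adjacent degrees. This is what makes isolated classes exact.\<close>

definition betti_bound :: "('a => 'a => rat) => (int => 'a set) => (int => nat) => bool" where
  "betti_bound M S c <-> (\<exists>m :: int => nat. \<forall>i. m i \<le> rk M (S i) (S (i + 1)) \<and>
     card (S i) = m i + m (i - 1) + c i)"

text \<open>Stated additively, which avoids truncated subtraction of ranks.\<close>

definition betti :: "('a => 'a => rat) => (int => 'a set) => int => nat => bool" where
  "betti M S i n <-> card (S i) = rk M (S i) (S (i + 1)) + rk M (S (i - 1)) (S i) + n"

lemma betti_boundI:
  assumes "\<And>i. m i \<le> rk M (S i) (S (i + 1))" "\<And>i. card (S i) = m i + m (i - 1) + c i"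
  shows "betti_bound M S c"
  using assms unfolding betti_bound_def by blast

text \<open>With \<open>S1\<close> as subcomplex and \<open>S2\<close> as quotient, a cycle
  \<open>f\<close> of \<open>S2\<close> extends if and only if the connecting map kills its
  class.\<close>

definition extends_to_cycle ::
  "('a => 'a => rat) => (int => 'a set) => (int => 'a set) => int => ('a => rat) => bool" where
  "extends_to_cycle M S1 S2 i f <->
     (\<exists>g\<in>supp_on (S1 i). app M (S1 i \<union> S2 i) (S1 (i + 1) \<union> S2 (i + 1)) (g + f) = 0)"

text \<open>Each \<open>i\<close> in \<open>I\<close> certifies rank at least one for the connecting
  map in degree \<open>i\<close>. It removes one class of the quotient in degree \<open>i\<close>
  and one class of the subcomplex in degree \<open>i + 1\<close>; the latter accounts for the term
  with \<open>i - 1\<close>.\<close>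

lemma betti_bound_Un:
  assumes fin: "\<And>i. finite (S1 i)" "\<And>i. finite (S2 i)"
    and dj: "\<And>i. S1 i \<inter> S2 i = {}"
    and z: "\<And>i p q. p \<in> S1 i ==> q \<in> S2 (i + 1) ==> M p q = 0"
    and b: "betti_bound M S1 c1" "betti_bound M S2 c2"
    and I: "\<And>i. i \<in> I ==> \<exists>f\<in>supp_on (S2 i). app M (S2 i) (S2 (i + 1)) f = 0 \<and>
      \<not> extends_to_cycle M S1 S2 i f"
    and c: "\<And>i. c i + of_bool (i \<in> I) + of_bool (i - 1 \<in> I) = c1 i + c2 i"
  shows "betti_bound M (\<lambda>i. S1 i \<union> S2 i) c"
proof -
  obtain m1 where m1: "\<And>i. m1 i \<le> rk M (S1 i) (S1 (i + 1))" "\<And>i. card (S1 i) = m1 i + m1 (i - 1) + c1 i"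
    using b(1) unfolding betti_bound_def by blast
  obtain m2 where m2: "\<And>i. m2 i \<le> rk M (S2 i) (S2 (i + 1))" "\<And>i. card (S2 i) = m2 i + m2 (i - 1) + c2 i"
    using b(2) unfolding betti_bound_def by blast
  show ?thesis
  proof (rule betti_boundI[of "\<lambda>i. m1 i + m2 i + of_bool (i \<in> I)"])
    fix i
    have zi: "\<forall>p\<in>S1 i. \<forall>q\<in>S2 (i + 1). M p q = 0" using z by blast
    have "rk M (S1 i) (S1 (i + 1)) + rk M (S2 i) (S2 (i + 1)) + of_bool (i \<in> I)
      \<le> rk M (S1 i \<union> S2 i) (S1 (i + 1) \<union> S2 (i + 1))"
    proof (cases "i \<in> I")
      case True
      then obtain f where f: "f \<in> supp_on (S2 i)" "app M (S2 i) (S2 (i + 1)) f = 0"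
        "\<not> extends_to_cycle M S1 S2 i f" using I by blast
      show ?thesis
        using rk_block_Suc[OF fin(1,2) fin(1,2) dj dj zi f(1,2)] f(3) True
        by (auto simp: extends_to_cycle_def)
    next
      case False
      then show ?thesis using rk_block[OF fin(1,2) fin(1,2) dj dj zi] by simp
    qed
    then show "m1 i + m2 i + of_bool (i \<in> I) \<le> rk M (S1 i \<union> S2 i) (S1 (i + 1) \<union> S2 (i + 1))"
      using m1(1)[of i] m2(1)[of i] by linarith
    show "card (S1 i \<union> S2 i) = m1 i + m2 i + of_bool (i \<in> I)
        + (m1 (i - 1) + m2 (i - 1) + of_bool (i - 1 \<in> I)) + c i"
      using card_Un_disjoint[OF fin dj] m1(2)[of i] m2(2)[of i] c[of i] by simp
  qed
qed

lemma rk_matching: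
  assumes fin: "finite P" "finite Q" and \<beta>: "bij_betw \<beta> P Q"
    and M: "\<And>p q. p \<in> P ==> q \<in> Q ==> M p q \<noteq> 0 <-> q = \<beta> p"
  shows "card P \<le> rk M P Q"
proof -
  obtain e where e: "bij_betw e {0..<card P} P" using ex_bij_betw_nat_finite[OF fin(1)] by blast
  have "app M P Q (unit_vec p) q = M p q" if "p \<in> P" "q \<in> Q" for p q
    using that fin by (simp add: app_def unit_vec_def of_bool_def if_distrib if_distribR cong: if_cong)
  moreover have "e i \<in> P" if "i < card P" for i using e that by (auto simp: bij_betw_def)
  moreover have "\<beta> p \<in> Q" if "p \<in> P" for p using \<beta> that by (auto simp: bij_betw_def)
  moreover have "\<beta> (e j) \<noteq> \<beta> (e i)" if "i < j" "j < card P" for i j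
    using that e \<beta> \<open>\<And>i. i < card P ==> e i \<in> P\<close>
    by (metis atLeast0LessThan bij_betw_def inj_on_def lessThan_iff less_irrefl less_trans)
  moreover have "M (e i) (\<beta> (e j)) = 0" if "i < j" "j < card P" for i j
  proof -
    have "e i \<in> P" "\<beta> (e j) \<in> Q" "\<beta> (e j) \<noteq> \<beta> (e i)"
      using calculation(2-4) that by auto
    then show ?thesis using M by blast
  qed
  moreover have "M p (\<beta> p) \<noteq> 0" if "p \<in> P" for p
    using calculation(3) that M by blast
  ultimately show ?thesis
    by (intro rk_triangular[OF fin, where f = "\<lambda>i. unit_vec (e i)" and q = "\<lambda>i. \<beta> (e i)"])
       (auto simp: unit_vec_in)
qed

text \<open>Simultaneous Gaussian elimination: the block from \<open>P\<close> to \<open>Q\<close>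
  is a permutation matrix up to nonzero factors, and the rank of a submatrix bounds that of the
  whole matrix from below, whatever the other blocks are.\<close>

lemma betti_bound_matching:
  assumes fin: "\<And>i. finite (P i)" "\<And>i. finite (Q i)"
    and dj: "\<And>i. P i \<inter> Q i = {}"
    and \<beta>: "\<And>i. bij_betw (\<beta> i) (P i) (Q (i + 1))"
    and M: "\<And>i p q. p \<in> P i ==> q \<in> Q (i + 1) ==> M p q \<noteq> 0 <-> q = \<beta> i p"
  shows "betti_bound M (\<lambda>i. P i \<union> Q i) (\<lambda>_. 0)"
proof (rule betti_boundI[of "\<lambda>i. card (P i)"])
  fix i
  have "card (P i) \<le> rk M (P i) (Q (i + 1))" by (rule rk_matching[OF fin \<beta> M])
  also have "\<dots> \<le> rk M (P i \<union> Q i) (P (i + 1) \<union> Q (i + 1))" by (rule rk_mono) (use fin in auto)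
  finally show "card (P i) \<le> rk M (P i \<union> Q i) (P (i + 1) \<union> Q (i + 1))" .
  show "card (P i \<union> Q i) = card (P i) + card (P (i - 1)) + 0"
    using card_Un_disjoint[OF fin dj] bij_betw_same_card[OF \<beta>[of "i - 1"]] by simp
qed

lemma betti_bound_transport:
  assumes b: "betti_bound M S c" and fin: "\<And>i. finite (S i)"
    and \<phi>: "\<And>i. bij_betw (\<phi> i) (S i) (S' (i + s))"
    and M: "\<And>i p q. p \<in> S i ==> q \<in> S (i + 1) ==> M' (\<phi> i p) (\<phi> (i + 1) q) = M p q"
    and c: "\<And>i. c' i = c (i - s)"
  shows "betti_bound M' S' c'"
proof -
  obtain m where m: "\<And>i. m i \<le> rk M (S i) (S (i + 1))" "\<And>i. card (S i) = m i + m (i - 1) + c i"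
    using b unfolding betti_bound_def by blast
  show ?thesis
  proof (rule betti_boundI[of "\<lambda>i. m (i - s)"])
    fix i
    have e: "S' (i + 1) = S' (i - s + 1 + s)" "S' i = S' (i - s + s)" by simp_all
    have "rk M' (S' (i - s + s)) (S' (i - s + 1 + s)) = rk M (S (i - s)) (S (i - s + 1))"
      by (rule rk_transport[where \<phi> = "\<phi> (i - s)" and \<psi> = "\<phi> (i - s + 1)"])
         (rule fin \<phi> M | assumption)+
    then show "m (i - s) \<le> rk M' (S' i) (S' (i + 1))" unfolding e using m(1) by simp
    show "card (S' i) = m (i - s) + m (i - 1 - s) + c' i"
      using bij_betw_same_card[OF \<phi>[of "i - s"]] m(2)[of "i - s"] by (simp add: c algebra_simps)
  qed
qed

lemma betti_lower_imp_eq: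
  assumes "betti_bound M S c"
    and "rk M (S i) (S (i + 1)) + rk M (S (i - 1)) (S i) + c i \<le> card (S i)"
  shows "betti M S i (c i)"
proof -
  obtain m where m: "\<And>i. m i \<le> rk M (S i) (S (i + 1))" "\<And>i. card (S i) = m i + m (i - 1) + c i"
    using assms(1) unfolding betti_bound_def by blast
  show ?thesis using m(1)[of i] m(1)[of "i - 1"] m(2)[of i] assms(2) by (simp add: betti_def)
qed

definition complex :: "('a => 'a => rat) => (int => 'a set) => bool" where
  "complex M S <-> (\<forall>i. finite (S i)) \<and>
     (\<forall>i. \<forall>p\<in>S (i - 1). \<forall>r\<in>S (i + 1). (\<Sum>q\<in>S i. M p q * M q r) = 0)"

lemma complex_finite: "complex M S ==> finite (S i)"
  by (simp add: complex_def)

lemma complex_app: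
  assumes "complex M S" 
  shows "app M (S i) (S (i + 1)) (app M (S (i - 1)) (S i) f) = 0"
proof
  fix r
  have "(\<Sum>q\<in>S i. (\<Sum>p\<in>S (i - 1). f p * M p q) * M q r) = 0" if "r \<in> S (i + 1)"
  proof -
    have "(\<Sum>q\<in>S i. (\<Sum>p\<in>S (i - 1). f p * M p q) * M q r)
      = (\<Sum>p\<in>S (i - 1). f p * (\<Sum>q\<in>S i. M p q * M q r))"
      by (simp add: sum_distrib_left sum_distrib_right mult.assoc) (rule sum.swap)
    also have "\<dots> = 0" using assms that by (simp add: complex_def)
    finally show ?thesis .
  qed
  then show "app M (S i) (S (i + 1)) (app M (S (i - 1)) (S i) f) r = 0 r" by (simp add: app_def)
qed

lemma complex_rk_le: "complex M S ==> rk M (S (i - 1)) (S i) + rk M (S i) (S (i + 1)) \<le> card (S i)"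
  by (rule rk_plus_rk_le) (auto simp: complex_finite complex_app)

text \<open>Where \<open>c\<close> vanishes, the two guaranteed ranks already fill the whole group
  of generators, and the square of the differential being zero leaves no room for a larger rank.
  Either end of the differential can provide this.\<close>

lemma betti_bound_rk_eq:
  assumes "betti_bound M S c" "complex M S" "\<And>i. m i \<le> rk M (S i) (S (i + 1))"
    "\<And>i. card (S i) = m i + m (i - 1) + c i" "c i = 0 \<or> c (i + 1) = 0"
  shows "rk M (S i) (S (i + 1)) = m i"
  using assms(3)[of i] assms(3)[of "i - 1"] assms(3)[of "i + 1"] assms(4)[of i] assms(4)[of "i + 1"]
    assms(5) complex_rk_le[OF assms(2), of i] complex_rk_le[OF assms(2), of "i + 1"]
  by auto

text \<open>Excess of the bound would have to be shared with a neighbouring degree, where there is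
  nothing to share.\<close>

lemma betti_isolated:
  assumes "betti_bound M S c" "complex M S" "c (i - 1) = 0 \<and> c (i + 1) = 0 \<or> c i = 0"
  shows "betti M S i (c i)"
proof -
  obtain m where m: "\<And>i. m i \<le> rk M (S i) (S (i + 1))" "\<And>i. card (S i) = m i + m (i - 1) + c i"
    using assms(1) unfolding betti_bound_def by blast
  show ?thesis
    using betti_bound_rk_eq[OF assms(1,2) m, of i] betti_bound_rk_eq[OF assms(1,2) m, of "i - 1"]
      m(2)[of i] assms(3) by (auto simp: betti_def)
qed

text \<open>For an adjacent pair of classes: exactness in degree \<open>i\<close> fixes the rank
  between the two, and the absence of classes in degree \<open>i + 2\<close> fixes the outgoing rank
  of the second.\<close>

lemma betti_next:
  assumes "betti_bound M S c" "complex M S" "betti M S i (c i)" "c (i + 2) = 0"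
  shows "betti M S (i + 1) (c (i + 1))"
proof -
  obtain m where m: "\<And>i. m i \<le> rk M (S i) (S (i + 1))" "\<And>i. card (S i) = m i + m (i - 1) + c i"
    using assms(1) unfolding betti_bound_def by blast
  show ?thesis
    using betti_bound_rk_eq[OF assms(1,2) m, of "i + 1"] assms(3,4) m(1)[of i] m(1)[of "i - 1"]
      m(2)[of i] m(2)[of "i + 1"] by (auto simp: betti_def add.commute)
qed

text \<open>In the long exact sequence a class of the subcomplex in degree \<open>i\<close> can only
  be killed from the homology of the quotient in degree \<open>i - 1\<close>, which is zero. In
  terms of ranks, \<open>rk_le_sub_quotient\<close> is used in degrees \<open>i\<close> and
  \<open>i - 1\<close>, and the guaranteed rank of the quotient between these degrees
  cancels.\<close>

lemma betti_lower_sub: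
  assumes cx: "complex M (\<lambda>i. S1 i \<union> S2 i)"
    and dj: "\<And>i. S1 i \<inter> S2 i = {}"
    and z: "\<And>i p q. p \<in> S1 i ==> q \<in> S2 (i + 1) ==> M p q = 0"
    and b2: "betti_bound M S2 c2" "c2 (i - 1) = 0"
    and h: "rk M (S1 i) (S1 (i + 1)) + rk M (S1 (i - 1)) (S1 i) + n \<le> card (S1 i)"
  shows "rk M (S1 i \<union> S2 i) (S1 (i + 1) \<union> S2 (i + 1))
    + rk M (S1 (i - 1) \<union> S2 (i - 1)) (S1 i \<union> S2 i) + n \<le> card (S1 i \<union> S2 i)"
proof -
  have fin: "finite (S1 i)" "finite (S2 i)" for i using complex_finite[OF cx, of i] by auto
  have *: "rk M (S1 i \<union> S2 i) (S1 (i + 1) \<union> S2 (i + 1)) + rk M (S2 (i - 1)) (S2 i)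
    \<le> rk M (S1 i) (S1 (i + 1)) + card (S2 i)" for i
    by (rule rk_le_sub_quotient[where ?O1.0 = "S1 (i - 1)"])
       (use fin dj z complex_app[OF cx, of i] in auto)
  obtain m where m: "\<And>i. m i \<le> rk M (S2 i) (S2 (i + 1))" "\<And>i. card (S2 i) = m i + m (i - 1) + c2 i"
    using b2(1) unfolding betti_bound_def by blast
  show ?thesis
    using *[of i] *[of "i - 1"] m(1)[of "i - 1"] m(1)[of "i - 2"] m(2)[of "i - 1"] b2(2) h
      card_Un_disjoint[OF fin(1)[of i] fin(2)[of i] dj] by simp
qed

text \<open>A basis of \<open>B\<close> is extended to a basis of \<open>Z\<close>. The added
  vectors are matched with the entries of \<open>ks\<close> equal to \<open>j\<close>, which gives a
  linear map on \<open>Z\<close> with kernel exactly \<open>B\<close>.\<close>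

lemma quotient_iso_dim:
  assumes fin: "finite P" and Z: "vs.subspace Z" "Z \<subseteq> supp_on P" and B: "vs.subspace B" "B \<subseteq> Z"
    and d: "vs.dim Z = vs.dim B + card {n. n < length ks \<and> ks ! n = j}"
  shows "quotient_iso Z B (graded_sum ks j)"
proof -
  define N where "N = {n. n < length ks \<and> ks ! n = j}"
  have gs: "graded_sum ks j = supp_on N" by (auto simp: graded_sum_def supp_on_def N_def)
  have fN: "finite N" by (simp add: N_def)
  obtain CB where CB: "finite CB" "CB \<subseteq> B" "vs.independent CB" "B \<subseteq> vs.span CB" "card CB = vs.dim B"
    using fd_basis[OF fin] Z B by (metis subset_trans)
  obtain CZ where CZ: "CB \<subseteq> CZ" "CZ \<subseteq> Z" "vs.independent CZ" "Z \<subseteq> vs.span CZ"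
    using vs.maximal_independent_subset_extend[of CB Z] CB B by blast
  have "CZ \<subseteq> vs.span (unit_vec ` P)" using CZ(2) Z(2) fin supp_on_span by blast
  then have fC: "finite CZ" using vs.independent_span_bound[of "unit_vec ` P" CZ] CZ(3) fin by auto
  have "card CZ = vs.dim Z" using CZ vs.basis_card_eq_dim by metis
  then have "card (CZ - CB) = card N"
    using d CB(1,5) CZ(1) by (simp add: card_Diff_subset N_def)
  then obtain e where e: "bij_betw e (CZ - CB) N"
    using finite_same_card_bij[of "CZ - CB" N] fC fN by auto
  obtain \<Phi> :: "('a => rat) => nat => rat" where lin: "lin \<Phi>"
    and \<Phi>: "\<And>x. x \<in> CZ ==> \<Phi> x = (if x \<in> CB then 0 else unit_vec (e x))"
    using vsp.linear_independent_extend[OF CZ(3), of "\<lambda>x. if x \<in> CB then 0 else unit_vec (e x)"]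
    by blast
  interpret \<Phi>: Vector_Spaces.linear scale_fun scale_fun \<Phi> by fact
  have \<Phi>B: "\<Phi> b = 0" if "b \<in> B" for b
  proof -
    have "vs.span CB \<subseteq> {x. \<Phi> x = 0}"
      by (rule vs.span_minimal) (use \<Phi> CZ(1) vsp.linear_subspace_kernel[OF lin] in auto)
    then show ?thesis using CB(4) that by auto
  qed
  have sum_\<Phi>: "\<Phi> (\<Sum>x\<in>CZ. scale_fun (f x) x) = (\<Sum>x\<in>CZ - CB. scale_fun (f x) (unit_vec (e x)))" for f
  proof -
    have "\<Phi> (\<Sum>x\<in>CZ. scale_fun (f x) x) = (\<Sum>x\<in>CZ. scale_fun (f x) (if x \<in> CB then 0 else unit_vec (e x)))"
      by (simp add: \<Phi>.sum \<Phi>.scale \<Phi>)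
    also have "\<dots> = (\<Sum>x\<in>CZ - CB. scale_fun (f x) (unit_vec (e x)))"
      by (rule sum.mono_neutral_cong_right) (use fC in auto)
    finally show ?thesis .
  qed
  have expand: "\<exists>f. z = (\<Sum>x\<in>CZ. scale_fun (f x) x)" if "z \<in> Z" for z
    using that CZ(4) vs.span_finite[OF fC] by blast
  have \<Phi>_ev: "(\<Sum>x\<in>CZ - CB. scale_fun (f x) (unit_vec (e x))) (e y) = f y" if "y \<in> CZ - CB" for f y
  proof -
    have "(\<Sum>x\<in>CZ - CB. scale_fun (f x) (unit_vec (e x))) (e y) = (\<Sum>x\<in>CZ - CB. f x * of_bool (e y = e x))"
      by (simp add: sum_apply scale_fun_def unit_vec_def)
    also have "\<dots> = (\<Sum>x\<in>CZ - CB. if x = y then f y else 0)"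
      using e that by (intro sum.cong) (auto simp: bij_betw_def inj_on_def)
    also have "\<dots> = f y" using that fC by simp
    finally show ?thesis .
  qed
  have ker: "z \<in> B" if z: "z \<in> Z" "\<Phi> z = 0" for z
  proof -
    obtain f where f: "z = (\<Sum>x\<in>CZ. scale_fun (f x) x)" using expand z(1) by blast
    have "f y = 0" if "y \<in> CZ - CB" for y
      using \<Phi>_ev[OF that, of f] sum_\<Phi>[of f] z(2) f by simp
    then have zB: "z = (\<Sum>x\<in>CB. scale_fun (f x) x)"
      unfolding f by (intro sum.mono_neutral_right) (use fC CZ(1) in \<open>auto simp: scale_fun_def\<close>)
    have "scale_fun (f x) x \<in> B" if "x \<in> CB" for x
      using that CB(2) vs.subspace_scale[OF B(1)] by auto
    then show ?thesis unfolding zB by (rule vs.subspace_sum[OF B(1)])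
  qed
  have im: "\<Phi> ` Z = supp_on N"
  proof (intro equalityI subsetI)
    fix y assume "y \<in> \<Phi> ` Z"
    then obtain f where f: "y = (\<Sum>x\<in>CZ - CB. scale_fun (f x) (unit_vec (e x)))"
      using expand sum_\<Phi> by blast
    have "scale_fun (f x) (unit_vec (e x)) \<in> supp_on N" if "x \<in> CZ - CB" for x
      using that e by (intro vs.subspace_scale[OF subspace_supp_on] unit_vec_in) (auto simp: bij_betw_def)
    then show "y \<in> supp_on N" unfolding f by (rule vs.subspace_sum[OF subspace_supp_on])
  next
    fix y assume y: "y \<in> supp_on N"
    define z where "z = (\<Sum>x\<in>CZ. scale_fun (y (e x)) x)"
    have "z \<in> Z" unfolding z_def
      using CZ(2) by (intro vs.subspace_sum[OF Z(1)] vs.subspace_scale[OF Z(1)]) auto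
    moreover have "\<Phi> z = y"
    proof
      fix n
      show "\<Phi> z n = y n"
      proof (cases "n \<in> N")
        case True
        then obtain x where x: "x \<in> CZ - CB" "n = e x" using e by (auto simp: bij_betw_def)
        then show ?thesis using \<Phi>_ev[OF x(1), of "\<lambda>x. y (e x)"] sum_\<Phi> by (simp add: z_def)
      next
        case False
        then have "n \<noteq> e x" if "x \<in> CZ - CB" for x using that e by (auto simp: bij_betw_def)
        then have "\<Phi> z n = 0"
          unfolding z_def sum_\<Phi> by (simp add: sum_apply scale_fun_def unit_vec_def)
        then show ?thesis using False y by (simp add: supp_on_def)
      qed
    qed
    ultimately show "y \<in> \<Phi> ` Z" by blast
  qed
  \<comment> \<open>The value on a coset is read off an arbitrary representative; this is sound
    because \<open>\<Phi>\<close> vanishes on \<open>B\<close>.\<close>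
  define \<phi> where "\<phi> S = \<Phi> (SOME z. z \<in> S)" for S
  have \<phi>: "\<phi> (z +o B) = \<Phi> z" for z
  proof -
    have "z \<in> z +o B" using vs.subspace_0[OF B(1)] by (auto simp: elt_set_plus_def)
    then have "(SOME x. x \<in> z +o B) \<in> z +o B"
      by (rule someI[where P = "\<lambda>x. x \<in> z +o B"])
    then obtain b where "b \<in> B" "(SOME x. x \<in> z +o B) = z + b" by (auto simp: elt_set_plus_def)
    then show ?thesis by (simp add: \<phi>_def \<Phi>.add \<Phi>B)
  qed
  have coset_eq: "z +o B = z' +o B" if "z \<in> Z" "z' \<in> Z" "\<Phi> z = \<Phi> z'" for z z'
  proof -
    have *: "z +o B \<subseteq> z' +o B" if "z - z' \<in> B" for z z'
    proof
      fix x assume "x \<in> z +o B"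
      then obtain b where b: "b \<in> B" "x = z + b" by (auto simp: elt_set_plus_def)
      then have "x = z' + ((z - z') + b)" by simp
      moreover have "(z - z') + b \<in> B" using that b vs.subspace_add[OF B(1)] by blast
      ultimately show "x \<in> z' +o B" unfolding elt_set_plus_def by blast
    qed
    have "z - z' \<in> B" using that vs.subspace_diff[OF Z(1)] by (intro ker) (auto simp: \<Phi>.diff)
    moreover have "z' - z \<in> B" using that vs.subspace_diff[OF Z(1)] by (intro ker) (auto simp: \<Phi>.diff)
    ultimately show ?thesis using * by blast
  qed
  show ?thesis
    unfolding quotient_iso_def gs
  proof (intro exI[of _ \<phi>] conjI ballI allI)
    show "bij_betw \<phi> (cosets Z B) (supp_on N)"
    proof (rule bij_betw_imageI)
      show "inj_on \<phi> (cosets Z B)"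
      proof (rule inj_onI)
        fix S S' assume S: "S \<in> cosets Z B" "S' \<in> cosets Z B" and eq: "\<phi> S = \<phi> S'"
        from S obtain z z' where z: "z \<in> Z" "S = z +o B" "z' \<in> Z" "S' = z' +o B"
          unfolding cosets_def by blast
        show "S = S'" unfolding z(2,4) by (rule coset_eq) (use z eq \<phi> in simp_all)
      qed
      show "\<phi> ` cosets Z B = supp_on N"
        using im by (simp add: \<phi> image_image cosets_def)
    qed
  qed (simp_all add: \<phi> \<Phi>.add \<Phi>.scale)
qed

section \<open>Connectivity of smoothings\<close>

text \<open>The closure that occurs in \<open>circles\<close>, named so that joins can be added one
  at a time.\<close>

definition eqc :: "('p \<times> 'p) set => ('p \<times> 'p) set" where
  "eqc R = (R \<union> R\<inverse>)\<^sup>*"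

lemma eqc_refl [simp]: "(x, x) \<in> eqc R"
  by (simp add: eqc_def)

lemma eqc_sym: "(x, y) \<in> eqc R ==> (y, x) \<in> eqc R"
  unfolding eqc_def using sym_rtrancl[of "R \<union> R\<inverse>"] by (auto simp: sym_def)

lemma eqc_trans: "(x, y) \<in> eqc R ==> (y, z) \<in> eqc R ==> (x, z) \<in> eqc R"
  unfolding eqc_def by (rule rtrancl_trans)

lemma eqc_base: "(x, y) \<in> R ==> (x, y) \<in> eqc R"
  unfolding eqc_def by auto

lemma eqc_subset:
  assumes R: "R \<subseteq> E" and refl: "\<And>x. (x, x) \<in> E" and sym: "\<And>x y. (x, y) \<in> E ==> (y, x) \<in> E"
    and trans: "\<And>x y z. (x, y) \<in> E ==> (y, z) \<in> E ==> (x, z) \<in> E"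
  shows "eqc R \<subseteq> E"
proof -
  have "(x, y) \<in> E" if "(x, y) \<in> (R \<union> R\<inverse>)\<^sup>*" for x y
    using that by (induction rule: rtrancl_induct) (use R sym trans refl in blast)+
  then show ?thesis by (auto simp: eqc_def)
qed

lemma eqc_least: "R \<subseteq> eqc S ==> eqc R \<subseteq> eqc S"
  by (rule eqc_subset) (auto intro: eqc_sym eqc_trans)

lemma eqc_mono: "R \<subseteq> S ==> eqc R \<subseteq> eqc S"
  by (rule eqc_least) (auto intro: eqc_base)

lemma eqc_image:
  assumes "(x, y) \<in> eqc R" "\<And>x y. (x, y) \<in> R ==> (f x, f y) \<in> eqc S"
  shows "(f x, f y) \<in> eqc S"
proof -
  have "eqc R \<subseteq> {(x, y). (f x, f y) \<in> eqc S}"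
    by (rule eqc_subset) (use assms(2) in \<open>auto intro: eqc_sym eqc_trans\<close>)
  then show ?thesis using assms(1) by auto
qed

lemma eqc_insert:
  "(x, y) \<in> eqc (insert (p, q) R) <->
     (x, y) \<in> eqc R \<or> (x, p) \<in> eqc R \<and> (q, y) \<in> eqc R \<or> (x, q) \<in> eqc R \<and> (p, y) \<in> eqc R"
  (is "?L <-> ?R")
proof
  let ?E = "{(x, y). (x, y) \<in> eqc R \<or> (x, p) \<in> eqc R \<and> (q, y) \<in> eqc R \<or> (x, q) \<in> eqc R \<and> (p, y) \<in> eqc R}"
  have "eqc (insert (p, q) R) \<subseteq> ?E"
  proof (rule eqc_subset)
    show "insert (p, q) R \<subseteq> ?E" by (auto intro: eqc_base)
    show "(y, x) \<in> ?E" if "(x, y) \<in> ?E" for x y using that by (auto intro: eqc_sym)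
    show "(x, z) \<in> ?E" if "(x, y) \<in> ?E" "(y, z) \<in> ?E" for x y z
      using that by (auto intro: eqc_sym eqc_trans)
  qed auto
  then show "?L ==> ?R" by auto
next
  have m: "eqc R \<subseteq> eqc (insert (p, q) R)" by (rule eqc_mono) auto
  have "(p, q) \<in> eqc (insert (p, q) R)" by (rule eqc_base) simp
  then show "?R ==> ?L" using m eqc_sym eqc_trans by (smt (verit) subsetD)
qed

definition conn :: "'p diagram => nat set => ('p \<times> 'p) set" where
  "conn D v = eqc (joins D v)"

lemmas conn_refl [simp] = eqc_refl[of _ "joins D v" for D v, folded conn_def]
lemmas conn_sym = eqc_sym[of _ _ "joins D v" for D v, folded conn_def]
lemmas conn_trans = eqc_trans[of _ _ "joins D v" for D v, folded conn_def]
lemmas conn_base = eqc_base[of _ _ "joins D v" for D v, folded conn_def]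

definition cls :: "'p diagram => nat set => 'p => 'p set" where
  "cls D v p = {q. (p, q) \<in> conn D v}"

lemma circles_eq: "circles D v = cls D v ` points D"
  by (auto simp: circles_def quotient_def cls_def conn_def eqc_def)

lemma cls_self [simp]: "p \<in> cls D v p"
  by (simp add: cls_def)

lemma cls_eq_iff: "cls D v p = cls D v q <-> (p, q) \<in> conn D v"
  by (auto simp: cls_def set_eq_iff intro: conn_sym conn_trans)

lemma in_cls: "q \<in> cls D v p <-> (p, q) \<in> conn D v"
  by (simp add: cls_def)

lemma crossing_points:
  assumes "k < n_crossings D" "crossings D ! k = (a, b, c, d)"
  shows "a \<in> points D" "b \<in> points D" "c \<in> points D" "d \<in> points D"
proof -
  have "(a, b, c, d) \<in> set (crossings D)" using assms nth_mem by metis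
  then have "{a, b, c, d} \<subseteq> points D"
    using UN_upper[of "(a, b, c, d)" "set (crossings D)" "\<lambda>(a, b, c, d). {a, b, c, d}"]
    by (auto simp: points_def)
  then show "a \<in> points D" "b \<in> points D" "c \<in> points D" "d \<in> points D" by auto
qed

lemma joins_points: "joins D v \<subseteq> points D \<times> points D"
proof -
  have "smoothing_joins t (crossings D ! k) \<subseteq> points D \<times> points D" if "k < n_crossings D" for k t
    using crossing_points[OF that] by (cases "crossings D ! k"; cases t) auto
  moreover have "set (arcs D) \<subseteq> points D \<times> points D" by (auto simp: points_def)
  ultimately show ?thesis unfolding joins_def by blast
qed

lemma conn_points: "(p, q) \<in> conn D v ==> p \<in> points D <-> q \<in> points D"
proof -
  have "eqc (joins D v) \<subseteq> {(p, q). p \<in> points D <-> q \<in> points D}"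
    by (rule eqc_subset) (use joins_points in auto)
  then show "(p, q) \<in> conn D v ==> p \<in> points D <-> q \<in> points D" by (auto simp: conn_def)
qed

lemma cls_subset: "p \<in> points D ==> cls D v p \<subseteq> points D"
  using conn_points by (fastforce simp: cls_def)

lemma finite_points: "finite (points D)"
  by (auto simp: points_def)

lemma finite_circles: "finite (circles D v)"
  by (simp add: circles_eq finite_points)

text \<open>\<open>J\<close> collects the joins that do not come from crossing \<open>k\<close>;
  they are the same in both smoothings.\<close>

lemma joins_split:
  assumes "k < n_crossings D" "crossings D ! k = (a, b, c, d)" "k \<notin> v"
  obtains J where "joins D v = insert (a, b) (insert (c, d) J)"
    "joins D (insert k v) = insert (a, d) (insert (b, c) J)"
proof
  let ?J = "set (arcs D) \<union> (\<Union>j\<in>{..<n_crossings D} - {k}. smoothing_joins (j \<in> v) (crossings D ! j))"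
  have e: "{..<n_crossings D} = insert k ({..<n_crossings D} - {k})" using assms(1) by auto
  have "joins D v = set (arcs D) \<union> (\<Union>j\<in>insert k ({..<n_crossings D} - {k}). smoothing_joins (j \<in> v) (crossings D ! j))"
    unfolding joins_def using e by simp
  also have "\<dots> = insert (a, b) (insert (c, d) ?J)" using assms(2,3) by auto
  finally show "joins D v = insert (a, b) (insert (c, d) ?J)" .
  have "joins D (insert k v) = set (arcs D) \<union> (\<Union>j\<in>insert k ({..<n_crossings D} - {k}). smoothing_joins (j \<in> insert k v) (crossings D ! j))"
    unfolding joins_def using e by simp
  also have "(\<Union>j\<in>insert k ({..<n_crossings D} - {k}). smoothing_joins (j \<in> insert k v) (crossings D ! j))
    = {(a, d), (b, c)} \<union> (\<Union>j\<in>{..<n_crossings D} - {k}. smoothing_joins (j \<in> insert k v) (crossings D ! j))"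
    by (subst UN_insert) (simp add: assms(2))
  also have "(\<Union>j\<in>{..<n_crossings D} - {k}. smoothing_joins (j \<in> insert k v) (crossings D ! j))
    = (\<Union>j\<in>{..<n_crossings D} - {k}. smoothing_joins (j \<in> v) (crossings D ! j))"
    by (rule SUP_cong) auto
  also have "set (arcs D) \<union> ({(a, d), (b, c)} \<union> (\<Union>j\<in>{..<n_crossings D} - {k}. smoothing_joins (j \<in> v) (crossings D ! j)))
    = insert (a, d) (insert (b, c) ?J)" by blast
  finally show "joins D (insert k v) = insert (a, d) (insert (b, c) ?J)" .
qed

context
  fixes D :: "'p diagram" and v k a b c d
  assumes k: "k < n_crossings D" "crossings D ! k = (a, b, c, d)" "k \<notin> v"
begin

lemma conn_crossing:
  "(a, b) \<in> conn D v" "(c, d) \<in> conn D v" "(a, d) \<in> conn D (insert k v)" "(b, c) \<in> conn D (insert k v)"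
  using joins_split[OF k] by (metis conn_base insertI1 insertI2)+

text \<open>If \<open>a\<close> and \<open>c\<close> are connected afterwards, all four ends of the
  crossing lie in one class then. Over the common joins \<open>J\<close>, the pairs ab, cd, ac
  generate the same equivalence as ad, bc, so changing the crossing amounts to adding the single
  join ac.\<close>

lemma conn_merge_eq:
  assumes "(a, c) \<in> conn D (insert k v)"
  shows "conn D (insert k v) = eqc (insert (a, c) (joins D v))"
proof
  obtain J where J: "joins D v = insert (a, b) (insert (c, d) J)"
    "joins D (insert k v) = insert (a, d) (insert (b, c) J)" using joins_split[OF k] by blast
  let ?E = "eqc (insert (a, c) (joins D v))"
  have "(a, c) \<in> ?E" "(a, b) \<in> ?E" "(c, d) \<in> ?E" by (auto intro!: eqc_base simp: J)
  then have "(a, d) \<in> ?E" "(b, c) \<in> ?E" by (meson eqc_sym eqc_trans)+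
  then show "conn D (insert k v) \<subseteq> ?E"
    unfolding conn_def by (intro eqc_least) (auto intro!: eqc_base simp: J)
  have "(a, b) \<in> conn D (insert k v)" "(c, d) \<in> conn D (insert k v)"
    using assms conn_crossing by (meson conn_sym conn_trans)+
  then show "?E \<subseteq> conn D (insert k v)"
    using assms unfolding conn_def by (intro eqc_least) (auto intro!: eqc_base simp: J)
qed

text \<open>The same argument with the two smoothings exchanged: a split is a merge read
  backwards.\<close>

lemma conn_split_eq:
  assumes "(a, c) \<in> conn D v"
  shows "conn D v = eqc (insert (a, c) (joins D (insert k v)))"
proof
  obtain J where J: "joins D v = insert (a, b) (insert (c, d) J)"
    "joins D (insert k v) = insert (a, d) (insert (b, c) J)" using joins_split[OF k] by blast
  let ?E = "eqc (insert (a, c) (joins D (insert k v)))"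
  have "(a, c) \<in> ?E" "(a, d) \<in> ?E" "(b, c) \<in> ?E" by (auto intro!: eqc_base simp: J)
  then have "(a, b) \<in> ?E" "(c, d) \<in> ?E" by (meson eqc_sym eqc_trans)+
  then show "conn D v \<subseteq> ?E"
    unfolding conn_def by (intro eqc_least) (auto intro!: eqc_base simp: J)
  have "(a, d) \<in> conn D v" "(b, c) \<in> conn D v"
    using assms conn_crossing by (meson conn_sym conn_trans)+
  then show "?E \<subseteq> conn D v"
    using assms unfolding conn_def by (intro eqc_least) (auto intro!: eqc_base simp: J)
qed

lemma conn_merge:
  assumes "(a, c) \<in> conn D (insert k v)"
  shows "(p, q) \<in> conn D (insert k v) <-> (p, q) \<in> conn D v \<or>
    (p, a) \<in> conn D v \<and> (c, q) \<in> conn D v \<or> (p, c) \<in> conn D v \<and> (a, q) \<in> conn D v"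
  unfolding conn_merge_eq[OF assms] eqc_insert by (simp add: conn_def)

lemma conn_split:
  assumes "(a, c) \<in> conn D v"
  shows "(p, q) \<in> conn D v <-> (p, q) \<in> conn D (insert k v) \<or>
    (p, a) \<in> conn D (insert k v) \<and> (c, q) \<in> conn D (insert k v) \<or>
    (p, c) \<in> conn D (insert k v) \<and> (a, q) \<in> conn D (insert k v)"
  unfolding conn_split_eq[OF assms] eqc_insert by (simp add: conn_def)

lemma circles_merge:
  assumes "(a, c) \<notin> conn D v" "(a, c) \<in> conn D (insert k v)"
  shows "circles D v - circles D (insert k v) = {cls D v a, cls D v c}" (is ?A)
    "circles D (insert k v) - circles D v = {cls D (insert k v) a}" (is ?B)
    "cls D v a \<noteq> cls D v c"
proof -
  let ?w = "insert k v"
  note m = conn_merge[OF assms(2)]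
  have pts: "a \<in> points D" "c \<in> points D" using crossing_points[OF k(1,2)] by auto
  have same: "cls D ?w p = cls D v p" if "(p, a) \<notin> conn D v" "(p, c) \<notin> conn D v" for p
    using that by (auto simp: cls_def m)
  have w: "cls D ?w p = cls D ?w a" if "(p, a) \<in> conn D v \<or> (p, c) \<in> conn D v" for p
    unfolding cls_eq_iff m using that by auto
  have ne: "cls D ?w a \<noteq> cls D v p" for p
    using assms by (metis cls_eq_iff cls_self in_cls)
  have n1: "cls D v p \<noteq> cls D ?w q" if "(p, a) \<in> conn D v \<or> (p, c) \<in> conn D v" for p q
  proof
    assume e: "cls D v p = cls D ?w q"
    then have "cls D ?w q = cls D ?w p" using cls_self in_cls cls_eq_iff by metis
    then show False using w[OF that] ne[of p] e by simp
  qed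
  have "C \<in> {cls D v a, cls D v c}" if C: "C \<in> circles D v" "C \<notin> circles D ?w" for C
  proof -
    obtain p where p: "p \<in> points D" "C = cls D v p" using C(1) by (auto simp: circles_eq)
    then have "(p, a) \<in> conn D v \<or> (p, c) \<in> conn D v"
      using same[of p] C(2) by (auto simp: circles_eq)
    then show ?thesis using p(2) by (auto simp: cls_eq_iff)
  qed
  moreover have "cls D v a \<in> circles D v - circles D ?w" "cls D v c \<in> circles D v - circles D ?w"
    using pts n1 by (auto simp: circles_eq)
  ultimately show ?A by blast
  have "C = cls D ?w a" if C: "C \<in> circles D ?w" "C \<notin> circles D v" for C
  proof -
    obtain p where p: "p \<in> points D" "C = cls D ?w p" using C(1) by (auto simp: circles_eq)
    then have "(p, a) \<in> conn D v \<or> (p, c) \<in> conn D v"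
      using same[of p] C(2) by (auto simp: circles_eq)
    then show ?thesis using w p(2) by blast
  qed
  moreover have "cls D ?w a \<in> circles D ?w - circles D v"
    using pts ne by (auto simp: circles_eq)
  ultimately show ?B by blast
  show "cls D v a \<noteq> cls D v c" using assms(1) by (simp add: cls_eq_iff)
qed

lemma circles_split:
  assumes "(a, c) \<in> conn D v" "(a, c) \<notin> conn D (insert k v)"
  shows "circles D (insert k v) - circles D v = {cls D (insert k v) a, cls D (insert k v) c}" (is ?A)
    "circles D v - circles D (insert k v) = {cls D v a}" (is ?B)
    "cls D (insert k v) a \<noteq> cls D (insert k v) c"
proof -
  let ?w = "insert k v"
  note m = conn_split[OF assms(1)]
  have pts: "a \<in> points D" "c \<in> points D" using crossing_points[OF k(1,2)] by auto
  have same: "cls D v p = cls D ?w p" if "(p, a) \<notin> conn D ?w" "(p, c) \<notin> conn D ?w" for p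
    using that by (auto simp: cls_def m)
  have w: "cls D v p = cls D v a" if "(p, a) \<in> conn D ?w \<or> (p, c) \<in> conn D ?w" for p
    unfolding cls_eq_iff m using that by auto
  have ne: "cls D v a \<noteq> cls D ?w p" for p
    using assms by (metis cls_eq_iff cls_self in_cls)
  have n1: "cls D ?w p \<noteq> cls D v q" if "(p, a) \<in> conn D ?w \<or> (p, c) \<in> conn D ?w" for p q
  proof
    assume e: "cls D ?w p = cls D v q"
    then have "cls D v q = cls D v p" using cls_self in_cls cls_eq_iff by metis
    then show False using w[OF that] ne[of p] e by simp
  qed
  have "C \<in> {cls D ?w a, cls D ?w c}" if C: "C \<in> circles D ?w" "C \<notin> circles D v" for C
  proof -
    obtain p where p: "p \<in> points D" "C = cls D ?w p" using C(1) by (auto simp: circles_eq)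
    then have "(p, a) \<in> conn D ?w \<or> (p, c) \<in> conn D ?w"
      using same[of p] C(2) by (auto simp: circles_eq)
    then show ?thesis using p(2) by (auto simp: cls_eq_iff)
  qed
  moreover have "cls D ?w a \<in> circles D ?w - circles D v" "cls D ?w c \<in> circles D ?w - circles D v"
    using pts n1 by (auto simp: circles_eq)
  ultimately show ?A by blast
  have "C = cls D v a" if C: "C \<in> circles D v" "C \<notin> circles D ?w" for C
  proof -
    obtain p where p: "p \<in> points D" "C = cls D v p" using C(1) by (auto simp: circles_eq)
    then have "(p, a) \<in> conn D ?w \<or> (p, c) \<in> conn D ?w"
      using same[of p] C(2) by (auto simp: circles_eq)
    then show ?thesis using w p(2) by blast
  qed
  moreover have "cls D v a \<in> circles D v - circles D ?w"
    using pts ne by (auto simp: circles_eq)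
  ultimately show ?B by blast
  show "cls D ?w a \<noteq> cls D ?w c" using assms(2) by (simp add: cls_eq_iff)
qed

lemma common_circles:
  assumes "(a, c) \<in> conn D v <-> (a, c) \<notin> conn D (insert k v)"
  shows "circles D v \<inter> circles D (insert k v) =
     cls D v ` {p \<in> points D. (p, a) \<notin> conn D v \<and> (p, c) \<notin> conn D v}"
    and "p \<in> points D ==> (p, a) \<notin> conn D v ==> (p, c) \<notin> conn D v ==> cls D (insert k v) p = cls D v p"
proof -
  have same: "cls D (insert k v) p = cls D v p" if "(p, a) \<notin> conn D v" "(p, c) \<notin> conn D v" for p
  proof (cases "(a, c) \<in> conn D v")
    case True
    then show ?thesis using that by (auto simp: cls_def conn_split[OF True])
  next
    case False
    then have "(a, c) \<in> conn D (insert k v)" using assms by simp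
    then show ?thesis using that by (auto simp: cls_def conn_merge)
  qed
  have "circles D v \<inter> circles D (insert k v) = circles D v - (circles D v - circles D (insert k v))" by blast
  also have "\<dots> = circles D v - {cls D v a, cls D v c}"
  proof (cases "(a, c) \<in> conn D v")
    case True
    then have "cls D v a = cls D v c" by (simp add: cls_eq_iff)
    then show ?thesis using circles_split(2) True assms by simp
  next
    case False
    then show ?thesis using circles_merge(1) assms by simp
  qed
  also have "\<dots> = cls D v ` {p \<in> points D. (p, a) \<notin> conn D v \<and> (p, c) \<notin> conn D v}"
  proof -
    have "cls D v p \<in> {cls D v a, cls D v c} <-> (p, a) \<in> conn D v \<or> (p, c) \<in> conn D v" for p
      by (simp add: cls_eq_iff)
    then show ?thesis unfolding circles_eq by blast
  qed
  finally show "circles D v \<inter> circles D (insert k v) =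
     cls D v ` {p \<in> points D. (p, a) \<notin> conn D v \<and> (p, c) \<notin> conn D v}" .
  show "p \<in> points D ==> (p, a) \<notin> conn D v ==> (p, c) \<notin> conn D v ==> cls D (insert k v) p = cls D v p"
    using same by blast
qed

end

section \<open>The Khovanov complex in terms of sets of points\<close>

text \<open>
  A labelling is encoded by the set of the points on circles labelled X.  This makes the
  generators of all smoothings comparable.
\<close>

definition saturated :: "'p diagram => nat set => 'p set => bool" where
  "saturated D v A <-> A \<subseteq> points D \<and> (\<forall>p q. (p, q) \<in> conn D v --> p \<in> A --> q \<in> A)"

text \<open>The arguments tell whether a circle is labelled X. Multiplication and comultiplication
  become relations because all their coefficients are 0 or 1; X times X is related to
  nothing.\<close>

definition merge_rel :: "bool => bool => bool => bool" where
  "merge_rel x y z <-> \<not> (x \<and> y) \<and> (z <-> x \<or> y)"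

definition split_rel :: "bool => bool => bool => bool" where
  "split_rel x y z <-> (if x then y \<and> z else y \<noteq> z)"

text \<open>The ends \<open>a\<close> and \<open>c\<close> represent all circles at the crossing,
  since in either smoothing \<open>b\<close> and \<open>d\<close> are each joined to one of
  them.\<close>

definition edge :: "'p diagram => nat set => nat => 'p set => 'p set => bool" where
  "edge D v k A A' <-> (case crossings D ! k of (a, b, c, d) =>
     (\<forall>p\<in>points D. (p, a) \<notin> conn D v --> (p, c) \<notin> conn D v --> (p \<in> A' <-> p \<in> A)) \<and>
     (if (a, c) \<in> conn D v then split_rel (a \<in> A) (a \<in> A') (c \<in> A')
      else merge_rel (a \<in> A) (c \<in> A) (a \<in> A')))"

text \<open>Every change of smoothing merges two circles or splits one; this excludes virtual diagrams.\<close>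

definition alternating :: "'p diagram => bool" where
  "alternating D <-> (\<forall>v k a b c d. v \<subseteq> {..<n_crossings D} --> k < n_crossings D --> k \<notin> v -->
     crossings D ! k = (a, b, c, d) --> (a, c) \<in> conn D v <-> (a, c) \<notin> conn D (insert k v))"

lemma saturatedD: "saturated D v A ==> (p, q) \<in> conn D v ==> p \<in> A <-> q \<in> A"
  unfolding saturated_def using conn_sym by metis

lemma saturated_subset: "saturated D v A ==> A \<subseteq> points D"
  by (simp add: saturated_def)

lemma finite_saturated: "finite {A. saturated D v A}"
  by (rule finite_subset[of _ "Pow (points D)"]) (auto simp: saturated_def finite_points)

lemma saturated_cls_subset: "saturated D v A ==> p \<in> A ==> cls D v p \<subseteq> A"
  by (auto simp: saturated_def cls_def)

lemma saturated_cls: "p \<in> points D ==> saturated D v (cls D v p)"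
  using cls_subset[of p D v] by (auto simp: saturated_def in_cls intro: conn_trans)

lemma saturated_Un: "saturated D v A ==> saturated D v B ==> saturated D v (A \<union> B)"
  by (auto simp: saturated_def)

lemma saturated_Diff: "saturated D v A ==> saturated D v B ==> saturated D v (A - B)"
  using saturatedD[of D v A] saturatedD[of D v B] by (auto simp: saturated_def)

lemma saturated_disjoint: "saturated D v B ==> p \<notin> B ==> B \<inter> cls D v p = {}"
  using saturatedD[of D v B p] by (auto simp: cls_def)

lemma saturated_Diff_Un: "saturated D v B ==> p \<in> B ==> (B - cls D v p) \<union> cls D v p = B"
  using saturated_cls_subset[of D v B p] by blast

lemma alternatingD:
  assumes "alternating D" "v \<subseteq> {..<n_crossings D}" "k < n_crossings D" "k \<notin> v"
    "crossings D ! k = (a, b, c, d)"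
  shows "(a, c) \<in> conn D v <-> (a, c) \<notin> conn D (insert k v)"
  using assms unfolding alternating_def by blast

lemma saturated_empty [simp]: "saturated D v {}"
  by (simp add: saturated_def)

text \<open>Multiplication by X on the circle through p, which commutes with the edge maps:\<close>

lemma edge_linear:
  assumes k: "k < n_crossings D" "crossings D ! k = (a, b, c, d)" "k \<notin> v"
    and alt: "(a, c) \<in> conn D v <-> (a, c) \<notin> conn D (insert k v)"
    and sat: "saturated D v A" "saturated D (insert k v) A'" and p: "p \<in> points D" "p \<notin> A"
  shows "edge D v k (A \<union> cls D v p) A' <-> p \<in> A' \<and> edge D v k A (A' - cls D (insert k v) p)"
proof -
  let ?w = "insert k v"
  have pts: "a \<in> points D" "c \<in> points D" using crossing_points[OF k(1,2)] by auto
  have A: "x \<in> A <-> y \<in> A" if "(x, y) \<in> conn D v" for x y using saturatedD[OF sat(1) that] .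
  have A': "x \<in> A' <-> y \<in> A'" if "(x, y) \<in> conn D ?w" for x y using saturatedD[OF sat(2) that] .
  have far: "cls D ?w q = cls D v q" if "q \<in> points D" "(q, a) \<notin> conn D v" "(q, c) \<notin> conn D v" for q
    using common_circles(2)[OF k alt that] .
  have off_iff: "(x \<in> A \<union> cls D v p) = (x \<in> A \<or> (p, x) \<in> conn D v)"
    "(x \<in> A' - cls D ?w p) = (x \<in> A' \<and> (p, x) \<notin> conn D ?w)" for x
    by (auto simp: cls_def)
  show ?thesis
  \<comment> \<open>Away from the crossing the circle of \<open>p\<close> survives unchanged and X
    on it is simply carried along. At the crossing the claim is linearity of the product and the
    coproduct over multiplication by X.\<close>
  proof (cases "(p, a) \<in> conn D v \<or> (p, c) \<in> conn D v")
    case False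
    then have nc: "(p, a) \<notin> conn D v" "(p, c) \<notin> conn D v" by auto
    have pw: "cls D ?w p = cls D v p" by (rule far[OF p(1) nc])
    then have nw: "(p, a) \<notin> conn D ?w" "(p, c) \<notin> conn D ?w" using nc in_cls by metis+
    have "(\<forall>x\<in>points D. (x, a) \<notin> conn D v --> (x, c) \<notin> conn D v --> (x \<in> A') = (x \<in> A \<or> (p, x) \<in> conn D v))
      <-> p \<in> A' \<and> (\<forall>x\<in>points D. (x, a) \<notin> conn D v --> (x, c) \<notin> conn D v -->
          (x \<in> A' \<and> (p, x) \<notin> conn D ?w) = (x \<in> A))" (is "?L <-> ?R")
    proof
      assume L: ?L
      then have "p \<in> A'" using p(1) nc by auto
      moreover have "(x \<in> A' \<and> (p, x) \<notin> conn D ?w) = (x \<in> A)"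
        if "x \<in> points D" "(x, a) \<notin> conn D v" "(x, c) \<notin> conn D v" for x
      proof -
        have "(p, x) \<in> conn D ?w <-> (p, x) \<in> conn D v" using pw in_cls by metis
        moreover have "x \<notin> A" if "(p, x) \<in> conn D v" using A[OF that] p(2) by simp
        ultimately show ?thesis using L that by auto
      qed
      ultimately show ?R by blast
    next
      assume R: ?R
      show ?L
      proof (intro ballI impI)
        fix x assume x: "x \<in> points D" "(x, a) \<notin> conn D v" "(x, c) \<notin> conn D v"
        have "(p, x) \<in> conn D ?w <-> (p, x) \<in> conn D v" using pw in_cls by metis
        moreover have "x \<in> A'" if "(p, x) \<in> conn D ?w" using A'[OF that] R by simp
        ultimately show "(x \<in> A') = (x \<in> A \<or> (p, x) \<in> conn D v)" using R x by auto
      qed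
    qed
    then show ?thesis
      unfolding edge_def k(2) prod.case off_iff using nc nw by auto
  next
    case True
    have off: "(\<forall>x\<in>points D. (x, a) \<notin> conn D v --> (x, c) \<notin> conn D v --> (x \<in> A') = (x \<in> A \<or> (p, x) \<in> conn D v))
      <-> (\<forall>x\<in>points D. (x, a) \<notin> conn D v --> (x, c) \<notin> conn D v -->
          (x \<in> A' \<and> (p, x) \<notin> conn D ?w) = (x \<in> A))"
    proof (intro ball_cong refl imp_cong)
      fix x assume x: "x \<in> points D" "(x, a) \<notin> conn D v" "(x, c) \<notin> conn D v"
      have "(p, x) \<notin> conn D v" using True x(2,3) conn_sym conn_trans by metis
      moreover have "(x, p) \<notin> conn D ?w"
        using far[OF x] \<open>(p, x) \<notin> conn D v\<close> conn_sym in_cls by metis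
      ultimately show "((x \<in> A') = (x \<in> A \<or> (p, x) \<in> conn D v)) = ((x \<in> A' \<and> (p, x) \<notin> conn D ?w) = (x \<in> A))"
        using conn_sym by metis
    qed
    show ?thesis
    proof (cases "(a, c) \<in> conn D v")
      case s: True
      then have ns: "(a, c) \<notin> conn D ?w" using alt by simp
      have pv: "(p, a) \<in> conn D v" "(p, c) \<in> conn D v" using True s conn_sym conn_trans by metis+
      have "a \<notin> A" using A[OF pv(1)] p(2) by simp
      have "(p, a) \<in> conn D ?w \<or> (p, c) \<in> conn D ?w"
        using pv(1) conn_split[OF k s, of p a] by auto
      then consider "(p, a) \<in> conn D ?w" "(p, c) \<notin> conn D ?w" | "(p, c) \<in> conn D ?w" "(p, a) \<notin> conn D ?w"
        using ns conn_sym conn_trans by metis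
      then show ?thesis
        unfolding edge_def k(2) prod.case off_iff off using s pv \<open>a \<notin> A\<close> A'[of p a] A'[of p c]
        by cases (auto simp: split_rel_def)
    next
      case m: False
      then have w: "(a, c) \<in> conn D ?w" using alt by simp
      have pw: "(p, a) \<in> conn D ?w" using True conn_merge[OF k w, of p a] by auto
      consider "(p, a) \<in> conn D v" "(p, c) \<notin> conn D v" | "(p, c) \<in> conn D v" "(p, a) \<notin> conn D v"
        using True m conn_sym conn_trans by metis
      then show ?thesis
        unfolding edge_def k(2) prod.case off_iff off using m pw A'[OF pw] A[of p a] A[of p c] p(2)
        by cases (auto simp: merge_rel_def)
    qed
  qed
qed

text \<open>The empty set is the labelling with One everywhere. It generates the module of the
  vertex under the actions of X, so together with \<open>edge_linear\<close> its image determines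
  the edge map.\<close>

lemma edge_empty:
  assumes k: "k < n_crossings D" "crossings D ! k = (a, b, c, d)" "k \<notin> v"
    and alt: "(a, c) \<in> conn D v <-> (a, c) \<notin> conn D (insert k v)"
    and sat: "saturated D (insert k v) A'"
  shows "edge D v k {} A' <->
    (if (a, c) \<in> conn D v then A' = cls D (insert k v) a \<or> A' = cls D (insert k v) c else A' = {})"
proof -
  let ?w = "insert k v"
  have A': "x \<in> A' <-> y \<in> A'" if "(x, y) \<in> conn D ?w" for x y using saturatedD[OF sat that] .
  have pts: "a \<in> points D" "c \<in> points D" using crossing_points[OF k(1,2)] by auto
  have far: "cls D ?w q = cls D v q" if "q \<in> points D" "(q, a) \<notin> conn D v" "(q, c) \<notin> conn D v" for q
    using common_circles(2)[OF k alt that] .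
  have sub: "A' \<subseteq> points D" using sat by (rule saturated_subset)
  show ?thesis
  proof (cases "(a, c) \<in> conn D v")
    case s: True
    then have ns: "(a, c) \<notin> conn D ?w" using alt by simp
    have near: "(p, a) \<in> conn D ?w \<or> (p, c) \<in> conn D ?w <-> (p, a) \<in> conn D v" for p
      using conn_split[OF k s, of p a] by auto
    have near': "(p, c) \<in> conn D v <-> (p, a) \<in> conn D v" for p
      using s conn_sym conn_trans by metis
    have cw: "x \<in> cls D ?w y <-> (x, y) \<in> conn D ?w" for x y by (auto simp: cls_def intro: conn_sym)
    have "A' = cls D ?w a" if e: "edge D v k {} A'" "a \<in> A'" "c \<notin> A'"
    proof (intro set_eqI iffI)
      fix x assume x: "x \<in> A'"
      then have "(x, a) \<in> conn D v" using e(1) sub s near' by (auto simp: edge_def k(2))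
      then have "(x, a) \<in> conn D ?w" using near A'[of x c] x e(3) by blast
      then show "x \<in> cls D ?w a" by (simp add: cw)
    qed (use e A' cw in blast)
    moreover have "A' = cls D ?w c" if e: "edge D v k {} A'" "c \<in> A'" "a \<notin> A'"
    proof (intro set_eqI iffI)
      fix x assume x: "x \<in> A'"
      then have "(x, a) \<in> conn D v" using e(1) sub s near' by (auto simp: edge_def k(2))
      then have "(x, c) \<in> conn D ?w" using near A'[of x a] x e(3) by blast
      then show "x \<in> cls D ?w c" by (simp add: cw)
    qed (use e A' cw in blast)
    moreover have "edge D v k {} (cls D ?w a)" "edge D v k {} (cls D ?w c)"
      using s ns near near' conn_sym[of a c D ?w] conn_sym[of c a D ?w]
      by (auto simp: edge_def k(2) split_rel_def cw)
    moreover have "a \<in> A' <-> c \<notin> A'" if "edge D v k {} A'"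
      using that s by (auto simp: edge_def k(2) split_rel_def)
    ultimately show ?thesis using s by metis
  next
    case m: False
    then have w: "(a, c) \<in> conn D ?w" using alt by simp
    have near: "(p, a) \<in> conn D v \<or> (p, c) \<in> conn D v ==> (p, a) \<in> conn D ?w" for p
      using conn_merge[OF k w, of p a] by auto
    have "A' = {}" if e: "edge D v k {} A'"
    proof (rule ccontr)
      assume "A' \<noteq> {}"
      then obtain x where x: "x \<in> A'" by auto
      have "a \<notin> A'" using e m by (auto simp: edge_def k(2) merge_rel_def)
      moreover have "(x, a) \<in> conn D ?w"
        using e x sub near by (auto simp: edge_def k(2))
      ultimately show False using A' x by blast
    qed
    moreover have "edge D v k {} {}" using m by (simp add: edge_def k(2) merge_rel_def)
    ultimately show ?thesis using m by auto
  qed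
qed

lemma card_circles_insert:
  assumes k: "k < n_crossings D" "crossings D ! k = (a, b, c, d)" "k \<notin> v"
    and alt: "(a, c) \<in> conn D v <-> (a, c) \<notin> conn D (insert k v)"
  shows "int (card (circles D (insert k v))) = int (card (circles D v)) + (if (a, c) \<in> conn D v then 1 else -1)"
proof -
  let ?w = "insert k v"
  have c: "card (circles D u) = card (circles D u - circles D u') + card (circles D u \<inter> circles D u')" for u u'
    using card_Diff_subset_Int[of "circles D u" "circles D u'"] card_mono[of "circles D u" "circles D u \<inter> circles D u'"]
    by (simp add: finite_circles)
  show ?thesis
    using c[of v ?w] c[of ?w v] circles_split[OF k] circles_merge[OF k] alt
    by (auto simp: Int_commute)
qed

text \<open>Intermediate labellings are counted, not just asserted to exist: a composite can have
  coefficient 2, as when a circle labelled One is split and the halves are merged again, giving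
  2X.\<close>

definition two_steps :: "'p diagram => nat set => nat => nat => 'p set => 'p set => nat" where
  "two_steps D v k l A A'' =
     card {A'. saturated D (insert k v) A' \<and> edge D v k A A' \<and> edge D (insert k v) l A' A''}"

text \<open>X on the circle of \<open>p\<close> may be applied before the first edge, between the
  edges or after the second. Adding the circle of \<open>p\<close> is therefore a bijection between
  the intermediate labellings of the two composites.\<close>

lemma two_steps_linear:
  assumes alt: "alternating D" and v: "v \<subseteq> {..<n_crossings D}"
    and k: "k < n_crossings D" "k \<notin> v" and l: "l < n_crossings D" "l \<notin> v" "k \<noteq> l"
    and sat: "saturated D v A" "saturated D (insert l (insert k v)) A''" and p: "p \<in> points D" "p \<notin> A"
  shows "two_steps D v k l (A \<union> cls D v p) A'' =
    (if p \<in> A'' then two_steps D v k l A (A'' - cls D (insert l (insert k v)) p) else 0)"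
proof -
  let ?v1 = "insert k v" and ?v2 = "insert l (insert k v)"
  obtain a b c d where cr: "crossings D ! k = (a, b, c, d)" by (cases "crossings D ! k")
  obtain a' b' c' d' where cr': "crossings D ! l = (a', b', c', d')" by (cases "crossings D ! l")
  have alt1: "(a, c) \<in> conn D v <-> (a, c) \<notin> conn D ?v1"
    using alternatingD[OF alt v k cr] .
  have alt2: "(a', c') \<in> conn D ?v1 <-> (a', c') \<notin> conn D ?v2"
    using alternatingD[OF alt _ l(1) _ cr', of ?v1] v k l by auto
  note lin1 = edge_linear[OF k(1) cr k(2) alt1 sat(1) _ p]
  have lin2: "edge D ?v1 l (B \<union> cls D ?v1 p) A'' <-> p \<in> A'' \<and> edge D ?v1 l B (A'' - cls D ?v2 p)"
    if "saturated D ?v1 B" "p \<notin> B" for B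
    using edge_linear[OF l(1) cr' _ alt2 that(1) sat(2) p(1) that(2)] l by auto
  have c1: "saturated D ?v1 (cls D ?v1 p)" by (rule saturated_cls[OF p(1)])
  have s2: "saturated D ?v2 (A'' - cls D ?v2 p)"
    using sat(2) saturated_cls[OF p(1)] by (rule saturated_Diff)
  have lv: "l \<notin> ?v1" using l by simp
  define S where "S = {A'. saturated D ?v1 A' \<and> edge D v k (A \<union> cls D v p) A' \<and> edge D ?v1 l A' A''}"
  define T where "T = {B. saturated D ?v1 B \<and> edge D v k A B \<and> p \<in> A'' \<and> edge D ?v1 l B (A'' - cls D ?v2 p)}"
  have T: "B \<inter> cls D ?v1 p = {}" if B: "B \<in> T" for B
  proof (rule saturated_disjoint)
    show sB: "saturated D ?v1 B" using B by (simp add: T_def)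
    \<comment> \<open>If \<open>p\<close> were in \<open>B\<close>, linearity of the second edge
      would force \<open>p\<close> into its target, from which the circle of \<open>p\<close> has
      been removed.\<close>
    show "p \<notin> B"
    proof
      assume pB: "p \<in> B"
      have sB': "saturated D ?v1 (B - cls D ?v1 p)" using sB c1 by (rule saturated_Diff)
      have "edge D ?v1 l ((B - cls D ?v1 p) \<union> cls D ?v1 p) (A'' - cls D ?v2 p)"
        unfolding saturated_Diff_Un[OF sB pB] using B by (simp add: T_def)
      then show False
        using edge_linear[OF l(1) cr' lv alt2 sB' s2 p(1)] by simp
    qed
  qed
  have TS: "B \<union> cls D ?v1 p \<in> S" if B: "B \<in> T" for B
  proof -
    have sB: "saturated D ?v1 B" using B by (simp add: T_def)
    have s: "saturated D ?v1 (B \<union> cls D ?v1 p)" using sB c1 by (rule saturated_Un)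
    have nB: "p \<notin> B" using T[OF B] cls_self[of p D ?v1] by blast
    have "(B \<union> cls D ?v1 p) - cls D ?v1 p = B" using T[OF B] by blast
    then have "edge D v k (A \<union> cls D v p) (B \<union> cls D ?v1 p)"
      using lin1[OF s] B by (simp add: T_def)
    moreover have "edge D ?v1 l (B \<union> cls D ?v1 p) A''"
      using lin2[OF sB nB] B by (simp add: T_def)
    ultimately show ?thesis using s by (simp add: S_def)
  qed
  have ST: "A' - cls D ?v1 p \<in> T \<and> p \<in> A'" if A': "A' \<in> S" for A'
  proof -
    have sA: "saturated D ?v1 A'" using A' by (simp add: S_def)
    have e: "p \<in> A'" "edge D v k A (A' - cls D ?v1 p)" using lin1[OF sA] A' by (simp_all add: S_def)
    have s: "saturated D ?v1 (A' - cls D ?v1 p)" using sA c1 by (rule saturated_Diff)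
    have "edge D ?v1 l ((A' - cls D ?v1 p) \<union> cls D ?v1 p) A''"
      unfolding saturated_Diff_Un[OF sA e(1)] using A' by (simp add: S_def)
    then have "p \<in> A'' \<and> edge D ?v1 l (A' - cls D ?v1 p) (A'' - cls D ?v2 p)"
      using lin2[OF s] by simp
    then show ?thesis using s e by (simp add: T_def)
  qed
  have "bij_betw (\<lambda>B. B \<union> cls D ?v1 p) T S"
  proof (rule bij_betw_imageI)
    show "inj_on (\<lambda>B. B \<union> cls D ?v1 p) T"
    proof (rule inj_onI)
      fix B B' assume B: "B \<in> T" "B' \<in> T" and e: "B \<union> cls D ?v1 p = B' \<union> cls D ?v1 p"
      show "B = B'" using T[OF B(1)] T[OF B(2)] e by blast
    qed
    show "(\<lambda>B. B \<union> cls D ?v1 p) ` T = S"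
    proof (intro equalityI subsetI)
      fix A' assume A': "A' \<in> S"
      then have "A' = (A' - cls D ?v1 p) \<union> cls D ?v1 p"
        using ST[OF A'] saturated_Diff_Un[of D ?v1 A' p] by (simp add: S_def)
      then show "A' \<in> (\<lambda>B. B \<union> cls D ?v1 p) ` T" using ST[OF A'] by (rule image_eqI[OF _ conjunct1])
    qed (use TS in blast)
  qed
  then have "card S = card T" by (rule bij_betw_same_card[symmetric])
  moreover have "T = (if p \<in> A'' then {B. saturated D ?v1 B \<and> edge D v k A B \<and>
      edge D ?v1 l B (A'' - cls D ?v2 p)} else {})"
    by (auto simp: T_def)
  ultimately show ?thesis by (simp add: two_steps_def S_def)
qed

lemma conn_mono_merge:
  assumes k: "k < n_crossings D" "crossings D ! k = (a, b, c, d)" "k \<notin> v"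
    and "(a, c) \<in> conn D (insert k v)"
  shows "conn D v \<subseteq> conn D (insert k v)"
  using conn_merge[OF k assms(4)] by auto

lemma cls_disjoint: "cls D v x \<noteq> cls D v y ==> cls D v x \<inter> cls D v y = {}"
  by (metis (no_types) cls_eq_iff disjoint_iff in_cls)

text \<open>The four combinations of merge and split, applied to One everywhere. The inequalities in
  the last case express that X times X is zero, and a summand that occurs twice counts
  twice.\<close>

lemma two_steps_empty:
  assumes alt: "alternating D" and v: "v \<subseteq> {..<n_crossings D}"
    and k: "k < n_crossings D" "k \<notin> v" and l: "l < n_crossings D" "l \<notin> v" "k \<noteq> l"
    and cr: "crossings D ! k = (a, b, c, d)" "crossings D ! l = (a', b', c', d')"
    and sat: "saturated D (insert l (insert k v)) A''"
  defines "C \<equiv> cls D (insert l (insert k v))"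
  shows "two_steps D v k l {} A'' =
    (if (a, c) \<notin> conn D v then
       (if (a', c') \<notin> conn D (insert k v) then of_bool (A'' = {})
        else of_bool (A'' = C a') + of_bool (A'' = C c'))
     else (if (a', c') \<notin> conn D (insert k v) then of_bool (A'' = C a) + of_bool (A'' = C c)
       else of_bool (A'' = C a \<union> C a' \<and> C a \<noteq> C a') + of_bool (A'' = C a \<union> C c' \<and> C a \<noteq> C c')
         + of_bool (A'' = C c \<union> C a' \<and> C c \<noteq> C a') + of_bool (A'' = C c \<union> C c' \<and> C c \<noteq> C c')))"
proof -
  let ?v1 = "insert k v" and ?v2 = "insert l (insert k v)"
  have alt1: "(a, c) \<in> conn D v <-> (a, c) \<notin> conn D ?v1" by (rule alternatingD[OF alt v k cr(1)])
  have v1: "?v1 \<subseteq> {..<n_crossings D}" "l \<notin> ?v1" using v k l by auto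
  have alt2: "(a', c') \<in> conn D ?v1 <-> (a', c') \<notin> conn D ?v2"
    by (rule alternatingD[OF alt v1(1) l(1) v1(2) cr(2)])
  have pts: "a \<in> points D" "c \<in> points D" using crossing_points[OF k(1) cr(1)] by auto
  note e1 = edge_empty[OF k(1) cr(1) k(2) alt1]
  note e2 = edge_empty[OF l(1) cr(2) v1(2) alt2]
  have Ceq: "C x = C y <-> (x, y) \<in> conn D ?v2" for x y by (simp add: C_def cls_eq_iff)
  have ne2: "C a' \<noteq> C c'" if "(a', c') \<in> conn D ?v1" using that alt2 by (simp add: Ceq)
  have E2: "edge D ?v1 l {} A'' <-> (if (a', c') \<in> conn D ?v1 then A'' = C a' \<or> A'' = C c' else A'' = {})"
    using e2[OF sat] by (simp add: C_def)
  show ?thesis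
  proof (cases "(a, c) \<in> conn D v")
    case False
    have "{A'. saturated D ?v1 A' \<and> edge D v k {} A' \<and> edge D ?v1 l A' A''}
      = (if edge D ?v1 l {} A'' then {{}} else {})"
      using e1 False by auto
    then have "two_steps D v k l {} A'' = of_bool (edge D ?v1 l {} A'')"
      by (simp add: two_steps_def)
    then show ?thesis using False E2 ne2 by auto
  next
    case True
    have ns: "cls D ?v1 a \<noteq> cls D ?v1 c" using True alt1 by (simp add: cls_eq_iff)
    have lin: "edge D ?v1 l (cls D ?v1 x) A'' <-> x \<in> A'' \<and> edge D ?v1 l {} (A'' - C x)"
      if "x \<in> points D" for x
      using edge_linear[OF l(1) cr(2) v1(2) alt2 saturated_empty sat that] by (simp add: C_def)
    have sd: "saturated D ?v2 (A'' - C x)" if "x \<in> points D" for x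
      unfolding C_def by (rule saturated_Diff[OF sat saturated_cls[OF that]])
    have "{A'. saturated D ?v1 A' \<and> edge D v k {} A' \<and> edge D ?v1 l A' A''}
      = {A'. (A' = cls D ?v1 a \<or> A' = cls D ?v1 c) \<and> edge D ?v1 l A' A''}"
      using e1[of "cls D ?v1 a"] e1[of "cls D ?v1 c"] e1 True saturated_cls[OF pts(1), of ?v1]
        saturated_cls[OF pts(2), of ?v1] by auto
    also have "\<dots> = (if edge D ?v1 l (cls D ?v1 a) A'' then {cls D ?v1 a} else {})
        \<union> (if edge D ?v1 l (cls D ?v1 c) A'' then {cls D ?v1 c} else {})"
      by auto
    finally have ts: "two_steps D v k l {} A'' = of_bool (edge D ?v1 l (cls D ?v1 a) A'')
        + of_bool (edge D ?v1 l (cls D ?v1 c) A'')"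
      using ns by (simp add: two_steps_def)
    have sub: "C x \<subseteq> A''" if "x \<in> A''" for x
      using saturated_cls_subset[OF sat that] by (simp add: C_def)
    have self: "x \<in> C x" for x by (simp add: C_def)
    show ?thesis
    proof (cases "(a', c') \<in> conn D ?v1")
      case m: False
      have "edge D ?v1 l (cls D ?v1 x) A'' <-> A'' = C x" if "x \<in> points D" for x
      proof -
        have "edge D ?v1 l {} (A'' - C x) <-> A'' - C x = {}"
          using e2[OF sd[OF that]] m by simp
        then show ?thesis using lin[OF that] sub[of x] self[of x] by auto
      qed
      then show ?thesis using True m ts pts by simp
    next
      case s: True
      have *: "x \<in> A'' \<and> A'' - C x = C y <-> A'' = C x \<union> C y \<and> C x \<noteq> C y" for x y
      proof -
        have "C x \<inter> C y = {}" if "C x \<noteq> C y"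
          using that cls_disjoint by (simp add: C_def)
        then show ?thesis using sub[of x] self[of x] self[of y] by blast
      qed
      have ed: "edge D ?v1 l (cls D ?v1 x) A'' <-> (A'' = C x \<union> C a' \<and> C x \<noteq> C a') \<or> (A'' = C x \<union> C c' \<and> C x \<noteq> C c')"
        if "x \<in> points D" for x
      proof -
        have "edge D ?v1 l {} (A'' - C x) <-> A'' - C x = C a' \<or> A'' - C x = C c'"
          using e2[OF sd[OF that]] s by (simp add: C_def)
        then show ?thesis using lin[OF that] *[of x a'] *[of x c'] by blast
      qed
      have ex: "\<not> ((A'' = C x \<union> C a' \<and> C x \<noteq> C a') \<and> (A'' = C x \<union> C c' \<and> C x \<noteq> C c'))" for x
        using *[of x a'] *[of x c'] ne2[OF s] by metis
      have ob: "of_bool (P \<or> Q) = of_bool P + (of_bool Q :: nat)" if "\<not> (P \<and> Q)" for P Q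
        using that by auto
      have "of_bool (edge D ?v1 l (cls D ?v1 x) A'') =
          of_bool (A'' = C x \<union> C a' \<and> C x \<noteq> C a') + (of_bool (A'' = C x \<union> C c' \<and> C x \<noteq> C c') :: nat)"
        if "x \<in> points D" for x
        unfolding ed[OF that] by (rule ob[OF ex])
      from this[OF pts(1)] this[OF pts(2)] show ?thesis
        unfolding ts using True s by (simp only: if_True if_False not_True_eq_False simp_thms ac_simps)
    qed
  qed
qed

text \<open>In most cases the formulas of \<open>two_steps_empty\<close> agree at once. Only
  merge-split against merge-split and split-merge against split-merge require to identify the final
  circles at the two crossings.\<close>

lemma two_steps_empty_commute:
  assumes alt: "alternating D" and v: "v \<subseteq> {..<n_crossings D}"
    and k: "k < n_crossings D" "k \<notin> v" and l: "l < n_crossings D" "l \<notin> v" "k \<noteq> l"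
    and sat: "saturated D (insert l (insert k v)) A''"
  shows "two_steps D v k l {} A'' = two_steps D v l k {} A''"
proof -
  obtain a b c d where cr: "crossings D ! k = (a, b, c, d)" by (cases "crossings D ! k")
  obtain a' b' c' d' where cr': "crossings D ! l = (a', b', c', d')" by (cases "crossings D ! l")
  let ?v1 = "insert k v" and ?w1 = "insert l v" and ?v2 = "insert l (insert k v)"
  have comm: "insert k ?w1 = ?v2" by auto
  have v1: "?v1 \<subseteq> {..<n_crossings D}" "l \<notin> ?v1" using v k l by auto
  have w1: "?w1 \<subseteq> {..<n_crossings D}" "k \<notin> ?w1" using v k l by auto
  have alt1: "(a, c) \<in> conn D v <-> (a, c) \<notin> conn D ?v1" by (rule alternatingD[OF alt v k cr])
  have alt2: "(a', c') \<in> conn D ?v1 <-> (a', c') \<notin> conn D ?v2"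
    by (rule alternatingD[OF alt v1(1) l(1) v1(2) cr'])
  have alt1': "(a', c') \<in> conn D v <-> (a', c') \<notin> conn D ?w1" by (rule alternatingD[OF alt v l(1,2) cr'])
  have alt2': "(a, c) \<in> conn D ?w1 <-> (a, c) \<notin> conn D ?v2"
    using alternatingD[OF alt w1(1) k(1) w1(2) cr] by (simp add: comm)
  let ?C = "cls D ?v2"
  note card1 = card_circles_insert[OF k(1) cr k(2) alt1] card_circles_insert[OF l(1) cr' v1(2) alt2]
  note card2 = card_circles_insert[OF l(1) cr' l(2) alt1'] card_circles_insert[OF k(1) cr w1(2), unfolded comm, OF alt2']
  \<comment> \<open>A merge loses a circle and a split gains one. Both routes have the same ends, so
    the total change in the number of circles agrees; this excludes all but six
    combinations.\<close>
  have count: "(if (a, c) \<in> conn D v then 1 else -1) + (if (a', c') \<in> conn D ?v1 then 1 else -1)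
    = (if (a', c') \<in> conn D v then 1 else -1) + (if (a, c) \<in> conn D ?w1 then 1 else (-1 :: int))"
    using card1 card2 by linarith
  note F1 = two_steps_empty[OF alt v k l cr cr' sat]
  note F2 = two_steps_empty[OF alt v l(1,2) k l(3)[symmetric] cr' cr, unfolded comm, OF sat]
  have Ceq: "?C x = ?C y <-> (x, y) \<in> conn D ?v2" for x y by (simp add: cls_eq_iff)
  consider (mm) "(a, c) \<notin> conn D v" "(a', c') \<notin> conn D ?v1" "(a', c') \<notin> conn D v" "(a, c) \<notin> conn D ?w1"
    | (msms) "(a, c) \<notin> conn D v" "(a', c') \<in> conn D ?v1" "(a', c') \<notin> conn D v" "(a, c) \<in> conn D ?w1"
    | (mssm) "(a, c) \<notin> conn D v" "(a', c') \<in> conn D ?v1" "(a', c') \<in> conn D v" "(a, c) \<notin> conn D ?w1"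
    | (smms) "(a, c) \<in> conn D v" "(a', c') \<notin> conn D ?v1" "(a', c') \<notin> conn D v" "(a, c) \<in> conn D ?w1"
    | (smsm) "(a, c) \<in> conn D v" "(a', c') \<notin> conn D ?v1" "(a', c') \<in> conn D v" "(a, c) \<notin> conn D ?w1"
    | (ss) "(a, c) \<in> conn D v" "(a', c') \<in> conn D ?v1" "(a', c') \<in> conn D v" "(a, c) \<in> conn D ?w1"
    using count by (auto split: if_splits)
  then show ?thesis
  proof cases
    case mm
    then show ?thesis by (simp add: F1 F2)
  next
    case msms
    have ac1: "(a, c) \<in> conn D ?v1" using msms alt1 by simp
    have sub: "conn D v \<subseteq> conn D ?v1" by (rule conn_mono_merge[OF k(1) cr k(2) ac1])
    \<comment> \<open>The ends \<open>a'\<close> and \<open>c'\<close> were apart and the first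
      merge connects them, so it joined exactly their two circles. The circle split next is thus the
      merged one, and its halves are the circles of \<open>a\<close> and \<open>c\<close>.\<close>
    have "(a', a) \<in> conn D v \<and> (c, c') \<in> conn D v \<or> (a', c) \<in> conn D v \<and> (a, c') \<in> conn D v"
      using msms(2,3) conn_merge[OF k(1) cr k(2) ac1, of a' c'] by blast
    then have "(a', a) \<in> conn D ?v1" "(a', c) \<in> conn D ?v1"
      using sub ac1 by (meson conn_sym conn_trans subsetD)+
    then have x: "(a', a) \<in> conn D ?v2 \<or> (c', a) \<in> conn D ?v2" "(a', c) \<in> conn D ?v2 \<or> (c', c) \<in> conn D ?v2"
      using conn_split[OF l(1) cr' v1(2) msms(2)] by blast+
    have "(a, c) \<notin> conn D ?v2" "(a', c') \<notin> conn D ?v2" using msms alt2 alt2' by simp_all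
    then have "?C a' = ?C a \<and> ?C c' = ?C c \<or> ?C a' = ?C c \<and> ?C c' = ?C a"
      unfolding Ceq using x conn_sym conn_trans by metis
    moreover have "two_steps D v k l {} A'' = of_bool (A'' = ?C a') + of_bool (A'' = ?C c')"
      using msms by (simp add: F1)
    moreover have "two_steps D v l k {} A'' = of_bool (A'' = ?C a) + of_bool (A'' = ?C c)"
      using msms by (simp add: F2)
    ultimately show ?thesis by (elim disjE conjE) (simp_all only: add.commute)
  next
    case mssm
    then show ?thesis by (simp add: F1 F2)
  next
    case smms
    then show ?thesis by (simp add: F1 F2)
  next
    case smsm
    \<comment> \<open>All four ends finally lie on one circle, and both routes give twice X on
      it.\<close>
    have ac2: "(a, c) \<in> conn D ?v2" "(a', c') \<in> conn D ?v2" using smsm alt2 alt2' by simp_all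
    have sub: "conn D ?v1 \<subseteq> conn D ?v2" by (rule conn_mono_merge[OF l(1) cr' v1(2) ac2(2)])
    have "(a', a) \<in> conn D ?v1 \<or> (a', c) \<in> conn D ?v1"
      using smsm(2,3) conn_split[OF k(1) cr k(2) smsm(1), of a' c'] by blast
    then have "(a', a) \<in> conn D ?v2" using sub ac2(1) by (meson conn_sym conn_trans subsetD)
    then have "?C a' = ?C a" "?C c' = ?C a" "?C c = ?C a"
      unfolding Ceq using ac2 conn_sym conn_trans by metis+
    then show ?thesis using smsm by (simp add: F1 F2)
  next
    case ss
    have un: "(A'' = ?C x \<union> ?C y \<and> ?C x \<noteq> ?C y) = (A'' = ?C y \<union> ?C x \<and> ?C y \<noteq> ?C x)" for x y
      by (auto simp: Un_commute)
    have 1: "two_steps D v k l {} A'' =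
      of_bool (A'' = ?C a \<union> ?C a' \<and> ?C a \<noteq> ?C a') + of_bool (A'' = ?C a \<union> ?C c' \<and> ?C a \<noteq> ?C c')
         + of_bool (A'' = ?C c \<union> ?C a' \<and> ?C c \<noteq> ?C a') + of_bool (A'' = ?C c \<union> ?C c' \<and> ?C c \<noteq> ?C c')"
      using ss by (simp only: F1 if_False if_True not_True_eq_False simp_thms)
    have 2: "two_steps D v l k {} A'' =
      of_bool (A'' = ?C a' \<union> ?C a \<and> ?C a' \<noteq> ?C a) + of_bool (A'' = ?C a' \<union> ?C c \<and> ?C a' \<noteq> ?C c)
         + of_bool (A'' = ?C c' \<union> ?C a \<and> ?C c' \<noteq> ?C a) + of_bool (A'' = ?C c' \<union> ?C c \<and> ?C c' \<noteq> ?C c)"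
      using ss by (simp only: F2 if_False if_True not_True_eq_False simp_thms)
    show ?thesis unfolding 1 2 un[of a' a] un[of a' c] un[of c' a] un[of c' c] by (simp only: ac_simps)
  qed
qed

text \<open>Induction on the number of points labelled X: \<open>two_steps_linear\<close> strips one
  circle labelled X from both sides until only One is left.\<close>

lemma two_steps_commute:
  assumes alt: "alternating D" and v: "v \<subseteq> {..<n_crossings D}"
    and k: "k < n_crossings D" "k \<notin> v" and l: "l < n_crossings D" "l \<notin> v" "k \<noteq> l"
    and sat: "saturated D v A" "saturated D (insert l (insert k v)) A''"
  shows "two_steps D v k l A A'' = two_steps D v l k A A''"
  using sat
proof (induction "card A" arbitrary: A A'' rule: less_induct)
  case less
  have comm: "insert k (insert l v) = insert l (insert k v)" by auto
  show ?case
  proof (cases "A = {}")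
    case True
    then show ?thesis using two_steps_empty_commute[OF alt v k l less.prems(2)] by simp
  next
    case False
    then obtain p where p: "p \<in> A" by auto
    let ?B = "A - cls D v p" and ?E = "A'' - cls D (insert l (insert k v)) p"
    have pp: "p \<in> points D" using p less.prems(1) saturated_subset by blast
    have fA: "finite A" by (rule finite_subset[OF saturated_subset[OF less.prems(1)] finite_points])
    have sB: "saturated D v ?B" using less.prems(1) saturated_cls[OF pp] by (rule saturated_Diff)
    have sE: "saturated D (insert l (insert k v)) ?E"
      using less.prems(2) saturated_cls[OF pp] by (rule saturated_Diff)
    have pB: "p \<notin> ?B" by simp
    have A: "?B \<union> cls D v p = A" by (rule saturated_Diff_Un[OF less.prems(1) p])
    have "?B \<subset> A" using p cls_self[of p D v] by blast
    then have "card ?B < card A" by (rule psubset_card_mono[OF fA])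
    then have "two_steps D v k l ?B ?E = two_steps D v l k ?B ?E" using less.hyps sB sE by blast
    then show ?thesis
      using two_steps_linear[OF alt v k l sB less.prems(2) pp pB]
        two_steps_linear[OF alt v l(1,2) k l(3)[symmetric] sB _ pp pB, of A''] less.prems(2)
      unfolding A comm by simp
  qed
qed

text \<open>At most one \<open>k\<close> qualifies. The sum stands for a case distinction on its
  existence, with value 0 if there is none.\<close>

definition dmat :: "'p diagram => nat set \<times> 'p set => nat set \<times> 'p set => rat" where
  "dmat D s t = (\<Sum>k | k < n_crossings D \<and> k \<notin> fst s \<and> fst t = insert k (fst s) \<and>
     edge D (fst s) k (snd s) (snd t). edge_sign (fst s) k)"

definition qdeg :: "'p diagram => nat set \<times> 'p set => int" where
  "qdeg D s = (\<Sum>C\<in>circles D (fst s). if C \<subseteq> snd s then -1 else 1) + int (card (fst s))"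

definition cells :: "'p diagram => (nat set \<times> 'p set) set" where
  "cells D = {(v, A). v \<subseteq> {..<n_crossings D} \<and> saturated D v A}"

definition gcells :: "'p diagram => int => int => (nat set \<times> 'p set) set" where
  "gcells D j i = {s \<in> cells D. int (card (fst s)) = i \<and> qdeg D s = j}"

lemma finite_cells: "finite (cells D)"
  by (rule finite_subset[of _ "Pow {..<n_crossings D} \<times> Pow (points D)"])
     (auto simp: cells_def finite_points dest: saturated_subset)

lemma finite_gcells: "finite (gcells D j i)"
  by (rule finite_subset[OF _ finite_cells]) (auto simp: gcells_def)

lemma dmat_insert:
  assumes "k < n_crossings D" "k \<notin> v"
  shows "dmat D (v, A) (insert k v, A') = edge_sign v k * of_bool (edge D v k A A')"
proof -
  have "{l. l < n_crossings D \<and> l \<notin> v \<and> insert k v = insert l v \<and> edge D v l A A'}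
    = (if edge D v k A A' then {k} else {})"
    using assms by auto
  then show ?thesis by (simp add: dmat_def)
qed

lemma dmat_nonzero:
  assumes "dmat D (v, A) (w, A') \<noteq> 0"
  obtains k where "k < n_crossings D" "k \<notin> v" "w = insert k v" "edge D v k A A'"
proof -
  have "{k. k < n_crossings D \<and> k \<notin> v \<and> w = insert k v \<and> edge D v k A A'} \<noteq> {}"
    using assms by (auto simp: dmat_def intro: sum.neutral)
  then show ?thesis using that by blast
qed

lemma edge_sign_nonzero [simp]: "edge_sign v k \<noteq> 0"
  by (simp add: edge_sign_def)

lemma edge_sign_anticommute:
  assumes "finite v" "k \<notin> v" "l \<notin> v" "k \<noteq> l"
  shows "edge_sign v k * edge_sign (insert k v) l = - (edge_sign v l * edge_sign (insert l v) k)"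
proof -
  have *: "edge_sign v k * edge_sign (insert k v) l = - (edge_sign v l * edge_sign (insert l v) k)"
    if "k < l" "k \<notin> v" for k l
  proof -
    have "{j \<in> insert k v. j < l} = insert k {j \<in> v. j < l}" "{j \<in> insert l v. j < k} = {j \<in> v. j < k}"
      using that by auto
    then show ?thesis using assms(1) that by (simp add: edge_sign_def)
  qed
  show ?thesis
  proof (cases "k < l")
    case True
    then show ?thesis using * assms by blast
  next
    case False
    then have "l < k" using assms by simp
    from *[OF this assms(3)] show ?thesis by simp
  qed
qed

text \<open>Product and coproduct lower the degree of labels by one, which the shift by the number
  of 1-smoothed crossings compensates.\<close>

lemma qdeg_edge:
  assumes k: "k < n_crossings D" "crossings D ! k = (a, b, c, d)" "k \<notin> v" and fin: "finite v"
    and alt: "(a, c) \<in> conn D v <-> (a, c) \<notin> conn D (insert k v)"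
    and sat: "saturated D v A" "saturated D (insert k v) A'" and e: "edge D v k A A'"
  shows "qdeg D (insert k v, A') = qdeg D (v, A)"
proof -
  let ?w = "insert k v"
  define f where "f B C = (if (C :: 'a set) \<subseteq> B then -1 else (1 :: int))" for B C
  have f: "f B (cls D u p) = (if p \<in> B then -1 else 1)" if "saturated D u B" for u B p
    using saturated_cls_subset[OF that] cls_self[of p D u] by (auto simp: f_def)
  have f': "f A (cls D v a) = (if a \<in> A then -1 else 1)" "f A (cls D v c) = (if c \<in> A then -1 else 1)"
    "f A' (cls D ?w a) = (if a \<in> A' then -1 else 1)" "f A' (cls D ?w c) = (if c \<in> A' then -1 else 1)"
    using f[OF sat(1)] f[OF sat(2)] by auto
  have s: "(\<Sum>C\<in>circles D u. g C) = (\<Sum>C\<in>circles D u - circles D u'. g C) + (\<Sum>C\<in>circles D u \<inter> circles D u'. g C)"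
    for u u' and g :: "'a set => int"
    using sum.Int_Diff[of "circles D u" g "circles D u'"] by (simp add: finite_circles add.commute)
  have common: "(\<Sum>C\<in>circles D ?w \<inter> circles D v. f A' C) = (\<Sum>C\<in>circles D v \<inter> circles D ?w. f A C)"
  proof (rule sum.cong)
    fix C assume "C \<in> circles D v \<inter> circles D ?w"
    then obtain p where p: "p \<in> points D" "C = cls D v p" "(p, a) \<notin> conn D v" "(p, c) \<notin> conn D v"
      unfolding common_circles(1)[OF k alt] by auto
    have "C = cls D ?w p" using common_circles(2)[OF k alt p(1,3,4)] p(2) by simp
    then have "f A' C = (if p \<in> A' then -1 else 1)" using f[OF sat(2)] by simp
    also have "\<dots> = (if p \<in> A then -1 else 1)" using e p by (simp add: edge_def k(2))
    also have "\<dots> = f A C" using f[OF sat(1)] p(2) by simp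
    finally show "f A' C = f A C" .
  qed auto
  have w: "int (card ?w) = int (card v) + 1" using k(3) fin by simp
  have "(\<Sum>C\<in>circles D ?w - circles D v. f A' C) + 1 = (\<Sum>C\<in>circles D v - circles D ?w. f A C)"
  proof (cases "(a, c) \<in> conn D v")
    case True
    then have "(a, c) \<notin> conn D ?w" using alt by simp
    from circles_split[OF k True this] show ?thesis
      using e True by (auto simp: edge_def k(2) split_rel_def f' split: if_splits)
  next
    case False
    then have "(a, c) \<in> conn D ?w" using alt by simp
    from circles_merge[OF k False this] show ?thesis
      using e False by (auto simp: edge_def k(2) merge_rel_def f' split: if_splits)
  qed
  then show ?thesis
    unfolding qdeg_def fst_conv snd_conv f_def[symmetric]
    using s[of "f A'" ?w v] s[of "f A" v ?w] common w by simp
qed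

lemma dmat_qdeg:
  assumes "alternating D" "s \<in> cells D" "t \<in> cells D" "dmat D s t \<noteq> 0"
  shows "qdeg D t = qdeg D s" "card (fst t) = Suc (card (fst s))"
proof -
  obtain v A w A' where st: "s = (v, A)" "t = (w, A')" by (cases s; cases t)
  obtain k where k: "k < n_crossings D" "k \<notin> v" "w = insert k v" "edge D v k A A'"
    using dmat_nonzero assms(4) st by metis
  obtain a b c d where cr: "crossings D ! k = (a, b, c, d)" by (cases "crossings D ! k")
  have v: "v \<subseteq> {..<n_crossings D}" "saturated D v A" "saturated D (insert k v) A'"
    using assms(2,3) st k by (auto simp: cells_def)
  have fin: "finite v" using v(1) finite_subset by blast
  show "qdeg D t = qdeg D s"
    using qdeg_edge[OF k(1) cr k(2) fin alternatingD[OF assms(1) v(1) k(1,2) cr] v(2,3) k(4)]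
    by (simp add: st k)
  show "card (fst t) = Suc (card (fst s))" using fin k by (simp add: st)
qed

text \<open>Between \<open>v\<close> and \<open>v\<close> enlarged by two crossings there are just
  two routes. They have equally many intermediate labellings by \<open>two_steps_commute\<close>,
  and their signs are opposite.\<close>

lemma complex_dmat:
  assumes alt: "alternating D"
  shows "complex (dmat D) (gcells D j)"
  unfolding complex_def
proof (intro conjI allI ballI)
  fix i p r assume p: "p \<in> gcells D j (i - 1)" and r: "r \<in> gcells D j (i + 1)"
  obtain v A where pv: "p = (v, A)" by (cases p)
  obtain x A'' where rx: "r = (x, A'')" by (cases r)
  have v: "v \<subseteq> {..<n_crossings D}" and sA: "saturated D v A" and sx: "saturated D x A''"
    using p r pv rx by (auto simp: gcells_def cells_def)
  have fv: "finite v" using v finite_subset by blast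
  show "(\<Sum>q\<in>gcells D j i. dmat D p q * dmat D q r) = 0"
  proof (cases "\<exists>k l. k < n_crossings D \<and> l < n_crossings D \<and> k \<notin> v \<and> l \<notin> v \<and> k \<noteq> l \<and> x = insert l (insert k v)")
    case False
    have "dmat D p q * dmat D q r = 0" if "q \<in> gcells D j i" for q
    proof (rule ccontr)
      assume ne: "dmat D p q * dmat D q r \<noteq> 0"
      obtain w A' where q: "q = (w, A')" by (cases q)
      obtain k where k: "k < n_crossings D" "k \<notin> v" "w = insert k v"
        using ne dmat_nonzero[of D v A w A'] pv q by auto
      obtain l where l: "l < n_crossings D" "l \<notin> w" "x = insert l w"
        using ne dmat_nonzero[of D w A' x A''] rx q by auto
      show False using False k l by blast
    qed
    then show ?thesis by (intro sum.neutral) auto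
  next
    case True
    then obtain k l where kl: "k < n_crossings D" "k \<notin> v" "l < n_crossings D" "l \<notin> v" "k \<noteq> l"
      and x: "x = insert l (insert k v)" by blast
    define T where "T k l = Pair (insert k v) ` {A'. saturated D (insert k v) A' \<and> edge D v k A A' \<and>
      edge D (insert k v) l A' A''}" for k l
    have cT: "card (T k l) = two_steps D v k l A A''" for k l
      unfolding T_def two_steps_def by (rule card_image) (auto simp: inj_on_def)
    have fT: "finite (T k l)" for k l
      unfolding T_def using finite_saturated by (auto intro: finite_subset[OF _ finite_saturated])
    have on: "q \<in> gcells D j i \<and> dmat D p q * dmat D q r = edge_sign v k * edge_sign (insert k v) l"
      if q: "q \<in> T k l" and kl: "k < n_crossings D" "k \<notin> v" "l < n_crossings D" "l \<notin> v" "k \<noteq> l"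
        "x = insert l (insert k v)" for q k l
    proof -
      obtain A' where q': "q = (insert k v, A')" "saturated D (insert k v) A'" "edge D v k A A'"
        "edge D (insert k v) l A' A''" using q by (auto simp: T_def)
      have d1: "dmat D p q = edge_sign v k"
        unfolding pv q'(1) using dmat_insert[OF kl(1,2)] q'(3) by simp
      have "l \<notin> insert k v" using kl by simp
      then have d2: "dmat D q r = edge_sign (insert k v) l"
        unfolding rx q'(1) kl(6) using dmat_insert[OF kl(3)] q'(4) by simp
      have qc: "q \<in> cells D" using q' v kl by (auto simp: cells_def)
      have "p \<in> cells D" using p by (simp add: gcells_def)
      then have "qdeg D q = qdeg D p" "card (fst q) = Suc (card (fst p))"
        using dmat_qdeg[OF alt _ qc] d1 by simp_all
      then have "q \<in> gcells D j i" using qc p by (auto simp: gcells_def)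
      then show ?thesis using d1 d2 by simp
    qed
    have x': "x = insert k (insert l v)" using x by auto
    have "(\<Sum>q\<in>gcells D j i. dmat D p q * dmat D q r) = (\<Sum>q\<in>T k l \<union> T l k. dmat D p q * dmat D q r)"
    proof (rule sum.mono_neutral_right[OF finite_gcells])
      show "T k l \<union> T l k \<subseteq> gcells D j i"
        using on[OF _ kl x] on[OF _ kl(3,4,1,2) kl(5)[symmetric] x'] by blast
      show "\<forall>q\<in>gcells D j i - (T k l \<union> T l k). dmat D p q * dmat D q r = 0"
      proof (intro ballI, rule ccontr)
        fix q assume q: "q \<in> gcells D j i - (T k l \<union> T l k)" and ne: "dmat D p q * dmat D q r \<noteq> 0"
        obtain w A' where qw: "q = (w, A')" by (cases q)
        obtain k' where k': "k' < n_crossings D" "k' \<notin> v" "w = insert k' v" "edge D v k' A A'"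
          using ne dmat_nonzero[of D v A w A'] pv qw by auto
        obtain l' where l': "l' < n_crossings D" "l' \<notin> w" "x = insert l' w" "edge D w l' A' A''"
          using ne dmat_nonzero[of D w A' x A''] rx qw by auto
        have "k' = k \<and> l' = l \<or> k' = l \<and> l' = k"
          using x k'(2,3) l'(2,3) kl by (auto simp: set_eq_iff)
        moreover have "saturated D (insert k' v) A'" using q qw k' by (auto simp: gcells_def cells_def)
        ultimately have "q \<in> T k l \<union> T l k" using k' l' qw by (auto simp: T_def)
        then show False using q by simp
      qed
    qed
    also have "\<dots> = (\<Sum>q\<in>T k l. dmat D p q * dmat D q r) + (\<Sum>q\<in>T l k. dmat D p q * dmat D q r)"
    proof (rule sum.union_disjoint[OF fT fT])
      have "insert k v \<noteq> insert l v" using kl by auto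
      then show "T k l \<inter> T l k = {}" by (auto simp: T_def)
    qed
    also have "(\<Sum>q\<in>T k l. dmat D p q * dmat D q r)
      = (\<Sum>q\<in>T k l. edge_sign v k * edge_sign (insert k v) l)"
      using on[OF _ kl x] by (intro sum.cong) auto
    also have "(\<Sum>q\<in>T l k. dmat D p q * dmat D q r)
      = (\<Sum>q\<in>T l k. edge_sign v l * edge_sign (insert l v) k)"
      using on[OF _ kl(3,4,1,2) kl(5)[symmetric] x'] by (intro sum.cong) auto
    also have "(\<Sum>q\<in>T k l. edge_sign v k * edge_sign (insert k v) l)
        + (\<Sum>q\<in>T l k. edge_sign v l * edge_sign (insert l v) k) = 0"
      using two_steps_commute[OF alt v kl sA, of A''] sx x edge_sign_anticommute[OF fv kl(2,4,5)]
      by (simp add: cT)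
    finally show ?thesis .
  qed
qed (rule finite_gcells)

definition encode :: "'p diagram => 'p cube_gen => nat set \<times> 'p set" where
  "encode D s = (fst s, {p \<in> points D. snd s (cls D (fst s) p) = X})"

lemma gen_eqI: "(g = X <-> h = X) ==> g = h"
  by (cases g; cases h) auto

lemma encode_saturated: "saturated D (fst s) (snd (encode D s))"
proof -
  have "snd s (cls D (fst s) q) = snd s (cls D (fst s) p)" if "(p, q) \<in> conn D (fst s)" for p q
    using that cls_eq_iff by metis
  then show ?thesis
    unfolding saturated_def encode_def using conn_points by fastforce
qed

lemma encode_cls: 
  assumes "p \<in> points D"
  shows "snd s (cls D (fst s) p) = X <-> p \<in> snd (encode D s)"
  using assms by (simp add: encode_def)

lemma bij_encode: "bij_betw (encode D) (gens D) (cells D)"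
proof (rule bij_betw_imageI)
  show "inj_on (encode D) (gens D)"
  proof (rule inj_onI)
    fix s t assume s: "s \<in> gens D" and t: "t \<in> gens D" and e: "encode D s = encode D t"
    obtain v x w y where st: "s = (v, x)" "t = (w, y)" by (cases s; cases t)
    have vw: "w = v" using e by (simp add: encode_def st)
    have "x C = y C" for C
    proof (cases "C \<in> circles D v")
      case True
      then obtain p where p: "p \<in> points D" "C = cls D v p" by (auto simp: circles_eq)
      have "x C = X <-> y C = X"
        using encode_cls[OF p(1), of s] encode_cls[OF p(1), of t] e p(2) by (simp add: st vw)
      then show ?thesis by (rule gen_eqI)
    next
      case False
      then show ?thesis
        using s t by (auto simp: gens_def labellings_def st vw PiE_def extensional_def)
    qed
    then show "s = t" by (auto simp: st vw)
  qed
  show "encode D ` gens D = cells D"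
  proof (intro equalityI subsetI)
    fix s assume "s \<in> encode D ` gens D"
    then obtain t where t: "t \<in> gens D" "s = encode D t" by blast
    then show "s \<in> cells D" using encode_saturated[of D t]
      by (auto simp: cells_def gens_def encode_def)
  next
    fix s assume s: "s \<in> cells D"
    obtain v A where vA: "s = (v, A)" by (cases s)
    have sat: "saturated D v A" and v: "v \<subseteq> {..<n_crossings D}" using s by (auto simp: cells_def vA)
    define x where "x = (\<lambda>C\<in>circles D v. if C \<subseteq> A then X else One)"
    have "x (cls D v p) = X <-> p \<in> A" if "p \<in> points D" for p
      using that saturated_cls_subset[OF sat, of p] cls_self[of p D v] by (auto simp: x_def circles_eq)
    then have "encode D (v, x) = s"
      using saturated_subset[OF sat] by (auto simp: encode_def vA)
    moreover have "(v, x) \<in> gens D" using v by (auto simp: gens_def labellings_def x_def)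
    ultimately show "s \<in> encode D ` gens D" by force
  qed
qed

lemma finite_gens: "finite (gens D)"
  using bij_betw_finite[OF bij_encode] finite_cells by blast

lemma quantum_deg_encode: "s \<in> gens D ==> quantum_deg D s = qdeg D (encode D s)"
proof -
  obtain v x where s: "s = (v, x)" by (cases s)
  have "gen_deg (x C) = (if C \<subseteq> snd (encode D s) then -1 else 1)" if C: "C \<in> circles D v" for C
  proof -
    obtain p where p: "p \<in> points D" "C = cls D v p" using C by (auto simp: circles_eq)
    have "C \<subseteq> snd (encode D s) <-> p \<in> snd (encode D s)"
      using saturated_cls_subset[OF encode_saturated, of p D s] p(2) s cls_self[of p D v] by auto
    also have "\<dots> <-> x C = X" using encode_cls[OF p(1), of s] p(2) s by simp
    finally show ?thesis by (cases "x C") auto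
  qed
  then show ?thesis by (simp add: quantum_deg_def qdeg_def s encode_def)
qed

text \<open>\<open>edge_coeff\<close> names the two merged or split circles in either order. The
  comparison therefore uses commutativity of the product and cocommutativity of the
  coproduct.\<close>

lemma edge_coeff_encode:
  assumes alt: "alternating D" and v: "v \<subseteq> {..<n_crossings D}" and k: "k < n_crossings D" "k \<notin> v"
  shows "edge_coeff D v (insert k v) x y =
    of_bool (edge D v k (snd (encode D (v, x))) (snd (encode D (insert k v, y))))"
proof -
  let ?w = "insert k v" and ?A = "snd (encode D (v, x))" and ?B = "snd (encode D (insert k v, y))"
  obtain a b c d where cr: "crossings D ! k = (a, b, c, d)" by (cases "crossings D ! k")
  have alt1: "(a, c) \<in> conn D v <-> (a, c) \<notin> conn D ?w" by (rule alternatingD[OF alt v k cr])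
  have pts: "a \<in> points D" "c \<in> points D" using crossing_points[OF k(1) cr] by auto
  have x: "x (cls D v p) = (if p \<in> ?A then X else One)" if "p \<in> points D" for p
    using encode_cls[OF that, of "(v, x)"] by (cases "x (cls D v p)") auto
  have y: "y (cls D ?w p) = (if p \<in> ?B then X else One)" if "p \<in> points D" for p
    using encode_cls[OF that, of "(?w, y)"] by (cases "y (cls D ?w p)") auto
  have far: "(\<forall>C\<in>circles D v \<inter> circles D ?w. x C = y C) <->
    (\<forall>p\<in>points D. (p, a) \<notin> conn D v --> (p, c) \<notin> conn D v --> (p \<in> ?B <-> p \<in> ?A))"
  proof -
    have "x (cls D v p) = y (cls D v p) <-> (p \<in> ?B <-> p \<in> ?A)"
      if "p \<in> points D" "(p, a) \<notin> conn D v" "(p, c) \<notin> conn D v" for p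
      using x[OF that(1)] y[OF that(1)] common_circles(2)[OF k(1) cr k(2) alt1 that] by auto
    then show ?thesis unfolding common_circles(1)[OF k(1) cr k(2) alt1] by auto
  qed
  show ?thesis
  proof (cases "(a, c) \<in> conn D v")
    case True
    then have n: "(a, c) \<notin> conn D ?w" using alt1 by simp
    note cs = circles_split[OF k(1) cr k(2) True n]
    have "(\<exists>A B C. B \<noteq> C \<and> circles D v - circles D ?w = {A} \<and> circles D ?w - circles D v = {B, C}
         \<and> (y B, y C) \<in> comult_terms (x A)) <->
         (y (cls D ?w a), y (cls D ?w c)) \<in> comult_terms (x (cls D v a))"
    proof -
      have sw: "(g, h) \<in> comult_terms f <-> (h, g) \<in> comult_terms f" for f g h
        by (cases f) auto
      show ?thesis unfolding cs(1,2) using cs(3) sw by (auto simp: doubleton_eq_iff)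
    qed
    moreover have "\<not> (\<exists>A B C. A \<noteq> B \<and> circles D v - circles D ?w = {A, B} \<and> circles D ?w - circles D v = {C}
         \<and> y C \<in> mult_terms (x A) (x B))"
      unfolding cs(1,2) by auto
    moreover have "(y (cls D ?w a), y (cls D ?w c)) \<in> comult_terms (x (cls D v a))
      <-> split_rel (a \<in> ?A) (a \<in> ?B) (c \<in> ?B)"
      unfolding x[OF pts(1)] y[OF pts(1)] y[OF pts(2)] by (auto simp: split_rel_def)
    ultimately show ?thesis
      unfolding edge_coeff_def far edge_def cr prod.case using True by (simp only: if_True simp_thms)
  next
    case False
    then have n: "(a, c) \<in> conn D ?w" using alt1 by simp
    note cs = circles_merge[OF k(1) cr k(2) False n]
    have "(\<exists>A B C. A \<noteq> B \<and> circles D v - circles D ?w = {A, B} \<and> circles D ?w - circles D v = {C}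
         \<and> y C \<in> mult_terms (x A) (x B)) <->
         y (cls D ?w a) \<in> mult_terms (x (cls D v a)) (x (cls D v c))"
    proof -
      have sw: "mult_terms g h = mult_terms h g" for g h by (cases g; cases h) auto
      show ?thesis unfolding cs(1,2) using cs(3) sw by (auto simp: doubleton_eq_iff)
    qed
    moreover have "\<not> (\<exists>A B C. B \<noteq> C \<and> circles D v - circles D ?w = {A} \<and> circles D ?w - circles D v = {B, C}
         \<and> (y B, y C) \<in> comult_terms (x A))"
      unfolding cs(1,2) by auto
    moreover have "y (cls D ?w a) \<in> mult_terms (x (cls D v a)) (x (cls D v c))
      <-> merge_rel (a \<in> ?A) (c \<in> ?A) (a \<in> ?B)"
      unfolding x[OF pts(1)] x[OF pts(2)] y[OF pts(1)] by (auto simp: merge_rel_def)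
    ultimately show ?thesis
      unfolding edge_coeff_def far edge_def cr prod.case using False by (simp only: if_False simp_thms)
  qed
qed

definition gen_mat :: "'p diagram => 'p cube_gen => 'p cube_gen => rat" where
  "gen_mat D s t = dmat D (encode D s) (encode D t)"

text \<open>The double sum over the changed crossing and the old labelling is reindexed by source
  generators; the remaining generators have coefficient 0.\<close>

lemma khov_diff_app:
  assumes alt: "alternating D"
  shows "khov_diff D f = app (gen_mat D) (gens D) (gens D) f"
proof
  fix t :: "'a cube_gen"
  obtain w y where t: "t = (w, y)" by (cases t)
  show "khov_diff D f t = app (gen_mat D) (gens D) (gens D) f t"
  proof (cases "t \<in> gens D")
    case False
    then show ?thesis by (simp add: khov_diff_def app_def t)
  next
    case True
    then have w: "w \<subseteq> {..<n_crossings D}" by (auto simp: gens_def t)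
    then have fw: "finite w" using finite_subset by blast
    define S where "S = Sigma w (\<lambda>k. labellings D (w - {k}))"
    define h where "h = (\<lambda>(k, x :: 'a set => gen). (w - {k}, x))"
    have flab: "finite (labellings D v)" if "v \<subseteq> {..<n_crossings D}" for v
    proof (rule finite_subset)
      show "labellings D v \<subseteq> snd ` gens D"
      proof
        fix x assume "x \<in> labellings D v"
        then have "(v, x) \<in> gens D" using that by (simp add: gens_def)
        then show "x \<in> snd ` gens D" by (rule image_eqI[rotated]) simp
      qed
      show "finite (snd ` gens D)" using finite_gens by blast
    qed
    have inj: "inj_on h S"
    proof (rule inj_onI)
      fix s s' assume "s \<in> S" "s' \<in> S" "h s = h s'"
      then show "s = s'" by (auto simp: S_def h_def)
    qed
    have hS: "h ` S \<subseteq> gens D" using w by (auto simp: S_def h_def gens_def)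
    have mat: "gen_mat D (w - {k}, x) t = edge_sign (w - {k}) k * edge_coeff D (w - {k}) w x y"
      if "k \<in> w" for k x
    proof -
      have k: "k < n_crossings D" "k \<notin> w - {k}" "insert k (w - {k}) = w" "w - {k} \<subseteq> {..<n_crossings D}"
        using that w by auto
      have e: "encode D (w - {k}, x) = (w - {k}, snd (encode D (w - {k}, x)))"
        "encode D t = (insert k (w - {k}), snd (encode D (w, y)))"
        using k by (simp_all add: encode_def t)
      show ?thesis
        unfolding gen_mat_def e(2) by (subst e(1))
          (use dmat_insert[OF k(1,2)] edge_coeff_encode[OF alt k(4) k(1,2), unfolded k(3)] k(3) in simp)
    qed
    have "khov_diff D f t = (\<Sum>k\<in>w. \<Sum>x\<in>labellings D (w - {k}). f (h (k, x)) * gen_mat D (h (k, x)) t)"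
      using True mat by (auto simp: khov_diff_def t h_def intro!: sum.cong)
    also have "\<dots> = (\<Sum>s\<in>S. f (h s) * gen_mat D (h s) t)"
    proof -
      have "finite (labellings D (w - {k}))" for k by (rule flab) (use w in blast)
      then show ?thesis unfolding S_def by (subst sum.Sigma) (use fw in auto)
    qed
    also have "\<dots> = (\<Sum>s\<in>h ` S. f s * gen_mat D s t)"
      by (simp add: sum.reindex[OF inj])
    also have "\<dots> = (\<Sum>s\<in>gens D. f s * gen_mat D s t)"
    proof (rule sum.mono_neutral_left[OF finite_gens hS], intro ballI)
      fix s assume s: "s \<in> gens D - h ` S"
      obtain v x where vx: "s = (v, x)" by (cases s)
      have "gen_mat D s t = 0"
      proof (rule ccontr)
        assume "gen_mat D s t \<noteq> 0"
        then obtain k where k: "k < n_crossings D" "k \<notin> v" "w = insert k v"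
          using dmat_nonzero[of D v "snd (encode D s)" w "snd (encode D t)"]
          by (auto simp: gen_mat_def vx t encode_def)
        then have "w - {k} = v" by auto
        then have "s = h (k, x)" "(k, x) \<in> S" using s k by (auto simp: h_def S_def vx gens_def)
        then show False using s by blast
      qed
      then show "f s * gen_mat D s t = 0" by simp
    qed
    finally show ?thesis using True by (simp add: app_def)
  qed
qed

definition ggens :: "'p diagram => int => int => 'p cube_gen set" where
  "ggens D j i = {s \<in> gens D. int (card (fst s)) = i \<and> quantum_deg D s = j}"

lemma chains_eq: "chains D i j = supp_on (ggens D j i)"
  by (auto simp: chains_def supp_on_def ggens_def)

lemma bij_encode_graded: "bij_betw (encode D) (ggens D j i) (gcells D j i)"
proof -
  have "encode D ` ggens D j i = gcells D j i"
  proof (intro equalityI subsetI)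
    fix s assume "s \<in> encode D ` ggens D j i"
    then obtain t where t: "t \<in> ggens D j i" "s = encode D t" by blast
    then show "s \<in> gcells D j i"
      using bij_betwE[OF bij_encode[of D]] quantum_deg_encode[of t D]
      by (auto simp: ggens_def gcells_def encode_def)
  next
    fix s assume s: "s \<in> gcells D j i"
    then have "s \<in> encode D ` gens D" using bij_encode[of D] by (simp add: gcells_def bij_betw_def)
    then obtain t where t: "t \<in> gens D" "s = encode D t" by blast
    then show "s \<in> encode D ` ggens D j i"
      using s quantum_deg_encode[of t D] by (auto simp: ggens_def gcells_def encode_def)
  qed
  moreover have "inj_on (encode D) (ggens D j i)"
    using bij_encode[of D] by (auto simp: bij_betw_def ggens_def intro: inj_on_subset)
  ultimately show ?thesis by (simp add: bij_betw_def)
qed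

lemma khov_diff_graded:
  assumes alt: "alternating D" and f: "f \<in> supp_on (ggens D j i)"
  shows "khov_diff D f = app (gen_mat D) (ggens D j i) (ggens D j (i + 1)) f"
proof
  fix t
  have sub: "ggens D j i \<subseteq> gens D" by (auto simp: ggens_def)
  have *: "(\<Sum>s\<in>gens D. f s * gen_mat D s t) = (\<Sum>s\<in>ggens D j i. f s * gen_mat D s t)"
    by (rule sum.mono_neutral_right[OF finite_gens sub]) (use f in \<open>auto simp: supp_on_def\<close>)
  show "khov_diff D f t = app (gen_mat D) (ggens D j i) (ggens D j (i + 1)) f t"
  proof (cases "t \<in> ggens D j (i + 1)")
    case True
    then show ?thesis using * by (auto simp: khov_diff_app[OF alt] app_def ggens_def)
  next
    case False
    have "gen_mat D s t = 0" if "s \<in> ggens D j i" "t \<in> gens D" for s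
    proof (rule ccontr)
      assume ne: "gen_mat D s t \<noteq> 0"
      have sg: "s \<in> gens D" using that(1) sub by blast
      have c: "encode D s \<in> cells D" "encode D t \<in> cells D"
        using bij_betwE[OF bij_encode[of D]] sg that(2) by auto
      from dmat_qdeg[OF alt c] ne have "qdeg D (encode D t) = qdeg D (encode D s)"
        "card (fst t) = Suc (card (fst s))" by (simp_all add: gen_mat_def encode_def)
      then have "t \<in> ggens D j (i + 1)"
        using that sg by (simp add: ggens_def quantum_deg_encode)
      then show False using False by simp
    qed
    then show ?thesis using False * by (simp add: khov_diff_app[OF alt] app_def)
  qed
qed

lemma quotient_iso_betti:
  assumes alt: "alternating D" and b: "betti (dmat D) (gcells D j) i (card {n. n < length ks \<and> ks ! n = j'})"
  shows "quotient_iso (cycles D i j) (boundaries D i j) (graded_sum ks j')"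
proof -
  have fin: "finite (ggens D j i)" for i
    by (rule finite_subset[OF _ finite_gens]) (auto simp: ggens_def)
  let ?d = "\<lambda>i. app (gen_mat D) (ggens D j i) (ggens D j (i + 1))"
  have Z: "cycles D i j = {f \<in> supp_on (ggens D j i). ?d i f = 0}"
    using khov_diff_graded[OF alt] by (auto simp: cycles_def chains_eq)
  have B: "boundaries D i j = ?d (i - 1) ` supp_on (ggens D j (i - 1))"
    using khov_diff_graded[OF alt] by (auto simp: boundaries_def chains_eq image_def)
  have tr: "rk (dmat D) (gcells D j i) (gcells D j i') = rk (gen_mat D) (ggens D j i) (ggens D j i')" for i i'
    by (rule rk_transport[OF fin fin bij_encode_graded bij_encode_graded]) (simp add: gen_mat_def)
  have cx: "complex (gen_mat D) (ggens D j)"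
    unfolding complex_def
  proof (intro conjI allI ballI)
    fix i p r assume p: "p \<in> ggens D j (i - 1)" and r: "r \<in> ggens D j (i + 1)"
    have "(\<Sum>q\<in>ggens D j i. gen_mat D p q * gen_mat D q r)
      = (\<Sum>q\<in>gcells D j i. dmat D (encode D p) q * dmat D q (encode D r))"
      unfolding gen_mat_def by (rule sum.reindex_bij_betw[OF bij_encode_graded])
    also have "\<dots> = 0"
    proof -
      have "encode D p \<in> gcells D j (i - 1)" "encode D r \<in> gcells D j (i + 1)"
        using p r bij_betwE[OF bij_encode_graded] by blast+
      then show ?thesis using complex_dmat[OF alt, of j] unfolding complex_def by blast
    qed
    finally show "(\<Sum>q\<in>ggens D j i. gen_mat D p q * gen_mat D q r) = 0" .
  qed (rule fin)
  have c: "card (ggens D j i) = card (gcells D j i)"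
    by (rule bij_betw_same_card[OF bij_encode_graded])
  show ?thesis
  proof (rule quotient_iso_dim[OF fin])
    show "vs.subspace (cycles D i j)" unfolding Z by (rule subspace_kernel)
    show "cycles D i j \<subseteq> supp_on (ggens D j i)" unfolding Z by blast
    show "vs.subspace (boundaries D i j)" unfolding B by (rule subspace_app)
    show "boundaries D i j \<subseteq> cycles D i j"
    proof
      fix y assume "y \<in> boundaries D i j"
      then obtain f where f: "y = ?d (i - 1) f" unfolding B by blast
      have "?d i y = 0" using complex_app[OF cx, of i f] f by simp
      moreover have "y \<in> supp_on (ggens D j i)" unfolding f by simp
      ultimately show "y \<in> cycles D i j" unfolding Z by blast
    qed
    show "vs.dim (cycles D i j) = vs.dim (boundaries D i j) + card {n. n < length ks \<and> ks ! n = j'}"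
      using dim_kernel[OF fin[of i], of "gen_mat D" "ggens D j (i + 1)"] b c
      unfolding Z B betti_def tr by (simp add: rk_def)
  qed
qed

section \<open>Smoothings of P(3, -3, q) and of a diagram with seven crossings\<close>

text \<open>
  The third column is replaced by a single crossing, crossing 6 of the model, which is
  1-smoothed if and only if all crossings of the column are.  The two points at level l of the
  columns 0 and 1 become 2 l, 2 l + 1 and 8 + 2 l, 9 + 2 l.  Numbers from 16 on denote the
  circles inside the third column.
\<close>

definition model :: "nat diagram" where
  "model = \<lparr>crossings = [(1,0,2,3), (3,2,4,5), (5,4,6,7), (8,10,11,9), (10,12,13,11), (12,14,15,13),
     (0,9,15,6)], arcs = [(1,8), (7,14)]\<rparr>"

abbreviation PD :: "nat => ppoint diagram" where
  "PD m \<equiv> pretzel 3 (-3) (int m)"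

definition vert_above :: "nat set => nat => bool" where
  "vert_above v l <-> (\<forall>j<l. 6 + j \<in> v)"

definition vert_below :: "nat => nat set => nat => bool" where
  "vert_below m v l <-> (\<forall>j. l \<le> j --> j < m --> 6 + j \<in> v)"

definition model_state :: "nat => nat set => nat set" where
  "model_state m v = v \<inter> {..<6} \<union> (if vert_above v m then {6} else {})"

text \<open>If the column contains a horizontal crossing, its two top ends are connected to each
  other and to the point 0, which is the top left point of the first column, and its two bottom ends
  to the point 15, the bottom right point of the second. Any other level lies on the circle directly
  below its nearest higher horizontal crossing, and that crossing names the circle.\<close>

definition level_code :: "nat => nat set => nat => nat" where
  "level_code m v l = (if vert_above v l then 0 else if vert_below m v l then 15
     else 16 + Max {j. j < l \<and> 6 + j \<notin> v})"

text \<open>In a completely vertical column the right strand continues the point 0 and the left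
  strand the point 9; only then does the side matter.\<close>

fun point_code :: "nat => nat set => ppoint => nat" where
  "point_code m v (i, l, s) = (if i < 2 then 8 * i + 2 * l + of_bool s
     else if vert_above v m then (if s then 0 else 9) else level_code m v l)"

text \<open>Chooses a point with a given code. The circle below the horizontal crossing
  \<open>h\<close> has code \<open>16 + h\<close> and passes through level \<open>h + 1\<close>,
  hence the 15.\<close>

definition point_of :: "nat => ppoint" where
  "point_of c = (if c < 16 then (c div 8, (c mod 8) div 2, odd c) else (2, c - 15, False))"

lemma less_6_cases: "(k::nat) < 6 ==> k = 0 \<or> k = 1 \<or> k = 2 \<or> k = 3 \<or> k = 4 \<or> k = 5"
  by auto

lemma PD_crossing:
  "l < m ==> crossings (PD m) ! (6 + l) = ((2, l, True), (2, l, False), (2, Suc l, False), (2, Suc l, True))"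
  using crossings_pretzel_nth(3)[of "6 + l" m] by (simp add: pretzel_crossing_def)

lemma PD_crossing_low:
  "crossings (PD m) ! 0 = ((0, 0, True), (0, 0, False), (0, 1, False), (0, 1, True))"
  "crossings (PD m) ! 1 = ((0, 1, True), (0, 1, False), (0, 2, False), (0, 2, True))"
  "crossings (PD m) ! 2 = ((0, 2, True), (0, 2, False), (0, 3, False), (0, 3, True))"
  "crossings (PD m) ! 3 = ((1, 0, False), (1, 1, False), (1, 1, True), (1, 0, True))"
  "crossings (PD m) ! 4 = ((1, 1, False), (1, 2, False), (1, 2, True), (1, 1, True))"
  "crossings (PD m) ! 5 = ((1, 2, False), (1, 3, False), (1, 3, True), (1, 2, True))"
  by (simp_all only: crossings_pretzel_nth)
     (simp_all add: crossings_pretzel_nth pretzel_crossing_def numeral_eq_Suc)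

lemma model_crossing:
  "crossings model ! 0 = (1,0,2,3)" "crossings model ! 1 = (3,2,4,5)" "crossings model ! 2 = (5,4,6,7)"
  "crossings model ! 3 = (8,10,11,9)" "crossings model ! 4 = (10,12,13,11)"
  "crossings model ! 5 = (12,14,15,13)" "crossings model ! 6 = (0,9,15,6)"
  by (simp_all add: model_def)

lemma n_crossings_model: "n_crossings model = 7"
  by (simp add: model_def)

lemma crossing_point_of:
  assumes "k < 6" "crossings model ! k = (a, b, c, d)"
  shows "crossings (PD m) ! k = (point_of a, point_of b, point_of c, point_of d)"
    "a < 16" "b < 16" "c < 16" "d < 16"
proof -
  have "crossings (PD m) ! k = (point_of a, point_of b, point_of c, point_of d) \<and>
    a < 16 \<and> b < 16 \<and> c < 16 \<and> d < 16"
    using less_6_cases[OF assms(1)] assms(2)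
    by (elim disjE; simp only: PD_crossing_low model_crossing prod.inject;
        elim conjE; hypsubst; simp add: point_of_def)
  then show "crossings (PD m) ! k = (point_of a, point_of b, point_of c, point_of d)"
    "a < 16" "b < 16" "c < 16" "d < 16" by blast+
qed

lemma point_code_point_of: "c < 16 ==> point_code m v (point_of c) = c"
proof -
  assume c: "c < 16"
  then have "c div 8 < 2" by auto
  moreover have "8 * (c div 8) + 2 * (c mod 8 div 2) + of_bool (odd c) = c"
  proof -
    have "c mod 8 mod 2 = c mod 2" by (simp add: mod_mod_cancel)
    then have "2 * (c mod 8 div 2) + of_bool (odd c) = c mod 8"
      by (metis mult_div_mod_eq of_bool_odd_eq_mod_2)
    then show ?thesis by (metis add.assoc mult_div_mod_eq)
  qed
  ultimately show ?thesis using c by (simp add: point_of_def)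
qed

lemma point_of_point_code: "i < 2 ==> l \<le> 3 ==> point_of (point_code m v (i, l, s)) = (i, l, s)"
proof -
  assume "i < 2" "l \<le> 3"
  then have "(i = 0 \<or> i = 1) \<and> (l = 0 \<or> l = 1 \<or> l = 2 \<or> l = 3)" by auto
  then show ?thesis by (cases s) (auto simp: point_of_def)
qed

lemma point_of_in_points: "c < 16 ==> point_of c \<in> points (PD m)"
proof -
  assume "c < 16"
  then have "c div 8 < 2" "c mod 8 div 2 \<le> 3" by auto
  then have "c div 8 = 0 \<or> c div 8 = 1" "c mod 8 div 2 \<le> 3" by auto
  then show ?thesis using \<open>c < 16\<close> by (auto simp: points_pretzel point_of_def)
qed

lemma joins_PD:
  "(x, y) \<in> joins (PD m) v <-> (x, y) \<in> set (arcs (PD m)) \<or>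
     (\<exists>k<6. (x, y) \<in> smoothing_joins (k \<in> v) (crossings (PD m) ! k)) \<or>
     (\<exists>l<m. (x, y) \<in> smoothing_joins (6 + l \<in> v) ((2, l, True), (2, l, False), (2, Suc l, False), (2, Suc l, True)))"
proof -
  have "{..<n_crossings (PD m)} = {..<6} \<union> (\<lambda>l. 6 + l) ` {..<m}"
  proof (intro set_eqI iffI)
    fix x assume x: "x \<in> {..<n_crossings (PD m)}"
    show "x \<in> {..<6} \<union> (\<lambda>l. 6 + l) ` {..<m}"
    proof (cases "x < 6")
      case False
      then show ?thesis using x by (auto simp: n_crossings_pretzel intro!: image_eqI[of _ _ "x - 6"])
    qed simp
  qed (auto simp: n_crossings_pretzel)
  then show ?thesis unfolding joins_def by (auto simp: PD_crossing)
qed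

lemma arcs_PD: "set (arcs (PD m)) = {((0, 0, True), (1, 0, False)), ((1, 0, True), (2, 0, False)),
   ((2, 0, True), (0, 0, False)), ((0, 3, True), (1, 3, False)), ((1, 3, True), (2, m, False)),
   ((2, m, True), (0, 3, False))}"
  by (auto simp: pretzel_def)

lemma joins_model:
  "(x, y) \<in> joins model u <-> (x, y) = (1, 8) \<or> (x, y) = (7, 14) \<or>
     (\<exists>k<6. (x, y) \<in> smoothing_joins (k \<in> u) (crossings model ! k)) \<or>
     (if 6 \<in> u then (x, y) = (0, 6) \<or> (x, y) = (9, 15) else (x, y) = (0, 9) \<or> (x, y) = (15, 6))"
proof -
  have "{..<n_crossings model} = insert 6 {..<6}" by (auto simp: n_crossings_model)
  then show ?thesis unfolding joins_def by (auto simp: model_crossing model_def)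
qed

lemma model_state_low: "k < 6 ==> k \<in> model_state m v <-> k \<in> v"
  by (simp add: model_state_def)

lemma model_state_6: "6 \<in> model_state m v <-> vert_above v m"
  by (simp add: model_state_def)

lemma level_code_Suc:
  assumes "6 + l \<in> v" "l < m"
  shows "level_code m v (Suc l) = level_code m v l"
proof -
  have "vert_above v (Suc l) = vert_above v l" using assms by (auto simp: vert_above_def less_Suc_eq)
  moreover have "vert_below m v (Suc l) = vert_below m v l"
    using assms by (auto simp: vert_below_def) (metis Suc_leI le_neq_implies_less)
  moreover have "{j. j < Suc l \<and> 6 + j \<notin> v} = {j. j < l \<and> 6 + j \<notin> v}"
    using assms by (auto simp: less_Suc_eq)
  ultimately show ?thesis by (simp add: level_code_def)
qed

text \<open>\<open>point_code\<close> sends each join either to a join of the model, possibly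
  reversed, or to a single point.\<close>

lemma conn_PD_imp_model:
  assumes "(p, q) \<in> conn (PD m) v"
  shows "(point_code m v p, point_code m v q) \<in> conn model (model_state m v)"
  unfolding conn_def
proof (rule eqc_image[OF assms[unfolded conn_def]])
  fix x y assume xy: "(x, y) \<in> joins (PD m) v"
  let ?u = "model_state m v"
  have b: "(x, y) \<in> joins model ?u ==> (x, y) \<in> eqc (joins model ?u)"
    "(y, x) \<in> joins model ?u ==> (x, y) \<in> eqc (joins model ?u)" for x y
    by (auto intro: eqc_base eqc_sym)
  from xy[unfolded joins_PD] show "(point_code m v x, point_code m v y) \<in> eqc (joins model ?u)"
  proof (elim disjE exE conjE)
    assume "(x, y) \<in> set (arcs (PD m))"
    moreover have "vert_above v 0" "vert_below m v m" by (auto simp: vert_above_def vert_below_def)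
    ultimately show ?thesis
      by (cases "vert_above v m")
         (auto simp: arcs_PD level_code_def joins_model model_state_6 intro: b)
  next
    fix k assume k: "k < 6" and xy: "(x, y) \<in> smoothing_joins (k \<in> v) (crossings (PD m) ! k)"
    obtain a b' c d where cr: "crossings model ! k = (a, b', c, d)" by (cases "crossings model ! k")
    have "(point_code m v x, point_code m v y) \<in> smoothing_joins (k \<in> v) (crossings model ! k)"
      using xy crossing_point_of[OF k cr] unfolding cr
      by (cases "k \<in> v") (auto simp: point_code_point_of simp del: point_code.simps)
    then show ?thesis using k by (intro b) (auto simp: joins_model model_state_low)
  next
    fix l assume l: "l < m" and xy: "(x, y) \<in> smoothing_joins (6 + l \<in> v)
      ((2, l, True), (2, l, False), (2, Suc l, False), (2, Suc l, True))"
    have "point_code m v x = point_code m v y"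
    proof (cases "6 + l \<in> v")
      case True
      then show ?thesis using xy level_code_Suc[OF True l] by auto
    next
      case False
      then have "\<not> vert_above v m" using l by (auto simp: vert_above_def)
      then show ?thesis using xy False by auto
    qed
    then show ?thesis by simp
  qed
qed

lemma conn_column:
  assumes "l \<le> l'" "l' \<le> m" "\<And>j. l \<le> j ==> j < l' ==> 6 + j \<in> v"
  shows "((2, l, s), (2, l', s)) \<in> conn (PD m) v"
  using assms
proof (induction l' rule: dec_induct)
  case (step n)
  have "((2, n, s), (2, Suc n, s)) \<in> conn (PD m) v"
  proof (cases s)
    case True
    then have "((2, n, s), (2, Suc n, s)) \<in> joins (PD m) v"
      using step unfolding joins_PD by (intro disjI2 exI[of _ n]) auto
    then show ?thesis by (rule conn_base)
  next
    case False
    then have "((2, n, s), (2, Suc n, s)) \<in> joins (PD m) v"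
      using step unfolding joins_PD by (intro disjI2 exI[of _ n]) auto
    then show ?thesis by (rule conn_base)
  qed
  then show ?case using step by (auto intro: conn_trans)
qed simp

lemma conn_horizontal:
  assumes "l < m" "6 + l \<notin> v"
  shows "((2, l, True), (2, l, False)) \<in> conn (PD m) v" "((2, Suc l, False), (2, Suc l, True)) \<in> conn (PD m) v"
proof -
  have "((2, l, True), (2, l, False)) \<in> joins (PD m) v" "((2, Suc l, False), (2, Suc l, True)) \<in> joins (PD m) v"
    using assms unfolding joins_PD by (auto intro!: disjI2 exI[of _ l])
  then show "((2, l, True), (2, l, False)) \<in> conn (PD m) v" "((2, Suc l, False), (2, Suc l, True)) \<in> conn (PD m) v"
    by (auto intro: conn_base)
qed

lemma conn_arcs: "(x, y) \<in> set (arcs (PD m)) ==> (x, y) \<in> conn (PD m) v"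
  by (rule conn_base) (simp add: joins_PD)

text \<open>Both strands entering from the top run down to the highest horizontal crossing
  \<open>h\<close>, which connects them.\<close>

lemma conn_top:
  assumes "\<not> vert_above v m"
  shows "((0, 0, False), (1, 0, True)) \<in> conn (PD m) v"
proof -
  define h where "h = (LEAST l. l < m \<and> 6 + l \<notin> v)"
  have h: "h < m \<and> 6 + h \<notin> v"
    unfolding h_def by (rule LeastI_ex) (use assms in \<open>auto simp: vert_above_def\<close>)
  have j: "6 + j \<in> v" if "j < h" for j
    using not_less_Least[of j "\<lambda>l. l < m \<and> 6 + l \<notin> v"] that h unfolding h_def[symmetric] by auto
  have "((2, 0, s), (2, h, s)) \<in> conn (PD m) v" for s using h j by (intro conn_column) auto
  moreover have "((2, h, True), (2, h, False)) \<in> conn (PD m) v" using conn_horizontal h by blast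
  moreover have "((2, 0, True), (0, 0, False)) \<in> conn (PD m) v" "((1, 0, True), (2, 0, False)) \<in> conn (PD m) v"
    by (auto intro!: conn_arcs simp: arcs_PD)
  ultimately show ?thesis by (meson conn_sym conn_trans)
qed

lemma conn_bottom:
  assumes "\<not> vert_above v m"
  shows "((1, 3, True), (0, 3, False)) \<in> conn (PD m) v"
proof -
  define h where "h = Max {l. l < m \<and> 6 + l \<notin> v}"
  have fin: "finite {l. l < m \<and> 6 + l \<notin> v}" by simp
  have "{l. l < m \<and> 6 + l \<notin> v} \<noteq> {}" using assms by (auto simp: vert_above_def)
  from Max_in[OF fin this] have h: "h < m \<and> 6 + h \<notin> v" by (simp add: h_def)
  have j: "6 + j \<in> v" if "h < j" "j < m" for j
    using Max_ge[OF fin, of j] that unfolding h_def[symmetric] by auto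
  have "((2, Suc h, s), (2, m, s)) \<in> conn (PD m) v" for s using h j by (intro conn_column) auto
  moreover have "((2, Suc h, False), (2, Suc h, True)) \<in> conn (PD m) v" using conn_horizontal h by blast
  moreover have "((1, 3, True), (2, m, False)) \<in> conn (PD m) v" "((2, m, True), (0, 3, False)) \<in> conn (PD m) v"
    by (auto intro!: conn_arcs simp: arcs_PD)
  ultimately show ?thesis by (meson conn_sym conn_trans)
qed

lemma conn_full:
  assumes "vert_above v m"
  shows "((0, 0, False), (0, 3, False)) \<in> conn (PD m) v" "((1, 0, True), (1, 3, True)) \<in> conn (PD m) v"
proof -
  have "((2, 0, s), (2, m, s)) \<in> conn (PD m) v" for s
    using assms by (intro conn_column) (auto simp: vert_above_def)
  moreover have "((2, 0, True), (0, 0, False)) \<in> conn (PD m) v" "((1, 0, True), (2, 0, False)) \<in> conn (PD m) v"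
     "((1, 3, True), (2, m, False)) \<in> conn (PD m) v" "((2, m, True), (0, 3, False)) \<in> conn (PD m) v"
    by (auto intro!: conn_arcs simp: arcs_PD)
  ultimately show "((0, 0, False), (0, 3, False)) \<in> conn (PD m) v" "((1, 0, True), (1, 3, True)) \<in> conn (PD m) v"
    by (meson conn_sym conn_trans)+
qed

text \<open>A point of the third column is moved along vertical crossings until it reaches an end of
  the column or the horizontal crossing that names its circle.\<close>

lemma conn_point_of_code:
  assumes "p \<in> points (PD m)"
  shows "(p, point_of (point_code m v p)) \<in> conn (PD m) v"
proof -
  obtain i l s where p: "p = (i, l, s)" by (cases p)
  have "i < 2 \<and> l \<le> 3 \<or> i = 2 \<and> l \<le> m" using assms by (auto simp: p points_pretzel)
  then show ?thesis
  proof (elim disjE conjE)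
    assume "i < 2" "l \<le> 3"
    then show ?thesis using point_of_point_code by (simp add: p del: point_code.simps)
  next
    assume i: "i = 2" and l: "l \<le> m"
    have P: "point_of 0 = (0, 0, False)" "point_of 9 = (1, 0, True)" "point_of 15 = (1, 3, True)"
      by (simp_all add: point_of_def)
    have a: "((2, 0, True), (0, 0, False)) \<in> conn (PD m) v" "((1, 0, True), (2, 0, False)) \<in> conn (PD m) v"
      "((1, 3, True), (2, m, False)) \<in> conn (PD m) v" "((2, m, True), (0, 3, False)) \<in> conn (PD m) v"
      by (auto intro!: conn_arcs simp: arcs_PD)
    have top: "((2, 0, s), (2, l, s)) \<in> conn (PD m) v" if "vert_above v l"
      using that l by (intro conn_column) (auto simp: vert_above_def)
    show ?thesis
    proof (cases "vert_above v m")
      case True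
      then have "vert_above v l" using l by (auto simp: vert_above_def)
      note top[OF this]
      then show ?thesis using True a by (cases s) (auto simp: p i P intro: conn_sym conn_trans)
    next
      case nf: False
      consider "vert_above v l" | "\<not> vert_above v l" "vert_below m v l" | "\<not> vert_above v l" "\<not> vert_below m v l" by blast
      then show ?thesis
      proof cases
        case 1
        have "((2, 0, s), (0, 0, False)) \<in> conn (PD m) v"
          using a(1,2) conn_top[OF nf] by (cases s) (auto intro: conn_sym conn_trans)
        then show ?thesis using top[OF 1] nf 1
          by (auto simp: p i P level_code_def intro: conn_sym conn_trans)
      next
        case 2
        have "((2, l, s), (2, m, s)) \<in> conn (PD m) v"
          using 2(2) l by (intro conn_column) (auto simp: vert_below_def)
        moreover have "((2, m, s), (1, 3, True)) \<in> conn (PD m) v"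
          using a(3,4) conn_bottom[OF nf] by (cases s) (auto intro: conn_sym conn_trans)
        ultimately show ?thesis using nf 2
          by (auto simp: p i P level_code_def intro: conn_trans)
      next
        case 3
        let ?J = "{j. j < l \<and> 6 + j \<notin> v}"
        define h where "h = Max ?J"
        have "?J \<noteq> {}" using 3 by (auto simp: vert_above_def)
        then have h: "h < l" "6 + h \<notin> v" using Max_in[of ?J] by (auto simp: h_def)
        have j: "6 + j \<in> v" if "h < j" "j < l" for j
          using Max_ge[of ?J j] that unfolding h_def[symmetric] by auto
        have 1: "((2, Suc h, s), (2, l, s)) \<in> conn (PD m) v"
          using h j l by (intro conn_column) auto
        have 2: "((2, Suc h, s), (2, Suc h, False)) \<in> conn (PD m) v"
          using conn_horizontal(2)[of h m v] h l by (cases s) (auto intro: conn_sym)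
        have "point_code m v p = 16 + h" using nf 3 by (simp add: p i level_code_def h_def)
        then have e: "point_of (point_code m v p) = (2, Suc h, False)" by (simp add: point_of_def)
        show ?thesis unfolding e unfolding p i using conn_trans[OF conn_sym[OF 1] 2] .
      qed
    qed
  qed
qed

lemma conn_model_imp_PD:
  assumes "(x, y) \<in> conn model (model_state m v)"
  shows "(point_of x, point_of y) \<in> conn (PD m) v"
  unfolding conn_def
proof (rule eqc_image[OF assms[unfolded conn_def]], fold conn_def)
  fix x y assume "(x, y) \<in> joins model (model_state m v)"
  moreover have P: "point_of 0 = (0, 0, False)" "point_of 1 = (0, 0, True)" "point_of (Suc 0) = (0, 0, True)"
    "point_of 6 = (0, 3, False)" "point_of 7 = (0, 3, True)"
    "point_of 8 = (1, 0, False)" "point_of 9 = (1, 0, True)" "point_of 14 = (1, 3, False)" "point_of 15 = (1, 3, True)"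
    by (simp_all add: point_of_def)
  moreover have "(point_of x, point_of y) \<in> conn (PD m) v"
    if k: "k < 6" and xy: "(x, y) \<in> smoothing_joins (k \<in> model_state m v) (crossings model ! k)" for k
  proof -
    obtain a b c d where cr: "crossings model ! k = (a, b, c, d)" by (cases "crossings model ! k")
    have "(point_of x, point_of y) \<in> smoothing_joins (k \<in> v) (crossings (PD m) ! k)"
      using xy crossing_point_of(1)[OF k cr] unfolding cr model_state_low[OF k]
      by (cases "k \<in> v") auto
    then have "(point_of x, point_of y) \<in> joins (PD m) v" using k by (auto simp: joins_PD)
    then show ?thesis by (rule conn_base)
  qed
  moreover have "((0, 0, True), (1, 0, False)) \<in> conn (PD m) v" "((0, 3, True), (1, 3, False)) \<in> conn (PD m) v"
    by (auto intro!: conn_arcs simp: arcs_PD)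
  ultimately show "(point_of x, point_of y) \<in> conn (PD m) v"
    using conn_full[of v m] conn_top[of v m] conn_bottom[of v m]
    by (auto simp: joins_model model_state_6 split: if_splits)
qed

lemma conn_PD_iff:
  assumes "p \<in> points (PD m)" "q \<in> points (PD m)"
  shows "(p, q) \<in> conn (PD m) v <-> (point_code m v p, point_code m v q) \<in> conn model (model_state m v)"
proof
  assume "(point_code m v p, point_code m v q) \<in> conn model (model_state m v)"
  then have "(point_of (point_code m v p), point_of (point_code m v q)) \<in> conn (PD m) v"
    by (rule conn_model_imp_PD)
  then show "(p, q) \<in> conn (PD m) v"
    using conn_point_of_code[OF assms(1), of v] conn_point_of_code[OF assms(2), of v]
    by (meson conn_sym conn_trans)
qed (rule conn_PD_imp_model)

text \<open>Used for codes from 16 on: they are not points of \<open>model\<close>, so each forms a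
  class of its own.\<close>

lemma conn_outside: "(x, y) \<in> conn D v ==> x \<notin> points D ==> y = x"
proof -
  have "eqc (joins D v) \<subseteq> {(x, y). y = x \<or> x \<in> points D \<and> y \<in> points D}"
    by (rule eqc_subset) (use joins_points[of D v] in auto)
  then show "(x, y) \<in> conn D v ==> x \<notin> points D ==> y = x" by (auto simp: conn_def)
qed

lemma points_model: "points model = {..<16}"
proof
  show "points model \<subseteq> {..<16}" unfolding points_def model_def by auto
  have "{..<16} \<subseteq> ({0,1,2,3,4,5,6,7,8,9,10,11,12,13,14,15} :: nat set)" by (auto; presburger)
  also have "\<dots> \<subseteq> points model" unfolding points_def model_def by auto
  finally show "{..<16} \<subseteq> points model" .
qed

text \<open>Crossings of the first two columns are crossings of the model. In the third column,
  changing the only remaining horizontal crossing is changing crossing 6 of the model; changing any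
  other one merges two circles with different codes.\<close>

lemma alternating_PD:
  assumes alt: "alternating model"
  shows "alternating (PD m)"
  unfolding alternating_def
proof (intro allI impI)
  fix v k a b c d
  assume v: "v \<subseteq> {..<n_crossings (PD m)}" and k: "k < n_crossings (PD m)" "k \<notin> v"
    and cr: "crossings (PD m) ! k = (a, b, c, d)"
  have pts: "a \<in> points (PD m)" "c \<in> points (PD m)" using crossing_points[OF k(1) cr] by auto
  note iff = conn_PD_iff[OF pts]
  have u: "model_state m v \<subseteq> {..<n_crossings model}"
    by (auto simp: model_state_def n_crossings_model)
  show "(a, c) \<in> conn (PD m) v <-> (a, c) \<notin> conn (PD m) (insert k v)"
  proof (cases "k < 6")
    case True
    obtain a' b' c' d' where cr': "crossings model ! k = (a', b', c', d')" by (cases "crossings model ! k")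
    have ac: "a = point_of a'" "c = point_of c'" "a' < 16" "c' < 16"
      using crossing_point_of(1)[OF True cr', of m] crossing_point_of(2-)[OF True cr'] cr by auto
    have "vert_above (insert k v) m = vert_above v m" using True by (auto simp: vert_above_def)
    then have ms: "model_state m (insert k v) = insert k (model_state m v)"
      using True by (auto simp: model_state_def)
    have "k \<notin> model_state m v" "k < n_crossings model"
      using True k(2) by (auto simp: model_state_low n_crossings_model)
    from alternatingD[OF alt u this(2,1) cr'] show ?thesis
      unfolding iff ms unfolding ac point_code_point_of[OF ac(3)] point_code_point_of[OF ac(4)] .
  next
    case False
    define l where "l = k - 6"
    have kl: "k = 6 + l" and l: "l < m" using False k(1) by (auto simp: l_def n_crossings_pretzel)
    have ac: "a = (2, l, True)" "c = (2, Suc l, False)" using cr PD_crossing[OF l] kl by auto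
    have nv: "6 + l \<notin> v" using k(2) kl by simp
    have nf: "\<not> vert_above v m" using l nv by (auto simp: vert_above_def)
    have nS: "\<not> vert_above v (Suc l)" using nv by (auto simp: vert_above_def)
    have nb: "\<not> vert_below m v l" using l nv by (auto simp: vert_below_def)
    have pa: "point_code m v a = level_code m v l" "point_code m v c = level_code m v (Suc l)"
      using nf by (simp_all add: ac)
    show ?thesis
    \<comment> \<open>If the column becomes completely vertical, the ends of the changed crossing
      have codes 0 and 15 before, but 0 and 9 after the change; crossing 6 of the model then
      connects 9 with 15.\<close>
    proof (cases "vert_above (insert k v) m")
      case True
      have "6 + j \<in> v" if "j < m" "j \<noteq> l" for j
        using True that by (auto simp: vert_above_def kl)
      then have "vert_above v l" "vert_below m v (Suc l)"
        using l by (auto simp: vert_above_def vert_below_def)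
      then have p: "point_code m v a = 0" "point_code m v c = 15"
        using nS unfolding pa by (simp_all add: level_code_def)
      have w: "point_code m (insert k v) a = 0" "point_code m (insert k v) c = 9"
        using True by (simp_all add: ac)
      have ms: "model_state m (insert k v) = insert 6 (model_state m v)"
        using True nf kl by (auto simp: model_state_def)
      have n6: "6 \<notin> model_state m v" using nf by (simp add: model_state_6)
      have "(9, 15) \<in> joins model (insert 6 (model_state m v))" by (simp add: joins_model)
      then have "(9, 15) \<in> conn model (insert 6 (model_state m v))" by (rule conn_base)
      then have "(0, 9) \<in> conn model (insert 6 (model_state m v)) <-> (0, 15) \<in> conn model (insert 6 (model_state m v))"
        by (meson conn_sym conn_trans)
      then show ?thesis
        unfolding iff unfolding p w ms
        using alternatingD[OF alt u _ n6 model_crossing(7)] by (simp add: n_crossings_model)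
    next
      case nfw: False
      have w: "point_code m (insert k v) a = point_code m (insert k v) c"
        using nfw level_code_Suc[OF _ l, of "insert k v"] kl by (simp add: ac)
      have Ml: "{j. j < Suc l \<and> 6 + j \<notin> v} \<noteq> {}" "Max {j. j < Suc l \<and> 6 + j \<notin> v} = l"
        using nv by (auto intro!: Max_eqI)
      have "(level_code m v l, level_code m v (Suc l)) \<notin> conn model (model_state m v)"
      proof
        assume c: "(level_code m v l, level_code m v (Suc l)) \<in> conn model (model_state m v)"
        show False
        proof (cases "vert_above v l")
          case True
          then have "\<not> vert_below m v (Suc l)"
            using nfw by (auto simp: vert_above_def vert_below_def kl) (metis Suc_leI not_less_iff_gr_or_eq)
          then have "level_code m v (Suc l) = 16 + l" using nS Ml by (simp add: level_code_def)
          then show False using conn_outside[OF conn_sym[OF c]] True by (simp add: points_model level_code_def)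
        next
          case False
          let ?M = "{j. j < l \<and> 6 + j \<notin> v}"
          have "?M \<noteq> {}" using False by (auto simp: vert_above_def)
          then have "Max ?M < l" using Max_in[of ?M] by auto
          moreover have "level_code m v l = 16 + Max ?M" using False nb by (simp add: level_code_def)
          moreover from this have "level_code m v (Suc l) = 16 + Max ?M"
            using conn_outside[OF c] by (simp add: points_model)
          ultimately show False using nS Ml by (auto simp: level_code_def split: if_splits)
        qed
      qed
      then show ?thesis unfolding iff unfolding pa w by simp
    qed
  qed
qed

section \<open>Executable version of the complex of the seven-crossing diagram\<close>

type_synonym mcell = "bool list \<times> bool list"
type_synonym mvec = "(mcell \<times> int) list"

fun bor :: "bool list => bool list => bool list" where
  "bor (x # xs) (y # ys) = (if x then True else y) # bor xs ys"
| "bor _ _ = []"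

text \<open>Classes are bit masks of length 16. In a partition one or two of them contain
  \<open>a\<close> or \<open>b\<close>, which are the relevant cases.\<close>

definition join_classes :: "nat => nat => bool list list => bool list list" where
  "join_classes a b P = (case partition (\<lambda>m. m ! a \<or> m ! b) P of (S, R) =>
     (case S of [] => R | [x] => x # R | x # y # _ => bor x y # R))"

definition initial_classes :: "bool list list" where
  "initial_classes = join_classes 7 14 (join_classes 1 8
     (map (\<lambda>i. map (\<lambda>j. j = i) [0..<16]) [0..<16]))"

datatype table = Leaf "bool list list" | Node table table

fun make_table :: "(nat \<times> nat \<times> nat \<times> nat) list => bool list list => table" where
  "make_table ((a, b, c, d) # cs) P = Node
     (make_table cs (join_classes a b (join_classes c d P)))
     (make_table cs (join_classes a d (join_classes b c P)))"
| "make_table [] P = Leaf P"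

fun lookup :: "table => bool list => bool list list" where
  "lookup (Node x y) (u # us) = lookup (if u then y else x) us"
| "lookup (Leaf P) _ = P"
| "lookup (Node x y) [] = []"

definition circle_table :: table where
  "circle_table = make_table (crossings model) initial_classes"

definition model_circles :: "bool list => bool list list" where
  "model_circles us = lookup circle_table us"

\<comment> \<open>The circles of all 128 smoothings are computed once and stored as a code equation,
  so that the later evaluations merely look them up.\<close>
schematic_goal circle_table_code [code]: "circle_table = ?t"
  by code_simp

fun states :: "nat => nat => bool list list" where
  "states 0 i = (if i = 0 then [[]] else [])"
| "states (Suc n) i = map (Cons False) (states n i) @
     (case i of 0 => [] | Suc i => map (Cons True) (states n i))"

fun labels :: "bool list list => int => bool list => (int \<times> bool list) list" where
  "labels [] e m = [(e, m)]"
| "labels (x # P) e m = labels P (e - 1) (bor x m) @ labels P (e + 1) m"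

definition state_cells :: "bool list => int => (int \<times> mcell) list" where
  "state_cells us w = map (\<lambda>(e, as). (e, us, as)) (labels (model_circles us) w (replicate 16 False))"

text \<open>\<open>i\<close> counts the 1-smoothed crossings among the first six and
  \<open>h\<close> is the state of crossing 6, which enters the quantum shift separately.\<close>

definition all_cells :: "bool => nat => (int \<times> mcell) list" where
  "all_cells h i = concat (map (\<lambda>u. state_cells (u @ [h]) (int i + (if h then 1 else 0))) (states 6 i))"

fun select :: "int => (int \<times> mcell) list => mcell list" where
  "select j [] = []"
| "select j ((e, c) # L) = (if e = j then c # select j L else select j L)"

fun class_of :: "nat => bool list list => bool list" where
  "class_of a (m # P) = (if m ! a then m else class_of a P)"
| "class_of a [] = []"

definition split_targets where
  "split_targets as a c Q = [bor as (class_of a Q), bor as (class_of c Q)]"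

text \<open>\<open>m\<close> is the class of \<open>a\<close> before the change, so
  \<open>m ! c\<close> distinguishes a split from a merge. Splitting a circle labelled X leaves the
  set of points labelled X unchanged, since both halves are X.\<close>

definition crossing_targets where
  "crossing_targets w P as a c m = (if m ! c
     then (if as ! a then [as] else split_targets as a c (model_circles w))
     else if as ! a then (if as ! c then [] else [bor as (bor m (class_of c P))])
     else if as ! c then [bor as (bor m (class_of c P))] else [as])"

fun state_sign :: "bool list => nat => int" where
  "state_sign (u # us) (Suc k) = (if u then - state_sign us k else state_sign us k)"
| "state_sign _ _ = 1"

fun attach :: "bool list => int => bool list list => mvec" where
  "attach us x [] = []"
| "attach us x (as # L) = ((us, as), x) # attach us x L"

definition edge_targets ::
  "bool list => bool list => bool list list => nat => nat => nat => int => mvec" where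
  "edge_targets us as P k a c x = (if us ! k then [] else attach (us[k := True]) (x * state_sign us k)
     (crossing_targets (us[k := True]) P as a c (class_of a P)))"

fun all_targets :: "bool list => bool list => bool list list => nat => (nat \<times> nat \<times> nat \<times> nat) list => int => mvec" where
  "all_targets us as P k [] x = []"
| "all_targets us as P k ((a, b, c, d) # cs) x = edge_targets us as P k a c x @ all_targets us as P (Suc k) cs x"

fun diff_vec :: "mvec => mvec" where
  "diff_vec [] = []"
| "diff_vec (((us, as), x) # f) =
     all_targets us as (model_circles us) 0 (crossings model) x @ diff_vec f"

fun coeff_at :: "mcell => mvec => int" where
  "coeff_at q [] = 0"
| "coeff_at q ((t, s) # L) = (if t = q then s + coeff_at q L else coeff_at q L)"

fun vanishes_on :: "mvec => (mvec \<times> mcell) list => bool" where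
  "vanishes_on r [] = True"
| "vanishes_on r ((_, q) # L) = (if coeff_at q r = 0 then vanishes_on r L else False)"

text \<open>The pattern of \<open>rk_triangular\<close>: a nonzero entry at the own pivot and zeros
  at all later pivots.\<close>

fun triangular :: "(mvec \<times> mcell) list => bool" where
  "triangular [] = True"
| "triangular ((r, q) # L) = (if coeff_at q r = 0 then False else
     if vanishes_on r L then triangular L else False)"

text \<open>A row of a certificate is a combination of source generators, given by positions and
  coefficients, together with the position of its pivot among the targets.\<close>

type_synonym cert = "((nat \<times> int) list \<times> nat) list"

fun pick :: "mcell list => (nat \<times> int) list => mvec" where
  "pick P [] = []"
| "pick P ((i, x) # f) = (P ! i, x) # pick P f"

fun rows :: "mcell list => mcell list => cert => (mvec \<times> mcell) list" where
  "rows P Q [] = []"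
| "rows P Q ((f, q) # r) = (diff_vec (pick P f), Q ! q) # rows P Q r"

definition in_range :: "nat => nat => cert => bool" where
  "in_range n n' r = list_all (\<lambda>(f, q). list_all (\<lambda>(i, _). i < n) f \<and> q < n') r"

definition check_rank :: "cert => mcell list => mcell list => bool" where
  "check_rank r P Q = (in_range (length P) (length Q) r \<and> triangular (rows P Q r))"

definition units :: "(nat \<times> nat) list => cert" where
  "units = map (\<lambda>(p, q). ([(p, 1)], q))"

text \<open>The outer position is the number of 1-smoothed crossings among the first six; each entry
  starts with its quantum degree. Here single generators in a suitable order already give triangular
  minors, so every certificate is of the form \<open>units\<close>.\<close>

definition rank_certs_H :: "(int \<times> cert) list list" where
  "rank_certs_H = [
   [(-3, units [(0,0)]),
    (-1, units [(2,11), (0,0), (1,9)]),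
    (1, units [(2,19), (1,15), (0,0)]),
    (3, units [(0,0)])],
   [(-3, units [(2,2), (0,0)]),
    (-1, units [(13,18), (4,22), (0,21), (8,23), (11,14), (7,4), (3,2), (9,17), (1,15), (12,16), (2,3),
      (10,13)]),
    (1, units [(8,43), (22,49), (14,12), (10,7), (2,31), (12,45), (20,48), (19,32), (6,33), (0,30), (23,50),
      (5,19), (17,29), (11,8), (4,41), (16,47), (15,26), (9,6), (1,13), (13,11), (7,1)]),
    (3, units [(0,49), (8,45), (4,0), (1,4), (2,12), (14,56), (12,34), (13,43), (9,24), (10,15), (6,44),
      (7,8), (11,18), (3,32)]),
    (5, units [(0,2), (2,23), (1,22)])],
   [(-3, units [(1,0)]),
    (-1, units [(12,2), (7,3), (9,13), (23,14), (21,12), (15,6), (16,8), (13,4), (11,11), (6,10), (10,0),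
      (1,9)]),
    (1, units [(28,12), (5,9), (18,13), (4,29), (11,1), (21,36), (22,2), (58,54), (50,48), (56,52), (53,43),
      (8,5), (1,28), (25,8), (43,40), (2,4), (34,25), (12,20), (45,59), (48,39), (47,34), (37,21), (40,33),
      (36,23), (23,6), (30,15), (44,30), (52,50), (59,57), (42,27), (55,46), (7,18), (17,22), (27,26), (9,14),
      (20,0), (57,53), (54,45), (26,10)]),
    (3, units [(49,63), (25,54), (52,82), (35,25), (8,17), (18,49), (41,40), (17,73), (6,3), (23,52), (28,55),
      (34,23), (31,20), (0,38), (7,5), (58,92), (37,61), (27,79), (15,48), (57,90), (55,74), (20,0), (26,36),
      (38,30), (19,70), (51,64), (2,7), (10,44), (45,45), (9,9), (11,27), (36,33), (1,39), (39,56), (33,58),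
      (40,47), (43,89), (59,91), (50,71), (4,10), (24,77), (13,8), (32,22), (54,76), (22,2), (29,15)]),
    (5, units [(0,42), (15,21), (5,46), (18,33), (7,9), (21,44), (12,37), (20,32), (11,5), (8,20), (17,56),
      (13,53), (6,47), (19,35), (16,16), (3,30), (4,4), (14,11), (9,22), (10,0), (22,43)]),
    (7, units [(2,1), (0,3), (1,10)])],
   [(-1, units [(10,1), (8,0), (5,2)]),
    (1, units [(28,7), (16,2), (12,14), (20,1), (47,15), (36,6), (53,23), (45,21), (57,22), (30,9), (42,18),
      (44,16), (18,4), (26,20), (56,19), (35,5), (25,3), (23,0), (7,8), (17,10), (41,11)]),
    (3, units [(9,2), (3,12), (15,31), (52,26), (34,4), (50,10), (78,36), (54,17), (46,23), (8,5), (40,20),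
      (20,39), (64,34), (19,8), (12,7), (18,33), (76,45), (30,42), (32,0), (38,48), (66,37), (42,18), (62,30),
      (44,51), (84,59), (85,44), (81,57), (80,40), (83,58), (16,6), (73,52), (86,49), (63,32), (35,28),
      (88,55), (49,25), (57,22), (17,9), (39,13), (21,3), (33,27), (60,24), (10,35), (53,56), (89,50),
      (91,53)]),
    (5, units [(2,2), (27,48), (42,39), (24,4), (51,55), (5,14), (20,43), (6,34), (47,52), (59,53), (4,13),
      (46,42), (3,0), (14,6), (43,40), (0,10), (45,38), (28,21), (49,37), (8,16), (10,18), (38,54), (50,45),
      (12,19), (11,8), (35,11), (31,23), (7,35), (19,1), (18,9), (48,44), (56,47), (9,7), (25,28), (21,25),
      (55,58), (17,22), (29,50), (57,57)]),
    (7, units [(3,8), (7,2), (8,1), (4,9), (5,4), (1,14), (6,0), (12,21), (0,5), (11,23), (10,22), (13,15)]),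
    (9, units [(0,0)])],
   [(1, units [(22,2), (12,0), (20,1)]),
    (3, units [(33,4), (34,5), (1,1), (11,9), (51,8), (14,0), (50,11), (53,13), (35,7), (47,14), (55,10),
      (13,2), (40,6), (9,3)]),
    (5, units [(13,0), (10,12), (6,6), (45,22), (55,15), (26,1), (54,13), (18,3), (33,9), (12,2), (38,10),
      (19,4), (51,20), (2,8), (40,18), (34,16), (17,5), (22,19), (53,21), (59,23), (47,11)]),
    (7, units [(14,9), (1,1), (9,8), (13,4), (5,0), (18,7), (19,6), (10,3), (16,11), (11,2), (22,10),
      (12,14)]),
    (9, units [(2,2), (0,0)])],
   [(3, units [(12,0)]),
    (5, units [(16,1), (22,0), (19,2)]),
    (7, units [(5,0), (12,2), (2,1)]),
    (9, units [(1,0)])],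
   []]"

text \<open>Four minors contain one genuine combination of generators each; all remaining rows are
  single generators.\<close>

definition rank_certs_V :: "(int \<times> cert) list list" where
  "rank_certs_V = [
   [(-1, ([(0, -1), (1, 1), (2, -1), (3, 1)], 3) # units [(1,4), (0,5), (2,0)]),
    (1, units [(0,15), (5,2), (2,7), (4,11), (1,6), (3,17)]),
    (3, units [(1,0), (0,15), (3,5), (2,1)]),
    (5, units [(0,1)])],
   [(-1, units [(2,2), (0,0)]),
    (1, units [(10,13), (16,21), (17,22), (12,18), (5,3), (7,17), (4,16), (13,15), (3,0), (6,4), (2,6)]),
    (3, units [(0,32), (15,34), (3,20), (16,41), (10,22), (13,28), (9,30), (14,29), (11,23), (8,10), (2,4),
      (17,37), (7,7), (1,1)]),
    (5, units [(4,23), (3,22), (5,19), (1,9), (0,4)])],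
   [(-1, units [(1,0)]),
    (1, units [(22,14), (10,2), (2,3), (14,7), (13,5), (15,8), (16,10), (9,1), (8,13), (4,12), (11,4),
      (0,11)]),
    (3, ([(1, 1), (2, 1), (5, -1), (7, 1), (8, -1), (11, -1), (13, 1), (14, -1), (17, 1)], 4) # units [(12,0),
      (6,13), (2,11), (8,2), (11,9), (14,17), (20,10), (21,18), (17,5), (13,1), (7,3), (1,32), (16,7),
      (40,44), (28,30), (22,42), (38,40), (18,28), (23,15), (32,31), (29,24), (24,19), (27,21), (41,48),
      (15,39), (37,36), (33,33)]),
    (5, units [(8,0), (17,45), (20,31), (19,43), (23,48), (18,29), (21,42), (4,1), (3,21), (14,17), (5,4),
      (15,20), (0,10), (13,11), (11,6), (2,2), (10,5), (6,24), (7,15)]),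
    (7, units [(2,0), (0,2), (1,12)])],
   [(1, units [(11,2), (9,1), (4,0)]),
    (3, units [(26,5), (32,13), (9,2), (14,1), (38,12), (23,6), (41,17), (40,21), (47,23), (13,0), (30,10),
      (10,8), (21,18), (19,4), (25,20), (43,19), (39,14), (12,3), (31,11)]),
    (5, ([(2, 1), (3, 1), (9, -1), (27, 2)], 10) # units [(25,6), (8,11), (16,0), (0,18), (34,32), (47,41),
      (32,21), (4,3), (20,13), (5,22), (27,8), (24,14), (2,20), (3,2), (18,4), (22,7), (36,23), (13,1),
      (31,30), (19,12), (23,15), (43,36), (14,27), (30,17), (46,38), (42,29), (26,35)]),
    (7, units [(2,6), (12,12), (13,17), (0,0), (5,8), (11,18), (1,1), (9,9), (7,10), (3,7), (4,3), (14,21)]),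
    (9, units [(0,0)])],
   [(3, units [(21,4), (8,0), (10,5), (19,2), (11,1)]),
    (5, units [(41,17), (37,11), (28,15), (22,6), (6,0), (33,13), (21,5), (31,10), (9,2), (26,4), (19,7),
      (11,1), (17,16), (38,9)]),
    (7, units [(6,8), (13,5), (12,4), (16,13), (5,1), (21,10), (4,0), (3,3), (18,9), (23,17), (20,15)]),
    (9, units [(2,2), (0,0)])],
   [(3, units [(3,0)]),
    (5, units [(11,3), (8,2), (0,0), (7,1)]),
    (7, units [(10,4), (14,5), (2,2), (9,0), (15,1), (11,3)]),
    (9, ([(0, 2), (3, 1), (4, 1), (5, 1)], 0) # units [(1,1), (3,3), (5,2)])],
   []]"

definition rank_certs :: "bool => nat => (int \<times> cert) list" where
  "rank_certs h i = (if i < 7 then (if h then rank_certs_V ! i else rank_certs_H ! i) else [])"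

definition rank_table :: "bool => ((nat \<times> int) \<times> nat) list" where
    "rank_table h = (if h then [((0, -1), 4), ((0, 1), 6), ((0, 3), 4), ((0, 5), 1), ((1, -1), 2), ((1, 1), 11), ((1,
     3), 14), ((1, 5), 5), ((2, -1), 1), ((2, 1), 12), ((2, 3), 28), ((2, 5), 19), ((2, 7), 3), ((3, 1), 3), ((3, 3),
     19), ((3, 5), 28), ((3, 7), 12), ((3, 9), 1), ((4, 3), 5), ((4, 5), 14), ((4, 7), 11), ((4, 9), 2), ((5, 3), 1),
     ((5, 5), 4), ((5, 7), 6), ((5, 9), 4)] else [((0, -3), 1), ((0, -1), 3), ((0, 1), 3), ((0, 3), 1), ((1, -3), 2),
     ((1, -1), 12), ((1, 1), 21), ((1, 3), 14), ((1, 5), 3), ((2, -3), 1), ((2, -1), 12), ((2, 1), 39), ((2, 3), 46),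
     ((2, 5), 21), ((2, 7), 3), ((3, -1), 3), ((3, 1), 21), ((3, 3), 46), ((3, 5), 39), ((3, 7), 12), ((3, 9), 1),
     ((4, 1), 3), ((4, 3), 14), ((4, 5), 21), ((4, 7), 12), ((4, 9), 2), ((5, 3), 1), ((5, 5), 3), ((5, 7), 3), ((5,
     9), 1)])"

definition model_rank :: "bool => nat => int => nat" where
  "model_rank h i j = (case map_of (rank_table h) (i, j) of None => 0 | Some r => r)"

text \<open>For \<open>False\<close> this is the two-component unlink: four classes in homological
  degree 3, the number of negative crossings, and quantum degrees -2, 0, 0, 2 shifted by 3. For
  \<open>True\<close> it is the square knot, whose determinant 9 leads to the ten classes of a thin
  knot, with its symmetry about (3, 4). Crossing 6 is not counted in the homological degree.\<close>

definition model_betti :: "bool => (nat \<times> int) list" where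
  "model_betti h = (if h then [(0, -3), (1, 1), (2, 1), (3, 3), (3, 3), (3, 5), (3, 5), (4, 7), (5, 7), (6, 11)]
     else [(3, 1), (3, 3), (3, 3), (3, 5)])"

definition degs :: "int list" where
  "degs = [-3, -1, 1, 3, 5, 7, 9, 11]"

fun check_ranks :: "bool => nat => (int \<times> cert) list => (int \<times> mcell) list => (int \<times> mcell) list => bool" where
  "check_ranks h i [] P Q = True"
| "check_ranks h i ((j, r) # cs) P Q = (if length r = model_rank h i j then
     if check_rank r (select j P) (select j Q) then check_ranks h i cs P Q else False else False)"

definition check_size :: "bool => nat => int => nat => bool" where
  "check_size h i j n <-> n = model_rank h i j +
     (case i of 0 => 0 | Suc i' => model_rank h i' j) +
     length (filter (\<lambda>x. x = (i, j)) (model_betti h))"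

fun check_sizes :: "bool => nat => int list => (int \<times> mcell) list => bool" where
  "check_sizes h i [] P = True"
| "check_sizes h i (j # js) P = (if check_size h i j (length (select j P)) then check_sizes h i js P else False)"

definition check_degs :: "(int \<times> mcell) list => bool" where
  "check_degs = list_all (\<lambda>c. fst c \<in> set degs)"

definition check_level :: "bool => nat => bool" where
  "check_level h i <-> check_ranks h i (rank_certs h i) (all_cells h i) (all_cells h (Suc i))"

definition check_cells :: "bool => nat => bool" where
  "check_cells h i <-> check_degs (all_cells h i) \<and> check_sizes h i degs (all_cells h i)"

definition check_table :: "bool => bool" where
  "check_table h <-> list_all (\<lambda>((i, j), r). i < 6 \<and> j \<in> set degs \<and> j \<in> set (map fst (rank_certs h i))) (rank_table h)
     \<and> list_all (\<lambda>(i, j). i < 7 \<and> j \<in> set degs) (model_betti h)"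

fun alternating_at :: "bool list => bool list list => nat => (nat \<times> nat \<times> nat \<times> nat) list => bool" where
  "alternating_at us P k [] = True"
| "alternating_at us P k ((a, b, c, d) # cs) = (if us ! k then alternating_at us P (Suc k) cs
     else if (class_of a P ! c) = (class_of a (model_circles (us[k := True])) ! c) then False
     else alternating_at us P (Suc k) cs)"

fun check_alternating :: "bool list list => bool" where
  "check_alternating [] = True"
| "check_alternating (us # L) = (if alternating_at us (model_circles us) 0 (crossings model)
     then check_alternating L else False)"

fun mult_vec :: "nat => mvec => mvec" where
  "mult_vec p [] = []"
| "mult_vec p (((us, as), x) # f) = (if as ! p then mult_vec p f
     else ((us, bor as (class_of p (model_circles us))), x) # mult_vec p f)"

fun pairing :: "mvec => mvec => int" where
  "pairing [] r = 0"
| "pairing ((t, y) # c) r = y * coeff_at t r + pairing c r"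

fun check_cocycle :: "mvec => mcell list => bool" where
  "check_cocycle c [] = True"
| "check_cocycle c (t # L) = (if pairing c (diff_vec [(t, 1)]) = 0 then check_cocycle c L else False)"

fun check_zero :: "mvec => mcell list => bool" where
  "check_zero r [] = True"
| "check_zero r (t # L) = (if coeff_at t r = 0 then check_zero r L else False)"

text \<open>Coefficients refer to positions in the lists of generators; the final digit of a name is
  the quantum degree, except for the vectors beginning with \<open>p\<close>, where it is the
  homological degree. \<open>cycle5\<close> and \<open>cycle3\<close> are cycles of the horizontal
  part, \<open>cocycle3\<close> and \<open>cocycle1\<close> detect their images under X, and
  \<open>vcocycle5\<close> and \<open>vcocycle3\<close> their images under the saddle. The vectors
  beginning with \<open>p\<close> are cycle-cocycle pairs of the vertical part, for the classes at
  (1, 1) and (4, 7).\<close>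

definition cycle5 :: mvec where
  "cycle5 = pick (select 5 (all_cells False 3)) [(3, 1), (4, -1), (14, -1), (16, 1), (18, -1), (20, 1), (22, -1), (24, 1), (26, -1), (54, 1), (55, 1), (56, 1), (60, -1)]"

definition cycle3 :: mvec where
  "cycle3 = pick (select 3 (all_cells False 3)) [(2, 1), (3, -1), (9, 1), (15, -1), (92, -1), (93, 1)]"

definition cocycle3 :: mvec where
  "cocycle3 = pick (select 3 (all_cells False 3)) [(3, 1), (34, -1), (38, 1), (58, 1), (62, -1), (82, -1), (87, 1), (92, -1)]"

definition cocycle1 :: mvec where
  "cocycle1 = pick (select 1 (all_cells False 3)) [(2, -1), (4, 1), (5, -1), (24, 1), (25, -1), (27, -1), (28, -1), (40, -1), (42, 1), (43, 1), (55, 1), (57, -1), (60, 1)]"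

definition vcocycle5 :: mvec where
  "vcocycle5 = pick (select 5 (all_cells True 3)) [(47, 1)]"

definition vcocycle3 :: mvec where
  "vcocycle3 = pick (select 3 (all_cells True 3)) [(46, -1), (48, 1)]"

definition pcycle1 :: mvec where
  "pcycle1 = pick (select 1 (all_cells True 1)) [(15, 1), (16, 1), (17, -1)]"

definition pcocycle1 :: mvec where
  "pcocycle1 = pick (select 1 (all_cells True 1)) [(11, 1), (12, 1), (15, -1)]"

definition pcycle4 :: mvec where
  "pcycle4 = pick (select 7 (all_cells True 4)) [(11, 1), (14, -1)]"

definition pcocycle4 :: mvec where
  "pcocycle4 = pick (select 7 (all_cells True 4)) [(3, 1), (7, -1), (14, 1)]"

subsection \<open>Correctness of the executable model\<close>

definition mask :: "bool list => nat set" where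
  "mask m = {p. p < 16 \<and> m ! p}"

definition state_of :: "bool list => nat set" where
  "state_of us = {k. k < 7 \<and> us ! k}"

definition decode :: "mcell => nat set \<times> nat set" where
  "decode c = (state_of (fst c), mask (snd c))"

lemma length_bor [simp]: "length (bor x y) = min (length x) (length y)"
  by (induction x y rule: bor.induct) auto

lemma nth_bor: "i < length x ==> i < length y ==> bor x y ! i = (x ! i \<or> y ! i)"
  by (induction x y arbitrary: i rule: bor.induct) (auto simp: nth_Cons split: nat.splits)

lemma mask_bor: "length x = 16 ==> length y = 16 ==> mask (bor x y) = mask x \<union> mask y"
  by (auto simp: mask_def nth_bor)

lemma mask_inj: "length x = 16 ==> length y = 16 ==> mask x = mask y ==> x = y"
  by (rule nth_equalityI) (auto simp: mask_def set_eq_iff)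

lemma in_mask: "p < 16 ==> p \<in> mask m <-> m ! p"
  by (simp add: mask_def)

lemma state_of_inj: "length x = 7 ==> length y = 7 ==> state_of x = state_of y ==> x = y"
  by (rule nth_equalityI) (auto simp: state_of_def set_eq_iff)

definition represents :: "bool list list => (nat \<times> nat) set => bool" where
  "represents P R <-> distinct P \<and> (\<forall>m\<in>set P. length m = 16) \<and>
     mask ` set P = (\<lambda>p. {q. (p, q) \<in> eqc R}) ` {..<16}"

lemma represents_class:
  assumes P: "represents P R" and a: "a < 16"
  obtains ma where "ma \<in> set P" "length ma = 16" "mask ma = {q. (a, q) \<in> eqc R}"
    "\<And>m. m \<in> set P ==> m ! a <-> m = ma"
proof -
  have "{q. (a, q) \<in> eqc R} \<in> mask ` set P" using P a by (auto simp: represents_def)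
  then obtain ma where ma: "ma \<in> set P" "mask ma = {q. (a, q) \<in> eqc R}" by auto
  have len: "length m = 16" if "m \<in> set P" for m using P that by (auto simp: represents_def)
  have "m ! a <-> m = ma" if m: "m \<in> set P" for m
  proof
    have "mask m \<in> (\<lambda>p. {q. (p, q) \<in> eqc R}) ` {..<16}" using P m by (auto simp: represents_def)
    then obtain p where p: "mask m = {q. (p, q) \<in> eqc R}" by auto
    assume "m ! a"
    then have "(p, a) \<in> eqc R" using in_mask[OF a, of m] p by auto
    then have "mask m = mask ma" unfolding p ma(2) by (auto intro: eqc_sym eqc_trans)
    then show "m = ma" using len[OF m] len[OF ma(1)] by (rule mask_inj[rotated 2])
  next
    assume "m = ma"
    then show "m ! a" using in_mask[OF a, of ma] ma(2) by simp
  qed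
  then show ?thesis using that ma len[OF ma(1)] by blast
qed

lemma represents_join:
  assumes P: "represents P R" and a: "a < 16" and b: "b < 16"
  shows "represents (join_classes a b P) (insert (a, b) R)"
proof -
  obtain ma where ma: "ma \<in> set P" "length ma = 16" "mask ma = {q. (a, q) \<in> eqc R}"
    "\<And>m. m \<in> set P ==> m ! a <-> m = ma" using represents_class[OF P a] by blast
  obtain mb where mb: "mb \<in> set P" "length mb = 16" "mask mb = {q. (b, q) \<in> eqc R}"
    "\<And>m. m \<in> set P ==> m ! b <-> m = mb" using represents_class[OF P b] by blast
  have dP: "distinct P" and lP: "\<And>m. m \<in> set P ==> length m = 16"
    and mP: "mask ` set P = (\<lambda>p. {q. (p, q) \<in> eqc R}) ` {..<16}"
    using P by (auto simp: represents_def)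
  let ?f = "\<lambda>m. m ! a \<or> m ! b"
  define S where "S = filter ?f P"
  define F where "F = filter (\<lambda>m. \<not> ?f m) P"
  have sS: "set S = {ma, mb}" unfolding S_def using ma mb by auto
  have sF: "set F = set P - {ma, mb}" unfolding F_def using ma mb by auto
  have dS: "distinct S" "distinct F" using dP by (auto simp: S_def F_def)
  have cS: "length S = card {ma, mb}" using distinct_card[OF dS(1)] sS by simp
  define z where "z = (case S of [] => ma | [x] => x | x # y # _ => bor x y)"
  have z: "join_classes a b P = z # F \<and> length z = 16 \<and> mask z = mask ma \<union> mask mb"
  proof (cases "ma = mb")
    case True
    then have "length S = 1" using cS by simp
    then obtain x where x: "S = [x]" by (auto simp: length_Suc_conv)
    then have "x = ma" using sS True by auto
    then show ?thesis using x True ma(2)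
      by (simp add: z_def join_classes_def partition_filter_conv S_def[symmetric] F_def[symmetric] o_def
          del: partition_filter_conv) (simp add: S_def F_def o_def)
  next
    case False
    then have "length S = 2" using cS by simp
    then obtain x y where xy: "S = [x, y]" by (auto simp: length_Suc_conv numeral_2_eq_2)
    then have "x = ma \<and> y = mb \<or> x = mb \<and> y = ma" using sS False by (auto simp: doubleton_eq_iff)
    then have "length z = 16" "mask z = mask ma \<union> mask mb"
      using ma(2) mb(2) by (auto simp: z_def xy mask_bor)
    moreover have "join_classes a b P = z # F"
      using xy by (simp add: z_def join_classes_def S_def F_def o_def)
    ultimately show ?thesis by blast
  qed
  have E: "(p, q) \<in> eqc (insert (a, b) R) <-> (if (a, p) \<in> eqc R \<or> (b, p) \<in> eqc R
      then (a, q) \<in> eqc R \<or> (b, q) \<in> eqc R else (p, q) \<in> eqc R)" for p q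
    unfolding eqc_insert by (smt (verit) eqc_sym eqc_trans eqc_refl)
  have "mask ` set (z # F) = (\<lambda>p. {q. (p, q) \<in> eqc (insert (a, b) R)}) ` {..<16}" (is "?L = ?R")
  proof (intro equalityI subsetI)
    fix M assume "M \<in> ?L"
    then consider "M = mask z" | m where "m \<in> set P" "m \<noteq> ma" "m \<noteq> mb" "M = mask m" using sF by auto
    then show "M \<in> ?R"
    proof cases
      case 1
      then have "M = {q. (a, q) \<in> eqc (insert (a, b) R)}" using z ma(3) mb(3) by (auto simp: E)
      then show ?thesis using a by blast
    next
      case 2
      obtain p where p: "p < 16" "mask m = {q. (p, q) \<in> eqc R}" using mP 2(1) by blast
      have "(p, a) \<notin> eqc R" "(p, b) \<notin> eqc R"
        using p(2) in_mask[OF a, of m] in_mask[OF b, of m] ma(4)[OF 2(1)] mb(4)[OF 2(1)] 2 by auto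
      then have "M = {q. (p, q) \<in> eqc (insert (a, b) R)}"
        using 2 p eqc_sym[of a p R] eqc_sym[of b p R] by (auto simp: E)
      then show ?thesis using p(1) by blast
    qed
  next
    fix M assume "M \<in> ?R"
    then obtain p where p: "p < 16" "M = {q. (p, q) \<in> eqc (insert (a, b) R)}" by auto
    show "M \<in> ?L"
    proof (cases "(a, p) \<in> eqc R \<or> (b, p) \<in> eqc R")
      case True
      then have "M = mask z" using z ma(3) mb(3) p(2) by (auto simp: E)
      then show ?thesis by simp
    next
      case False
      then have M: "M = {q. (p, q) \<in> eqc R}" using p(2) by (auto simp: E)
      then have "M \<in> mask ` set P" using mP p(1) by blast
      then obtain m where m: "m \<in> set P" "M = mask m" by auto
      have "m \<noteq> ma" "m \<noteq> mb" using False m M ma(3) mb(3) by auto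
      then show ?thesis using m sF by auto
    qed
  qed
  moreover have "z \<notin> set F"
  proof
    assume "z \<in> set F"
    then have "z \<in> set P" "z \<noteq> ma" using sF by auto
    then have "\<not> z ! a" using ma(4) by simp
    moreover have "a \<in> mask z" using z ma(3) by simp
    ultimately show False using in_mask[OF a] by simp
  qed
  ultimately show ?thesis
    using z dS(2) lP sF by (auto simp: represents_def)
qed

fun smooth_all :: "bool list => (nat \<times> nat \<times> nat \<times> nat) list => (nat \<times> nat) set => (nat \<times> nat) set" where
  "smooth_all (u # us) (c # cs) R = smooth_all us cs (smoothing_joins u c \<union> R)"
| "smooth_all _ _ R = R"

lemma represents_lookup:
  assumes "represents P R" "length us = length cs"
    "\<forall>(a, b, c, d)\<in>set cs. a < 16 \<and> b < 16 \<and> c < 16 \<and> d < 16"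
  shows "represents (lookup (make_table cs P) us) (smooth_all us cs R)"
  using assms
proof (induction us cs R arbitrary: P rule: smooth_all.induct)
  case (1 u us cr cs R)
  obtain a b c d where c: "cr = (a, b, c, d)" by (cases cr)
  have lt: "a < 16" "b < 16" "c < 16" "d < 16" using 1(4) by (auto simp: c)
  have "represents (if u then join_classes a d (join_classes b c P) else join_classes a b (join_classes c d P))
    (smoothing_joins u cr \<union> R)"
    using 1(2) lt by (cases u) (auto simp: c intro!: represents_join)
  then have "represents (lookup (make_table cs (if u then join_classes a d (join_classes b c P)
    else join_classes a b (join_classes c d P))) us) (smooth_all us cs (smoothing_joins u cr \<union> R))"
    by (rule 1(1)) (use 1(3,4) in auto)
  then show ?case by (cases u) (simp_all add: c)
qed auto

lemma represents_initial: "represents initial_classes {(7, 14), (1, 8)}"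
proof -
  let ?f = "\<lambda>i::nat. map (\<lambda>j. j = i) [0..<16]"
  have m: "mask (?f i) = {i}" if "i < 16" for i
    using that by (auto simp: mask_def)
  have "inj_on ?f (set [0..<16])"
  proof (rule inj_onI)
    fix x y assume "x \<in> set [0..<16]" "y \<in> set [0..<16]" "?f x = ?f y"
    then show "x = y" using m[of x] m[of y] by (metis atLeastLessThan_iff set_upt singleton_inject)
  qed
  then have d: "distinct (map ?f [0..<16])" by (simp add: distinct_map)
  have e: "eqc {} = (Id :: (nat \<times> nat) set)" by (simp add: eqc_def)
  have "mask ` set (map ?f [0..<16]) = (\<lambda>i. mask (?f i)) ` {..<16}"
    by (simp add: image_image atLeast0LessThan)
  also have "\<dots> = (\<lambda>i. {i}) ` {..<16}" using m by auto
  also have "\<dots> = (\<lambda>p. {q. (p, q) \<in> eqc {}}) ` {..<16}" by (auto simp: e)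
  finally have "represents (map ?f [0..<16]) {}" using d by (auto simp: represents_def)
  then show ?thesis unfolding initial_classes_def
    by (intro represents_join) simp_all
qed

lemma length_7_cases:
  assumes "length us = 7"
  obtains u0 u1 u2 u3 u4 u5 u6 where "us = [u0, u1, u2, u3, u4, u5, u6]"
  using assms by (auto simp: numeral_eq_Suc length_Suc_conv)

lemma smooth_all_model:
  assumes "length us = 7"
  shows "smooth_all us (crossings model) {(7, 14), (1, 8)} = joins model (state_of us)"
proof -
  obtain u0 u1 u2 u3 u4 u5 u6 where us: "us = [u0, u1, u2, u3, u4, u5, u6]"
    using length_7_cases[OF assms] .
  have 7: "{..<7::nat} = {0, 1, 2, 3, 4, 5, 6}" by auto
  have st: "0 \<in> state_of us = u0" "1 \<in> state_of us = u1" "2 \<in> state_of us = u2" "3 \<in> state_of us = u3"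
    "4 \<in> state_of us = u4" "5 \<in> state_of us = u5" "6 \<in> state_of us = u6"
    by (simp_all add: state_of_def us)
  have "joins model (state_of us) = {(1, 8), (7, 14)} \<union> (\<Union>k\<in>{0, 1, 2, 3, 4, 5, 6}.
      smoothing_joins (k \<in> state_of us) (crossings model ! k))"
    unfolding joins_def n_crossings_model 7 by (simp add: model_def)
  also have "\<dots> = {(1, 8), (7, 14)} \<union> (smoothing_joins u0 (1,0,2,3) \<union> smoothing_joins u1 (3,2,4,5)
    \<union> smoothing_joins u2 (5,4,6,7) \<union> smoothing_joins u3 (8,10,11,9) \<union> smoothing_joins u4 (10,12,13,11)
    \<union> smoothing_joins u5 (12,14,15,13) \<union> smoothing_joins u6 (0,9,15,6))"
    unfolding UN_insert UN_empty st model_crossing by blast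
  also have "\<dots> = smooth_all us (crossings model) {(7, 14), (1, 8)}"
    unfolding us model_def by (simp add: Un_ac insert_commute del: smoothing_joins.simps)
  finally show ?thesis ..
qed

lemma represents_model:
  assumes "length us = 7"
  shows "represents (model_circles us) (joins model (state_of us))"
  unfolding model_circles_def circle_table_def smooth_all_model[OF assms, symmetric]
  by (rule represents_lookup[OF represents_initial]) (use assms in \<open>auto simp: model_def\<close>)

lemma mask_circles:
  assumes "length us = 7"
  shows "mask ` set (model_circles us) = circles model (state_of us)"
  using represents_model[OF assms]
  by (auto simp: represents_def circles_eq points_model cls_def conn_def image_def)

lemma class_of_eq:
  assumes "length us = 7" "a < 16"
  shows "length (class_of a (model_circles us)) = 16"
    and "mask (class_of a (model_circles us)) = cls model (state_of us) a"
proof -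
  obtain ma where ma: "ma \<in> set (model_circles us)" "length ma = 16"
    "mask ma = {q. (a, q) \<in> eqc (joins model (state_of us))}"
    "\<And>m. m \<in> set (model_circles us) ==> m ! a <-> m = ma"
    using represents_class[OF represents_model[OF assms(1)] assms(2)] by blast
  have "class_of a P = ma" if "ma \<in> set P" "set P \<subseteq> set (model_circles us)" for P
    using that ma(4) by (induction P) auto
  then have "class_of a (model_circles us) = ma" using ma(1) by blast
  then show "length (class_of a (model_circles us)) = 16"
    and "mask (class_of a (model_circles us)) = cls model (state_of us) a"
    using ma by (simp_all add: cls_def conn_def)
qed

text \<open>\<open>Y\<close> is the set of circles chosen to be labelled X, in addition to the
  points already collected in \<open>m0\<close>.\<close>

lemma labels_iff:
  assumes "distinct P" "\<forall>m\<in>set P. length m = 16" "length m0 = 16"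
  shows "(e, m) \<in> set (labels P e0 m0) <-> length m = 16 \<and>
    (\<exists>Y\<subseteq>set P. mask m = mask m0 \<union> \<Union> (mask ` Y) \<and> e = e0 + (\<Sum>z\<in>set P. if z \<in> Y then -1 else 1))"
  using assms
proof (induction P arbitrary: e0 m0)
  case Nil
  then show ?case using mask_inj[of m m0] by auto
next
  case (Cons x P)
  have x: "x \<notin> set P" "length x = 16" and P: "distinct P" "\<forall>m\<in>set P. length m = 16" using Cons.prems by auto
  have l: "length (bor x m0) = 16" using x(2) Cons.prems(3) by simp
  let ?Q = "\<lambda>Y m1 e1. mask m = mask m1 \<union> \<Union> (mask ` Y) \<and> e = e1 + (\<Sum>z\<in>set P. if z \<in> Y then -1 else 1)"
  let ?R = "\<lambda>Y. mask m = mask m0 \<union> \<Union> (mask ` Y) \<and> e = e0 + (\<Sum>z\<in>set (x # P). if z \<in> Y then -1 else 1)"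
  have s: "(\<Sum>z\<in>set (x # P). if z \<in> Y then -1 else 1) = (if x \<in> Y then -1 else 1) + (\<Sum>z\<in>set P. if z \<in> Y then -1 else (1::int))" for Y
    using x(1) by simp
  have s': "(\<Sum>z\<in>set P. if z \<in> insert x Y then -1 else 1) = (\<Sum>z\<in>set P. if z \<in> Y then -1 else (1::int))"
    "(\<Sum>z\<in>set P. if z \<in> Y - {x} then -1 else 1) = (\<Sum>z\<in>set P. if z \<in> Y then -1 else (1::int))" for Y
    using x(1) by (auto intro!: sum.cong)
  have ex: "(\<exists>Y\<subseteq>set (x # P). ?R Y) <-> (\<exists>Y\<subseteq>set P. ?Q Y (bor x m0) (e0 - 1)) \<or> (\<exists>Y\<subseteq>set P. ?Q Y m0 (e0 + 1))"
  proof
    assume "\<exists>Y\<subseteq>set (x # P). ?R Y"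
    then obtain Y where Y: "Y \<subseteq> set (x # P)" "?R Y" by blast
    show "(\<exists>Y\<subseteq>set P. ?Q Y (bor x m0) (e0 - 1)) \<or> (\<exists>Y\<subseteq>set P. ?Q Y m0 (e0 + 1))"
    proof (cases "x \<in> Y")
      case True
      then have "?Q (Y - {x}) (bor x m0) (e0 - 1)"
        using Y(2) unfolding s s' mask_bor[OF x(2) Cons.prems(3)] by auto
      then show ?thesis using Y(1) by (intro disjI1 exI[of _ "Y - {x}"]) auto
    next
      case False
      then have "?Q Y m0 (e0 + 1)" using Y(2) unfolding s by auto
      then show ?thesis using Y(1) False by (intro disjI2 exI[of _ Y]) auto
    qed
  next
    assume "(\<exists>Y\<subseteq>set P. ?Q Y (bor x m0) (e0 - 1)) \<or> (\<exists>Y\<subseteq>set P. ?Q Y m0 (e0 + 1))"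
    then show "\<exists>Y\<subseteq>set (x # P). ?R Y"
    proof (elim disjE exE conjE)
      fix Y assume Y: "Y \<subseteq> set P" "mask m = mask (bor x m0) \<union> \<Union> (mask ` Y)"
        "e = e0 - 1 + (\<Sum>z\<in>set P. if z \<in> Y then -1 else 1)"
      have "?R (insert x Y)" using Y unfolding s s' mask_bor[OF x(2) Cons.prems(3)] by auto
      then show ?thesis using Y(1) by (intro exI[of _ "insert x Y"]) auto
    next
      fix Y assume Y: "Y \<subseteq> set P" "mask m = mask m0 \<union> \<Union> (mask ` Y)"
        "e = e0 + 1 + (\<Sum>z\<in>set P. if z \<in> Y then -1 else 1)"
      have "x \<notin> Y" using Y(1) x(1) by blast
      then have "?R Y" using Y unfolding s by auto
      then show ?thesis using Y(1) by (intro exI[of _ Y]) auto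
    qed
  qed
  have A: "(e, m) \<in> set (labels P (e0 - 1) (bor x m0)) <->
      length m = 16 \<and> (\<exists>Y\<subseteq>set P. ?Q Y (bor x m0) (e0 - 1))"
    by (rule Cons.IH[OF P l])
  have B: "(e, m) \<in> set (labels P (e0 + 1) m0) <-> length m = 16 \<and> (\<exists>Y\<subseteq>set P. ?Q Y m0 (e0 + 1))"
    by (rule Cons.IH[OF P Cons.prems(3)])
  show ?case unfolding labels.simps set_append Un_iff A B ex by blast
qed

lemma state_cells_iff:
  assumes us: "length us = 7"
  shows "(e, c) \<in> set (state_cells us w) <-> fst c = us \<and> length (snd c) = 16 \<and>
    saturated model (state_of us) (mask (snd c)) \<and>
    e = w + (\<Sum>C\<in>circles model (state_of us). if C \<subseteq> mask (snd c) then -1 else 1)"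
proof -
  let ?P = "model_circles us" and ?v = "state_of us"
  obtain vs m where c: "c = (vs, m)" by (cases c)
  have P: "distinct ?P" "\<forall>m\<in>set ?P. length m = 16"
    using represents_model[OF us] by (auto simp: represents_def)
  have inj: "inj_on mask (set ?P)" using P(2) by (auto intro!: inj_onI mask_inj)
  have m0: "mask (replicate 16 False) = {}" by (auto simp: mask_def)
  have circ: "mask x \<in> circles model ?v" if "x \<in> set ?P" for x using mask_circles[OF us] that by blast
  have L: "(e, m) \<in> set (labels ?P w (replicate 16 False)) <-> length m = 16 \<and>
    (\<exists>Y\<subseteq>set ?P. mask m = \<Union> (mask ` Y) \<and> e = w + (\<Sum>z\<in>set ?P. if z \<in> Y then -1 else 1))"
    using labels_iff[OF P, of "replicate 16 False" e m w] by (simp add: m0)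
  have sum: "(\<Sum>C\<in>circles model ?v. if C \<subseteq> A then -1 else 1) = (\<Sum>z\<in>set ?P. if mask z \<subseteq> A then -1 else (1::int))" for A
    unfolding mask_circles[OF us, symmetric] by (rule sum.reindex_cong[OF inj]) auto
  have "(\<exists>Y\<subseteq>set ?P. mask m = \<Union> (mask ` Y) \<and> e = w + (\<Sum>z\<in>set ?P. if z \<in> Y then -1 else 1))
    <-> saturated model ?v (mask m) \<and> e = w + (\<Sum>C\<in>circles model ?v. if C \<subseteq> mask m then -1 else 1)"
    (is "?L <-> ?R")
  proof
    assume ?L
    then obtain Y where Y: "Y \<subseteq> set ?P" "mask m = \<Union> (mask ` Y)"
      "e = w + (\<Sum>z\<in>set ?P. if z \<in> Y then -1 else 1)" by blast
    have sat: "saturated model ?v (mask z)" if "z \<in> set ?P" for z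
      using circ[OF that] saturated_cls by (auto simp: circles_eq)
    have "saturated model ?v (mask m)"
      unfolding Y(2) saturated_def
    proof (intro conjI allI impI)
      show "\<Union> (mask ` Y) \<subseteq> points model"
      proof (rule UN_least)
        fix z assume "z \<in> Y"
        then show "mask z \<subseteq> points model" using Y(1) by (intro saturated_subset[OF sat]) auto
      qed
      fix p q assume "(p, q) \<in> conn model ?v" "p \<in> \<Union> (mask ` Y)"
      then show "q \<in> \<Union> (mask ` Y)" using sat Y(1) saturatedD by fastforce
    qed
    moreover have "mask z \<subseteq> mask m <-> z \<in> Y" if z: "z \<in> set ?P" for z
    proof
      assume sub: "mask z \<subseteq> mask m"
      obtain p where p: "mask z = cls model ?v p" using circ[OF z] by (auto simp: circles_eq)
      then have "p \<in> mask m" using sub cls_self[of p model ?v] by auto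
      then obtain y where y: "y \<in> Y" "p \<in> mask y" using Y(2) by blast
      obtain p' where p': "mask y = cls model ?v p'" using circ[of y] y(1) Y(1) by (auto simp: circles_eq)
      then have "mask y = mask z" using y(2) p cls_eq_iff in_cls by metis
      then have "y = z" using inj y(1) Y(1) z by (auto dest: inj_onD)
      then show "z \<in> Y" using y by simp
    qed (use Y(2) in blast)
    ultimately show ?R unfolding sum Y(3) by simp
  next
    assume R: ?R
    define Y where "Y = {z \<in> set ?P. mask z \<subseteq> mask m}"
    have "mask m \<subseteq> \<Union> (mask ` Y)"
    proof
      fix p assume p: "p \<in> mask m"
      then have "p \<in> points model" using R saturated_subset[of model ?v "mask m"] by auto
      then have "cls model ?v p \<in> mask ` set ?P" unfolding mask_circles[OF us] by (auto simp: circles_eq)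
      then obtain x where x: "x \<in> set ?P" "mask x = cls model ?v p" by (metis imageE)
      have "cls model ?v p \<subseteq> mask m" using R p saturated_cls_subset[of model ?v "mask m" p] by simp
      then have "x \<in> Y" using x by (simp add: Y_def)
      moreover have "p \<in> mask x" unfolding x(2) by simp
      ultimately show "p \<in> \<Union> (mask ` Y)" by blast
    qed
    then have "mask m = \<Union> (mask ` Y)" by (auto simp: Y_def)
    moreover have "e = w + (\<Sum>z\<in>set ?P. if z \<in> Y then -1 else 1)"
      using R unfolding sum by (auto simp: Y_def intro!: sum.cong)
    ultimately show ?L by (intro exI[of _ Y]) (auto simp: Y_def)
  qed
  then show ?thesis using L by (auto simp: state_cells_def c)
qed

lemma set_states: "set (states n i) = {us. length us = n \<and> length (filter id us) = i}"
proof (induction n i rule: states.induct)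
  case (2 n i)
  show ?case
  proof (intro set_eqI)
    fix us show "us \<in> set (states (Suc n) i) <-> us \<in> {us. length us = Suc n \<and> length (filter id us) = i}"
    proof (cases us)
      case Nil
      then show ?thesis by (cases i) auto
    next
      case (Cons u vs)
      then show ?thesis using 2 by (cases u; cases i) (simp_all add: image_iff id_def)
    qed
  qed
qed auto

lemma card_state_of: "length us = 7 ==> card (state_of us) = length (filter id us)"
  by (simp add: length_filter_conv_card state_of_def)

lemma all_cells_iff:
  "(e, c) \<in> set (all_cells h i) <-> length (fst c) = 7 \<and> length (snd c) = 16 \<and> fst c ! 6 = h \<and>
     card (state_of (fst c)) = i + of_bool h \<and> decode c \<in> cells model \<and> e = qdeg model (decode c)"
proof -
  have "(e, c) \<in> set (all_cells h i) <-> (\<exists>u. length u = 6 \<and> length (filter id u) = i \<and>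
     (e, c) \<in> set (state_cells (u @ [h]) (int i + of_bool h)))"
    by (auto simp: all_cells_def set_states)
  also have "\<dots> <-> (\<exists>u. length u = 6 \<and> length (filter id u) = i \<and> fst c = u @ [h] \<and> length (snd c) = 16 \<and>
    saturated model (state_of (fst c)) (mask (snd c)) \<and>
    e = int i + of_bool h + (\<Sum>C\<in>circles model (state_of (fst c)). if C \<subseteq> mask (snd c) then -1 else 1))"
    using state_cells_iff by (auto cong: conj_cong)
  also have "\<dots> <-> length (fst c) = 7 \<and> length (snd c) = 16 \<and> fst c ! 6 = h \<and>
     card (state_of (fst c)) = i + of_bool h \<and> decode c \<in> cells model \<and> e = qdeg model (decode c)"
    (is "?L <-> ?R")
  proof
    assume ?L
    then obtain u where u: "length u = 6" "length (filter id u) = i" "fst c = u @ [h]" "length (snd c) = 16"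
      "saturated model (state_of (fst c)) (mask (snd c))"
      "e = int i + of_bool h + (\<Sum>C\<in>circles model (state_of (fst c)). if C \<subseteq> mask (snd c) then -1 else 1)" by blast
    then show ?R
      using card_state_of[of "fst c"] by (auto simp: cells_def decode_def qdeg_def n_crossings_model state_of_def nth_append)
  next
    assume R: ?R
    then obtain u0 u1 u2 u3 u4 u5 u6 where us: "fst c = [u0, u1, u2, u3, u4, u5, u6]"
      using length_7_cases by blast
    let ?u = "[u0, u1, u2, u3, u4, u5]"
    have f: "fst c = ?u @ [h]" using R us by simp
    have "length (filter id (fst c)) = i + of_bool h" using R card_state_of[of "fst c"] by simp
    then have "length (filter id ?u) = i" unfolding f filter_append by (cases h) simp_all
    moreover have "e = int i + of_bool h + (\<Sum>C\<in>circles model (state_of (fst c)). if C \<subseteq> mask (snd c) then -1 else 1)"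
      using R by (auto simp: qdeg_def decode_def)
    moreover have "saturated model (state_of (fst c)) (mask (snd c))"
      using R by (simp add: cells_def decode_def)
    ultimately show ?L using f R by (intro exI[of _ ?u]) simp
  qed
  finally show ?thesis .
qed

text \<open>The degree shift lets \<open>i\<close> count only the crossings of the first two
  columns, so that both parts are indexed alike.\<close>

definition model_part :: "bool => int => int => (nat set \<times> nat set) set" where
  "model_part h j i = {s \<in> gcells model j (i + of_bool h). 6 \<in> fst s <-> h}"

lemma select_iff: "c \<in> set (select j (all_cells h i)) <-> length (fst c) = 7 \<and> length (snd c) = 16 \<and>
   decode c \<in> model_part h j (int i)"
proof -
  have "c \<in> set (select j L) <-> (j, c) \<in> set L" for L
    by (induction j L rule: select.induct) auto
  then have "c \<in> set (select j (all_cells h i)) <-> (j, c) \<in> set (all_cells h i)" .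
  also have "\<dots> <-> length (fst c) = 7 \<and> length (snd c) = 16 \<and> decode c \<in> model_part h j (int i)"
    unfolding all_cells_iff by (auto simp: model_part_def gcells_def decode_def state_of_def)
  finally show ?thesis .
qed

lemma decode_inj: "inj_on decode {c. length (fst c) = 7 \<and> length (snd c) = 16}"
proof (rule inj_onI)
  fix c c' assume c: "c \<in> {c. length (fst c) = 7 \<and> length (snd c) = 16}"
    "c' \<in> {c. length (fst c) = 7 \<and> length (snd c) = 16}" "decode c = decode c'"
  then have "fst c = fst c'" by (intro state_of_inj) (simp_all add: decode_def)
  moreover have "snd c = snd c'" using c by (intro mask_inj) (simp_all add: decode_def)
  ultimately show "c = c'" by (rule prod_eqI)
qed

lemma decode_surj:
  assumes "s \<in> cells model"
  obtains c where "length (fst c) = 7" "length (snd c) = 16" "decode c = s"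
proof -
  obtain v A where s: "s = (v, A)" by (cases s)
  have v: "v \<subseteq> {..<7}" "A \<subseteq> {..<16}"
    using assms saturated_subset[of model v A] by (auto simp: s cells_def n_crossings_model points_model)
  let ?c = "(map (\<lambda>k. k \<in> v) [0..<7], map (\<lambda>p. p \<in> A) [0..<16])"
  have "decode ?c = s" using v by (auto simp: decode_def state_of_def mask_def s)
  then show ?thesis by (intro that[of ?c]) simp_all
qed

lemma select_image: "decode ` set (select j (all_cells h i)) = model_part h j (int i)"
proof (intro equalityI subsetI)
  fix s assume s: "s \<in> model_part h j (int i)"
  then have "s \<in> cells model" by (simp add: model_part_def gcells_def)
  then obtain c where "length (fst c) = 7" "length (snd c) = 16" "decode c = s" by (rule decode_surj)
  then show "s \<in> decode ` set (select j (all_cells h i))" using s select_iff by blast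
qed (auto simp: select_iff)

lemma finite_model_part: "finite (model_part h j i)"
  by (rule finite_subset[OF _ finite_gcells[of model j "i + of_bool h"]]) (auto simp: model_part_def)

text \<open>The circles are nonempty and pairwise disjoint, so the circles labelled X can be
  recovered from the mask. Distinctness turns lengths of lists into cardinalities.\<close>

lemma distinct_labels:
  assumes "\<forall>m\<in>set P. length m = 16 \<and> mask m \<noteq> {} \<and> mask m \<inter> mask m0 = {}" "length m0 = 16"
    and "pairwise (\<lambda>x y. mask x \<inter> mask y = {}) (set P)" "distinct P"
  shows "distinct (labels P e0 m0)"
  using assms
proof (induction P arbitrary: e0 m0)
  case (Cons x P)
  have x: "x \<notin> set P" "length x = 16" "mask x \<noteq> {}" "mask x \<inter> mask m0 = {}"
    and P: "distinct P" "\<forall>m\<in>set P. length m = 16" "pairwise (\<lambda>x y. mask x \<inter> mask y = {}) (set P)"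
    using Cons.prems by (auto simp: pairwise_insert)
  have l: "length (bor x m0) = 16" using x(2) Cons.prems(2) by simp
  have xP: "mask y \<inter> mask x = {}" if "y \<in> set P" for y
    using Cons.prems(3) that x(1) by (auto simp: pairwise_def)
  have "(e, m) \<notin> set (labels P (e0 + 1) m0)" if "(e, m) \<in> set (labels P (e0 - 1) (bor x m0))" for e m
  proof
    assume "(e, m) \<in> set (labels P (e0 + 1) m0)"
    then obtain Y where "Y \<subseteq> set P" "mask m = mask m0 \<union> \<Union> (mask ` Y)"
      unfolding labels_iff[OF P(1,2) Cons.prems(2)] by blast
    then have "mask m \<inter> mask x = {}" using xP x(4) by blast
    moreover have "mask x \<subseteq> mask m"
      using that unfolding labels_iff[OF P(1,2) l] mask_bor[OF x(2) Cons.prems(2)] by blast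
    ultimately show False using x(3) by blast
  qed
  moreover have "distinct (labels P (e0 - 1) (bor x m0))"
    by (rule Cons.IH) (use Cons.prems P l xP mask_bor[OF x(2) Cons.prems(2)] in auto)
  moreover have "distinct (labels P (e0 + 1) m0)"
    by (rule Cons.IH) (use Cons.prems P in auto)
  ultimately show ?case by (auto simp: disjoint_iff)
qed simp

lemma distinct_state_cells:
  assumes us: "length us = 7"
  shows "distinct (state_cells us w)"
proof -
  let ?P = "model_circles us" and ?v = "state_of us"
  have P: "distinct ?P" "\<forall>m\<in>set ?P. length m = 16"
    using represents_model[OF us] by (auto simp: represents_def)
  have c: "\<exists>p. mask m = cls model ?v p" if "m \<in> set ?P" for m
  proof -
    have "mask m \<in> circles model ?v" using mask_circles[OF us] that by blast
    then show ?thesis by (auto simp: circles_eq)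
  qed
  have "distinct (labels ?P w (replicate 16 False))"
  proof (rule distinct_labels)
    show "\<forall>m\<in>set ?P. length m = 16 \<and> mask m \<noteq> {} \<and> mask m \<inter> mask (replicate 16 False) = {}"
    proof
      fix m assume m: "m \<in> set ?P"
      obtain p where "mask m = cls model ?v p" using c[OF m] by blast
      then have "p \<in> mask m" by simp
      moreover have "mask (replicate 16 False) = {}" by (auto simp: mask_def)
      ultimately show "length m = 16 \<and> mask m \<noteq> {} \<and> mask m \<inter> mask (replicate 16 False) = {}"
        using P(2) m by auto
    qed
    show "pairwise (\<lambda>x y. mask x \<inter> mask y = {}) (set ?P)"
    proof (rule pairwiseI)
      fix x y assume xy: "x \<in> set ?P" "y \<in> set ?P" "x \<noteq> y"
      then have "mask x \<noteq> mask y" using P(2) mask_inj by blast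
      then show "mask x \<inter> mask y = {}" using c[OF xy(1)] c[OF xy(2)] cls_disjoint by metis
    qed
  qed (use P in auto)
  moreover have "inj_on (\<lambda>(e, as). (e, us, as)) (set L)" for L :: "(int \<times> bool list) list"
    by (auto simp: inj_on_def)
  ultimately show ?thesis unfolding state_cells_def by (simp add: distinct_map)
qed

lemma distinct_states: "distinct (states n i)"
  by (induction n i rule: states.induct) (auto simp: distinct_map split: nat.splits)

lemma distinct_all_cells: "distinct (all_cells h i)"
proof -
  let ?f = "\<lambda>u. state_cells (u @ [h]) (int i + (if h then 1 else 0))"
  have len: "length (u @ [h]) = 7" if "u \<in> set (states 6 i)" for u using that by (simp add: set_states)
  have sub: "fst (snd c) = u @ [h]" if "u \<in> set (states 6 i)" "c \<in> set (?f u)" for u c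
    using that state_cells_iff[OF len[OF that(1)], of "fst c" "snd c"] by simp
  have ne: "?f u \<noteq> []" if "u \<in> set (states 6 i)" for u
  proof -
    have "labels P e m \<noteq> []" for P e m by (induction P e m rule: labels.induct) auto
    then show ?thesis by (simp add: state_cells_def)
  qed
  have "inj_on ?f (set (states 6 i))"
  proof (rule inj_onI)
    fix u u' assume u: "u \<in> set (states 6 i)" "u' \<in> set (states 6 i)" "?f u = ?f u'"
    obtain c where c: "c \<in> set (?f u)" using ne[OF u(1)] by (cases "?f u") auto
    then have "c \<in> set (?f u')" using u(3) by (simp only:)
    then have "u @ [h] = u' @ [h]" using sub[OF u(1) c] sub[OF u(2)] by metis
    then show "u = u'" by simp
  qed
  then have "distinct (map ?f (states 6 i))" by (simp add: distinct_map distinct_states)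
  moreover have "distinct L" if "L \<in> set (map ?f (states 6 i))" for L
    using that distinct_state_cells len by auto
  moreover have "set L \<inter> set L' = {}" if L: "L \<in> set (map ?f (states 6 i))" "L' \<in> set (map ?f (states 6 i))" "L \<noteq> L'" for L L'
  proof -
    obtain u u' where u: "u \<in> set (states 6 i)" "L = ?f u" "u' \<in> set (states 6 i)" "L' = ?f u'"
      using L(1,2) by auto
    show ?thesis
    proof (rule ccontr)
      assume "set L \<inter> set L' \<noteq> {}"
      then obtain c where c: "c \<in> set (?f u)" "c \<in> set (?f u')" using u by auto
      have "u @ [h] = u' @ [h]" using sub[OF u(1) c(1)] sub[OF u(3) c(2)] by metis
      then have "u = u'" by simp
      then show False using L(3) u by simp
    qed
  qed
  ultimately show ?thesis unfolding all_cells_def by (rule distinct_concat)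
qed

lemma distinct_select: "distinct L ==> distinct (select j L)"
proof (induction j L rule: select.induct)
  case (2 j e c L)
  have "c' \<in> set (select j L) <-> (j, c') \<in> set L" for c'
    by (induction j L rule: select.induct) auto
  then show ?case using 2 by auto
qed simp

lemma card_model_part: "card (model_part h j (int i)) = length (select j (all_cells h i))"
proof -
  have "inj_on decode (set (select j (all_cells h i)))"
    by (rule inj_on_subset[OF decode_inj]) (auto simp: select_iff)
  then show ?thesis
    unfolding select_image[symmetric]
    by (simp add: card_image distinct_card distinct_select distinct_all_cells)
qed

text \<open>The relation solved for its target, in the form computed by
  \<open>crossing_targets\<close>.\<close>

lemma edge_merge_iff:
  assumes k: "k < n_crossings D" "crossings D ! k = (a, b, c, d)" "k \<notin> v"
    and m: "(a, c) \<notin> conn D v" "(a, c) \<in> conn D (insert k v)"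
    and sat: "saturated D v A" "saturated D (insert k v) A'"
  shows "edge D v k A A' <-> \<not> (a \<in> A \<and> c \<in> A) \<and>
    A' = (if a \<in> A \<or> c \<in> A then A \<union> cls D v a \<union> cls D v c else A)"
proof -
  let ?w = "insert k v"
  have A: "x \<in> A <-> y \<in> A" if "(x, y) \<in> conn D v" for x y using saturatedD[OF sat(1) that] .
  have A': "x \<in> A' <-> y \<in> A'" if "(x, y) \<in> conn D ?w" for x y using saturatedD[OF sat(2) that] .
  have near: "(x, a) \<in> conn D ?w" if "(x, a) \<in> conn D v \<or> (x, c) \<in> conn D v" for x
    using that conn_merge[OF k m(2), of x a] by auto
  have near': "x \<in> A' <-> a \<in> A'" if "(x, a) \<in> conn D v \<or> (x, c) \<in> conn D v" for x
    using A'[OF near[OF that]] .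
  have out: "x \<notin> A \<and> x \<notin> A' \<and> (x, a) \<notin> conn D v \<and> (x, c) \<notin> conn D v" if "x \<notin> points D" for x
    using that saturated_subset[OF sat(1)] saturated_subset[OF sat(2)] crossing_points[OF k(1,2)]
      conn_points[of x a D v] conn_points[of x c D v] by auto
  have cl: "x \<in> cls D v y <-> (x, y) \<in> conn D v" for x y by (auto simp: cls_def intro: conn_sym)
  have self: "(a, a) \<in> conn D v" "(c, c) \<in> conn D v" by simp_all
  show ?thesis
  proof
    assume e: "edge D v k A A'"
    then have e1: "x \<in> A' <-> x \<in> A" if "(x, a) \<notin> conn D v" "(x, c) \<notin> conn D v" for x
      using out[of x] that by (cases "x \<in> points D") (auto simp: edge_def k(2))
    have e2: "\<not> (a \<in> A \<and> c \<in> A)" "a \<in> A' <-> a \<in> A \<or> c \<in> A"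
      using e m by (auto simp: edge_def k(2) merge_rel_def)
    have "x \<in> A' <-> x \<in> (if a \<in> A \<or> c \<in> A then A \<union> cls D v a \<union> cls D v c else A)" for x
      using e1[of x] e2 near'[of x] A[of x a] A[of x c] by (auto simp: cl)
    then show "\<not> (a \<in> A \<and> c \<in> A) \<and> A' = (if a \<in> A \<or> c \<in> A then A \<union> cls D v a \<union> cls D v c else A)"
      using e2(1) by blast
  next
    assume r: "\<not> (a \<in> A \<and> c \<in> A) \<and> A' = (if a \<in> A \<or> c \<in> A then A \<union> cls D v a \<union> cls D v c else A)"
    then show "edge D v k A A'"
      using m by (auto simp: edge_def k(2) merge_rel_def cl)
  qed
qed

lemma edge_split_iff:
  assumes k: "k < n_crossings D" "crossings D ! k = (a, b, c, d)" "k \<notin> v"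
    and m: "(a, c) \<in> conn D v" "(a, c) \<notin> conn D (insert k v)"
    and sat: "saturated D v A" "saturated D (insert k v) A'"
  shows "edge D v k A A' <-> (if a \<in> A then A' = A
    else A' = A \<union> cls D (insert k v) a \<or> A' = A \<union> cls D (insert k v) c)"
proof -
  let ?w = "insert k v"
  have A: "x \<in> A <-> y \<in> A" if "(x, y) \<in> conn D v" for x y using saturatedD[OF sat(1) that] .
  have A': "x \<in> A' <-> y \<in> A'" if "(x, y) \<in> conn D ?w" for x y using saturatedD[OF sat(2) that] .
  have near: "(x, a) \<in> conn D v <-> (x, a) \<in> conn D ?w \<or> (x, c) \<in> conn D ?w" for x
    using conn_split[OF k m(1), of x a] by auto
  have cv: "(x, c) \<in> conn D v <-> (x, a) \<in> conn D v" for x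
    using m(1) conn_sym conn_trans by metis
  have ex: "\<not> ((x, a) \<in> conn D ?w \<and> (x, c) \<in> conn D ?w)" for x
    using m(2) conn_sym conn_trans by metis
  have out: "x \<notin> A \<and> x \<notin> A' \<and> (x, a) \<notin> conn D v" if "x \<notin> points D" for x
    using that saturated_subset[OF sat(1)] saturated_subset[OF sat(2)] crossing_points[OF k(1,2)]
      conn_points[of x a D v] conn_points[of x c D v] by auto
  have cl: "x \<in> cls D ?w y <-> (x, y) \<in> conn D ?w" for x y by (auto simp: cls_def intro: conn_sym)
  have ca: "(c, a) \<notin> conn D ?w" using m(2) conn_sym by metis
  have cA: "c \<in> A <-> a \<in> A" using A[OF m(1)] by simp
  show ?thesis
  proof
    assume e: "edge D v k A A'"
    then have e1: "x \<in> A' <-> x \<in> A" if "(x, a) \<notin> conn D v" for x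
      using out[of x] that by (cases "x \<in> points D") (auto simp: edge_def k(2) cv)
    have e2: "split_rel (a \<in> A) (a \<in> A') (c \<in> A')"
      using e m by (auto simp: edge_def k(2))
    have step: "x \<in> A' <-> (if (x, a) \<in> conn D ?w then a \<in> A' else if (x, c) \<in> conn D ?w then c \<in> A' else x \<in> A)" for x
      using e1[of x] near[of x] A'[of x a] A'[of x c] by auto
    have Ax: "x \<in> A <-> a \<in> A" if "(x, a) \<in> conn D ?w \<or> (x, c) \<in> conn D ?w" for x
      using A[of x a] near[of x] that by blast
    show "if a \<in> A then A' = A else A' = A \<union> cls D ?w a \<or> A' = A \<union> cls D ?w c"
    proof (cases "a \<in> A")
      case True
      then have "x \<in> A' <-> x \<in> A" for x
        using e2 step[of x] Ax[of x] by (auto simp: split_rel_def)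
      then show ?thesis using True by auto
    next
      case False
      then consider "a \<in> A'" "c \<notin> A'" | "c \<in> A'" "a \<notin> A'" using e2 by (auto simp: split_rel_def)
      then show ?thesis
      proof cases
        case 1
        then have "x \<in> A' <-> x \<in> A \<union> cls D ?w a" for x
          using step[of x] Ax[of x] False by (auto simp: cl)
        then show ?thesis using False by auto
      next
        case 2
        then have "x \<in> A' <-> x \<in> A \<union> cls D ?w c" for x
          using step[of x] Ax[of x] False ex[of x] by (auto simp: cl)
        then show ?thesis using False by auto
      qed
    qed
  next
    assume r: "if a \<in> A then A' = A else A' = A \<union> cls D ?w a \<or> A' = A \<union> cls D ?w c"
    have off: "(x \<in> A') = (x \<in> A)" if "(x, a) \<notin> conn D v" for x
      using r near[of x] that by (auto simp: cl split: if_splits)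
    have "split_rel (a \<in> A) (a \<in> A') (c \<in> A')"
      using r m(2) ca cA by (auto simp: cl split_rel_def split: if_splits)
    then show "edge D v k A A'"
      using m off by (auto simp: edge_def k(2))
  qed
qed

lemma crossing_targets_iff:
  assumes us: "length us = 7" and k: "k < 7" "\<not> us ! k" and cr: "crossings model ! k = (a, b, c, d)"
    and as: "length as = 16" "saturated model (state_of us) (mask as)"
    and as': "length as' = 16" "saturated model (insert k (state_of us)) (mask as')"
    and alt: "(a, c) \<in> conn model (state_of us) <-> (a, c) \<notin> conn model (insert k (state_of us))"
  defines "L \<equiv> crossing_targets (us[k := True]) (model_circles us) as a c (class_of a (model_circles us))"
  shows "as' \<in> set L <-> edge model (state_of us) k (mask as) (mask as')" "distinct L"
proof -
  let ?v = "state_of us" and ?w = "us[k := True]"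
  have kn: "k < n_crossings model" "k \<notin> ?v" using k by (auto simp: n_crossings_model state_of_def)
  have w: "state_of ?w = insert k ?v" "length ?w = 7"
    using us k by (auto simp: state_of_def nth_list_update)
  have "a \<in> points model" "c \<in> points model" using crossing_points[OF kn(1) cr] by auto
  then have ac: "a < 16" "c < 16" by (auto simp: points_model)
  let ?Ca = "class_of a (model_circles us)" and ?Cc = "class_of c (model_circles us)"
    and ?Da = "class_of a (model_circles ?w)" and ?Dc = "class_of c (model_circles ?w)"
  have l: "length ?Ca = 16" "length ?Cc = 16" "length ?Da = 16" "length ?Dc = 16"
    using class_of_eq(1)[OF us] class_of_eq(1)[OF w(2)] ac by auto
  have m: "mask ?Ca = cls model ?v a" "mask ?Cc = cls model ?v c"
    "mask ?Da = cls model (insert k ?v) a" "mask ?Dc = cls model (insert k ?v) c"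
    using class_of_eq(2)[OF us] class_of_eq(2)[OF w(2)] ac w(1) by auto
  have eq: "as' = x <-> mask as' = mask x" if "length x = 16" for x
    using that as'(1) mask_inj by blast
  have Aa: "as ! a <-> a \<in> mask as" "as ! c <-> c \<in> mask as" using in_mask ac by auto
  have Cac: "?Ca ! c <-> (a, c) \<in> conn model ?v"
    using in_mask[OF ac(2), of ?Ca] m(1) by (simp add: in_cls)
  show "as' \<in> set L <-> edge model ?v k (mask as) (mask as')"
  proof (cases "(a, c) \<in> conn model ?v")
    case True
    then have n: "(a, c) \<notin> conn model (insert k ?v)" using alt by simp
    show ?thesis
      unfolding edge_split_iff[OF kn(1) cr kn(2) True n as(2) as'(2)] L_def
      using True by (simp add: crossing_targets_def split_targets_def Cac Aa eq as(1) l mask_bor m)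
  next
    case False
    then have n: "(a, c) \<in> conn model (insert k ?v)" using alt by simp
    show ?thesis
      unfolding edge_merge_iff[OF kn(1) cr kn(2) False n as(2) as'(2)] L_def
      using False by (simp add: crossing_targets_def Cac Aa eq as(1) l mask_bor m Un_assoc)
  qed
  have "bor as ?Da \<noteq> bor as ?Dc" if "(a, c) \<in> conn model ?v" "a \<notin> mask as"
  proof
    assume "bor as ?Da = bor as ?Dc"
    then have "mask as \<union> mask ?Da = mask as \<union> mask ?Dc"
      using mask_bor[OF as(1) l(3)] mask_bor[OF as(1) l(4)] by simp
    moreover have "a \<in> mask ?Da" unfolding m by simp
    ultimately have "(c, a) \<in> conn model (insert k ?v)" using that(2) unfolding m by (auto simp: in_cls)
    then show False using that(1) alt conn_sym by metis
  qed
  then show "distinct L"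
    by (simp add: L_def crossing_targets_def split_targets_def Cac Aa)
qed

lemma coeff_at_append: "coeff_at q (L @ L') = coeff_at q L + coeff_at q L'"
  by (induction L rule: coeff_at.induct) auto

lemma coeff_at_attach:
  "distinct L ==> coeff_at (us', as') (attach us x L) = (if us' = us \<and> as' \<in> set L then x else 0)"
  by (induction us x L rule: attach.induct) auto

lemma state_sign_eq: "k \<le> length us ==> state_sign us k = (-1) ^ length (filter id (take k us))"
  by (induction us k rule: state_sign.induct) auto

lemma state_sign_edge_sign:
  assumes "length us = 7" "k < 7"
  shows "of_int (state_sign us k) = edge_sign (state_of us) k"
proof -
  have "length (filter id (take k us)) = card {j. j < length (take k us) \<and> take k us ! j}"
    by (simp add: length_filter_conv_card)
  also have "{j. j < length (take k us) \<and> take k us ! j} = {j \<in> state_of us. j < k}"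
    using assms by (auto simp: state_of_def)
  finally show ?thesis using assms by (simp add: state_sign_eq edge_sign_def id_def)
qed

definition valid_cell :: "mcell => bool" where
  "valid_cell c <-> length (fst c) = 7 \<and> length (snd c) = 16 \<and> decode c \<in> cells model"

lemma edge_targets_coeff:
  assumes alt: "alternating model" and c: "valid_cell (us, as)" and q: "valid_cell q"
    and k: "k < 7" and cr: "crossings model ! k = (a, b, c', d)"
  shows "of_int (coeff_at q (edge_targets us as (model_circles us) k a c' x)) =
    (if k \<notin> state_of us \<and> state_of (fst q) = insert k (state_of us) \<and>
        edge model (state_of us) k (mask as) (mask (snd q)) then of_int x * edge_sign (state_of us) k else 0)"
proof (cases "us ! k")
  case True
  then show ?thesis using k by (simp add: edge_targets_def state_of_def)
next
  case False
  let ?v = "state_of us"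
  obtain us' as' where q': "q = (us', as')" by (cases q)
  have us: "length us = 7" and as: "length as = 16" "saturated model ?v (mask as)"
    and us': "length us' = 7" and as': "length as' = 16" "saturated model (state_of us') (mask as')"
    and v: "?v \<subseteq> {..<n_crossings model}"
    using c q by (auto simp: valid_cell_def cells_def decode_def q')
  have kv: "k \<notin> ?v" using False k by (simp add: state_of_def)
  have w: "us' = us[k := True] <-> state_of us' = insert k ?v"
  proof -
    have "state_of (us[k := True]) = insert k ?v"
      using us k by (auto simp: state_of_def nth_list_update)
    then show ?thesis using state_of_inj[OF us', of "us[k := True]"] us by auto
  qed
  have a: "(a, c') \<in> conn model ?v <-> (a, c') \<notin> conn model (insert k ?v)"
    by (rule alternatingD[OF alt v _ kv cr]) (use k in \<open>simp add: n_crossings_model\<close>)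
  show ?thesis
  proof (cases "us' = us[k := True]")
    case eq: True
    then have "saturated model (insert k ?v) (mask as')" using w as'(2) by simp
    note ct = crossing_targets_iff[OF us k False cr as as'(1) this a]
    show ?thesis
      using False eq w kv ct(1) coeff_at_attach[OF ct(2)] state_sign_edge_sign[OF us k]
      by (auto simp: edge_targets_def q')
  next
    case neq: False
    have "coeff_at (us', as') (attach us'' x L) = 0" if "us' \<noteq> us''" for us'' x L
      using that by (induction us'' x L rule: attach.induct) auto
    then show ?thesis using False neq w by (auto simp: edge_targets_def q')
  qed
qed

lemma all_targets_coeff:
  assumes alt: "alternating model" and c: "valid_cell (us, as)" and q: "valid_cell q"
    and "cs = drop k (crossings model)" "k \<le> 7"
  shows "of_int (coeff_at q (all_targets us as (model_circles us) k cs x)) =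
    of_int x * (\<Sum>l | k \<le> l \<and> l < 7 \<and> l \<notin> state_of us \<and> state_of (fst q) = insert l (state_of us) \<and>
        edge model (state_of us) l (mask as) (mask (snd q)). edge_sign (state_of us) l)"
  using assms(4,5)
proof (induction cs arbitrary: k)
  case (Nil k)
  then have k: "k = 7" by (simp add: n_crossings_model)
  have e: "{l. k \<le> l \<and> l < 7 \<and> R l} = {}" for R using k by auto
  show ?case unfolding e by simp
next
  case (Cons cr0 cs k)
  obtain a b c' d where cr0: "cr0 = (a, b, c', d)" by (cases cr0)
  have k: "k < 7"
  proof (rule ccontr)
    assume "\<not> k < 7"
    then have "drop k (crossings model) = []" using n_crossings_model by simp
    then show False using Cons.prems(1) by simp
  qed
  have "cr0 # cs = crossings model ! k # drop (Suc k) (crossings model)"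
    using Cons.prems(1) k n_crossings_model Cons_nth_drop_Suc[of k "crossings model"] by simp
  then have cr: "crossings model ! k = (a, b, c', d)" and cs: "cs = drop (Suc k) (crossings model)"
    using cr0 by auto
  let ?E = "\<lambda>l. l \<notin> state_of us \<and> state_of (fst q) = insert l (state_of us) \<and>
        edge model (state_of us) l (mask as) (mask (snd q))"
  have e: "{l. k \<le> l \<and> l < 7 \<and> R l} = (if R k then {k} else {}) \<union> {l. Suc k \<le> l \<and> l < 7 \<and> R l}" for R
  proof (rule set_eqI)
    fix l
    show "l \<in> {l. k \<le> l \<and> l < 7 \<and> R l} <-> l \<in> (if R k then {k} else {}) \<union> {l. Suc k \<le> l \<and> l < 7 \<and> R l}"
      by (cases "l = k") (use k in auto)
  qed
  have "(\<Sum>l | k \<le> l \<and> l < 7 \<and> ?E l. edge_sign (state_of us) l) =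
    (if ?E k then edge_sign (state_of us) k else 0) + (\<Sum>l | Suc k \<le> l \<and> l < 7 \<and> ?E l. edge_sign (state_of us) l)"
    unfolding e[of ?E] by (subst sum.union_disjoint) auto
  then show ?case
    using Cons.IH[OF cs] k edge_targets_coeff[OF alt c q k cr, of x]
    by (simp add: cr0 coeff_at_append distrib_left)
qed

lemma cell_coeff:
  assumes "alternating model" "valid_cell (us, as)" "valid_cell q"
  shows "of_int (coeff_at q (all_targets us as (model_circles us) 0 (crossings model) x)) =
    of_int x * dmat model (decode (us, as)) (decode q)"
  using all_targets_coeff[OF assms, of _ 0 x] by (simp add: dmat_def decode_def n_crossings_model)

definition vec :: "mvec => nat set \<times> nat set => rat" where
  "vec f = (\<lambda>s. \<Sum>(c, x)\<leftarrow>f. if decode c = s then of_int x else 0)"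

lemma vec_Nil: "vec [] = 0"
  by (simp add: vec_def zero_fun_def)

lemma vec_Cons: "vec ((c, x) # f) = scale_fun (of_int x) (unit_vec (decode c)) + vec f"
  by (auto simp: vec_def scale_fun_def unit_vec_def fun_eq_iff)

lemma app_unit_vec: "finite P ==> p \<in> P ==> q \<in> Q ==> app M P Q (unit_vec p) q = M p q"
  by (simp add: app_def unit_vec_def of_bool_def if_distrib if_distribR cong: if_cong)

lemma vec_supp_on: "\<forall>(c, x)\<in>set f. decode c \<in> P ==> vec f \<in> supp_on P"
proof (induction f)
  case (Cons cx f)
  obtain c x where "cx = (c, x)" by (cases cx)
  then show ?case using Cons unfolding \<open>cx = (c, x)\<close> vec_Cons
    by (intro vs.subspace_add[OF subspace_supp_on] vs.subspace_scale[OF subspace_supp_on] unit_vec_in) auto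
qed (simp add: vec_Nil)

lemma app_vec:
  assumes alt: "alternating model" and fin: "finite P"
    and f: "\<forall>(c, x)\<in>set f. valid_cell c \<and> decode c \<in> P" and q: "valid_cell q" "decode q \<in> Q"
  shows "app (dmat model) P Q (vec f) (decode q) = of_int (coeff_at q (diff_vec f))"
  using f
proof (induction f rule: diff_vec.induct)
  case 1
  then show ?case by (simp add: vec_Nil app_def)
next
  case (2 us as x f)
  then have c: "valid_cell (us, as)" "decode (us, as) \<in> P" by auto
  have IH: "app (dmat model) P Q (vec f) (decode q) = of_int (coeff_at q (diff_vec f))"
    using 2 by auto
  have "app (dmat model) P Q (vec (((us, as), x) # f)) (decode q)
    = of_int x * app (dmat model) P Q (unit_vec (decode (us, as))) (decode q) + app (dmat model) P Q (vec f) (decode q)"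
    unfolding vec_Cons app_add app_scale by (simp add: scale_fun_def)
  also have "\<dots> = of_int (coeff_at q (diff_vec (((us, as), x) # f)))"
    using cell_coeff[OF alt c(1) q(1), of x] app_unit_vec[OF fin c(2) q(2), of "dmat model"] IH
    by (simp add: coeff_at_append)
  finally show ?case .
qed

lemma valid_select: "c \<in> set (select j (all_cells h i)) ==> valid_cell c \<and> decode c \<in> model_part h j (int i)"
  unfolding select_iff by (auto simp: valid_cell_def model_part_def gcells_def)

lemma vanishes_on_iff: "vanishes_on r L <-> (\<forall>(r', q)\<in>set L. coeff_at q r = 0)"
  by (induction r L rule: vanishes_on.induct) auto

lemma triangular_nth:
  "triangular L ==> i < length L ==> coeff_at (snd (L ! i)) (fst (L ! i)) \<noteq> 0 \<and>
     (\<forall>j. i < j --> j < length L --> coeff_at (snd (L ! j)) (fst (L ! i)) = 0)"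
proof (induction L arbitrary: i rule: triangular.induct)
  case (2 r q L)
  show ?case
  proof (cases i)
    case 0
    have "coeff_at (snd (L ! j)) r = 0" if "j < length L" for j
      using 2(2) nth_mem[OF that] by (auto simp: vanishes_on_iff split: if_splits)
    then show ?thesis using 0 2(2) by (auto simp: nth_Cons split: if_splits nat.splits)
  next
    case (Suc i')
    then show ?thesis using 2 by (auto simp: nth_Cons split: if_splits nat.splits)
  qed
qed simp

lemma rows_eq: "rows P Q r = map (\<lambda>(f, q). (diff_vec (pick P f), Q ! q)) r"
  by (induction P Q r rule: rows.induct) auto

lemma pick_eq: "pick P f = map (\<lambda>(i, x). (P ! i, x)) f"
  by (induction P f rule: pick.induct) auto

lemma check_rank_sound:
  assumes alt: "alternating model"
    and ch: "check_rank r (select j (all_cells h i)) (select j (all_cells h (Suc i)))"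
  shows "length r \<le> rk (dmat model) (model_part h j (int i)) (model_part h j (int (Suc i)))"
proof -
  let ?P = "select j (all_cells h i)" and ?Q = "select j (all_cells h (Suc i))"
  let ?f = "\<lambda>n. pick ?P (fst (r ! n))" and ?q = "\<lambda>n. ?Q ! snd (r ! n)"
  have rng: "in_range (length ?P) (length ?Q) r" and tri: "triangular (rows ?P ?Q r)"
    using ch by (auto simp: check_rank_def)
  have in_rng: "list_all (\<lambda>(i, _). i < length ?P) (fst (r ! n)) \<and> snd (r ! n) < length ?Q" if "n < length r" for n
    using rng[unfolded in_range_def list_all_length[of _ r]] that by (auto simp: split_beta)
  have f: "valid_cell c \<and> decode c \<in> model_part h j (int i)" if "n < length r" "(c, x) \<in> set (?f n)" for n c x
  proof -
    have "c \<in> set ?P" using that(2) in_rng[OF that(1)] by (auto simp: pick_eq list_all_iff)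
    then show ?thesis by (rule valid_select)
  qed
  have q: "valid_cell (?q n) \<and> decode (?q n) \<in> model_part h j (int (Suc i))" if "n < length r" for n
    by (rule valid_select, rule nth_mem) (use in_rng[OF that] in simp)
  have row: "rows ?P ?Q r ! n = (diff_vec (?f n), ?q n)" "length (rows ?P ?Q r) = length r" if "n < length r" for n
    using that by (auto simp: rows_eq split_beta)
  have app: "app (dmat model) (model_part h j (int i)) (model_part h j (int (Suc i))) (vec (?f n)) (decode (?q n'))
      = of_int (coeff_at (?q n') (diff_vec (?f n)))" if "n < length r" "n' < length r" for n n'
    by (rule app_vec[OF alt finite_model_part]) (use f[OF that(1)] q[OF that(2)] in auto)
  show ?thesis
  proof (rule rk_triangular[OF finite_model_part finite_model_part])
    fix n assume n: "n < length r"
    show "vec (?f n) \<in> supp_on (model_part h j (int i))" by (rule vec_supp_on) (use f[OF n] in auto)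
    show "decode (?q n) \<in> model_part h j (int (Suc i))" using q[OF n] by simp
    show "app (dmat model) (model_part h j (int i)) (model_part h j (int (Suc i))) (vec (?f n)) (decode (?q n)) \<noteq> 0"
      unfolding app[OF n n] using triangular_nth[OF tri, of n] row[OF n] n by simp
  next
    fix n n' assume n: "n < n'" "n' < length r"
    show "app (dmat model) (model_part h j (int i)) (model_part h j (int (Suc i))) (vec (?f n)) (decode (?q n')) = 0"
    proof -
      have nl: "n < length r" using n by simp
      have "coeff_at (snd (rows ?P ?Q r ! n')) (fst (rows ?P ?Q r ! n)) = 0"
        using triangular_nth[OF tri, of n, unfolded row(2)[OF nl]] n nl by blast
      then show ?thesis unfolding app[OF nl n(2)] row(1)[OF nl] row(1)[OF n(2)] by simp
    qed
  qed
qed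

subsection \<open>Certificates\<close>

lemma check_alternating_all: "check_alternating (concat (map (states 7) [0, 1, 2, 3, 4, 5, 6, 7]))"
  by code_simp

lemma alternating_at_sound:
  assumes "alternating_at us P k cs" "cs = drop k (crossings model)" "k \<le> l" "l < 7" "\<not> us ! l"
    "crossings model ! l = (a, b, c, d)"
  shows "(class_of a P ! c) \<noteq> (class_of a (model_circles (us[l := True])) ! c)"
  using assms
proof (induction us P k cs rule: alternating_at.induct)
  case (1 us P k)
  then have "length (crossings model) \<le> k" by simp
  then show ?case using 1 by (simp add: n_crossings_model)
next
  case (2 us P k a' b' c' d' cs)
  have "k < length (crossings model)" using 2(4) by (metis drop_eq_Nil list.distinct(1) not_le)
  then have dr: "(a', b', c', d') # cs = crossings model ! k # drop (Suc k) (crossings model)"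
    using 2(4) Cons_nth_drop_Suc[of k "crossings model"] by simp
  show ?case
  proof (cases "l = k")
    case True
    then show ?thesis using 2(3,7,8) dr by (auto split: if_splits)
  next
    case False
    then have "Suc k \<le> l" using 2(5) by simp
    have cs: "cs = drop (Suc k) (crossings model)" using dr by simp
    show ?thesis
    proof (cases "us ! k")
      case True
      then have "alternating_at us P (Suc k) cs" using 2(3) by simp
      then show ?thesis by (rule 2(1)[OF True _ cs \<open>Suc k \<le> l\<close> 2(6-8)])
    next
      case False
      then have "class_of a' P ! c' \<noteq> class_of a' (model_circles (us[k := True])) ! c'"
        "alternating_at us P (Suc k) cs" using 2(3) by (simp_all split: if_splits)
      then show ?thesis by (rule 2(2)[OF False _ _ cs \<open>Suc k \<le> l\<close> 2(6-8)])
    qed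
  qed
qed

lemma check_alternating_sound: "check_alternating L ==> us \<in> set L ==>
    alternating_at us (model_circles us) 0 (crossings model)"
  by (induction L rule: check_alternating.induct) (auto split: if_splits)

lemma alternating_model: "alternating model"
  unfolding alternating_def
proof (intro allI impI)
  fix v k a b c d
  assume v: "v \<subseteq> {..<n_crossings model}" and k: "k < n_crossings model" "k \<notin> v"
    and cr: "crossings model ! k = (a, b, c, d)"
  have "a \<in> points model" "c \<in> points model" using crossing_points[OF k(1) cr] by auto
  then have ac: "a < 16" "c < 16" by (auto simp: points_model)
  define us where "us = map (\<lambda>k. k \<in> v) [0..<7]"
  have len: "length us = 7" and k7: "k < 7" using k by (simp_all add: us_def n_crossings_model)
  have v': "state_of us = v" using v by (auto simp: state_of_def us_def n_crossings_model)
  have nk: "\<not> us ! k" using k k7 by (simp add: us_def)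
  have w: "state_of (us[k := True]) = insert k v" "length (us[k := True]) = 7"
    using v' k7 len by (auto simp: state_of_def nth_list_update)
  have "length (filter id us) \<le> 7" using length_filter_le[of id us] len by simp
  moreover have "n \<in> set [0, 1, 2, 3, 4, 5, 6, 7]" if "n \<le> 7" for n :: nat
    using that by (simp; arith)
  ultimately have "length (filter id us) \<in> set [0, 1, 2, 3, 4, 5, 6, 7]" by blast
  moreover have "us \<in> set (states 7 (length (filter id us)))" using len by (simp add: set_states)
  ultimately have "us \<in> set (concat (map (states 7) [0, 1, 2, 3, 4, 5, 6, 7]))" by force
  from check_alternating_sound[OF check_alternating_all this]
  have "(class_of a (model_circles us) ! c) \<noteq> (class_of a (model_circles (us[k := True])) ! c)"
    using alternating_at_sound[OF _ _ _ k7 nk cr, of "model_circles us" 0] by simp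
  moreover have "class_of a (model_circles us) ! c <-> (a, c) \<in> conn model v"
    using in_mask[OF ac(2)] class_of_eq(2)[OF len ac(1)] v' in_cls by metis
  moreover have "class_of a (model_circles (us[k := True])) ! c <-> (a, c) \<in> conn model (insert k v)"
    using in_mask[OF ac(2)] class_of_eq(2)[OF w(2) ac(1)] w(1) in_cls by metis
  ultimately show "(a, c) \<in> conn model v <-> (a, c) \<notin> conn model (insert k v)" by blast
qed

lemma check_table_model: "check_table False" "check_table True"
  by code_simp+

lemma check_cells_H: "check_cells False 0" "check_cells False 1" "check_cells False 2" "check_cells False 3"
    "check_cells False 4" "check_cells False 5" "check_cells False 6"
  by code_simp+

lemma check_cells_V: "check_cells True 0" "check_cells True 1" "check_cells True 2" "check_cells True 3"
    "check_cells True 4" "check_cells True 5" "check_cells True 6"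
  by code_simp+

lemma check_level_H0: "check_level False 0" by code_simp
lemma check_level_H1: "check_level False 1" by code_simp
lemma check_level_H2: "check_level False 2" by code_simp
lemma check_level_H3: "check_level False 3" by code_simp
lemma check_level_H4: "check_level False 4" by code_simp
lemma check_level_H5: "check_level False 5" by code_simp
lemma check_level_V0: "check_level True 0" by code_simp
lemma check_level_V1: "check_level True 1" by code_simp
lemma check_level_V2: "check_level True 2" by code_simp
lemma check_level_V3: "check_level True 3" by code_simp
lemma check_level_V4: "check_level True 4" by code_simp
lemma check_level_V5: "check_level True 5" by code_simp

lemma check_cycle5: "check_zero (diff_vec cycle5) (select 5 (all_cells False 4))" by code_simp
lemma check_cycle3: "check_zero (diff_vec cycle3) (select 3 (all_cells False 4))" by code_simp
lemma check_cocycle3: "check_cocycle cocycle3 (select 3 (all_cells False 2))" by code_simp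
lemma check_cocycle1: "check_cocycle cocycle1 (select 1 (all_cells False 2))" by code_simp
lemma check_vcocycle5: "check_cocycle vcocycle5 (select 5 (all_cells True 2))" by code_simp
lemma check_vcocycle3: "check_cocycle vcocycle3 (select 3 (all_cells True 2))" by code_simp
lemma check_pcycle1: "check_zero (diff_vec pcycle1) (select 1 (all_cells True 2))" by code_simp
lemma check_pcycle4: "check_zero (diff_vec pcycle4) (select 7 (all_cells True 5))" by code_simp
lemma check_pcocycle1: "check_cocycle pcocycle1 (select 1 (all_cells True 0))" by code_simp
lemma check_pcocycle4: "check_cocycle pcocycle4 (select 7 (all_cells True 3))" by code_simp

text \<open>Different absolute values make both the sum and the difference of the two pairings
  nonzero. Both are needed, because the relative sign of the two actions of X alternates with the
  layer.\<close>

lemma pairing_values: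
  "\<bar>pairing cocycle3 (mult_vec 0 cycle5)\<bar> \<noteq> \<bar>pairing cocycle3 (mult_vec 15 cycle5)\<bar>"
  "\<bar>pairing cocycle1 (mult_vec 0 cycle3)\<bar> \<noteq> \<bar>pairing cocycle1 (mult_vec 15 cycle3)\<bar>"
  "pairing vcocycle5 (diff_vec cycle5) \<noteq> 0" "pairing vcocycle3 (diff_vec cycle3) \<noteq> 0"
  "pairing pcocycle1 pcycle1 \<noteq> 0" "pairing pcocycle4 pcycle4 \<noteq> 0"
  by code_simp+

lemma check_ranks_sound:
  assumes "check_ranks h i cs P Q" "(j, r) \<in> set cs"
  shows "length r = model_rank h i j" "check_rank r (select j P) (select j Q)"
  using assms by (induction h i cs P Q rule: check_ranks.induct) (auto split: if_splits)

lemma check_sizes_sound: "check_sizes h i js P ==> j \<in> set js ==> check_size h i j (length (select j P))"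
  by (induction h i js P rule: check_sizes.induct) (auto split: if_splits)

lemma nat_less_7_cases: "(i::nat) < 7 ==> i = 0 \<or> i = 1 \<or> i = 2 \<or> i = 3 \<or> i = 4 \<or> i = 5 \<or> i = 6"
  by auto

lemma check_cells: "i < 7 ==> check_cells h i"
  using nat_less_7_cases[of i] check_cells_H check_cells_V by (cases h) auto

lemma check_level: "i < 6 ==> check_level h i"
  using less_6_cases[of i] check_level_H0 check_level_H1 check_level_H2 check_level_H3 check_level_H4
    check_level_H5 check_level_V0 check_level_V1 check_level_V2 check_level_V3 check_level_V4 check_level_V5
  by (cases h) auto

lemma check_table: "check_table h"
  using check_table_model by (cases h) auto

definition model_rank_int :: "bool => int => int => nat" where
  "model_rank_int h j i = (if i < 0 then 0 else model_rank h (nat i) j)"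

definition model_betti_int :: "bool => int => int => nat" where
  "model_betti_int h j i = length (filter (\<lambda>(i', j'). int i' = i \<and> j' = j) (model_betti h))"

lemma model_rank_nonzero:
  assumes "model_rank h i j \<noteq> 0"
  shows "i < 6" "j \<in> set degs" "j \<in> set (map fst (rank_certs h i))"
proof -
  have "map_of (rank_table h) (i, j) \<noteq> None" using assms by (auto simp: model_rank_def split: option.splits)
  then obtain r where "((i, j), r) \<in> set (rank_table h)" by (auto dest: map_of_SomeD)
  then show "i < 6" "j \<in> set degs" "j \<in> set (map fst (rank_certs h i))"
    using check_table[of h] by (auto simp: check_table_def list_all_iff)
qed

lemma model_betti_mem: "(i, j) \<in> set (model_betti h) ==> i < 7 \<and> j \<in> set degs"
  using check_table[of h] by (auto simp: check_table_def list_all_iff)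

lemma card_model_part_eq:
  "card (model_part h j (int i)) = model_rank h i j + (case i of 0 => 0 | Suc i' => model_rank h i' j) +
     length (filter (\<lambda>x. x = (i, j)) (model_betti h))"
proof (cases "i < 7 \<and> j \<in> set degs")
  case True
  then have "check_size h i j (length (select j (all_cells h i)))"
    using check_cells[of i h] check_sizes_sound by (auto simp: check_cells_def)
  then show ?thesis by (simp add: check_size_def card_model_part)
next
  case False
  \<comment> \<open>Outside the certified range there are no generators at all, and every term
    vanishes.\<close>
  have m0: "model_rank h i j = 0" using False model_rank_nonzero[of h i j] by force
  have m1: "(case i of 0 => 0 | Suc i' => model_rank h i' j) = 0"
  proof (cases i)
    case (Suc i')
    then show ?thesis using False model_rank_nonzero[of h i' j] by force
  qed simp
  have b: "filter (\<lambda>x. x = (i, j)) (model_betti h) = []"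
    using False model_betti_mem[of i j h] by (auto simp: filter_empty_conv)
  have "select j (all_cells h i) = []"
  proof (cases "i < 7")
    case True
    then have "j \<notin> set degs" using False by simp
    moreover have "fst c \<in> set degs" if "c \<in> set (all_cells h i)" for c
      using check_cells[OF True, of h] that by (auto simp: check_cells_def check_degs_def list_all_iff)
    ultimately have "(j, c) \<notin> set (all_cells h i)" for c by fastforce
    moreover have "c \<in> set (select j L) <-> (j, c) \<in> set L" for c L
      by (induction j L rule: select.induct) auto
    ultimately have "set (select j (all_cells h i)) = {}" by (simp add: set_eq_iff)
    then show ?thesis by simp
  next
    case i: False
    have "set (states 6 i) = {}"
    proof -
      have "length (filter id us) \<noteq> i" if "length us = 6" for us :: "bool list"
        using length_filter_le[of id us] that i by linarith
      then show ?thesis by (auto simp: set_states)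
    qed
    then show ?thesis by (simp add: all_cells_def)
  qed
  then show ?thesis using m0 m1 b by (simp add: card_model_part)
qed

lemma model_part_negative: "i < 0 ==> model_part h j i = {}"
proof -
  assume i: "i < 0"
  have False if "s \<in> model_part h j i" for s
  proof -
    have s: "int (card (fst s)) = i + of_bool h" "6 \<in> fst s <-> h" "fst s \<subseteq> {..<7}"
      using that by (auto simp: model_part_def gcells_def cells_def n_crossings_model)
    have "finite (fst s)" using s(3) finite_subset by blast
    then have "h ==> card (fst s) \<noteq> 0" using s(2) by auto
    then show False using s(1) i by (cases h) auto
  qed
  then show ?thesis by blast
qed

text \<open>The minors guarantee the tabulated ranks, and the size check shows that exactly
  \<open>model_betti\<close> is left over.\<close>

lemma betti_bound_model: "betti_bound (dmat model) (model_part h j) (model_betti_int h j)"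
proof (rule betti_boundI[of "model_rank_int h j"])
  fix i
  show "model_rank_int h j i \<le> rk (dmat model) (model_part h j i) (model_part h j (i + 1))"
  proof (cases "i < 0 \<or> model_rank h (nat i) j = 0")
    case True
    then show ?thesis by (auto simp: model_rank_int_def)
  next
    case False
    then have i: "i = int (nat i)" and r: "model_rank h (nat i) j \<noteq> 0" by auto
    have "j \<in> set (map fst (rank_certs h (nat i)))" using model_rank_nonzero[OF r] by simp
    then obtain r' where r': "(j, r') \<in> set (rank_certs h (nat i))" by auto
    have "check_ranks h (nat i) (rank_certs h (nat i)) (all_cells h (nat i)) (all_cells h (Suc (nat i)))"
      using check_level[OF model_rank_nonzero(1)[OF r], of h] by (simp add: check_level_def)
    from check_ranks_sound[OF this r']
    have "model_rank h (nat i) j \<le> rk (dmat model) (model_part h j (int (nat i))) (model_part h j (int (Suc (nat i))))"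
      using check_rank_sound[OF alternating_model] by metis
    then show ?thesis using i by (simp add: model_rank_int_def add.commute)
  qed
  show "card (model_part h j i) = model_rank_int h j i + model_rank_int h j (i - 1) + model_betti_int h j i"
  proof (cases "i < 0")
    case True
    have "model_betti_int h j i = 0" using True by (auto simp: model_betti_int_def filter_empty_conv)
    then show ?thesis using True by (simp add: model_part_negative model_rank_int_def)
  next
    case False
    then have i: "i = int (nat i)" by simp
    have "filter (\<lambda>x. x = (nat i, j)) (model_betti h) = filter (\<lambda>(i', j'). int i' = i \<and> j' = j) (model_betti h)"
      by (rule filter_cong) (use False in auto)
    then show ?thesis
      using card_model_part_eq[of h j "nat i"] i
      by (auto simp: model_rank_int_def model_betti_int_def nat_diff_distrib split: nat.splits)
  qed
qed

section \<open>Actions of X and detection of cycles in the model\<close>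

definition xmat :: "'p diagram => 'p => nat set \<times> 'p set => nat set \<times> 'p set => rat" where
  "xmat D p s t = of_bool (fst t = fst s \<and> p \<notin> snd s \<and> snd t = snd s \<union> cls D (fst s) p)"

lemma sum_vec:
  assumes "finite P" "\<forall>(c, x)\<in>set f. decode c \<in> P"
  shows "(\<Sum>s\<in>P. vec f s * F s) = (\<Sum>(c, x)\<leftarrow>f. of_int x * F (decode c))"
  using assms(2)
proof (induction f)
  case (Cons cx f)
  obtain c x where cx: "cx = (c, x)" by (cases cx)
  have c: "decode c \<in> P" using Cons.prems cx by auto
  have "(\<Sum>s\<in>P. vec (cx # f) s * F s) = (\<Sum>s\<in>P. (of_int x * of_bool (s = decode c)) * F s) + (\<Sum>s\<in>P. vec f s * F s)"
    unfolding cx vec_Cons by (simp add: scale_fun_def unit_vec_def algebra_simps sum.distrib)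
  also have "(\<Sum>s\<in>P. (of_int x * of_bool (s = decode c)) * F s) = of_int x * F (decode c)"
    using c assms(1) by (simp add: of_bool_def if_distrib if_distribR cong: if_cong)
  finally show ?case using Cons cx by simp
qed (simp add: vec_Nil)

lemma vec_decode:
  assumes "\<forall>(c, x)\<in>set f. valid_cell c" "valid_cell q"
  shows "vec f (decode q) = of_int (coeff_at q f)"
  using assms(1)
proof (induction f)
  case (Cons cx f)
  obtain c x where cx: "cx = (c, x)" by (cases cx)
  have "valid_cell c" using Cons.prems cx by auto
  then have "decode q = decode c <-> c = q"
    using inj_onD[OF decode_inj, of q c] assms(2) by (auto simp: valid_cell_def)
  then show ?case using Cons by (simp add: cx vec_Cons scale_fun_def unit_vec_def)
qed (simp add: vec_Nil)

lemma pairing_eq: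
  assumes "finite P" "\<forall>(c, x)\<in>set f. valid_cell c \<and> decode c \<in> P"
    and F: "\<And>q. valid_cell q ==> decode q \<in> P ==> F (decode q) = of_int (coeff_at q r)"
  shows "(\<Sum>s\<in>P. F s * vec f s) = of_int (pairing f r)"
proof -
  have "(\<Sum>s\<in>P. F s * vec f s) = (\<Sum>(c, x)\<leftarrow>f. of_int x * F (decode c))"
    using sum_vec[OF assms(1), of f F] assms(2) by (auto simp: mult.commute)
  also have "\<dots> = of_int (pairing f r)"
    using assms(2) F by (induction f r rule: pairing.induct) auto
  finally show ?thesis .
qed

lemma check_zero_sound: "check_zero r L ==> q \<in> set L ==> coeff_at q r = 0"
  by (induction r L rule: check_zero.induct) (auto split: if_splits)

lemma check_cocycle_sound: "check_cocycle c L ==> t \<in> set L ==> pairing c (diff_vec [(t, 1)]) = 0"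
  by (induction c L rule: check_cocycle.induct) (auto split: if_splits)

lemma cycle_sound:
  assumes "check_zero (diff_vec f) (select j (all_cells h (Suc i)))"
    and f: "\<forall>(c, x)\<in>set f. c \<in> set (select j (all_cells h i))"
  shows "vec f \<in> supp_on (model_part h j (int i))"
    and "app (dmat model) (model_part h j (int i)) (model_part h j (int i + 1)) (vec f) = 0"
proof -
  have f': "\<forall>(c, x)\<in>set f. valid_cell c \<and> decode c \<in> model_part h j (int i)"
    using f valid_select by fast
  then show "vec f \<in> supp_on (model_part h j (int i))" by (intro vec_supp_on) auto
  show "app (dmat model) (model_part h j (int i)) (model_part h j (int i + 1)) (vec f) = 0"
  proof
    fix s
    show "app (dmat model) (model_part h j (int i)) (model_part h j (int i + 1)) (vec f) s = 0 s"
    proof (cases "s \<in> model_part h j (int (Suc i))")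
      case True
      then obtain q where q: "q \<in> set (select j (all_cells h (Suc i)))" "s = decode q"
        unfolding select_image[symmetric] by blast
      have "app (dmat model) (model_part h j (int i)) (model_part h j (int (Suc i))) (vec f) (decode q)
        = of_int (coeff_at q (diff_vec f))"
        by (rule app_vec[OF alternating_model finite_model_part f']) (use valid_select[OF q(1)] in auto)
      then show ?thesis using check_zero_sound[OF assms(1) q(1)] q(2) by (simp add: add.commute)
    next
      case False
      then show ?thesis by (simp add: app_def add.commute)
    qed
  qed
qed

lemma cocycle_sound:
  assumes "check_cocycle c (select j (all_cells h i))"
    and c: "\<forall>(t, x)\<in>set c. t \<in> set (select j (all_cells h (Suc i)))"
    and t: "t \<in> model_part h j (int i)"
  shows "(\<Sum>p\<in>model_part h j (int i + 1). dmat model t p * vec c p) = 0"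
proof -
  obtain q where q: "q \<in> set (select j (all_cells h i))" "t = decode q"
    using t unfolding select_image[symmetric] by blast
  have c': "\<forall>(t, x)\<in>set c. valid_cell t \<and> decode t \<in> model_part h j (int (Suc i))"
    using c valid_select by fast
  have "(\<Sum>p\<in>model_part h j (int (Suc i)). dmat model t p * vec c p) = of_int (pairing c (diff_vec [(q, 1)]))"
  proof (rule pairing_eq[OF finite_model_part c'])
    fix q' assume q': "valid_cell q'"
    obtain us as where qq: "q = (us, as)" by (cases q)
    show "dmat model t (decode q') = of_int (coeff_at q' (diff_vec [(q, 1)]))"
      using cell_coeff[OF alternating_model _ q', of us as 1] valid_select[OF q(1)] q(2)
      by (simp add: qq)
  qed
  then show ?thesis using check_cocycle_sound[OF assms(1) q(1)] by (simp add: add.commute)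
qed

lemma xmat_coeff:
  assumes "valid_cell (us, as)" "valid_cell q" "p < 16"
  shows "of_int (coeff_at q (mult_vec p [((us, as), x)])) = of_int x * xmat model p (decode (us, as)) (decode q)"
proof -
  obtain us' as' where q: "q = (us', as')" by (cases q)
  have l: "length us = 7" "length as = 16" "length us' = 7" "length as' = 16"
    using assms by (auto simp: valid_cell_def q)
  have "us = us' <-> state_of us' = state_of us" using state_of_inj[OF l(1,3)] by auto
  moreover have "bor as (class_of p (model_circles us)) = as' <-> mask as' = mask as \<union> cls model (state_of us) p"
    using mask_inj[OF _ l(4), of "bor as (class_of p (model_circles us))"] l
      class_of_eq[OF l(1) assms(3)] mask_bor[OF l(2)] by auto
  ultimately show ?thesis
    using in_mask[OF assms(3), of as] by (auto simp: xmat_def decode_def q)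
qed

lemma mult_vec_append: "mult_vec p (((us, as), x) # f) = mult_vec p [((us, as), x)] @ mult_vec p f"
  by simp

lemma app_xmat_vec:
  assumes fin: "finite P"
    and f: "\<forall>(c, x)\<in>set f. valid_cell c \<and> decode c \<in> P" and q: "valid_cell q" "decode q \<in> Q" and p: "p < 16"
  shows "app (xmat model p) P Q (vec f) (decode q) = of_int (coeff_at q (mult_vec p f))"
  using f
proof (induction f)
  case Nil
  then show ?case by (simp add: vec_Nil app_def)
next
  case (Cons cx f)
  obtain us as x where cx: "cx = ((us, as), x)" by (metis surj_pair)
  have c: "valid_cell (us, as)" "decode (us, as) \<in> P" using Cons.prems cx by auto
  have IH: "app (xmat model p) P Q (vec f) (decode q) = of_int (coeff_at q (mult_vec p f))"
    using Cons by auto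
  have "app (xmat model p) P Q (vec (((us, as), x) # f)) (decode q)
    = of_int x * app (xmat model p) P Q (unit_vec (decode (us, as))) (decode q) + app (xmat model p) P Q (vec f) (decode q)"
    unfolding vec_Cons app_add app_scale by (simp add: scale_fun_def)
  also have "\<dots> = of_int (coeff_at q (mult_vec p (((us, as), x) # f)))"
    by (subst mult_vec_append)
      (simp add: coeff_at_append xmat_coeff[OF c(1) q(1) p] app_unit_vec[OF fin c(2) q(2)] IH del: mult_vec.simps)
  finally show ?case unfolding cx .
qed

lemma pick_valid:
  assumes "list_all (\<lambda>(i, _). i < n) f" "n = length P"
  shows "\<forall>(c, x)\<in>set (pick P f). c \<in> set P"
  using assms by (auto simp: pick_eq list_all_iff)

lemma select_lengths: "length (select 5 (all_cells False 3)) = 61" "length (select 3 (all_cells False 3)) = 94"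
    "length (select 1 (all_cells False 3)) = 61" "length (select 5 (all_cells True 3)) = 49"
    "length (select 3 (all_cells True 3)) = 49" "length (select 1 (all_cells True 1)) = 18"
    "length (select 7 (all_cells True 4)) = 24"
  by code_simp+

text \<open>
  A cycle of the horizontal part in quantum degree j, and the cocycles which detect its
  images under the two actions of X and under the saddle to the vertical part:
\<close>

lemma model_cycle:
  assumes "j = 3 \<or> j = 5"
  obtains g c e where
    "g \<in> supp_on (model_part False j 3)"
    "app (dmat model) (model_part False j 3) (model_part False j 4) g = 0"
    "\<And>t. t \<in> model_part False (j - 2) 2 ==> (\<Sum>p\<in>model_part False (j - 2) 3. dmat model t p * c p) = 0"
    "\<And>r :: rat. \<bar>r\<bar> = 1 ==> (\<Sum>p\<in>model_part False (j - 2) 3.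
       (app (xmat model 0) (model_part False j 3) (model_part False (j - 2) 3) g p +
        r * app (xmat model 15) (model_part False j 3) (model_part False (j - 2) 3) g p) * c p) \<noteq> 0"
    "\<And>t. t \<in> model_part True j 2 ==> (\<Sum>p\<in>model_part True j 3. dmat model t p * e p) = 0"
    "(\<Sum>p\<in>model_part True j 3. app (dmat model) (model_part False j 3) (model_part True j 3) g p * e p) \<noteq> 0"
proof -
  note witness = that
  \<comment> \<open>Multiplication by X lowers the quantum degree by 2 whereas the saddle preserves
    it; this fixes the degrees of the cocycles \<open>C\<close> and \<open>E\<close>.\<close>
  have main: thesis if
      g: "\<forall>(c, x)\<in>set G. c \<in> set (select j (all_cells False 3))" "check_zero (diff_vec G) (select j (all_cells False (Suc 3)))"
    and c: "\<forall>(t, x)\<in>set C. t \<in> set (select (j - 2) (all_cells False (Suc 2)))" "check_cocycle C (select (j - 2) (all_cells False 2))"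
    and e: "\<forall>(t, x)\<in>set E. t \<in> set (select j (all_cells True (Suc 2)))" "check_cocycle E (select j (all_cells True 2))"
    and v: "\<bar>pairing C (mult_vec 0 G)\<bar> \<noteq> \<bar>pairing C (mult_vec 15 G)\<bar>" "pairing E (diff_vec G) \<noteq> 0"
    for G C E
  proof (rule witness)
    note G = cycle_sound[OF g(2,1)] and C = cocycle_sound[OF c(2,1)] and E = cocycle_sound[OF e(2,1)]
    show "vec G \<in> supp_on (model_part False j 3)"
      "app (dmat model) (model_part False j 3) (model_part False j 4) (vec G) = 0"
      using G by simp_all
    show "(\<Sum>p\<in>model_part False (j - 2) 3. dmat model t p * vec C p) = 0" if "t \<in> model_part False (j - 2) 2" for t
      using C[of t] that by simp
    show "(\<Sum>p\<in>model_part True j 3. dmat model t p * vec E p) = 0" if "t \<in> model_part True j 2" for t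
      using E[of t] that by simp
    have g': "\<forall>(c, x)\<in>set G. valid_cell c \<and> decode c \<in> model_part False j 3"
      using g(1) valid_select[of _ j False 3] by fastforce
    have c': "\<forall>(t, x)\<in>set C. valid_cell t \<and> decode t \<in> model_part False (j - 2) 3"
      using c(1) valid_select[of _ "j - 2" False "Suc 2"] by fastforce
    have e': "\<forall>(t, x)\<in>set E. valid_cell t \<and> decode t \<in> model_part True j 3"
      using e(1) valid_select[of _ j True "Suc 2"] by fastforce
    have "(\<Sum>p\<in>model_part True j 3. app (dmat model) (model_part False j 3) (model_part True j 3) (vec G) p * vec E p)
      = of_int (pairing E (diff_vec G))"
      by (rule pairing_eq[OF finite_model_part e']) (rule app_vec[OF alternating_model finite_model_part g'])
    then show "(\<Sum>p\<in>model_part True j 3. app (dmat model) (model_part False j 3) (model_part True j 3) (vec G) p * vec E p) \<noteq> 0"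
      using v(2) by simp
    have x: "(\<Sum>p\<in>model_part False (j - 2) 3. app (xmat model n) (model_part False j 3) (model_part False (j - 2) 3) (vec G) p * vec C p)
      = of_int (pairing C (mult_vec n G))" if "n < 16" for n
      by (rule pairing_eq[OF finite_model_part c']) (rule app_xmat_vec[OF finite_model_part g' _ _ that])
    show "(\<Sum>p\<in>model_part False (j - 2) 3.
       (app (xmat model 0) (model_part False j 3) (model_part False (j - 2) 3) (vec G) p +
        r * app (xmat model 15) (model_part False j 3) (model_part False (j - 2) 3) (vec G) p) * vec C p) \<noteq> 0"
      if r: "\<bar>r\<bar> = 1" for r
    proof -
      have "(\<Sum>p\<in>model_part False (j - 2) 3.
       (app (xmat model 0) (model_part False j 3) (model_part False (j - 2) 3) (vec G) p +
        r * app (xmat model 15) (model_part False j 3) (model_part False (j - 2) 3) (vec G) p) * vec C p)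
        = of_int (pairing C (mult_vec 0 G)) + r * of_int (pairing C (mult_vec 15 G))"
        by (simp add: x[symmetric] distrib_right sum.distrib sum_distrib_left mult.assoc)
      moreover have "r = 1 \<or> r = -1" using r by linarith
      ultimately show ?thesis using v(1) by auto
    qed
  qed
  have s: "Suc 2 = 3" "Suc 3 = 4" "5 - 2 = (3 :: int)" "3 - 2 = (1 :: int)" by simp_all
  show thesis
    using assms
  proof
    assume j: "j = 5"
    show thesis
    proof (rule main[of cycle5 cocycle3 vcocycle5])
      show "\<forall>(c, x)\<in>set cycle5. c \<in> set (select j (all_cells False 3))"
        unfolding j cycle5_def by (rule pick_valid[of 61]) (simp_all add: select_lengths)
      show "\<forall>(t, x)\<in>set cocycle3. t \<in> set (select (j - 2) (all_cells False (Suc 2)))"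
        unfolding j cocycle3_def s by (rule pick_valid[of 94]) (simp_all add: select_lengths)
      show "\<forall>(t, x)\<in>set vcocycle5. t \<in> set (select j (all_cells True (Suc 2)))"
        unfolding j vcocycle5_def s by (rule pick_valid[of 49]) (simp_all add: select_lengths)
    qed (use check_cycle5 check_cocycle3 check_vcocycle5 pairing_values in \<open>simp_all add: j s\<close>)
  next
    assume j: "j = 3"
    show thesis
    proof (rule main[of cycle3 cocycle1 vcocycle3])
      show "\<forall>(c, x)\<in>set cycle3. c \<in> set (select j (all_cells False 3))"
        unfolding j cycle3_def by (rule pick_valid[of 94]) (simp_all add: select_lengths)
      show "\<forall>(t, x)\<in>set cocycle1. t \<in> set (select (j - 2) (all_cells False (Suc 2)))"
        unfolding j cocycle1_def s by (rule pick_valid[of 61]) (simp_all add: select_lengths)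
      show "\<forall>(t, x)\<in>set vcocycle3. t \<in> set (select j (all_cells True (Suc 2)))"
        unfolding j vcocycle3_def s by (rule pick_valid[of 49]) (simp_all add: select_lengths)
    qed (use check_cycle3 check_cocycle1 check_vcocycle3 pairing_values in \<open>simp_all add: j s\<close>)
  qed
qed

text \<open>Differentials never return crossing 6 to its 0-smoothing, so the intermediate generators
  outside the vertical part contribute nothing. Degree \<open>i\<close> of the part is degree
  \<open>i + 1\<close> of the full model.\<close>

lemma complex_model_part: "complex (dmat model) (model_part True j)"
proof -
  have fin: "finite (model_part True j i)" for i by (rule finite_model_part)
  show ?thesis
    unfolding complex_def
  proof (intro conjI allI ballI fin)
    fix i p r assume p: "p \<in> model_part True j (i - 1)" and r: "r \<in> model_part True j (i + 1)"
    have "(\<Sum>q\<in>model_part True j i. dmat model p q * dmat model q r)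
      = (\<Sum>q\<in>gcells model j (i + 1). dmat model p q * dmat model q r)"
    proof (rule sum.mono_neutral_left[OF finite_gcells])
      show "model_part True j i \<subseteq> gcells model j (i + 1)" by (auto simp: model_part_def)
      show "\<forall>q\<in>gcells model j (i + 1) - model_part True j i. dmat model p q * dmat model q r = 0"
      proof (intro ballI, rule ccontr)
        fix q assume q: "q \<in> gcells model j (i + 1) - model_part True j i" "dmat model p q * dmat model q r \<noteq> 0"
        then have "6 \<in> fst q" using dmat_nonzero[of model "fst p" "snd p" "fst q" "snd q"] p
          by (auto simp: model_part_def)
        then show False using q by (auto simp: model_part_def)
      qed
    qed
    also have "\<dots> = 0"
    proof -
      have "p \<in> gcells model j (i + 1 - 1)" "r \<in> gcells model j (i + 1 + 1)"
        using p r by (simp_all add: model_part_def)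
      then show ?thesis using complex_dmat[OF alternating_model, of j] unfolding complex_def by blast
    qed
    finally show "(\<Sum>q\<in>model_part True j i. dmat model p q * dmat model q r) = 0" .
  qed
qed

text \<open>The homology of the square knot has two adjacent pairs in the same quantum degree, (1,
  1), (2, 1) and (4, 7), (5, 7), which rank bounds alone would allow to cancel. A cycle that pairs
  nontrivially with a cocycle keeps the lower member of each pair alive.\<close>

lemma model_lower:
  assumes "(i, j) = (1, 1) \<or> (i, j) = (4, 7)"
  shows "rk (dmat model) (model_part True j i) (model_part True j (i + 1)) +
    rk (dmat model) (model_part True j (i - 1)) (model_part True j i) + 1 \<le> card (model_part True j i)"
proof -
  have main: "rk (dmat model) (model_part True j (int i')) (model_part True j (int i' + 1)) +
    rk (dmat model) (model_part True j (int i' - 1)) (model_part True j (int i')) + 1 \<le> card (model_part True j (int i'))"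
    if z: "check_zero (diff_vec Z) (select j (all_cells True (Suc (Suc n))))"
      "\<forall>(c, x)\<in>set Z. c \<in> set (select j (all_cells True (Suc n)))"
    and c: "check_cocycle C (select j (all_cells True n))"
      "\<forall>(c, x)\<in>set C. c \<in> set (select j (all_cells True (Suc n)))"
    and p: "pairing C Z \<noteq> 0" and i': "i' = Suc n" for i' n Z C
  proof -
    note Z = cycle_sound[OF z] and C = cocycle_sound[OF c]
    have z': "\<forall>(c, x)\<in>set Z. valid_cell c \<and> decode c \<in> model_part True j (int (Suc n))"
      and c': "\<forall>(c, x)\<in>set C. valid_cell c \<and> decode c \<in> model_part True j (int (Suc n))"
      using z(2) c(2) valid_select by fast+
    have "(\<Sum>s\<in>model_part True j (int (Suc n)). vec Z s * vec C s) = of_int (pairing C Z)"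
    proof (rule pairing_eq[OF finite_model_part c'])
      fix q assume q: "valid_cell q" "decode q \<in> model_part True j (int (Suc n))"
      show "vec Z (decode q) = of_int (coeff_at q Z)"
        by (rule vec_decode) (use z' q in auto)
    qed
    then have "(\<Sum>s\<in>model_part True j (int (Suc n)). vec Z s * vec C s) \<noteq> 0" using p by simp
    then have "rk (dmat model) (model_part True j (int n)) (model_part True j (int (Suc n))) +
      rk (dmat model) (model_part True j (int (Suc n))) (model_part True j (int (Suc n) + 1)) + 1
      \<le> card (model_part True j (int (Suc n)))"
      using complex_app[OF complex_model_part, of j "int (Suc n)"] Z C
      by (intro rk_pairing[OF finite_model_part finite_model_part]) (auto simp: add.commute)
    then show ?thesis by (simp add: i' add.commute)
  qed
  show ?thesis
    using assms
  proof
    assume ij: "(i, j) = (1, 1)"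
    then have e: "i = int 1" "j = 1" by auto
    show ?thesis unfolding e
    proof (rule main[unfolded e, of pcycle1 0 pcocycle1])
      show "\<forall>(c, x)\<in>set pcycle1. c \<in> set (select 1 (all_cells True (Suc 0)))"
        unfolding pcycle1_def One_nat_def[symmetric] by (rule pick_valid[of 18]) (simp_all add: select_lengths[unfolded One_nat_def])
      show "\<forall>(c, x)\<in>set pcocycle1. c \<in> set (select 1 (all_cells True (Suc 0)))"
        unfolding pcocycle1_def One_nat_def[symmetric] by (rule pick_valid[of 18]) (simp_all add: select_lengths[unfolded One_nat_def])
    qed (use check_pcycle1 check_pcocycle1 pairing_values in \<open>simp_all add: numeral_2_eq_2\<close>)
  next
    assume ij: "(i, j) = (4, 7)"
    then have e: "i = int 4" "j = 7" by auto
    have s: "Suc (Suc 3) = 5" "Suc 3 = 4" by simp_all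
    show ?thesis unfolding e
    proof (rule main[unfolded e, of pcycle4 3 pcocycle4])
      show "\<forall>(c, x)\<in>set pcycle4. c \<in> set (select 7 (all_cells True (Suc 3)))"
        unfolding pcycle4_def s by (rule pick_valid[of 24]) (simp_all add: select_lengths)
      show "\<forall>(c, x)\<in>set pcocycle4. c \<in> set (select 7 (all_cells True (Suc 3)))"
        unfolding pcocycle4_def s by (rule pick_valid[of 24]) (simp_all add: select_lengths)
    qed (use check_pcycle4 check_pcocycle4 pairing_values in \<open>simp_all add: s\<close>)
  qed
qed

section \<open>Generators of the complex of P(3, -3, q)\<close>

text \<open>The levels of the third column which lie on circles contained in the column:\<close>

definition inner :: "nat => nat set => nat set" where
  "inner m v = {l. 0 < l \<and> l + 5 \<notin> v \<and> \<not> vert_below m v l}"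

definition codes :: "nat => nat set => nat set" where
  "codes m v = {..<16} \<union> (+) 15 ` inner m v"

lemma inner_bounds: "l \<in> inner m v ==> 0 < l \<and> l < m"
  by (auto simp: inner_def vert_below_def)

lemma finite_inner [simp]: "finite (inner m v)"
  by (rule finite_subset[of _ "{..<m}"]) (auto dest: inner_bounds)

lemma inner_not_vert_above: "l \<in> inner m v ==> \<not> vert_above v m"
  by (auto simp: inner_def vert_below_def vert_above_def)

lemma level_code_inner:
  assumes "l \<in> inner m v"
  shows "level_code m v l = 15 + l"
proof -
  have l: "0 < l" "6 + (l - 1) \<notin> v" "\<not> vert_below m v l"
    using assms by (auto simp: inner_def add.commute)
  have "\<not> vert_above v l"
    unfolding vert_above_def using l(1,2) by (metis diff_less zero_less_one)
  moreover have "Max {j. j < l \<and> 6 + j \<notin> v} = l - 1" using l by (intro Max_eqI) auto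
  ultimately show ?thesis using l by (simp add: level_code_def)
qed

lemma point_code_inner: "l \<in> inner m v ==> point_code m v (2, l, s) = 15 + l"
  using level_code_inner inner_not_vert_above by simp

lemma level_code_codes: "level_code m v l \<in> codes m v"
proof (cases "vert_above v l \<or> vert_below m v l")
  case True
  then show ?thesis by (auto simp: level_code_def codes_def)
next
  case False
  define h where "h = Max {j. j < l \<and> 6 + j \<notin> v}"
  have "{j. j < l \<and> 6 + j \<notin> v} \<noteq> {}" using False by (auto simp: vert_above_def)
  then have h: "h < l" "6 + h \<notin> v" using Max_in[of "{j. j < l \<and> 6 + j \<notin> v}"] by (auto simp: h_def)
  have "\<not> vert_below m v (Suc h)"
    using False h(1) by (auto simp: vert_below_def dest!: Suc_leI intro: order.trans)
  then have "Suc h \<in> inner m v" using h by (simp add: inner_def add.commute)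
  moreover have "level_code m v l = 15 + Suc h" using False by (simp add: level_code_def h_def)
  ultimately show ?thesis by (auto simp: codes_def)
qed

lemma point_code_codes:
  assumes "p \<in> points (PD m)"
  shows "point_code m v p \<in> codes m v"
proof -
  obtain i l s where p: "p = (i, l, s)" by (cases p)
  consider "i < 2" "l \<le> 3" | "i = 2" using assms by (auto simp: p points_pretzel)
  then show ?thesis
  proof cases
    case 1
    then have "8 * i + 2 * l + of_bool s < 16" by (cases s) auto
    then show ?thesis using 1 by (simp add: p codes_def)
  next
    case 2
    then show ?thesis using level_code_codes by (simp add: p) (simp add: codes_def)
  qed
qed

lemma point_of_codes:
  assumes "c \<in> codes m v"
  shows "point_code m v (point_of c) = c" "point_of c \<in> points (PD m)"
proof -
  consider "c < 16" | l where "l \<in> inner m v" "c = 15 + l" using assms by (auto simp: codes_def)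
  then have "point_code m v (point_of c) = c \<and> point_of c \<in> points (PD m)"
  proof cases
    case 1
    then show ?thesis using point_code_point_of point_of_in_points by blast
  next
    case (2 l)
    then have "point_of c = (2, l, False)" using inner_bounds[of l] by (simp add: point_of_def)
    then show ?thesis using 2 point_code_inner inner_bounds[OF 2(1)] by (simp add: points_pretzel del: point_code.simps)
  qed
  then show "point_code m v (point_of c) = c" "point_of c \<in> points (PD m)" by auto
qed

lemma point_of_inner: "l \<in> inner m v ==> point_of (15 + l) = (2, l, False)"
  using inner_bounds[of l] by (simp add: point_of_def)

text \<open>A generator of the pretzel complex splits into a generator of the model,
  \<open>core\<close>, and the set of inner circles labelled X, \<open>mid\<close>;
  \<open>cell\<close> reassembles the two.\<close>

definition core :: "nat => nat set \<times> ppoint set => nat set \<times> nat set" where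
  "core m s = (model_state m (fst s), {c. c < 16 \<and> point_of c \<in> snd s})"

definition mid :: "nat => nat set \<times> ppoint set => nat set" where
  "mid m s = {l \<in> inner m (fst s). (2, l, False) \<in> snd s}"

definition cell :: "nat => nat set => nat set \<times> nat set => nat set \<times> ppoint set" where
  "cell m v t = (v, {p \<in> points (PD m). point_code m v p \<in> fst t \<union> (+) 15 ` snd t})"

lemma core_mid_iff:
  assumes "c \<in> codes m v"
  shows "c \<in> snd (core m (v, A)) \<union> (+) 15 ` mid m (v, A) <-> point_of c \<in> A"
proof -
  consider "c < 16" | l where "l \<in> inner m v" "c = 15 + l" using assms by (auto simp: codes_def)
  then show ?thesis
  proof cases
    case 1
    then show ?thesis using inner_bounds[of _ m v] by (force simp: core_def mid_def)
  next
    case (2 l)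
    then show ?thesis using inner_bounds[of l m v] by (auto simp: core_def mid_def point_of_inner)
  qed
qed

lemma saturated_mem_iff:
  assumes "saturated (PD m) v A" "p \<in> points (PD m)"
  shows "p \<in> A <-> point_code m v p \<in> snd (core m (v, A)) \<union> (+) 15 ` mid m (v, A)"
  unfolding core_mid_iff[OF point_code_codes[OF assms(2)]]
  by (rule saturatedD[OF assms(1) conn_point_of_code[OF assms(2)]])

lemma cell_core_mid:
  assumes "saturated (PD m) v A"
  shows "cell m v (snd (core m (v, A)), mid m (v, A)) = (v, A)"
  using saturated_mem_iff[OF assms] saturated_subset[OF assms] by (auto simp: cell_def)

lemma saturated_core:
  assumes "saturated (PD m) v A"
  shows "saturated model (model_state m v) (snd (core m (v, A)))"
  unfolding saturated_def
proof (intro conjI allI impI)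
  fix c c' assume c: "(c, c') \<in> conn model (model_state m v)" "c \<in> snd (core m (v, A))"
  have "(point_of c, point_of c') \<in> conn (PD m) v" by (rule conn_model_imp_PD[OF c(1)])
  then show "c' \<in> snd (core m (v, A))"
    using c conn_points[OF c(1)] saturatedD[OF assms] by (auto simp: core_def points_model)
qed (auto simp: core_def points_model)

lemma conn_model_code:
  "(c, c') \<in> conn model u ==> \<not> c < 16 ==> c' = c"
  by (rule conn_outside) (auto simp: points_model)

lemma saturated_cell:
  assumes "saturated model (model_state m v) B" "T \<subseteq> inner m v"
  shows "saturated (PD m) v (snd (cell m v (B, T)))"
  unfolding saturated_def
proof (intro conjI allI impI)
  fix p q assume pq: "(p, q) \<in> conn (PD m) v" "p \<in> snd (cell m v (B, T))"
  have pts: "p \<in> points (PD m)" "q \<in> points (PD m)"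
    using pq conn_points[OF pq(1)] by (auto simp: cell_def)
  have c: "(point_code m v p, point_code m v q) \<in> conn model (model_state m v)"
    by (rule conn_PD_imp_model[OF pq(1)])
  have "point_code m v p \<in> B \<union> (+) 15 ` T" using pq(2) by (simp add: cell_def)
  then have "point_code m v q \<in> B \<union> (+) 15 ` T"
  proof
    assume "point_code m v p \<in> B"
    then show ?thesis using saturatedD[OF assms(1) c] by blast
  next
    assume "point_code m v p \<in> (+) 15 ` T"
    moreover from this have "point_code m v q = point_code m v p"
      using conn_model_code[OF c] assms(2) inner_bounds[of _ m v] by fastforce
    ultimately show ?thesis by simp
  qed
  then show "q \<in> snd (cell m v (B, T))" using pts by (simp add: cell_def)
qed (auto simp: cell_def)

lemma core_cell:
  assumes "B \<subseteq> {..<16}" "T \<subseteq> inner m v"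
  shows "snd (core m (cell m v (B, T))) = B" "mid m (cell m v (B, T)) = T"
proof -
  have "15 + l \<notin> B" if "l \<in> inner m v" for l using assms inner_bounds[OF that] by auto
  then have "mid m (cell m v (B, T)) = T"
    using assms(2) point_code_inner[of _ m v] inner_bounds[of _ m v]
    by (auto simp: mid_def cell_def points_pretzel simp del: point_code.simps) fastforce+
  moreover have "c \<notin> (+) 15 ` T" if "c < 16" for c
    using assms(2) inner_bounds[of _ m v] that by fastforce
  then have "c < 16 \<and> (c \<in> B \<or> c \<in> (+) 15 ` T) <-> c \<in> B" for c
    using assms(1) by blast
  then have "snd (core m (cell m v (B, T))) = B"
    using point_of_in_points point_code_point_of by (simp add: core_def cell_def cong: conj_cong)
  ultimately show "snd (core m (cell m v (B, T))) = B" "mid m (cell m v (B, T)) = T" by auto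
qed

text \<open>Circles of different diagrams are compared through a common set of indices: two families
  with the same coincidences have equal sums.\<close>

lemma sum_image_cong:
  assumes "\<And>c d. c \<in> K ==> d \<in> K ==> F c = F d <-> G c = G d"
    and "\<And>c. c \<in> K ==> f (F c) = g (G c)"
  shows "sum f (F ` K) = sum g (G ` K)"
proof -
  define h where "h C = G (SOME c. c \<in> K \<and> F c = C)" for C
  have h: "h (F c) = G c" if "c \<in> K" for c
  proof -
    have "(SOME d. d \<in> K \<and> F d = F c) \<in> K \<and> F (SOME d. d \<in> K \<and> F d = F c) = F c"
      by (rule someI[of _ c]) (use that in auto)
    then show ?thesis using assms(1) that by (auto simp: h_def)
  qed
  have "bij_betw h (F ` K) (G ` K)"
    using h assms(1) by (auto simp: bij_betw_def inj_on_def image_image)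
  then have "sum g (G ` K) = (\<Sum>C\<in>F ` K. g (h C))" by (rule sum.reindex_bij_betw[symmetric])
  also have "\<dots> = sum f (F ` K)" by (rule sum.cong) (auto simp: h assms(2))
  finally show ?thesis ..
qed

lemma cls_subset_iff: "saturated D v A ==> cls D v p \<subseteq> A <-> p \<in> A"
  using saturated_cls_subset by fastforce

lemma circles_PD: "circles (PD m) v = (\<lambda>c. cls (PD m) v (point_of c)) ` codes m v"
proof -
  have "cls (PD m) v p \<in> (\<lambda>c. cls (PD m) v (point_of c)) ` codes m v" if "p \<in> points (PD m)" for p
    using that by (intro image_eqI[OF _ point_code_codes]) (simp_all add: cls_eq_iff conn_point_of_code)
  then show ?thesis by (auto simp: circles_eq point_of_codes)
qed

text \<open>The circles are those of the model state together with one for each inner level. An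
  inner circle contributes 1, or 1 - 2 if labelled X, and the weights of the two smoothings are
  exchanged for each other.\<close>

lemma qdeg_PD:
  assumes sat: "saturated (PD m) v A"
  shows "qdeg (PD m) (v, A) + int (card (model_state m v)) + 2 * int (card (mid m (v, A)))
    = qdeg model (core m (v, A)) + int (card v) + int (card (inner m v))"
proof -
  let ?u = "model_state m v" and ?B = "snd (core m (v, A))" and ?T = "mid m (v, A)"
  let ?f = "\<lambda>C. if C \<subseteq> A then -1 else 1 :: int"
  let ?g = "\<lambda>E. if E \<subseteq> ?B \<union> (+) 15 ` ?T then -1 else 1 :: int"
  have iff: "(point_of c, point_of d) \<in> conn (PD m) v <-> (c, d) \<in> conn model ?u"
    if "c \<in> codes m v" "d \<in> codes m v" for c d
    using conn_PD_iff[OF point_of_codes(2)[OF that(1)] point_of_codes(2)[OF that(2)]]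
    by (simp only: point_of_codes(1)[OF that(1)] point_of_codes(1)[OF that(2)])
  have B: "?B \<subseteq> {..<16}" by (auto simp: core_def)
  have T: "?T \<subseteq> inner m v" by (auto simp: mid_def)
  have sing: "cls model ?u (15 + l) = {15 + l}" if "l \<in> inner m v" for l
    using inner_bounds[OF that] conn_model_code[of "15 + l" _ ?u] by (auto simp: in_cls)
  have low: "cls model ?u c \<subseteq> {..<16}" if "c < 16" for c
    using cls_subset[of c model ?u] that by (simp add: points_model)
  have low_disj: "{..<16} \<inter> (+) 15 ` T' = {}" if "T' \<subseteq> inner m v" for T'
    using that inner_bounds[of _ m v] by fastforce
  have low_iff: "C \<subseteq> ?B \<union> (+) 15 ` ?T <-> C \<subseteq> ?B" if "C \<subseteq> {..<16}" for C
    using low_disj[OF T] that by blast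
  have inner_iff: "15 + l \<in> ?B \<union> (+) 15 ` ?T <-> l \<in> ?T" if "l \<in> inner m v" for l
    using B inner_bounds[OF that] by auto
  have "(\<Sum>C\<in>circles (PD m) v. ?f C) = (\<Sum>E\<in>cls model ?u ` codes m v. ?g E)"
    unfolding circles_PD
  proof (rule sum_image_cong)
    fix c assume c: "c \<in> codes m v"
    have "cls model ?u c \<subseteq> ?B \<union> (+) 15 ` ?T <-> c \<in> ?B \<union> (+) 15 ` ?T"
    proof -
      consider "c < 16" | l where "l \<in> inner m v" "c = 15 + l" using c by (auto simp: codes_def)
      then show ?thesis
      proof cases
        case 1
        then have "c \<in> ?B \<union> (+) 15 ` ?T <-> c \<in> ?B" using low_iff[of "{c}"] by simp
        then show ?thesis
          using low_iff[OF low[OF 1]] cls_subset_iff[OF saturated_core[OF sat]] by blast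
      next
        case (2 l)
        then show ?thesis by (simp add: sing)
      qed
    qed
    then show "?f (cls (PD m) v (point_of c)) = ?g (cls model ?u c)"
      using cls_subset_iff[OF sat] core_mid_iff[OF c] by simp
  qed (simp add: cls_eq_iff iff)
  also have "cls model ?u ` codes m v = circles model ?u \<union> (\<lambda>l. {15 + l}) ` inner m v"
    by (simp add: codes_def image_Un circles_eq points_model image_image sing cong: image_cong)
  also have "(\<Sum>E\<in>circles model ?u \<union> (\<lambda>l. {15 + l}) ` inner m v. ?g E)
    = (\<Sum>E\<in>circles model ?u. ?g E) + (\<Sum>E\<in>(\<lambda>l. {15 + l}) ` inner m v. ?g E)"
  proof (rule sum.union_disjoint)
    show "circles model ?u \<inter> (\<lambda>l. {15 + l}) ` inner m v = {}"
      using low low_disj[OF order.refl] by (force simp: circles_eq points_model)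
  qed (auto simp: finite_circles)
  also have "(\<Sum>E\<in>circles model ?u. ?g E) = (\<Sum>E\<in>circles model ?u. if E \<subseteq> ?B then -1 else 1)"
  proof (rule sum.cong[OF refl])
    fix E assume "E \<in> circles model ?u"
    then have "E \<subseteq> {..<16}" using low by (auto simp: circles_eq points_model)
    then show "?g E = (if E \<subseteq> ?B then -1 else 1)" using low_iff by simp
  qed
  also have "(\<Sum>E\<in>(\<lambda>l. {15 + l}) ` inner m v. ?g E) = (\<Sum>l\<in>inner m v. if l \<in> ?T then -1 else 1)"
  proof (subst sum.reindex)
    show "(\<Sum>l\<in>inner m v. (?g \<circ> (\<lambda>l. {15 + l})) l) = (\<Sum>l\<in>inner m v. if l \<in> ?T then -1 else 1)"
      by (rule sum.cong[OF refl]) (use inner_iff in simp)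
  qed (auto simp: inj_on_def)
  also have "\<dots> = int (card (inner m v)) - 2 * int (card ?T)"
  proof -
    have "(\<Sum>l\<in>inner m v. if l \<in> ?T then -1 else 1 :: int) = (\<Sum>l\<in>inner m v. 1 - 2 * of_bool (l \<in> ?T))"
      by (rule sum.cong) auto
    also have "\<dots> = int (card (inner m v)) - 2 * int (card (inner m v \<inter> {l. l \<in> ?T}))"
      by (simp add: sum_subtractf sum_distrib_left[symmetric] sum.If_cases of_bool_def)
    also have "inner m v \<inter> {l. l \<in> ?T} = ?T" using T by auto
    finally show ?thesis .
  qed
  finally show ?thesis by (simp add: qdeg_def) (simp add: core_def)
qed

text \<open>All data of the third column depend only on the crossings from 6 on; the next lemmas
  record this so that column patterns can be treated as sets \<open>K\<close>.\<close>

lemma vert_above_col: "vert_above (v \<inter> {6..}) l <-> vert_above v l"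
  by (simp add: vert_above_def)

lemma vert_below_col: "vert_below m (v \<inter> {6..}) l <-> vert_below m v l"
  by (simp add: vert_below_def)

lemma inner_col: "inner m (v \<inter> {6..}) = inner m v"
  by (auto simp: inner_def vert_below_col)

lemma point_code_col: "point_code m (v \<inter> {6..}) p = point_code m v p"
  by (cases p) (simp add: level_code_def vert_above_col vert_below_col)

lemma low_insert: "k < 6 ==> insert k v \<inter> {6..} = v \<inter> {6::nat..}"
  by auto

lemma col_eq:
  assumes "v \<inter> {6..} = w \<inter> {6..}"
  shows "vert_above v l = vert_above w l" "inner m v = inner m w" "point_code m v p = point_code m w p"
  using assms by (metis vert_above_col, metis inner_col, metis point_code_col)

lemma model_state_insert_low: "k < 6 ==> model_state m (insert k v) = insert k (model_state m v)"
  using col_eq(1)[OF low_insert, of k v m] by (auto simp: model_state_def)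

text \<open>Changing a crossing of the first two columns changes no code. Inner circles have codes
  from 16 on, never meet such a crossing and keep their labels.\<close>

lemma edge_low:
  assumes k: "k < 6"
    and sat: "saturated (PD m) v A" "saturated (PD m) (insert k v) A'"
  shows "edge (PD m) v k A A' <->
    edge model (model_state m v) k (snd (core m (v, A))) (snd (core m (insert k v, A'))) \<and>
    mid m (v, A) = mid m (insert k v, A')"
proof -
  let ?u = "model_state m v" and ?w = "insert k v"
  obtain a b c d where cr: "crossings model ! k = (a, b, c, d)" by (cases "crossings model ! k")
  note pts = crossing_point_of[OF k cr]
  have iff: "(p, point_of x) \<in> conn (PD m) v <-> (point_code m v p, x) \<in> conn model ?u"
    if "p \<in> points (PD m)" "x < 16" for p x
    using conn_PD_iff[OF that(1) point_of_in_points[OF that(2)], of v] point_code_point_of[OF that(2), of m v] by simp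
  have cw: "point_code m ?w p = point_code m v p" and iw: "inner m ?w = inner m v" for p
    using col_eq[OF low_insert[OF k, of v]] by auto
  have mid_eq: "mid m (v, A) = mid m (?w, A') <-> (\<forall>l\<in>inner m v. (2, l, False) \<in> A' <-> (2, l, False) \<in> A)"
    by (auto simp: mid_def iw)
  have pw: "(\<forall>p\<in>points (PD m). (p, point_of a) \<notin> conn (PD m) v --> (p, point_of c) \<notin> conn (PD m) v --> (p \<in> A' <-> p \<in> A))
    <-> (\<forall>x<16. (x, a) \<notin> conn model ?u --> (x, c) \<notin> conn model ?u --> (point_of x \<in> A' <-> point_of x \<in> A))
      \<and> mid m (v, A) = mid m (?w, A')" (is "?L <-> ?R")
  proof
    assume L: ?L
    have "(2, l, False) \<in> A' <-> (2, l, False) \<in> A" if l: "l \<in> inner m v" for l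
    proof -
      have c: "point_code m v (2, l, False) = 15 + l" by (rule point_code_inner[OF l])
      have p: "(2, l, False) \<in> points (PD m)" using inner_bounds[OF l] by (simp add: points_pretzel)
      have "(15 + l, x) \<notin> conn model ?u" if "x < 16" for x
        using conn_model_code[of "15 + l" x ?u] inner_bounds[OF l] that by fastforce
      then have "((2, l, False), point_of a) \<notin> conn (PD m) v" "((2, l, False), point_of c) \<notin> conn (PD m) v"
        using iff[OF p] pts c by (simp_all del: point_code.simps)
      then show ?thesis using L p by blast
    qed
    moreover have "point_of x \<in> A' <-> point_of x \<in> A"
      if x: "x < 16" "(x, a) \<notin> conn model ?u" "(x, c) \<notin> conn model ?u" for x
    proof -
      have "(point_of x, point_of a) \<notin> conn (PD m) v" "(point_of x, point_of c) \<notin> conn (PD m) v"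
        using iff[OF point_of_in_points[OF x(1)]] pts x point_code_point_of[OF x(1), of m v] by simp_all
      then show ?thesis using L point_of_in_points[OF x(1)] by blast
    qed
    ultimately show ?R unfolding mid_eq by blast
  next
    assume R: ?R
    show ?L
    proof (intro ballI impI)
      fix p assume p: "p \<in> points (PD m)" "(p, point_of a) \<notin> conn (PD m) v" "(p, point_of c) \<notin> conn (PD m) v"
      let ?x = "point_code m v p"
      have n: "(?x, a) \<notin> conn model ?u" "(?x, c) \<notin> conn model ?u" using iff[OF p(1)] p pts by simp_all
      have "p \<in> A <-> point_of ?x \<in> A" by (rule saturatedD[OF sat(1) conn_point_of_code[OF p(1)]])
      moreover have "p \<in> A' <-> point_of ?x \<in> A'"
        using saturatedD[OF sat(2) conn_point_of_code[OF p(1)]] cw by simp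
      moreover have "point_of ?x \<in> A' <-> point_of ?x \<in> A"
      proof -
        have "?x < 16 \<or> (\<exists>l\<in>inner m v. ?x = 15 + l)"
          using point_code_codes[OF p(1), of v] by (auto simp: codes_def)
        then show ?thesis
        proof
          assume "?x < 16" then show ?thesis using R n by blast
        next
          assume "\<exists>l\<in>inner m v. ?x = 15 + l"
          then obtain l where l: "l \<in> inner m v" "?x = 15 + l" by blast
          have "(2, l, False) \<in> A' <-> (2, l, False) \<in> A" using R[unfolded mid_eq] l(1) by blast
          then show ?thesis unfolding l(2) point_of_inner[OF l(1)] .
        qed
      qed
      ultimately show "p \<in> A' <-> p \<in> A" by blast
    qed
  qed
  have ac: "(point_of a, point_of c) \<in> conn (PD m) v <-> (a, c) \<in> conn model ?u"
    using iff[OF point_of_in_points] pts point_code_point_of by simp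
  have core: "x \<in> snd (core m (v', A'')) <-> point_of x \<in> A''" if "x < 16" for x v' A''
    using that by (simp add: core_def)
  show ?thesis
    unfolding edge_def pts(1) cr prod.case pw ac core[OF pts(2)] core[OF pts(4)]
    by (auto simp: points_model core)
qed

lemma cells_PD: "s \<in> cells (PD m) <-> fst s \<subseteq> {..<6 + m} \<and> saturated (PD m) (fst s) (snd s)"
  by (cases s) (simp add: cells_def n_crossings_pretzel)

lemma edge_sign_model_state: "k \<le> 6 ==> edge_sign (model_state m v) k = edge_sign v k"
  unfolding edge_sign_def by (rule arg_cong[where f = "\<lambda>n. (-1) ^ card n"]) (auto simp: model_state_def)

lemma dmat_low:
  assumes s: "s \<in> cells (PD m)" "t \<in> cells (PD m)" and col: "fst s \<inter> {6..} = fst t \<inter> {6..}"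
  shows "dmat (PD m) s t = dmat model (core m s) (core m t) * of_bool (mid m s = mid m t)"
proof -
  obtain v A w A' where st: "s = (v, A)" "t = (w, A')" by (cases s, cases t)
  have sat: "saturated (PD m) v A" "saturated (PD m) w A'" using s by (auto simp: st cells_PD)
  have col': "v \<inter> {6..} = w \<inter> {6..}" using col by (simp add: st)
  show ?thesis
  proof (cases "\<exists>k<6. k \<notin> v \<and> w = insert k v")
    case True
    then obtain k where k: "k < 6" "k \<notin> v" "w = insert k v" by blast
    have ms: "core m s = (model_state m v, snd (core m (v, A)))"
      "core m t = (insert k (model_state m v), snd (core m (insert k v, A')))"
      using model_state_insert_low[OF k(1)] by (simp_all add: core_def st k(3))
    have "k \<notin> model_state m v" using k by (simp add: model_state_low)
    then show ?thesis
      unfolding ms using k dmat_insert[of k "PD m" v A A']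
        dmat_insert[of k model "model_state m v" "snd (core m (v, A))" "snd (core m (insert k v, A'))"]
        edge_low[OF k(1) sat[unfolded k(3)]]
      by (simp add: st n_crossings_pretzel n_crossings_model edge_sign_model_state)
  next
    case False
    have "dmat (PD m) s t = 0"
    proof (rule ccontr)
      assume "dmat (PD m) s t \<noteq> 0"
      then obtain k where k: "k \<notin> v" "w = insert k v" unfolding st by (rule dmat_nonzero)
      have "k < 6"
      proof (rule ccontr)
        assume "\<not> k < 6"
        then have "k \<in> w \<inter> {6..}" using k by simp
        then show False using col' k(1) by blast
      qed
      then show False using False k by blast
    qed
    moreover have "dmat model (core m s) (core m t) = 0"
    proof (rule ccontr)
      assume "dmat model (core m s) (core m t) \<noteq> 0"
      then obtain k where k: "k < 7" "k \<notin> model_state m v" "model_state m w = insert k (model_state m v)"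
        unfolding st core_def fst_conv snd_conv by (elim dmat_nonzero) (simp add: n_crossings_model)
      have "k \<noteq> 6" using k(2,3) col_eq(1)[OF col', of m] model_state_6 by blast
      then have k6: "k < 6" using k(1) by simp
      have low: "x \<in> w <-> x = k \<or> x \<in> v" if "x < 6" for x
        using k(3) model_state_low[OF that] by blast
      have "x \<in> w <-> x \<in> insert k v" for x
      proof (cases "x < 6")
        case False
        then have "x \<in> w <-> x \<in> w \<inter> {6..}" "x \<in> v <-> x \<in> v \<inter> {6..}" by auto
        then show ?thesis using False k6 unfolding col' by auto
      qed (use low in simp)
      then have "w = insert k v" by blast
      moreover have "k \<notin> v" using k(2) k6 by (simp add: model_state_low)
      ultimately show False using False k6 by blast
    qed
    ultimately show ?thesis by simp
  qed
qed

text \<open>Without a choice of labels on inner circles, a column pattern \<open>K\<close> leaves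
  exactly a copy of one part of the model.\<close>

definition xcells :: "nat => nat set => int => int => (nat set \<times> ppoint set) set" where
  "xcells m K j i = {s \<in> gcells (PD m) j i. fst s \<inter> {6..} = K \<and> mid m s = inner m K}"

definition xcell :: "nat => nat set => nat set \<times> nat set => nat set \<times> ppoint set" where
  "xcell m K t = cell m (fst t \<inter> {..<6} \<union> K) (snd t, inner m K)"

lemma card_split_col:
  assumes "finite v" "v \<inter> {6..} = K"
  shows "card v = card (v \<inter> {..<6::nat}) + card K"
proof -
  have "v = (v \<inter> {..<6}) \<union> K" "(v \<inter> {..<6}) \<inter> K = {}" using assms(2) by auto
  moreover have "finite K" using assms by auto
  ultimately show ?thesis using assms(1) by (metis card_Un_disjoint finite_Int)
qed

lemma card_model_state: "card (model_state m v) = card (v \<inter> {..<6}) + of_bool (vert_above v m)"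
  by (simp add: model_state_def)

lemma core_in_model_part:
  assumes s: "s \<in> cells (PD m)" and K: "fst s \<inter> {6..} = K" "mid m s = inner m K"
  shows "core m s \<in> model_part (vert_above K m) j i <->
    s \<in> gcells (PD m) (j + int (card K) - of_bool (vert_above K m) - int (card (inner m K))) (i + int (card K))"
proof -
  obtain v A where vA: "s = (v, A)" by (cases s)
  have v: "v \<subseteq> {..<6 + m}" "saturated (PD m) v A" using s by (auto simp: vA cells_PD)
  have K': "v \<inter> {6..} = K" using K by (simp add: vA)
  have fin: "finite v" using v(1) by (rule finite_subset) simp
  have va: "vert_above v m = vert_above K m" and inn: "inner m v = inner m K"
    using vert_above_col[of v m] inner_col[of m v] by (simp_all add: K')
  have "core m s \<in> cells model"
    using saturated_core[OF v(2)] by (auto simp: vA cells_def core_def n_crossings_model model_state_def)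
  moreover have "6 \<in> fst (core m s) <-> vert_above K m" by (simp add: vA core_def model_state_6 va)
  moreover have "card (fst (core m s)) + card K = card v + of_bool (vert_above K m)"
    using card_split_col[OF fin K'] card_model_state[of m v] by (simp add: vA core_def va)
  moreover have "qdeg (PD m) s + int (card (model_state m v)) + int (card (inner m K))
      = qdeg model (core m s) + int (card v)"
    using qdeg_PD[OF v(2)] K(2) by (simp add: vA inn)
  moreover have "card (model_state m v) + card K = card v + of_bool (vert_above K m)"
    using card_split_col[OF fin K'] card_model_state[of m v] by (simp add: va)
  ultimately show ?thesis
    using s unfolding model_part_def gcells_def by (auto simp: vA)
qed

lemma xcell_core:
  assumes "s \<in> cells (PD m)" "fst s \<inter> {6..} = K" "mid m s = inner m K"
  shows "xcell m K (core m s) = s"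
proof -
  have "fst (core m s) \<inter> {..<6} \<union> K = fst s" using assms(2) by (auto simp: core_def model_state_def)
  then show ?thesis
    using cell_core_mid[of m "fst s" "snd s"] assms by (simp add: xcell_def cells_PD)
qed

lemma xcell_props:
  assumes K: "K \<subseteq> {6..<6 + m}" and t: "t \<in> model_part (vert_above K m) j i"
  shows "xcell m K t \<in> cells (PD m)" "fst (xcell m K t) \<inter> {6..} = K" "mid m (xcell m K t) = inner m K"
    "core m (xcell m K t) = t" "fst (xcell m K t) = fst t \<inter> {..<6} \<union> K"
proof -
  let ?v = "fst t \<inter> {..<6} \<union> K"
  show f: "fst (xcell m K t) = ?v" by (simp add: xcell_def cell_def)
  then show col: "fst (xcell m K t) \<inter> {6..} = K" using K by auto
  have colv: "?v \<inter> {6..} = K" using K by auto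
  have t': "fst t \<subseteq> {..<7}" "saturated model (fst t) (snd t)" "6 \<in> fst t <-> vert_above K m"
    using t by (auto simp: model_part_def gcells_def cells_def n_crossings_model)
  have x6: "x < 6 \<or> x = 6" if "x \<in> fst t" for x using t'(1) that by fastforce
  have va: "vert_above ?v m = vert_above K m" and inn: "inner m ?v = inner m K"
    using vert_above_col[of ?v m] inner_col[of m ?v] by (simp_all only: colv)
  have ms: "model_state m ?v = fst t"
    unfolding model_state_def va using t'(3) x6 K by (auto split: if_splits)
  show "xcell m K t \<in> cells (PD m)"
    using saturated_cell[of m ?v "snd t" "inner m K"] t'(2) K f unfolding ms inn
    by (auto simp: cells_PD xcell_def)
  have B: "snd t \<subseteq> {..<16}" using saturated_subset[OF t'(2)] by (simp add: points_model)
  show "mid m (xcell m K t) = inner m K" unfolding xcell_def using core_cell(2)[OF B] inn by simp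
  have "snd (core m (xcell m K t)) = snd t" unfolding xcell_def using core_cell(1)[OF B] inn by simp
  moreover have "fst (core m (xcell m K t)) = fst t" by (simp add: core_def f ms)
  ultimately show "core m (xcell m K t) = t" by (simp add: prod_eq_iff)
qed

text \<open>Each vertical crossing of \<open>K\<close> raises both degrees by one. The correction
  \<open>of_bool\<close> is the quantum weight that the model already counts for crossing 6, and
  each inner circle, labelled X, contributes -1.\<close>

lemma bij_xcell:
  assumes K: "K \<subseteq> {6..<6 + m}" and j': "j' = j + int (card K) - of_bool (vert_above K m) - int (card (inner m K))"
    and i': "i' = i + int (card K)"
  shows "bij_betw (xcell m K) (model_part (vert_above K m) j i) (xcells m K j' i')"
proof (rule bij_betw_byWitness[where f' = "core m"])
  show "\<forall>t\<in>model_part (vert_above K m) j i. core m (xcell m K t) = t"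
    using xcell_props(4)[OF K] by blast
  show "\<forall>s\<in>xcells m K j' i'. xcell m K (core m s) = s"
    by (auto simp: xcells_def gcells_def intro!: xcell_core)
  show "xcell m K ` model_part (vert_above K m) j i \<subseteq> xcells m K j' i'"
  proof
    fix s assume "s \<in> xcell m K ` model_part (vert_above K m) j i"
    then obtain t where t: "t \<in> model_part (vert_above K m) j i" "s = xcell m K t" by blast
    note x = xcell_props[OF K t(1)]
    show "s \<in> xcells m K j' i'"
      using core_in_model_part[OF x(1-3), of j i] x(2-4) t(1) by (simp add: xcells_def j' i' t(2))
  qed
  show "core m ` xcells m K j' i' \<subseteq> model_part (vert_above K m) j i"
    using core_in_model_part[of _ m K j i] by (auto simp: xcells_def j' i' gcells_def)
qed

lemma dmat_xcell:
  assumes K: "K \<subseteq> {6..<6 + m}"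
    and s: "s \<in> model_part (vert_above K m) j i" and t: "t \<in> model_part (vert_above K m) j' i'"
  shows "dmat (PD m) (xcell m K s) (xcell m K t) = dmat model s t"
  using dmat_low[OF xcell_props(1)[OF K s] xcell_props(1)[OF K t]] xcell_props(2-4)[OF K s] xcell_props(2-4)[OF K t]
  by simp

lemma betti_bound_xcells:
  assumes K: "K \<subseteq> {6..<6 + m}"
    and c: "\<And>i. c i = model_betti_int (vert_above K m)
      (j - int (card K) + of_bool (vert_above K m) + int (card (inner m K))) (i - int (card K))"
  shows "betti_bound (dmat (PD m)) (xcells m K j) c"
  by (rule betti_bound_transport[OF betti_bound_model finite_model_part bij_xcell[OF K] dmat_xcell[OF K] c]) auto

text \<open>The pattern starting at 7 leaves only the first crossing of the column horizontal. Its
  two ends used by \<open>edge\<close> have codes 0 and 15, so changing it is changing crossing 6 of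
  the model.\<close>

lemma edge_saddle:
  assumes m: "m > 0" and v: "v \<inter> {6..} = {7..<6 + m}"
    and sat: "saturated (PD m) v A" "saturated (PD m) (insert 6 v) A'"
  shows "edge (PD m) v 6 A A' <->
    edge model (model_state m v) 6 (snd (core m (v, A))) (snd (core m (insert 6 v, A')))"
proof -
  let ?u = "model_state m v" and ?w = "insert 6 v" and ?a = "(2, 0, True) :: ppoint" and ?c = "(2, Suc 0, False) :: ppoint"
  have in_v: "6 + j \<in> v <-> 0 < j \<and> j < m" for j
  proof -
    have "6 + j \<in> v <-> 6 + j \<in> v \<inter> {6..}" by simp
    then show ?thesis unfolding v by auto
  qed
  have n6: "6 \<notin> v" using in_v[of 0] by simp
  have va: "\<not> vert_above v m" "vert_above v 0" "\<not> vert_above v (Suc l)" "vert_below m v (Suc l)" for l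
    using m in_v n6 by (auto simp: vert_above_def vert_below_def)
  have wa: "vert_above ?w m"
  proof -
    have "6 + j \<in> ?w" if "j < m" for j using in_v[of j] that by (cases j) auto
    then show ?thesis by (simp add: vert_above_def)
  qed
  have code: "point_code m v (2, l, s) = (if l = 0 then 0 else 15)" for l s
    using va by (cases l) (simp_all add: level_code_def)
  have pts: "?a \<in> points (PD m)" "?c \<in> points (PD m)" using m by (auto simp: points_pretzel)
  have P: "point_of 0 = (0, 0, False)" "point_of 9 = (1, 0, True)" "point_of 15 = (1, 3, True)"
    by (simp_all add: point_of_def)
  have iff: "(p, ?a) \<in> conn (PD m) v <-> (point_code m v p, 0) \<in> conn model ?u"
    "(p, ?c) \<in> conn (PD m) v <-> (point_code m v p, 15) \<in> conn model ?u"
    if "p \<in> points (PD m)" for p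
    using conn_PD_iff[OF that pts(1), of v] conn_PD_iff[OF that pts(2), of v] code by simp_all
  have pw: "(\<forall>p\<in>points (PD m). (p, ?a) \<notin> conn (PD m) v --> (p, ?c) \<notin> conn (PD m) v --> (p \<in> A' <-> p \<in> A))
    <-> (\<forall>x<16. (x, 0) \<notin> conn model ?u --> (x, 15) \<notin> conn model ?u --> (point_of x \<in> A' <-> point_of x \<in> A))"
    (is "?L <-> ?R")
  proof
    assume L: ?L
    show ?R
      using L point_of_in_points iff[OF point_of_in_points] point_code_point_of by (metis (no_types, lifting))
  next
    assume R: ?R
    show ?L
    proof (intro ballI impI)
      fix p assume p: "p \<in> points (PD m)" "(p, ?a) \<notin> conn (PD m) v" "(p, ?c) \<notin> conn (PD m) v"
      let ?x = "point_code m v p"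
      have n: "(?x, 0) \<notin> conn model ?u" "(?x, 15) \<notin> conn model ?u" using iff[OF p(1)] p by auto
      obtain i l s where p': "p = (i, l, s)" by (cases p)
      have "i \<noteq> 2" using n code[of l s] by (auto simp: p' split: if_splits)
      then have i: "i < 2" "l \<le> 3" using p(1) by (auto simp: p' points_pretzel)
      then have "?x < 16" by (cases s) (auto simp: p')
      then show "p \<in> A' <-> p \<in> A" using R n point_of_point_code[OF i, of m v s] by (metis p')
    qed
  qed
  have arcs: "(?a, point_of 0) \<in> conn (PD m) v'" for v' by (rule conn_arcs) (simp add: arcs_PD P)
  have "(?c, point_of 15) \<in> conn (PD m) v" using conn_point_of_code[OF pts(2), of v] code[of "Suc 0" False] by simp
  \<comment> \<open>In the vertical column the code of \<open>?c\<close> is 9, not 15, but the left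
    strand connects the two.\<close>
  moreover have "(?c, point_of 15) \<in> conn (PD m) ?w"
  proof -
    have "(?c, point_of 9) \<in> conn (PD m) ?w" using conn_point_of_code[OF pts(2), of ?w] wa by simp
    then show ?thesis using conn_full(2)[OF wa] unfolding P by (rule conn_trans)
  qed
  ultimately have mem: "?a \<in> A <-> point_of 0 \<in> A" "?c \<in> A <-> point_of 15 \<in> A"
    "?a \<in> A' <-> point_of 0 \<in> A'" "?c \<in> A' <-> point_of 15 \<in> A'"
    using saturatedD[OF sat(1)] saturatedD[OF sat(2)] arcs by blast+
  have ac: "(?a, ?c) \<in> conn (PD m) v <-> (0, 15) \<in> conn model ?u"
    using iff(2)[OF pts(1)] code by simp
  have core: "x \<in> snd (core m (v', A'')) <-> point_of x \<in> A''" if "x < 16" for x v' A''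
    using that by (simp add: core_def)
  have cr: "crossings (PD m) ! 6 = (?a, (2, 0, False), ?c, (2, Suc 0, True))"
    using PD_crossing[OF m] by simp
  show ?thesis
    unfolding edge_def cr model_crossing(7) prod.case pw ac mem
    by (auto simp: points_model core)
qed

lemma dmat_saddle:
  assumes m: "m > 0" and s: "s \<in> cells (PD m)" "fst s \<inter> {6..} = {7..<6 + m}"
    and t: "t \<in> cells (PD m)" "fst t \<inter> {6..} = {6..<6 + m}"
  shows "dmat (PD m) s t = dmat model (core m s) (core m t)"
proof -
  obtain v A w A' where st: "s = (v, A)" "t = (w, A')" by (cases s, cases t)
  have sat: "saturated (PD m) v A" "saturated (PD m) w A'" using s t by (auto simp: st cells_PD)
  have v: "v \<inter> {6..} = {7..<6 + m}" and w: "w \<inter> {6..} = {6..<6 + m}" using s t by (auto simp: st)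
  have n6: "6 \<notin> v" "6 \<in> w"
  proof -
    have "6 \<notin> v \<inter> {6..}" "6 \<in> w \<inter> {6..}" unfolding v w using m by auto
    then show "6 \<notin> v" "6 \<in> w" by auto
  qed
  have wa: "vert_above w m" and va: "\<not> vert_above v m"
  proof -
    have "vert_above (w \<inter> {6..}) m" unfolding w by (simp add: vert_above_def)
    then show "vert_above w m" by (simp only: vert_above_col)
    show "\<not> vert_above v m" using n6 m by (auto simp: vert_above_def)
  qed
  have u6: "6 \<notin> model_state m v" "6 \<in> model_state m w" using wa va by (simp_all add: model_state_6)
  show ?thesis
  proof (cases "w = insert 6 v")
    case True
    have "model_state m w = insert 6 (model_state m v)" using True va wa by (auto simp: model_state_def)
    then have ms: "core m s = (model_state m v, snd (core m (v, A)))"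
      "core m t = (insert 6 (model_state m v), snd (core m (insert 6 v, A')))"
      by (simp_all add: core_def st True)
    show ?thesis
      unfolding ms using m n6 u6 dmat_insert[of 6 "PD m" v A A']
        dmat_insert[of 6 model "model_state m v" "snd (core m (v, A))" "snd (core m (insert 6 v, A'))"]
        edge_saddle[OF m v sat[unfolded True]]
      by (simp add: st True n_crossings_pretzel n_crossings_model edge_sign_model_state)
  next
    case False
    have "dmat (PD m) s t = 0"
    proof (rule ccontr)
      assume "dmat (PD m) s t \<noteq> 0"
      then obtain k where k: "k \<notin> v" "w = insert k v" unfolding st by (rule dmat_nonzero)
      then have "k = 6" using n6 by blast
      then show False using False k by blast
    qed
    moreover have "dmat model (core m s) (core m t) = 0"
    proof (rule ccontr)
      assume "dmat model (core m s) (core m t) \<noteq> 0"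
      then obtain k where k: "k \<notin> model_state m v" "model_state m w = insert k (model_state m v)"
        unfolding st core_def fst_conv snd_conv by (elim dmat_nonzero)
      have "k = 6" using k(2) u6 by (metis insertE)
      then have low: "x \<in> w <-> x \<in> v" if "x < 6" for x
        using k(2) model_state_low[OF that] that by blast
      have "x \<in> w <-> x \<in> insert 6 v" for x
      proof (cases "x < 6")
        case False
        then have "x \<in> w <-> x \<in> w \<inter> {6..}" "x \<in> v <-> x \<in> v \<inter> {6..}" by auto
        then show ?thesis unfolding v w using False m by auto
      qed (use low in auto)
      then show False using False by blast
    qed
    ultimately show ?thesis by simp
  qed
qed

section \<open>Merging a circle labelled One\<close>

context
  fixes D :: "'p diagram" and v k a b c d
  assumes k: "k < n_crossings D" "crossings D ! k = (a, b, c, d)" "k \<notin> v"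
    and ac: "(a, c) \<notin> conn D v" "(a, c) \<in> conn D (insert k v)"
begin

text \<open>One is the unit of the product: merging a circle labelled One passes on the label of the
  other circle, without loss of information.\<close>

lemma edge_merge_One:
  assumes sat: "saturated D v A" "saturated D (insert k v) A'" and c: "c \<notin> A"
  shows "edge D v k A A' <-> A' = A \<union> (if a \<in> A then cls D v c else {})"
proof
  assume e: "edge D v k A A'"
  have same: "p \<in> A' <-> p \<in> A" if "p \<in> points D" "(p, a) \<notin> conn D v" "(p, c) \<notin> conn D v" for p
    using e that by (simp add: edge_def k)
  have a: "a \<in> A' <-> a \<in> A" using e c ac by (auto simp: edge_def k merge_rel_def)
  have mono: "(p, q) \<in> conn D (insert k v)" if "(p, q) \<in> conn D v" for p q
    using conn_mono_merge[OF k ac(2)] that by blast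
  have "p \<in> A' <-> p \<in> A \<or> a \<in> A \<and> (c, p) \<in> conn D v" for p
  proof -
    consider "p \<notin> points D" | "p \<in> points D" "(p, a) \<in> conn D v" | "p \<in> points D" "(p, c) \<in> conn D v"
      | "p \<in> points D" "(p, a) \<notin> conn D v" "(p, c) \<notin> conn D v" by blast
    then show ?thesis
    proof cases
      case 1
      then have "(c, p) \<notin> conn D v" using conn_points[of c p D v] crossing_points[OF k(1,2)] by blast
      then show ?thesis using 1 saturated_subset[OF sat(1)] saturated_subset[OF sat(2)] by blast
    next
      case 2
      then have "(c, p) \<notin> conn D v" using ac(1) by (meson conn_sym conn_trans)
      moreover have "p \<in> A' <-> a \<in> A'" by (rule saturatedD[OF sat(2) mono[OF 2(2)]])
      moreover have "p \<in> A <-> a \<in> A" by (rule saturatedD[OF sat(1) 2(2)])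
      ultimately show ?thesis using a by blast
    next
      case 3
      have "(p, a) \<in> conn D (insert k v)" using mono[OF 3(2)] ac(2) by (meson conn_sym conn_trans)
      then have "p \<in> A' <-> a \<in> A'" by (rule saturatedD[OF sat(2)])
      moreover have "p \<in> A <-> c \<in> A" by (rule saturatedD[OF sat(1) 3(2)])
      moreover have "(c, p) \<in> conn D v" using 3 by (rule_tac conn_sym)
      ultimately show ?thesis using a c by blast
    next
      case 4
      then have "(c, p) \<notin> conn D v" by (meson conn_sym)
      then show ?thesis using same 4 by blast
    qed
  qed
  then show "A' = A \<union> (if a \<in> A then cls D v c else {})"
    by (intro set_eqI) (simp add: in_cls)
next
  assume A': "A' = A \<union> (if a \<in> A then cls D v c else {})"
  have "a \<in> A' <-> a \<in> A" by (simp add: A')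
  moreover have "p \<in> A' <-> p \<in> A" if "(p, c) \<notin> conn D v" for p
    using that conn_sym[of c p D v] by (auto simp: A' in_cls)
  ultimately show "edge D v k A A'" using c ac by (auto simp: edge_def k merge_rel_def)
qed

lemma saturated_merge_One:
  assumes sat: "saturated D v A" and c: "c \<notin> A"
  shows "saturated D (insert k v) (A \<union> (if a \<in> A then cls D v c else {}))" (is "saturated D _ ?S")
  unfolding saturated_def
proof (intro conjI allI impI)
  show "?S \<subseteq> points D"
    using saturated_subset[OF sat] cls_subset[OF crossing_points(3)[OF k(1,2)], of v] by simp
  fix p q assume pq: "(p, q) \<in> conn D (insert k v)" "p \<in> ?S"
  have S: "x \<in> ?S <-> x \<in> A \<or> a \<in> A \<and> (c, x) \<in> conn D v" for x by (simp add: in_cls)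
  from pq(1) consider "(p, q) \<in> conn D v" | "(p, a) \<in> conn D v" "(c, q) \<in> conn D v"
    | "(p, c) \<in> conn D v" "(a, q) \<in> conn D v"
    unfolding conn_merge[OF k ac(2)] by blast
  then show "q \<in> ?S"
  proof cases
    case 1
    then show ?thesis using pq(2) unfolding S using saturatedD[OF sat 1] conn_trans[OF _ 1] by blast
  next
    case 2
    have "(c, p) \<notin> conn D v" using 2(1) ac(1) by (meson conn_sym conn_trans)
    then have "a \<in> A" using pq(2) saturatedD[OF sat 2(1)] unfolding S by blast
    then show ?thesis using 2(2) unfolding S by blast
  next
    case 3
    then have "a \<in> A" using pq(2) saturatedD[OF sat 3(1)] c unfolding S by blast
    then show ?thesis using saturatedD[OF sat 3(2)] unfolding S by blast
  qed
qed

text \<open>The inverse of the merge: the circle of \<open>c\<close> becomes a circle of its own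
  again, labelled One.\<close>

lemma saturated_unmerge:
  assumes sat: "saturated D (insert k v) A'"
  shows "saturated D v (A' - cls D v c)"
    "A' = (A' - cls D v c) \<union> (if a \<in> A' - cls D v c then cls D v c else {})"
proof -
  have sat': "saturated D v A'"
    using sat conn_mono_merge[OF k ac(2)] unfolding saturated_def by blast
  then show "saturated D v (A' - cls D v c)"
    using saturated_Diff saturated_cls crossing_points(3)[OF k(1,2)] by metis
  have "a \<notin> cls D v c" using ac(1) conn_sym[of c a D v] by (auto simp: in_cls)
  moreover have "a \<in> A' <-> c \<in> A'" by (rule saturatedD[OF sat ac(2)])
  moreover have "if c \<in> A' then cls D v c \<subseteq> A' else A' \<inter> cls D v c = {}"
    using saturated_cls_subset[OF sat'] saturated_disjoint[OF sat'] by simp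
  ultimately show "A' = (A' - cls D v c) \<union> (if a \<in> A' - cls D v c then cls D v c else {})"
    by (auto split: if_splits)
qed

end

section \<open>Filtration of the part with a horizontal crossing in the third column\<close>

lemmas alternating_pretzel = alternating_PD[OF alternating_model]

lemma isolated_inner:
  assumes "0 < l" "l < m" "5 + l \<notin> v" "6 + l \<notin> v"
  shows "l \<in> inner m v"
  using assms by (auto simp: inner_def vert_below_def add.commute)

text \<open>Between two consecutive horizontal crossings the column contains a circle through just
  the two points of one level; its code belongs to no other level.\<close>

lemma conn_isolated:
  assumes l: "0 < l" "l < m" "5 + l \<notin> v" "6 + l \<notin> v" and p: "p \<in> points (PD m)"
  shows "((2, l, s), p) \<in> conn (PD m) v <-> p \<in> {(2, l, False), (2, l, True)}"
proof
  note inn = isolated_inner[OF l]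
  assume "((2, l, s), p) \<in> conn (PD m) v"
  then have "(15 + l, point_code m v p) \<in> conn model (model_state m v)"
    using conn_PD_imp_model point_code_inner[OF inn] by metis
  then have c: "point_code m v p = 15 + l" using conn_model_code l(1) by fastforce
  obtain i l' s' where p': "p = (i, l', s')" by (cases p)
  have "i = 2"
  proof (rule ccontr)
    assume "i \<noteq> 2"
    then have "i < 2" "l' \<le> 3" using p by (auto simp: p' points_pretzel)
    then show False using c l(1) by (cases s') (auto simp: p')
  qed
  then have lc: "level_code m v l' = 15 + l" using c inner_not_vert_above[OF inn] by (simp add: p')
  let ?H = "{j. j < l' \<and> 6 + j \<notin> v}"
  have "\<not> vert_above v l'" and M: "Max ?H + 1 = l" using lc l(1) by (auto simp: level_code_def split: if_splits)
  then have "?H \<noteq> {}" by (auto simp: vert_above_def)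
  then have "Max ?H < l'" using Max_in[of ?H] by auto
  moreover have "\<not> l < l'"
  proof
    assume "l < l'"
    then have "l \<le> Max ?H" using l(4) by (intro Max_ge) auto
    then show False using M by simp
  qed
  ultimately have "l' = l" using M by simp
  then show "p \<in> {(2, l, False), (2, l, True)}" using \<open>i = 2\<close> by (cases s') (auto simp: p')
next
  assume "p \<in> {(2, l, False), (2, l, True)}"
  moreover have "((2, l, False), (2, l, True)) \<in> conn (PD m) v"
    using conn_horizontal(2)[of "l - 1" m v] l by (simp add: Suc_diff_Suc numeral_eq_Suc)
  ultimately show "((2, l, s), p) \<in> conn (PD m) v" by (cases s) (auto intro: conn_sym)
qed

lemma cls_isolated:
  assumes "0 < l" "l < m" "5 + l \<notin> v" "6 + l \<notin> v"
  shows "cls (PD m) v (2, l, s) = {(2, l, False), (2, l, True)}"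
proof -
  have "(2, l, s') \<in> points (PD m)" for s' using assms by (simp add: points_pretzel)
  then have pts: "p \<in> points (PD m)" if "p \<in> cls (PD m) v (2, l, s) \<or> p \<in> {(2, l, False), (2, l, True)}" for p
    using that cls_subset[of "(2, l, s)" "PD m" v] by auto
  show ?thesis
  proof (rule set_eqI)
    fix p
    show "p \<in> cls (PD m) v (2, l, s) <-> p \<in> {(2, l, False), (2, l, True)}"
      using pts[of p] conn_isolated[OF assms, of p s] unfolding in_cls by blast
  qed
qed

lemma PD_crossing_points:
  assumes "k < 6 + m" "crossings (PD m) ! k = (a, b, c, d)" "k \<noteq> 6 + l" "k \<noteq> 5 + l" "0 < l"
  shows "a \<notin> {(2, l, False), (2, l, True)}" "c \<notin> {(2, l, False), (2, l, True)}"
proof -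
  have "a \<notin> {(2, l, False), (2, l, True)} \<and> c \<notin> {(2, l, False), (2, l, True)}"
  proof (cases "k < 6")
    case True
    obtain a' b' c' d' where cr: "crossings model ! k = (a', b', c', d')" by (cases "crossings model ! k")
    have "fst (point_of x) < 2" if "x < 16" for x using that by (auto simp: point_of_def)
    then have "fst a < 2" "fst c < 2" using crossing_point_of(1)[OF True cr, of m] crossing_point_of(2-)[OF True cr] assms(2) by auto
    then show ?thesis by auto
  next
    case False
    then have "k = 6 + (k - 6)" "k - 6 < m" using assms(1) by auto
    then show ?thesis using PD_crossing[of "k - 6" m] assms(2-5) by auto
  qed
  then show "a \<notin> {(2, l, False), (2, l, True)}" "c \<notin> {(2, l, False), (2, l, True)}" by auto
qed

lemma edge_isolated:
  assumes e: "edge (PD m) v k A A'" and k: "k < 6 + m" "k \<noteq> 6 + l" "k \<noteq> 5 + l"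
    and l: "0 < l" "l < m" "5 + l \<notin> v" "6 + l \<notin> v"
  shows "(2, l, False) \<in> A' <-> (2, l, False) \<in> A"
proof -
  obtain a b c d where cr: "crossings (PD m) ! k = (a, b, c, d)" by (cases "crossings (PD m) ! k")
  have pts: "a \<in> points (PD m)" "c \<in> points (PD m)" using crossing_points[OF _ cr] k(1) by (simp_all add: n_crossings_pretzel)
  have "((2, l, False), a) \<notin> conn (PD m) v" "((2, l, False), c) \<notin> conn (PD m) v"
    using conn_isolated[OF l pts(1)] conn_isolated[OF l pts(2)] PD_crossing_points[OF k(1) cr k(2,3) l(1)] by blast+
  moreover have "(2, l, False) \<in> points (PD m)" using l by (simp add: points_pretzel)
  ultimately show ?thesis using e by (simp add: edge_def cr)
qed

text \<open>Some crossing is horizontal and none from position \<open>k\<close> on is, so the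
  differences for consecutive \<open>k\<close> are the layers of the filtration.\<close>

definition hcells :: "nat => nat => int => int => (nat set \<times> ppoint set) set" where
  "hcells m k j i = {s \<in> gcells (PD m) j i. \<not> vert_above (fst s) m \<and> vert_below m (fst s) k}"

text \<open>Interpolates within a layer: crossings \<open>n\<close> to \<open>k - 1\<close> are
  horizontal and the circles strictly between them are labelled X. For \<open>n = k - 1\<close> this
  is the whole layer, for \<open>n = 0\<close> the part that survives cancellation.\<close>

definition ncells :: "nat => nat => nat => int => int => (nat set \<times> ppoint set) set" where
  "ncells m k n j i = {s \<in> gcells (PD m) j i. vert_below m (fst s) k \<and>
     (\<forall>l. n \<le> l --> l < k --> 6 + l \<notin> fst s) \<and> (\<forall>l. n < l --> l < k --> (2, l, False) \<in> snd s)}"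

lemma finite_hcells [simp]: "finite (hcells m k j i)"
  by (rule finite_subset[OF _ finite_gcells]) (auto simp: hcells_def)

lemma finite_ncells [simp]: "finite (ncells m k n j i)"
  by (rule finite_subset[OF _ finite_gcells]) (auto simp: ncells_def)

lemma ncells_subset: "n < k ==> k \<le> m ==> ncells m k n j i \<subseteq> hcells m k j i"
  by (auto simp: ncells_def hcells_def vert_above_def intro!: exI[of _ n])

lemma ncells_mono: "n \<le> n' ==> ncells m k n j i \<subseteq> ncells m k n' j i"
  by (auto simp: ncells_def)

text \<open>A crossing that is horizontal in the target was so in the source, and the circles
  between such crossings keep their labels. Hence the complement within \<open>hcells\<close> is a
  subcomplex.\<close>

lemma ncells_closed:
  assumes k: "k \<le> m" and s: "s \<in> hcells m k j i" and t: "t \<in> ncells m k n j i'" and st: "dmat (PD m) s t \<noteq> 0"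
  shows "s \<in> ncells m k n j i"
proof -
  obtain v A w A' where e: "s = (v, A)" "t = (w, A')" by (cases s, cases t)
  obtain x where x: "x < 6 + m" "x \<notin> v" "w = insert x v" "edge (PD m) v x A A'"
    using dmat_nonzero[of "PD m" v A w A'] st by (auto simp: e n_crossings_pretzel)
  have z: "6 + l \<notin> v" "x \<noteq> 6 + l" if "n \<le> l" "l < k" for l
    using t that by (auto simp: ncells_def e x(3))
  have "(2, l, False) \<in> A" if l: "n < l" "l < k" for l
  proof -
    have "5 + l = 6 + (l - 1)" using l by auto
    then have "5 + l \<notin> v" "x \<noteq> 5 + l" using z[of "l - 1"] l by simp_all
    then have "(2, l, False) \<in> A' <-> (2, l, False) \<in> A"
      using z[of l] l k by (intro edge_isolated[OF x(4,1)]) auto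
    then show ?thesis using t l by (auto simp: ncells_def e)
  qed
  then show ?thesis using s z by (auto simp: ncells_def hcells_def e)
qed

lemma hcells_minus_top: "k < m ==> hcells m (Suc k) j i - ncells m (Suc k) k j i = hcells m k j i"
proof -
  assume k: "k < m"
  have "vert_below m v (Suc k) \<and> 6 + k \<in> v <-> vert_below m v k" for v
    using k by (auto simp: vert_below_def Suc_le_eq) (metis le_neq_implies_less)
  moreover have "(\<forall>l. k \<le> l --> l < Suc k --> R l) <-> R k" for R
    by (metis le_refl lessI less_Suc_eq_le le_antisym)
  moreover have "\<not> (k < l \<and> l < Suc k)" for l by simp
  ultimately show ?thesis unfolding hcells_def ncells_def by (intro set_eqI) (simp, metis)
qed

text \<open>Generators with crossing \<open>n\<close> vertical (\<open>Q\<close>) are matched with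
  those where it is horizontal and the circle below it, at level \<open>n + 1\<close>, is labelled
  One (\<open>P\<close>): changing crossing \<open>n\<close> merges this circle into the one above.
  What remains has crossing \<open>n\<close> horizontal and X at level \<open>n + 1\<close>.\<close>

lemma betti_bound_cancel:
  assumes n: "Suc n < k" "k \<le> m"
  shows "betti_bound (dmat (PD m)) (\<lambda>i. ncells m k (Suc n) j i - ncells m k n j i) (\<lambda>_. 0)"
proof -
  let ?D = "PD m" and ?L = "{(2, Suc n, False), (2, Suc n, True)} :: ppoint set"
  let ?a = "(2, n, True) :: ppoint" and ?c = "(2, Suc n, False) :: ppoint"
  define P where "P i = {s \<in> ncells m k (Suc n) j i. 6 + n \<notin> fst s \<and> ?c \<notin> snd s}" for i
  define Q where "Q i = {s \<in> ncells m k (Suc n) j i. 6 + n \<in> fst s}" for i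
  define \<beta> where "\<beta> s = (insert (6 + n) (fst s), snd s \<union> (if ?a \<in> snd s then ?L else {}))" for s :: "nat set \<times> ppoint set"
  define \<beta>' where "\<beta>' s = (fst s - {6 + n}, snd s - ?L)" for s :: "nat set \<times> ppoint set"
  have cr: "crossings ?D ! (6 + n) = (?a, (2, n, False), ?c, (2, Suc n, True))"
    using PD_crossing[of n m] n by simp
  have x: "6 + n < n_crossings ?D" using n by (simp add: n_crossings_pretzel)
  have v: "cls ?D v ?c = ?L" "(?a, ?c) \<notin> conn ?D v" "(?a, ?c) \<in> conn ?D (insert (6 + n) v)"
    if "v \<subseteq> {..<6 + m}" "6 + n \<notin> v" "6 + Suc n \<notin> v" for v
  proof -
    show c: "cls ?D v ?c = ?L" using that n by (intro cls_isolated) auto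
    have "?a \<notin> cls ?D v ?c" unfolding c by simp
    then show nc: "(?a, ?c) \<notin> conn ?D v" unfolding in_cls by (meson conn_sym)
    have "v \<subseteq> {..<n_crossings ?D}" using that by (simp add: n_crossings_pretzel)
    then show "(?a, ?c) \<in> conn ?D (insert (6 + n) v)"
      using alternatingD[OF alternating_pretzel _ x that(2) cr] nc by blast
  qed
  have edge_iff: "edge ?D v (6 + n) A A' <-> A' = snd (\<beta> (v, A))"
    if "v \<subseteq> {..<6 + m}" "6 + n \<notin> v" "6 + Suc n \<notin> v" "saturated ?D v A" "saturated ?D (insert (6 + n) v) A'" "?c \<notin> A"
    for v A A'
    using edge_merge_One[OF x cr that(2) v(2,3)[OF that(1-3)] that(4-6)] v(1)[OF that(1-3)] by (simp add: \<beta>_def)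
  have P: "fst s \<subseteq> {..<6 + m} \<and> saturated ?D (fst s) (snd s) \<and> 6 + n \<notin> fst s \<and> 6 + Suc n \<notin> fst s \<and> ?c \<notin> snd s"
    if "s \<in> P i" for s i
    using that n by (auto simp: P_def ncells_def gcells_def cells_PD)
  have Q: "fst s \<subseteq> {..<6 + m} \<and> saturated ?D (fst s) (snd s) \<and> 6 + n \<in> fst s \<and> 6 + Suc n \<notin> fst s"
    if "s \<in> Q i" for s i
    using that n by (auto simp: Q_def ncells_def gcells_def cells_PD)
  have vb: "vert_below m (insert (6 + n) w) k = vert_below m w k" "vert_below m (w - {6 + n}) k = vert_below m w k" for w
    using n by (auto simp: vert_below_def)
  have \<beta>_cells: "\<beta> s \<in> cells ?D \<and> dmat ?D s (\<beta> s) \<noteq> 0" if "s \<in> P i" for s i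
  proof -
    note p = P[OF that]
    have w: "fst s \<subseteq> {..<6 + m}" "6 + n \<notin> fst s" "6 + Suc n \<notin> fst s" using p by auto
    have sat: "saturated ?D (insert (6 + n) (fst s)) (snd (\<beta> s))"
      using saturated_merge_One[OF x cr w(2) v(2,3)[OF w], of "snd s", unfolded v(1)[OF w]] p by (simp add: \<beta>_def)
    then have "\<beta> s \<in> cells ?D" using w n by (simp add: cells_PD \<beta>_def)
    moreover have "edge ?D (fst s) (6 + n) (snd s) (snd (\<beta> s))"
      using edge_iff[OF w _ sat] p by simp
    then have "dmat ?D (fst s, snd s) (insert (6 + n) (fst s), snd (\<beta> s)) \<noteq> 0"
      unfolding dmat_insert[OF x w(2)] by simp
    then have "dmat ?D s (\<beta> s) \<noteq> 0" by (simp add: \<beta>_def)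
    ultimately show ?thesis by blast
  qed
  have \<beta>'_cells: "\<beta>' s \<in> cells ?D \<and> \<beta> (\<beta>' s) = s \<and> dmat ?D (\<beta>' s) s \<noteq> 0" if "s \<in> Q i" for s i
  proof -
    note q = Q[OF that]
    define u where "u = fst s - {6 + n}"
    have w: "u \<subseteq> {..<6 + m}" "6 + n \<notin> u" "6 + Suc n \<notin> u" using q by (auto simp: u_def)
    have iu: "insert (6 + n) u = fst s" using q by (auto simp: u_def)
    have sat: "saturated ?D (insert (6 + n) u) (snd s)" using q by (simp add: iu)
    note un = saturated_unmerge[OF x cr w(2) v(2,3)[OF w] sat, unfolded v(1)[OF w]]
    have b': "\<beta>' s = (u, snd s - ?L)" by (simp add: \<beta>'_def u_def)
    have bb: "\<beta> (\<beta>' s) = s" using un(2) by (simp add: \<beta>_def b' iu prod_eq_iff)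
    have c: "\<beta>' s \<in> cells ?D" using un(1) w by (simp add: cells_PD b')
    have "edge ?D u (6 + n) (snd s - ?L) (snd s)"
      using edge_iff[OF w un(1) sat] bb by (simp add: b')
    then have "dmat ?D (u, snd s - ?L) (insert (6 + n) u, snd s) \<noteq> 0" using dmat_insert[OF x w(2)] by simp
    then show ?thesis using bb c by (simp add: b' iu)
  qed
  have "betti_bound (dmat ?D) (\<lambda>i. P i \<union> Q i) (\<lambda>_. 0)"
  proof (rule betti_bound_matching[where \<beta> = "\<lambda>_. \<beta>"])
    show "finite (P i)" "finite (Q i)" for i by (simp_all add: P_def Q_def)
    show "P i \<inter> Q i = {}" for i by (auto simp: P_def Q_def)
    show "bij_betw \<beta> (P i) (Q (i + 1))" for i
    proof (rule bij_betw_byWitness[where f' = \<beta>'])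
      show "\<forall>s\<in>P i. \<beta>' (\<beta> s) = s"
      proof
        fix s assume "s \<in> P i"
        note p = P[OF this]
        have "(2, Suc n, True) \<in> snd s <-> ?c \<in> snd s"
        proof (rule saturatedD)
          show "((2, Suc n, True), ?c) \<in> conn ?D (fst s)"
            using v(1)[of "fst s"] p in_cls[of "(2, Suc n, True)" ?D "fst s" ?c] by (auto intro: conn_sym)
        qed (use p in simp)
        then show "\<beta>' (\<beta> s) = s" using p by (auto simp: \<beta>_def \<beta>'_def prod_eq_iff)
      qed
      show "\<forall>s\<in>Q (i + 1). \<beta> (\<beta>' s) = s" using \<beta>'_cells by blast
      show "\<beta> ` P i \<subseteq> Q (i + 1)"
      proof
        fix t assume "t \<in> \<beta> ` P i"
        then obtain s where s: "s \<in> P i" "t = \<beta> s" by blast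
        have "s \<in> cells ?D" "s \<in> gcells ?D j i" using s by (auto simp: P_def ncells_def gcells_def)
        then have "t \<in> gcells ?D j (i + 1)"
          using dmat_qdeg[OF alternating_pretzel, of s m t] \<beta>_cells[OF s(1)] by (auto simp: gcells_def s(2))
        then show "t \<in> Q (i + 1)" using s(1) by (auto simp: Q_def P_def ncells_def \<beta>_def vb s(2))
      qed
      show "\<beta>' ` Q (i + 1) \<subseteq> P i"
      proof
        fix t assume "t \<in> \<beta>' ` Q (i + 1)"
        then obtain s where s: "s \<in> Q (i + 1)" "t = \<beta>' s" by blast
        have "s \<in> cells ?D" "s \<in> gcells ?D j (i + 1)" using s by (auto simp: Q_def ncells_def gcells_def)
        then have "t \<in> gcells ?D j i"
          using dmat_qdeg[OF alternating_pretzel, of t m s] \<beta>'_cells[OF s(1)] by (auto simp: gcells_def s(2))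
        then show "t \<in> P i" using s(1) by (auto simp: Q_def P_def ncells_def \<beta>'_def vb s(2))
      qed
    qed
    show "dmat ?D p q \<noteq> 0 <-> q = \<beta> p" if p: "p \<in> P i" and q: "q \<in> Q (i + 1)" for i p q
    proof
      assume d: "dmat ?D p q \<noteq> 0"
      obtain y where y: "y \<notin> fst p" "fst q = insert y (fst p)" "edge ?D (fst p) y (snd p) (snd q)"
        using dmat_nonzero[of ?D "fst p" "snd p" "fst q" "snd q"] d by auto
      have "y = 6 + n" using y(2) P[OF p] Q[OF q] by auto
      then show "q = \<beta> p"
        using edge_iff[of "fst p" "snd p" "snd q"] y P[OF p] Q[OF q] by (simp add: prod_eq_iff) (simp add: \<beta>_def)
    qed (use \<beta>_cells[OF p] in blast)
  qed
  moreover have "P i \<union> Q i = ncells m k (Suc n) j i - ncells m k n j i" for i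
  proof -
    have "s \<in> ncells m k n j i <-> 6 + n \<notin> fst s \<and> ?c \<in> snd s" if "s \<in> ncells m k (Suc n) j i" for s
      using that n by (auto simp: ncells_def Suc_le_eq) (metis Suc_lessI le_neq_implies_less)+
    then show ?thesis by (auto simp: P_def Q_def)
  qed
  ultimately show ?thesis by simp
qed

text \<open>Starting from the previous layers, the acyclic pieces of the new layer are adjoined as
  \<open>n\<close> descends from \<open>k\<close>; the bound \<open>c\<close> is unchanged.\<close>

lemma betti_bound_hcells_minus:
  assumes b: "betti_bound (dmat (PD m)) (hcells m k j) c" and k: "k < m" and n: "n \<le> k"
  shows "betti_bound (dmat (PD m)) (\<lambda>i. hcells m (Suc k) j i - ncells m (Suc k) n j i) c"
  using n
proof (induction rule: inc_induct)
  case base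
  show ?case using b by (simp add: hcells_minus_top[OF k])
next
  case (step n)
  have "betti_bound (dmat (PD m)) (\<lambda>i. (hcells m (Suc k) j i - ncells m (Suc k) (Suc n) j i) \<union>
    (ncells m (Suc k) (Suc n) j i - ncells m (Suc k) n j i)) c"
  proof (rule betti_bound_Un[OF _ _ _ _ step.IH betti_bound_cancel, where I = "{}"])
    show "dmat (PD m) p q = 0" if "p \<in> hcells m (Suc k) j i - ncells m (Suc k) (Suc n) j i"
      "q \<in> ncells m (Suc k) (Suc n) j (i + 1) - ncells m (Suc k) n j (i + 1)" for i p q
      using ncells_closed[of "Suc k" m p j i q "Suc n" "i + 1"] that k by auto
  qed (use step k in auto)
  moreover have "(hcells m (Suc k) j i - ncells m (Suc k) (Suc n) j i) \<union>
    (ncells m (Suc k) (Suc n) j i - ncells m (Suc k) n j i) = hcells m (Suc k) j i - ncells m (Suc k) n j i" for i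
    using ncells_mono[of n "Suc n" m "Suc k" j i] ncells_subset[of "Suc n" "Suc k" m j i] step k by auto
  ultimately show ?case by simp
qed

abbreviation low_col :: "nat => nat => nat set" where
  "low_col m k \<equiv> {6 + k..<6 + m}"

lemma inner_low_col: "k \<le> m ==> inner m (low_col m k) = {1..<k}"
proof -
  assume k: "k \<le> m"
  then have vb: "vert_below m (low_col m k) l <-> k \<le> l" for l
    by (auto simp: vert_below_def)
  show ?thesis
    unfolding inner_def vb set_eq_iff mem_Collect_eq atLeastLessThan_iff using k by arith
qed

lemma vert_above_low_col: "0 < k ==> k \<le> m ==> \<not> vert_above (low_col m k) m"
  by (auto simp: vert_above_def intro!: exI[of _ 0])

lemma ncells_0: "k \<le> m ==> ncells m k 0 j i = xcells m (low_col m k) j i"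
proof -
  assume k: "k \<le> m"
  have "fst s \<inter> {6..} = low_col m k <-> vert_below m (fst s) k \<and> (\<forall>l<k. 6 + l \<notin> fst s)"
    if "s \<in> gcells (PD m) j i" for s
  proof -
    have v: "fst s \<subseteq> {..<6 + m}" using that by (simp add: gcells_def cells_PD)
    have "6 + l \<in> fst s <-> k \<le> l \<and> l < m" if "vert_below m (fst s) k" "\<forall>l<k. 6 + l \<notin> fst s" for l
      using v that by (auto simp: vert_below_def) (metis not_le)
    moreover have "fst s \<inter> {6..} = low_col m k <-> (\<forall>l. 6 + l \<in> fst s <-> k \<le> l \<and> l < m)"
    proof
      assume "fst s \<inter> {6..} = low_col m k"
      then have "6 + l \<in> fst s \<inter> {6..} <-> 6 + l \<in> low_col m k" for l by (simp only:)
      then show "\<forall>l. 6 + l \<in> fst s <-> k \<le> l \<and> l < m" by simp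
    next
      assume l: "\<forall>l. 6 + l \<in> fst s <-> k \<le> l \<and> l < m"
      show "fst s \<inter> {6..} = low_col m k"
      proof (rule set_eqI)
        fix x
        show "x \<in> fst s \<inter> {6..} <-> x \<in> low_col m k"
          using l[rule_format, of "x - 6"] by (cases "x < 6") auto
      qed
    qed
    ultimately show ?thesis using k by (auto simp: vert_below_def)
  qed
  note v = this
  have i: "mid m s = {1..<k} <-> (\<forall>l. 0 < l --> l < k --> (2, l, False) \<in> snd s)"
    if "fst s \<inter> {6..} = low_col m k" for s
  proof -
    have inn: "inner m (fst s) = {1..<k}" using inner_col[of m "fst s"] inner_low_col[OF k] by (simp add: that)
    have "mid m s = {1..<k} <-> (\<forall>l. l \<in> {1..<k} --> (2, l, False) \<in> snd s)"
      unfolding mid_def inn by blast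
    then show ?thesis by simp (metis One_nat_def Suc_le_eq)
  qed
  show ?thesis
  proof (rule set_eqI)
    fix s
    show "s \<in> ncells m k 0 j i <-> s \<in> xcells m (low_col m k) j i"
      unfolding ncells_def xcells_def inner_low_col[OF k] mem_Collect_eq
      using v[of s] i[of s] by (simp only: le0 simp_thms) blast
  qed
qed

section \<open>Flipping a crossing between circles of the third column\<close>

text \<open>The column of layer \<open>k\<close> with one of its horizontal crossings,
  \<open>p\<close>, made vertical. These patterns are the first steps from layer \<open>k\<close>
  into the lower part of the filtration.\<close>

abbreviation up_col :: "nat => nat => nat => nat set" where
  "up_col m k p \<equiv> insert (6 + p) (low_col m k)"

context
  fixes m k p :: nat
  assumes k: "2 \<le> k" "k \<le> m" "p < k"
begin

lemma vert_below_up_col: "vert_below m (up_col m k p) l <-> k \<le> l \<or> Suc p = k \<and> l = p"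
proof
  assume vb: "vert_below m (up_col m k p) l"
  show "k \<le> l \<or> Suc p = k \<and> l = p"
  proof (rule ccontr)
    assume n: "\<not> ?thesis"
    then have "l < k" by simp
    have "6 + l \<in> up_col m k p" "Suc l < k ==> 6 + Suc l \<in> up_col m k p"
      using vb[unfolded vert_below_def, rule_format, of l] vb[unfolded vert_below_def, rule_format, of "Suc l"]
        \<open>l < k\<close> k by auto
    then have "l = p \<and> (Suc l < k --> Suc l = p)" using \<open>l < k\<close> by auto
    then show False using n k by auto
  qed
next
  assume "k \<le> l \<or> Suc p = k \<and> l = p"
  then show "vert_below m (up_col m k p) l" by (auto simp: vert_below_def)
qed

text \<open>Changing crossing \<open>p\<close> merges the circles at levels \<open>p\<close> and
  \<open>p + 1\<close>. The merged circle is named by its higher level, so level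
  \<open>p + 1\<close> disappears; for the last crossing the circle at level \<open>p\<close> is
  absorbed by the bottom of the column.\<close>

lemma inner_up_col: "inner m (up_col m k p) = {1..<k} - {if Suc p < k then Suc p else p}"
proof (rule set_eqI)
  fix l
  show "l \<in> inner m (up_col m k p) <-> l \<in> {1..<k} - {if Suc p < k then Suc p else p}"
  proof (cases "Suc p < k")
    case True
    then show ?thesis using k unfolding inner_def mem_Collect_eq vert_below_up_col by auto
  next
    case False
    then have "Suc p = k" using k by simp
    then show ?thesis using k unfolding inner_def mem_Collect_eq vert_below_up_col by auto
  qed
qed

lemma card_inner_up_col: "card (inner m (up_col m k p)) = k - 2"
  unfolding inner_up_col using k by (subst card_Diff_singleton) auto

lemma card_up_col: "card (up_col m k p) = Suc (m - k)"
  using k by (subst card_insert_disjoint) auto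

lemma up_col_subset: "up_col m k p \<subseteq> {6..<6 + m}"
  using k by auto

lemma not_vert_above_up_col:
  assumes "k \<le> l"
  shows "\<not> vert_above (up_col m k p) l"
proof -
  define j where "j = (if p = 0 then 1 else 0 :: nat)"
  have "j < l" "6 + j \<notin> up_col m k p" using assms k by (auto simp: j_def)
  then show ?thesis by (auto simp: vert_above_def)
qed

context
  fixes v :: "nat set"
  assumes v: "v \<inter> {6..} = low_col m k"
begin

lemma insert_col: "insert (6 + p) v \<inter> {6..} = up_col m k p"
  using v by auto

lemma low_col_iff: "6 + l \<in> v <-> k \<le> l \<and> l < m"
proof -
  have "6 + l \<in> v <-> 6 + l \<in> v \<inter> {6..}" by simp
  then show ?thesis by (simp add: v)
qed

lemma inner_low: "inner m v = {1..<k}"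
  using inner_col[of m v] inner_low_col[of k m] k by (simp add: v)

lemma inner_up: "inner m (insert (6 + p) v) = {1..<k} - {if Suc p < k then Suc p else p}"
  using inner_col[of m "insert (6 + p) v"] inner_up_col unfolding insert_col by simp

lemma not_vert_above: "k \<le> l ==> \<not> vert_above v l" "k \<le> l ==> \<not> vert_above (insert (6 + p) v) l"
proof -
  show "k \<le> l ==> \<not> vert_above (insert (6 + p) v) l"
    using not_vert_above_up_col[of l] vert_above_col[of "insert (6 + p) v" l] unfolding insert_col by blast
  then show "k \<le> l ==> \<not> vert_above v l" by (auto simp: vert_above_def)
qed

lemma vert_below_up: "vert_below m (insert (6 + p) v) l <-> k \<le> l \<or> Suc p = k \<and> l = p"
  using vert_below_col[of m "insert (6 + p) v" l] vert_below_up_col unfolding insert_col by blast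

lemma level_code_low: "level_code m v l = (if l = 0 then 0 else if k \<le> l then 15 else 15 + l)"
proof -
  consider "l = 0" | "0 < l" "l < k" | "0 < l" "k \<le> l" by linarith
  then show ?thesis
  proof cases
    case 1
    then show ?thesis by (simp add: level_code_def vert_above_def)
  next
    case 2
    then show ?thesis using level_code_inner[of l m v] by (simp add: inner_low)
  next
    case 3
    then have "vert_below m v l" using low_col_iff by (auto simp: vert_below_def)
    then show ?thesis using 3 not_vert_above(1) by (simp add: level_code_def)
  qed
qed

lemma level_code_up:
  assumes "l \<noteq> Suc p"
  shows "level_code m (insert (6 + p) v) l = (if l = 0 then 0 else if k \<le> l \<or> l = p \<and> Suc p = k then 15 else 15 + l)"
proof -
  consider "l = 0" | "0 < l" "l < k" "\<not> (l = p \<and> Suc p = k)" | "0 < l" "k \<le> l" | "0 < l" "l = p" "Suc p = k" by linarith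
  then show ?thesis
  proof cases
    case 1
    then show ?thesis by (simp add: level_code_def vert_above_def)
  next
    case 2
    then have "l \<in> inner m (insert (6 + p) v)" using assms by (auto simp: inner_up)
    then show ?thesis using level_code_inner[of l m "insert (6 + p) v"] 2 by simp
  next
    case 3
    then show ?thesis using not_vert_above(2)[of l] vert_below_up[of l] by (simp add: level_code_def)
  next
    case 4
    have "6 + 0 \<notin> v" using low_col_iff[of 0] k by simp
    then have "\<not> vert_above (insert (6 + p) v) l" using 4 by (auto simp: vert_above_def intro!: exI[of _ 0])
    then show ?thesis using 4 vert_below_up[of l] by (simp add: level_code_def)
  qed
qed

text \<open>Merging a further circle into the one through \<open>e\<close>: label One changes
  nothing, label X acts as multiplication by X at \<open>e\<close>.\<close>

lemma merge_on_class:
  assumes sat: "saturated model u B" "saturated model u B'" and e: "e < 16"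
  shows "(\<forall>y<16. (y, e) \<notin> conn model u --> (y \<in> B' <-> y \<in> B)) \<and> merge_rel (e \<in> B) z (e \<in> B') <->
    (if z then e \<notin> B \<and> B' = B \<union> cls model u e else B' = B)"
proof -
  have sub: "B \<subseteq> {..<16}" "B' \<subseteq> {..<16}" "cls model u e \<subseteq> {..<16}"
    using saturated_subset[OF sat(1)] saturated_subset[OF sat(2)] cls_subset[of e model u] e
    by (auto simp: points_model)
  have c: "y \<in> cls model u e <-> (y, e) \<in> conn model u" for y unfolding in_cls by (meson conn_sym)
  have same: "y \<in> B <-> e \<in> B" "y \<in> B' <-> e \<in> B'" if "(y, e) \<in> conn model u" for y
    using saturatedD[OF sat(1) that] saturatedD[OF sat(2) that] by auto
  have eq: "B' = S <-> (\<forall>y<16. y \<in> B' <-> y \<in> S)" if "S \<subseteq> {..<16}" for S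
    using sub(2) that by blast
  show ?thesis
  proof (cases z)
    case True
    have "B' = B \<union> cls model u e <-> (\<forall>y<16. y \<in> B' <-> y \<in> B \<or> (y, e) \<in> conn model u)"
      using eq[of "B \<union> cls model u e"] sub by (simp add: c)
    moreover have "(\<forall>y<16. (y, e) \<notin> conn model u --> (y \<in> B' <-> y \<in> B)) \<and> e \<notin> B \<and> e \<in> B' <->
      e \<notin> B \<and> (\<forall>y<16. y \<in> B' <-> y \<in> B \<or> (y, e) \<in> conn model u)" (is "?P <-> ?Q")
    proof
      assume P: ?P
      have "y \<in> B' <-> y \<in> B \<or> (y, e) \<in> conn model u" if "y < 16" for y
        using P that same(2)[of y] by (cases "(y, e) \<in> conn model u") simp_all
      then show ?Q using P by simp
    next
      assume Q: ?Q
      then have "e \<in> B'" using e conn_refl[of e model u] by simp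
      then show ?P using Q by simp
    qed
    ultimately show ?thesis using True by (simp add: merge_rel_def)
  next
    case False
    moreover have "(\<forall>y<16. (y, e) \<notin> conn model u --> (y \<in> B' <-> y \<in> B)) \<and> (e \<in> B' <-> e \<in> B) <->
      (\<forall>y<16. y \<in> B' <-> y \<in> B)" (is "?P <-> ?Q")
    proof
      assume P: ?P
      have "y \<in> B' <-> y \<in> B" if "y < 16" for y
        using P that same[of y] by (cases "(y, e) \<in> conn model u") simp_all
      then show ?Q by simp
    qed (use e in simp)
    ultimately show ?thesis using eq[OF sub(1)] by (simp add: merge_rel_def)
  qed
qed

text \<open>\<open>N\<close> is the set of inner circles labelled One, while all inner circles of
  the target are X. An interior merge yields X only from One and X, and X times X is zero. At the
  two ends of the column an inner circle labelled X is merged into the rest of the diagram and acts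
  there as X at the point 0 or 15.\<close>

lemma edge_column:
  fixes A A' :: "ppoint set"
  defines "u \<equiv> model_state m v" and "B \<equiv> snd (core m (v, A))" and "B' \<equiv> snd (core m (insert (6 + p) v, A'))"
    and "N \<equiv> {1..<k} - mid m (v, A)"
  assumes sat: "saturated (PD m) v A" "saturated (PD m) (insert (6 + p) v) A'"
    and mid: "mid m (insert (6 + p) v, A') = inner m (up_col m k p)"
  shows "edge (PD m) v (6 + p) A A' <-> (N = {p} \<or> N = {Suc p}) \<and> B' = B \<or>
    N = {} \<and> (p = 0 \<and> 0 \<notin> B \<and> B' = B \<union> cls model u 0 \<or> Suc p = k \<and> 15 \<notin> B \<and> B' = B \<union> cls model u 15)"
proof -
  let ?w = "insert (6 + p) v" and ?a = "(2, p, True) :: ppoint" and ?c = "(2, Suc p, False) :: ppoint"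
  let ?T = "mid m (v, A)"
  \<comment> \<open>The codes of the two circles meeting at crossing \<open>p\<close>; above the
    first crossing and below the last one these are the end points 0 and 15.\<close>
  define ca where "ca = (if p = 0 then 0 else 15 + p)"
  define cc where "cc = (if Suc p = k then 15 else 15 + Suc p)"
  have va: "\<not> vert_above v m" "\<not> vert_above ?w m" using not_vert_above k by auto
  have ms: "model_state m ?w = u" unfolding u_def model_state_def using va by auto
  have code: "point_code m v (2, l, s) = (if l = 0 then 0 else if k \<le> l then 15 else 15 + l)" for l s
    using va level_code_low by simp
  have ca: "point_code m v ?a = ca" and cc: "point_code m v ?c = cc"
    unfolding code ca_def cc_def using k by auto
  have pts: "?a \<in> points (PD m)" "?c \<in> points (PD m)" using k by (auto simp: points_pretzel)
  have T: "?T \<subseteq> {1..<k}" by (auto simp: mid_def inner_low)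
  have satB: "saturated model u B" "saturated model u B'"
    using saturated_core[OF sat(1)] saturated_core[OF sat(2)] unfolding ms by (simp_all add: u_def B_def B'_def)
  have sub: "B \<subseteq> {..<16}" "B' \<subseteq> {..<16}"
    using saturated_subset[OF satB(1)] saturated_subset[OF satB(2)] by (auto simp: points_model)
  have iff: "(x, ?a) \<in> conn (PD m) v <-> (point_code m v x, ca) \<in> conn model u"
    "(x, ?c) \<in> conn (PD m) v <-> (point_code m v x, cc) \<in> conn model u" if "x \<in> points (PD m)" for x
    using conn_PD_iff[OF that pts(1), of v] conn_PD_iff[OF that pts(2), of v] by (simp_all only: ca cc u_def)
  have big: "(y, y') \<in> conn model u <-> y = y'" if "\<not> y' < 16" for y y'
    using conn_model_code[of y' y u] that conn_sym[of y y' model u] by auto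
  have memA: "x \<in> A <-> point_code m v x \<in> B \<union> (+) 15 ` ?T" if "x \<in> points (PD m)" for x
    unfolding B_def by (rule saturated_mem_iff[OF sat(1) that])
  have memA': "x \<in> A' <-> point_code m ?w x \<in> B' \<union> (+) 15 ` inner m (up_col m k p)" if "x \<in> points (PD m)" for x
    using saturated_mem_iff[OF sat(2) that] unfolding mid B'_def .
  have mem_low: "y \<in> B'' \<union> (+) 15 ` T' <-> y \<in> B''" if "y < 16" "0 \<notin> T'" for y B'' and T' :: "nat set"
  proof -
    have "y \<noteq> 15 + l" if "l \<in> T'" for l using that \<open>0 \<notin> T'\<close> \<open>y < 16\<close> by (cases l) auto
    then show ?thesis by blast
  qed
  have mem_high: "15 + l \<in> B'' \<union> (+) 15 ` T' <-> l \<in> T'" if "0 < l" "B'' \<subseteq> {..<16}" for l B'' and T' :: "nat set"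
    using that by auto
  have n0: "0 \<notin> ?T" "0 \<notin> inner m (up_col m k p)" using T by (auto simp: inner_up_col)
  have a: "?a \<in> A <-> (if p = 0 then 0 \<in> B else p \<in> ?T)"
    unfolding memA[OF pts(1)] ca ca_def using mem_low[OF _ n0(1), of 0 B] mem_high[of p B ?T] sub by simp
  have c: "?c \<in> A <-> (if Suc p = k then 15 \<in> B else Suc p \<in> ?T)"
    unfolding memA[OF pts(2)] cc cc_def using mem_low[OF _ n0(1), of 15 B] mem_high[of "Suc p" B ?T] sub by auto
  have a': "?a \<in> A' <-> (if p = 0 then 0 \<in> B' else if Suc p = k then 15 \<in> B' else True)"
  proof -
    have "point_code m ?w ?a = (if p = 0 then 0 else if Suc p = k then 15 else 15 + p)"
      using va level_code_up[of p] k by simp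
    moreover have "p \<in> inner m (up_col m k p)" if "0 < p" "Suc p \<noteq> k" using that k by (auto simp: inner_up_col)
    ultimately show ?thesis
      unfolding memA'[OF pts(1)]
      using mem_low[OF _ n0(2), of 0 B'] mem_low[OF _ n0(2), of 15 B'] mem_high[of p B' "inner m (up_col m k p)"] sub by auto
  qed
  have nc: "(?a, ?c) \<notin> conn (PD m) v"
  proof (cases "Suc p = k")
    case True
    then have "ca = 15 + p" "0 < p" "cc = 15" using k by (auto simp: ca_def cc_def)
    then have "(cc, ca) \<notin> conn model u" using big[of ca cc] by auto
    then show ?thesis using iff(2)[OF pts(1)] conn_sym[of ca cc model u] unfolding ca by blast
  next
    case False
    then have "cc = 16 + p" "ca \<noteq> cc" by (auto simp: ca_def cc_def)
    then show ?thesis using iff(2)[OF pts(1)] big[of cc ca] unfolding ca by simp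
  qed
  \<comment> \<open>Inner circles not at the crossing keep their labels, and the target has only X
    there; so One can occur at the levels \<open>p\<close> and \<open>Suc p\<close> alone.\<close>
  have pw: "(\<forall>x\<in>points (PD m). (x, ?a) \<notin> conn (PD m) v --> (x, ?c) \<notin> conn (PD m) v --> (x \<in> A' <-> x \<in> A)) <->
    (\<forall>y<16. (y, ca) \<notin> conn model u --> (y, cc) \<notin> conn model u --> (y \<in> B' <-> y \<in> B)) \<and> N \<subseteq> {p, Suc p}"
    (is "?L <-> ?R")
  proof
    assume L: ?L
    have "y \<in> B' <-> y \<in> B" if y: "y < 16" "(y, ca) \<notin> conn model u" "(y, cc) \<notin> conn model u" for y
    proof -
      have "(point_of y, ?a) \<notin> conn (PD m) v" "(point_of y, ?c) \<notin> conn (PD m) v"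
        using iff[OF point_of_in_points[OF y(1)]] y point_code_point_of[OF y(1)] by simp_all
      then have "point_of y \<in> A' <-> point_of y \<in> A" using L point_of_in_points[OF y(1)] by blast
      then show ?thesis using y by (simp add: B_def B'_def core_def)
    qed
    moreover have lT: "l \<in> ?T" if l: "0 < l" "l < k" "l \<noteq> p" "l \<noteq> Suc p" for l
    proof -
      have x: "(2, l, False) \<in> points (PD m)" using l k by (simp add: points_pretzel)
      have cl: "point_code m v (2, l, False) = 15 + l" using code l by simp
      have "ca \<noteq> 15 + l" "cc \<noteq> 15 + l" using l by (auto simp: ca_def cc_def)
      moreover have "\<not> 15 + l < 16" using l by simp
      ultimately have "(15 + l, ca) \<notin> conn model u" "(15 + l, cc) \<notin> conn model u"
        using big[of "15 + l"] by (meson conn_sym)+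
      then have "((2, l, False), ?a) \<notin> conn (PD m) v" "((2, l, False), ?c) \<notin> conn (PD m) v"
        using iff[OF x] by (simp_all only: cl simp_thms)
      then have "(2, l, False) \<in> A' <-> (2, l, False) \<in> A" using L x by blast
      moreover have "l \<in> inner m (up_col m k p)" using l by (auto simp: inner_up_col)
      then have "(2, l, False) \<in> A'" using mid by (auto simp: mid_def)
      ultimately show ?thesis using l by (simp add: mid_def inner_low)
    qed
    have "l \<in> {p, Suc p}" if "l \<in> N" for l using lT[of l] that by (auto simp: N_def)
    then have "N \<subseteq> {p, Suc p}" by blast
    ultimately show ?R by blast
  next
    assume R: ?R
    show ?L
    proof (intro ballI impI)
      fix x assume x: "x \<in> points (PD m)" "(x, ?a) \<notin> conn (PD m) v" "(x, ?c) \<notin> conn (PD m) v"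
      let ?y = "point_code m v x"
      have y: "(?y, ca) \<notin> conn model u" "(?y, cc) \<notin> conn model u" using iff[OF x(1)] x by auto
      then have ne: "?y \<noteq> ca" "?y \<noteq> cc" by auto
      have cw: "point_code m ?w x = ?y"
      proof -
        obtain i l s where x': "x = (i, l, s)" by (cases x)
        show ?thesis
        proof (cases "i < 2")
          case False
          then have i: "i = 2" using x(1) by (auto simp: x' points_pretzel)
          have "l \<noteq> p" "l \<noteq> Suc p" using ne ca cc code by (auto simp: x' i simp del: point_code.simps)
          then have "level_code m ?w l = level_code m v l" using level_code_up[of l] level_code_low[of l] by simp
          then show ?thesis using va by (simp add: x' i)
        qed (simp add: x')
      qed
      have "?y \<in> {..<16} \<union> (+) 15 ` {1..<k}"
        using point_code_codes[OF x(1), of v] by (simp only: codes_def inner_low)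
      then have "?y < 16 \<or> (\<exists>l\<in>{1..<k}. ?y = 15 + l)" by blast
      then show "x \<in> A' <-> x \<in> A"
      proof
        assume low: "?y < 16"
        then show ?thesis
          unfolding memA[OF x(1)] memA'[OF x(1)] cw
          using mem_low[OF low n0(1), of B] mem_low[OF low n0(2), of B'] R y by blast
      next
        assume "\<exists>l\<in>{1..<k}. ?y = 15 + l"
        then obtain l where l: "0 < l" "l < k" "?y = 15 + l" by auto
        have "l \<noteq> p" "l \<noteq> Suc p" using ne l by (auto simp: ca_def cc_def)
        have "l \<in> ?T"
        proof (rule ccontr)
          assume "l \<notin> ?T"
          then have "l \<in> N" using l by (simp add: N_def)
          then show False using R \<open>l \<noteq> p\<close> \<open>l \<noteq> Suc p\<close> by blast
        qed
        moreover have "l \<in> inner m (up_col m k p)" using l \<open>l \<noteq> p\<close> \<open>l \<noteq> Suc p\<close> by (auto simp: inner_up_col)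
        ultimately show ?thesis
          unfolding memA[OF x(1)] memA'[OF x(1)] cw l(3) by blast
      qed
    qed
  qed
  have cr: "crossings (PD m) ! (6 + p) = (?a, (2, p, False), ?c, (2, Suc p, True))"
    using PD_crossing[of p m] k by simp
  have edge: "edge (PD m) v (6 + p) A A' <->
    (\<forall>y<16. (y, ca) \<notin> conn model u --> (y, cc) \<notin> conn model u --> (y \<in> B' <-> y \<in> B)) \<and> N \<subseteq> {p, Suc p} \<and>
    merge_rel (?a \<in> A) (?c \<in> A) (?a \<in> A')"
    unfolding edge_def cr prod.case pw using nc by simp
  have bigc: "(y, y') \<notin> conn model u" if "y < 16" "\<not> y' < 16" for y y' using big that by auto
  have N: "N \<subseteq> {1..<k}" "\<And>l. 0 < l ==> l < k ==> l \<in> ?T <-> l \<notin> N" by (auto simp: N_def)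
  consider "p = 0" "Suc p < k" | "0 < p" "Suc p = k" | "0 < p" "Suc p < k" using k by linarith
  then show ?thesis
  proof cases
    case 1
    have N1: "N \<subseteq> {p, Suc p} <-> N \<subseteq> {1}" "N \<subseteq> {1} ==> 1 \<in> ?T <-> N = {}" "N \<noteq> {p}"
      using N 1 by auto
    have "edge (PD m) v (6 + p) A A' <-> N \<subseteq> {1} \<and>
      (\<forall>y<16. (y, 0) \<notin> conn model u --> (y \<in> B' <-> y \<in> B)) \<and> merge_rel (0 \<in> B) (1 \<in> ?T) (0 \<in> B')"
      unfolding edge a c a' N1(1) using 1 bigc by (auto simp: ca_def cc_def)
    also have "\<dots> <-> N \<subseteq> {1} \<and> (if 1 \<in> ?T then 0 \<notin> B \<and> B' = B \<union> cls model u 0 else B' = B)"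
      using merge_on_class[OF satB, of 0 "1 \<in> ?T"] by simp
    also have "\<dots> <-> N = {1} \<and> B' = B \<or> N = {} \<and> 0 \<notin> B \<and> B' = B \<union> cls model u 0"
      using N1(2) by (cases "N \<subseteq> {1}") auto
    finally show ?thesis using 1 N1(3) by simp
  next
    case 2
    have Np: "N \<subseteq> {p, Suc p} <-> N \<subseteq> {p}" "N \<subseteq> {p} ==> p \<in> ?T <-> N = {}" "N \<noteq> {Suc p}"
      using N 2 by auto
    have "edge (PD m) v (6 + p) A A' <-> N \<subseteq> {p} \<and>
      (\<forall>y<16. (y, 15) \<notin> conn model u --> (y \<in> B' <-> y \<in> B)) \<and> merge_rel (15 \<in> B) (p \<in> ?T) (15 \<in> B')"
      unfolding edge a c a' Np(1) using 2 bigc by (auto simp: ca_def cc_def merge_rel_def)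
    also have "\<dots> <-> N \<subseteq> {p} \<and> (if p \<in> ?T then 15 \<notin> B \<and> B' = B \<union> cls model u 15 else B' = B)"
      using merge_on_class[OF satB, of 15 "p \<in> ?T"] by simp
    also have "\<dots> <-> N = {p} \<and> B' = B \<or> N = {} \<and> 15 \<notin> B \<and> B' = B \<union> cls model u 15"
      using Np(2) by (cases "N \<subseteq> {p}") auto
    finally show ?thesis using 2 Np(3) by simp
  next
    case 3
    have "B' = B <-> (\<forall>y<16. y \<in> B' <-> y \<in> B)" using sub by blast
    moreover have "N \<subseteq> {p, Suc p} \<and> merge_rel (p \<in> ?T) (Suc p \<in> ?T) True <-> N = {p} \<or> N = {Suc p}"
      using N(2)[of p] N(2)[of "Suc p"] 3 k by (auto simp: merge_rel_def)
    ultimately show ?thesis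
      unfolding edge a c a' using 3 bigc by (auto simp: ca_def cc_def)
  qed
qed

end

text \<open>\<open>edge_column\<close> in matrix form. It retains the three ways to reach a cell
  with all inner circles X: two circles inside the column, or the action of X at the top or at the
  bottom.\<close>

lemma dmat_column:
  assumes s: "s \<in> gcells (PD m) j (3 + int (m - k))" "fst s \<inter> {6..} = low_col m k"
    and t: "t \<in> model_part False j' i'"
  defines "N \<equiv> {1..<k} - mid m s"
  shows "dmat (PD m) s (xcell m (up_col m k p) t) =
    - (of_bool (N = {p} \<or> N = {Suc p}) * of_bool (t = core m s) + of_bool (N = {}) *
      (of_bool (p = 0) * xmat model 0 (core m s) t + of_bool (Suc p = k) * xmat model 15 (core m s) t))"
proof -
  obtain v A where vA: "s = (v, A)" by (cases s)
  have v: "v \<inter> {6..} = low_col m k" using s(2) by (simp add: vA)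
  have c: "v \<subseteq> {..<6 + m}" "saturated (PD m) v A" "card v = 3 + (m - k)"
    using s(1) by (auto simp: vA gcells_def cells_PD)
  have K: "up_col m k p \<subseteq> {6..<6 + m}" "\<not> vert_above (up_col m k p) m"
    using up_col_subset not_vert_above_up_col k by auto
  define T where "T = xcell m (up_col m k p) t"
  have "t \<in> model_part (vert_above (up_col m k p) m) j' i'" using t K(2) by simp
  note x = xcell_props[OF K(1) this, folded T_def]
  have n: "6 + p \<notin> v" "6 + p < n_crossings (PD m)" using low_col_iff[OF v] k by (auto simp: n_crossings_pretzel)
  have fin: "finite v" using c(1) by (rule finite_subset) simp
  \<comment> \<open>In this degree exactly three crossings of the first two columns are 1-smoothed,
    and the horizontal crossings above \<open>p\<close> do not count; hence the odd power.\<close>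
  have sign: "edge_sign v (6 + p) = -1"
  proof -
    have "y < 6 + p <-> y < 6" if "y \<in> v" for y
      using low_col_iff[OF v, of "y - 6"] that k by (cases "y < 6") auto
    then have "{y \<in> v. y < 6 + p} = v \<inter> {..<6}" by auto
    moreover have "card (v \<inter> {..<6}) = 3" using card_split_col[OF fin v] c(3) by simp
    ultimately show ?thesis by (simp add: edge_sign_def)
  qed
  have va: "\<not> vert_above v m" "\<not> vert_above (insert (6 + p) v) m" using not_vert_above[OF v] k by auto
  have ms: "model_state m (insert (6 + p) v) = model_state m v" using va by (auto simp: model_state_def)
  show ?thesis
  proof (cases "fst t = model_state m v")
    case True
    have "model_state m v \<inter> {..<6} = v \<inter> {..<6}" by (auto simp: model_state_def)
    then have fT: "fst T = insert (6 + p) v" using x(5) v by (auto simp: True)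
    then obtain A' where T: "T = (insert (6 + p) v, A')" by (cases T) auto
    have sat': "saturated (PD m) (insert (6 + p) v) A'" using x(1) by (simp add: T cells_PD)
    have t': "t = (model_state m v, snd (core m (insert (6 + p) v, A')))"
      using x(4) by (simp add: T core_def prod_eq_iff ms)
    have m': "mid m (insert (6 + p) v, A') = inner m (up_col m k p)" using x(3) by (simp add: T)
    have core: "fst (core m (v, A)) = model_state m v" by (simp add: core_def)
    have N': "{1..<k} - mid m (v, A) = N" by (simp add: N_def vA)
    have "p = 0 ==> Suc p \<noteq> k" using k by simp
    then show ?thesis
      unfolding T_def[symmetric]
      unfolding T vA dmat_insert[OF n(2,1)] sign edge_column[OF v c(2) sat' m']
        N' xmat_def t' prod_eq_iff fst_conv snd_conv core
      by (cases "N = {}"; cases "p = 0"; cases "Suc p = k") simp_all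
  next
    case False
    have "dmat (PD m) s T = 0"
    proof (rule ccontr)
      assume "dmat (PD m) s T \<noteq> 0"
      then obtain y where y: "y \<notin> v" "fst T = insert y v"
        using dmat_nonzero[of "PD m" v A "fst T" "snd T"] by (auto simp: vA)
      have "6 + p \<in> fst T" using x(2) by auto
      then have "y = 6 + p" using y n(1) by auto
      then have "fst (core m T) = model_state m v" by (simp add: core_def y(2) ms)
      then show False using False x(4) by simp
    qed
    moreover have "core m s \<noteq> t" "fst (core m s) \<noteq> fst t" using False by (auto simp: vA core_def)
    ultimately show ?thesis by (auto simp: T_def[symmetric] xmat_def)
  qed
qed

end

section \<open>Cycles which do not extend\<close>

lemma sum_xcells:
  assumes "K \<subseteq> {6..<6 + m}" "j' = j + int (card K) - of_bool (vert_above K m) - int (card (inner m K))"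
    and "i' = i + int (card K)"
  shows "(\<Sum>s\<in>xcells m K j' i'. F s) = (\<Sum>t\<in>model_part (vert_above K m) j i. F (xcell m K t))"
  by (rule sum.reindex_bij_betw[symmetric]) (rule bij_xcell[OF assms])

lemma xcells_subset_hcells:
  assumes "0 < k" "k \<le> k'" "k \<le> m"
  shows "xcells m (low_col m k) j i \<subseteq> hcells m k' j i"
proof
  fix s assume s: "s \<in> xcells m (low_col m k) j i"
  then have col: "fst s \<inter> {6..} = low_col m k" by (simp add: xcells_def)
  have "vert_above (fst s) m = vert_above (low_col m k) m" "vert_below m (fst s) k' = vert_below m (low_col m k) k'"
    using vert_above_col[of "fst s" m] vert_below_col[of m "fst s" k'] by (simp_all only: col)
  moreover have "vert_below m (low_col m k) k'" using assms by (auto simp: vert_below_def)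
  ultimately show "s \<in> hcells m k' j i"
    using s vert_above_low_col[OF assms(1,3)] by (simp add: hcells_def xcells_def)
qed

lemma hcells_col:
  assumes s: "s \<in> hcells m k j i" and t: "t \<in> xcells m (up_col m k p) j' i'" and p: "p < k" "k \<le> m"
    and d: "dmat (PD m) s t \<noteq> 0"
  shows "fst s \<inter> {6..} = low_col m k \<or> fst s \<inter> {6..} = up_col m k p"
proof -
  obtain x where x: "x \<notin> fst s" "fst t = insert x (fst s)"
    using dmat_nonzero[of "PD m" "fst s" "snd s" "fst t" "snd t"] d by auto
  have col: "insert x (fst s) \<inter> {6..} = up_col m k p" using t by (simp add: xcells_def x(2))
  have vb: "y \<in> fst s" if "y \<in> low_col m k" for y
  proof -
    have "y = 6 + (y - 6)" "k \<le> y - 6" "y - 6 < m" using that by auto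
    then show ?thesis using s unfolding hcells_def vert_below_def by (metis (mono_tags, lifting) mem_Collect_eq)
  qed
  show ?thesis
  proof (cases "x < 6")
    case True
    then show ?thesis using col low_insert[OF True, of "fst s"] by simp
  next
    case False
    then have "x \<in> up_col m k p" using col by auto
    then have xp: "x = 6 + p" using x(1) vb by blast
    have "y \<in> fst s \<inter> {6..} <-> y \<in> low_col m k" for y
    proof -
      have "y \<in> insert x (fst s) \<inter> {6..} <-> y = 6 + p \<or> y \<in> low_col m k" unfolding col by simp
      moreover have "6 + p \<notin> low_col m k" using p by simp
      ultimately show ?thesis using x(1) by (auto simp: xp)
    qed
    then show ?thesis by blast
  qed
qed

text \<open>A single circle labelled One at level \<open>l\<close> can be merged upwards or
  downwards, by crossing \<open>l - 1\<close> or \<open>l\<close>. The alternating signs cancel the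
  two contributions.\<close>

lemma sum_neighbours:
  assumes "1 \<le> l" "l < (k :: nat)"
  shows "(\<Sum>p<k. (-1) ^ p * of_bool (l = p \<or> l = Suc p)) = (0 :: rat)"
proof -
  have "(\<Sum>p<k. (-1) ^ p * of_bool (l = p \<or> l = Suc p)) = (\<Sum>p\<in>{l - 1, l}. (-1) ^ p * of_bool (l = p \<or> l = Suc p) :: rat)"
    by (rule sum.mono_neutral_right) (use assms in auto)
  also have "\<dots> = (-1) ^ (l - 1) + (-1) ^ l" using assms by (cases l) auto
  also have "\<dots> = 0" using assms by (cases l) auto
  finally show ?thesis .
qed

text \<open>The class transported through the cancelled generators is detected without computing the
  zigzags: a functional on all of \<open>hcells\<close> that factors through the differential
  vanishes on cycles, and it is chosen to see only the fully X-labelled cells of the layer, where it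
  computes the two actions of X paired with the cocycle \<open>c\<close>.\<close>

lemma horizontal_not_extends:
  assumes k: "2 \<le> k" "k \<le> m" and j0: "j0 = 3 \<or> j0 = 5"
    and j: "j = j0 + int (m - k) - int (k - 1)" and i: "i = 3 + int (m - k)"
  defines "K \<equiv> low_col m k"
  shows "\<exists>f\<in>supp_on (xcells m K j i). app (dmat (PD m)) (xcells m K j i) (xcells m K j (i + 1)) f = 0 \<and>
    \<not> extends_to_cycle (dmat (PD m)) (\<lambda>i. hcells m k j i - xcells m K j i) (xcells m K j) i f"
proof -
  let ?M = "dmat (PD m)"
  have K: "K \<subseteq> {6..<6 + m}" "\<not> vert_above K m" "inner m K = {1..<k}" "card K = m - k"
    using k vert_above_low_col[of k m] inner_low_col[of k m] by (auto simp: K_def)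
  from j0 obtain g c where g: "g \<in> supp_on (model_part False j0 3)"
      "app (dmat model) (model_part False j0 3) (model_part False j0 4) g = 0"
    and c: "\<And>t. t \<in> model_part False (j0 - 2) 2 ==> (\<Sum>p\<in>model_part False (j0 - 2) 3. dmat model t p * c p) = 0"
    and gc: "\<And>r :: rat. \<bar>r\<bar> = 1 ==> (\<Sum>p\<in>model_part False (j0 - 2) 3.
       (app (xmat model 0) (model_part False j0 3) (model_part False (j0 - 2) 3) g p +
        r * app (xmat model 15) (model_part False j0 3) (model_part False (j0 - 2) 3) g p) * c p) \<noteq> 0"
    by (rule model_cycle) blast
  define f where "f s = (if s \<in> xcells m K j i then g (core m s) else 0)" for s
  let ?MP = "model_part False (j0 - 2) 3"
  have sum_f: "(\<Sum>s\<in>xcells m K j i. f s * h s) = (\<Sum>t\<in>model_part False j0 3. g t * h (xcell m K t))" for h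
  proof -
    have "(\<Sum>s\<in>xcells m K j i. f s * h s) = (\<Sum>s\<in>xcells m K j i. g (core m s) * h s)" by (simp add: f_def)
    also have "\<dots> = (\<Sum>t\<in>model_part (vert_above K m) j0 3. g (core m (xcell m K t)) * h (xcell m K t))"
      by (rule sum_xcells[OF K(1)]) (use K k in \<open>simp_all add: j i\<close>)
    also have "\<dots> = (\<Sum>t\<in>model_part False j0 3. g t * h (xcell m K t))"
      using K(2) xcell_props(4)[OF K(1)] by (intro sum.cong) auto
    finally show ?thesis .
  qed
  have f: "f \<in> supp_on (xcells m K j i)" by (simp add: supp_on_def f_def)
  have bij: "bij_betw (xcell m K) (model_part False j0 4) (xcells m K j (i + 1))"
    using bij_xcell[OF K(1), of j j0 "i + 1" 4] K k by (simp add: j i)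
  have cyc: "app ?M (xcells m K j i) (xcells m K j (i + 1)) f = 0"
  proof
    fix q
    show "app ?M (xcells m K j i) (xcells m K j (i + 1)) f q = 0 q"
    proof (cases "q \<in> xcells m K j (i + 1)")
      case True
      then obtain q' where q': "q' \<in> model_part False j0 4" "q = xcell m K q'"
        using bij_betw_imp_surj_on[OF bij] by (metis imageE)
      have "app ?M (xcells m K j i) (xcells m K j (i + 1)) f q
        = (\<Sum>t\<in>model_part False j0 3. g t * ?M (xcell m K t) (xcell m K q'))"
        using True sum_f[of "\<lambda>s. ?M s q"] by (simp add: app_def q'(2))
      also have "\<dots> = (\<Sum>t\<in>model_part False j0 3. g t * dmat model t q')"
        using K(2) q'(1) by (intro sum.cong refl arg_cong2[where f = times] dmat_xcell[OF K(1)]) auto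
      also have "\<dots> = 0" using fun_cong[OF g(2), of q'] q'(1) by (simp add: app_def)
      finally show ?thesis by simp
    qed (simp add: app_def)
  qed
  have "\<not> extends_to_cycle ?M (\<lambda>i. hcells m k j i - xcells m K j i) (xcells m K j) i f"
  proof
    assume "extends_to_cycle ?M (\<lambda>i. hcells m k j i - xcells m K j i) (xcells m K j) i f"
    moreover have sub: "(hcells m k j i - xcells m K j i) \<union> xcells m K j i = hcells m k j i" for i
      using xcells_subset_hcells[of k k m j i] k by (auto simp: K_def)
    ultimately obtain z' where z': "z' \<in> supp_on (hcells m k j i - xcells m K j i)"
      "app ?M (hcells m k j i) (hcells m k j (i + 1)) (z' + f) = 0"
      by (auto simp: extends_to_cycle_def sub)
    \<comment> \<open>The cocycle \<open>c\<close> is placed on every pattern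
      \<open>up_col m k p\<close>, on cells whose inner circles are all X, with signs alternating in
      \<open>p\<close>, and pulled back by the differential.\<close>
    define \<Lambda> where "\<Lambda> s = (\<Sum>p<k. (-1) ^ p * (\<Sum>t\<in>?MP. ?M s (xcell m (up_col m k p) t) * c t))" for s
    have up: "up_col m k p \<subseteq> {6..<6 + m}" "\<not> vert_above (up_col m k p) m" "card (up_col m k p) = Suc (m - k)"
      "card (inner m (up_col m k p)) = k - 2" if "p < k" for p
      using up_col_subset[OF k that] not_vert_above_up_col[OF k that, of m] card_up_col[OF k that]
        card_inner_up_col[OF k that] k by auto
    have bij_up: "bij_betw (xcell m (up_col m k p)) (model_part False (j0 - 2) i0) (xcells m (up_col m k p) j (i0 + int (Suc (m - k))))"
      if "p < k" for p i0
      using bij_xcell[OF up(1)[OF that], of j "j0 - 2" "i0 + int (Suc (m - k))" i0] up[OF that] k by (simp add: j of_nat_diff)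
    have x_up: "xcell m (up_col m k p) t \<in> xcells m (up_col m k p) j (i + 1)" if "p < k" "t \<in> ?MP" for p t
      using bij_betwE[OF bij_up[OF that(1), of 3]] that(2) by (simp add: i algebra_simps)
    have x_h: "xcell m (up_col m k p) t \<in> hcells m k j (i + 1)" if "p < k" "t \<in> ?MP" for p t
    proof -
      have x: "xcell m (up_col m k p) t \<in> gcells (PD m) j (i + 1)" "fst (xcell m (up_col m k p) t) \<inter> {6..} = up_col m k p"
        using x_up[OF that] by (auto simp: xcells_def)
      have "\<not> vert_above (fst (xcell m (up_col m k p) t)) m"
        using vert_above_col[of "fst (xcell m (up_col m k p) t)" m] up(2)[OF that(1)] unfolding x(2) by simp
      moreover have "vert_below m (fst (xcell m (up_col m k p) t)) k"
        using vert_below_col[of m "fst (xcell m (up_col m k p) t)" k] unfolding x(2) by (auto simp: vert_below_def)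
      ultimately show ?thesis using x(1) by (simp add: hcells_def)
    qed
    \<comment> \<open>\<open>\<Lambda>\<close> factors through the differential, and
      \<open>z' + f\<close> is assumed to be a cycle.\<close>
    have zero: "(\<Sum>s\<in>hcells m k j i. (z' + f) s * \<Lambda> s) = 0"
    proof -
      have "(\<Sum>s\<in>hcells m k j i. (z' + f) s * \<Lambda> s) =
        (\<Sum>s\<in>hcells m k j i. \<Sum>p<k. \<Sum>t\<in>?MP. (-1) ^ p * c t * ((z' + f) s * ?M s (xcell m (up_col m k p) t)))"
        by (simp add: \<Lambda>_def sum_distrib_left mult_ac)
      also have "\<dots> = (\<Sum>p<k. \<Sum>t\<in>?MP. \<Sum>s\<in>hcells m k j i. (-1) ^ p * c t * ((z' + f) s * ?M s (xcell m (up_col m k p) t)))"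
        by (subst sum.swap) (intro sum.cong refl sum.swap)
      also have "\<dots> = (\<Sum>p<k. \<Sum>t\<in>?MP. (-1) ^ p * c t * app ?M (hcells m k j i) (hcells m k j (i + 1)) (z' + f) (xcell m (up_col m k p) t))"
        using x_h by (intro sum.cong refl) (simp add: app_def sum_distrib_left)
      also have "\<dots> = 0" by (simp add: z'(2))
      finally show ?thesis .
    qed
    \<comment> \<open>On a source that already has an \<open>up_col\<close> pattern only crossings
      of the first two columns can change, and there \<open>c\<close> is a cocycle of the
      model.\<close>
    have \<Lambda>_up: "\<Lambda> s = 0" if s: "s \<in> hcells m k j i" and p0: "p0 < k" "fst s \<inter> {6..} = up_col m k p0" for s p0
    proof -
      have s': "s \<in> cells (PD m)" "s \<in> gcells (PD m) j i" using s by (auto simp: hcells_def gcells_def)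
      have "(\<Sum>t\<in>?MP. ?M s (xcell m (up_col m k p) t) * c t) = 0" if p: "p < k" for p
      proof (cases "p = p0")
        case True
        have "?M s (xcell m (up_col m k p) t) = dmat model (core m s) t * of_bool (mid m s = inner m (up_col m k p))"
          if t: "t \<in> ?MP" for t
        proof -
          have "t \<in> model_part (vert_above (up_col m k p) m) (j0 - 2) 3" using t up(2)[OF p] by simp
          note x = xcell_props[OF up(1)[OF p] this]
          show ?thesis using dmat_low[OF s'(1) x(1)] x p0(2) True by simp
        qed
        then have "(\<Sum>t\<in>?MP. ?M s (xcell m (up_col m k p) t) * c t)
          = (\<Sum>t\<in>?MP. dmat model (core m s) t * c t) * of_bool (mid m s = inner m (up_col m k p))"
          by (simp add: sum_distrib_right mult_ac)
        also have "\<dots> = 0"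
        proof (cases "mid m s = inner m (up_col m k p)")
          case mid: True
          have "s \<in> xcells m (up_col m k p) j i" using s'(2) p0(2) mid True by (simp add: xcells_def)
          then have "s \<in> xcells m (up_col m k p) j (2 + int (Suc (m - k)))" by (simp add: i algebra_simps)
          then obtain t where t: "t \<in> model_part False (j0 - 2) 2" "s = xcell m (up_col m k p) t"
            using bij_betw_imp_surj_on[OF bij_up[OF p, of 2]] by (metis imageE)
          have "core m s = t" using xcell_props(4)[OF up(1)[OF p], of t "j0 - 2" 2] t up(2)[OF p] by simp
          then show ?thesis using c[OF t(1)] by simp
        qed simp
        finally show ?thesis .
      next
        case False
        have "?M s (xcell m (up_col m k p) t) = 0" if t: "t \<in> ?MP" for t
        proof (rule ccontr)
          assume "?M s (xcell m (up_col m k p) t) \<noteq> 0"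
          then have "fst s \<inter> {6..} = low_col m k \<or> fst s \<inter> {6..} = up_col m k p"
            using hcells_col[OF s x_up[OF p t] p k(2)] by blast
          moreover have "6 + p0 \<in> fst s \<inter> {6..}" unfolding p0(2) by simp
          ultimately have "6 + p0 \<in> low_col m k \<or> 6 + p0 \<in> up_col m k p" by metis
          then show False using False p0(1) by auto
        qed
        then show ?thesis by simp
      qed
      then show ?thesis by (simp add: \<Lambda>_def)
    qed
    \<comment> \<open>Contributions from a single circle labelled One cancel by
      \<open>sum_neighbours\<close>. If all inner circles are X, only the first and the last
      crossing contribute, and the position of the last one, \<open>k - 1\<close>, gives the
      relative sign.\<close>
    have \<Lambda>_low: "\<Lambda> s = - of_bool (mid m s = inner m K) *
        (\<Sum>t\<in>?MP. (xmat model 0 (core m s) t + (-1) ^ (k - 1) * xmat model 15 (core m s) t) * c t)"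
      if s: "s \<in> hcells m k j i" and col: "fst s \<inter> {6..} = low_col m k" for s
    proof -
      have s': "s \<in> gcells (PD m) j (3 + int (m - k))" using s by (auto simp: hcells_def i)
      define N where "N = {1..<k} - mid m s"
      have inn: "inner m (fst s) = {1..<k}" using inner_col[of m "fst s"] K(3) by (simp add: col K_def)
      then have N: "N = {} <-> mid m s = inner m K" by (auto simp: N_def mid_def K(3))
      define S where "S = (\<Sum>t\<in>?MP. of_bool (t = core m s) * c t)"
      define S0 where "S0 = (\<Sum>t\<in>?MP. xmat model 0 (core m s) t * c t)"
      define S15 where "S15 = (\<Sum>t\<in>?MP. xmat model 15 (core m s) t * c t)"
      have col_sum: "(\<Sum>t\<in>?MP. ?M s (xcell m (up_col m k p) t) * c t) =
        - (of_bool (N = {p} \<or> N = {Suc p}) * S + of_bool (N = {}) * (of_bool (p = 0) * S0 + of_bool (Suc p = k) * S15))"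
        if p: "p < k" for p
      proof -
        have "(\<Sum>t\<in>?MP. ?M s (xcell m (up_col m k p) t) * c t) = (\<Sum>t\<in>?MP.
          - (of_bool (N = {p} \<or> N = {Suc p}) * (of_bool (t = core m s) * c t) + of_bool (N = {}) *
          (of_bool (p = 0) * (xmat model 0 (core m s) t * c t) + of_bool (Suc p = k) * (xmat model 15 (core m s) t * c t))))"
          by (rule sum.cong[OF refl], subst dmat_column[OF k p s' col, folded N_def]) (simp_all add: algebra_simps)
        then show ?thesis unfolding S_def S0_def S15_def
          by (simp only: sum_negf sum.distrib sum_distrib_left[symmetric])
      qed
      have distr: "x * - (a * S + n * (b * S0 + b' * S15)) = - (x * a * S) - n * (b * (x * S0) + b' * (x * S15))" for x a b b' n :: rat
        by (simp add: algebra_simps)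
      have "\<Lambda> s = (\<Sum>p<k. (-1) ^ p *
        - (of_bool (N = {p} \<or> N = {Suc p}) * S + of_bool (N = {}) * (of_bool (p = 0) * S0 + of_bool (Suc p = k) * S15)))"
        unfolding \<Lambda>_def by (intro sum.cong refl) (simp only: col_sum lessThan_iff)
      also have "\<dots> = (\<Sum>p<k. - ((-1) ^ p * of_bool (N = {p} \<or> N = {Suc p}) * S) - of_bool (N = {}) *
        (of_bool (p = 0) * ((-1) ^ p * S0) + of_bool (Suc p = k) * ((-1) ^ p * S15)))"
        by (intro sum.cong refl) (rule distr)
      also have "\<dots> = - (\<Sum>p<k. (-1) ^ p * of_bool (N = {p} \<or> N = {Suc p})) * S - of_bool (N = {}) *
        ((\<Sum>p<k. of_bool (p = 0) * ((-1) ^ p * S0)) + (\<Sum>p<k. of_bool (Suc p = k) * ((-1) ^ p * S15)))"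
        by (simp only: sum_subtractf sum_negf sum.distrib sum_distrib_left[symmetric] sum_distrib_right[symmetric] mult_minus_left)
      also have "(\<Sum>p<k. of_bool (p = 0) * ((-1) ^ p * S0)) = S0"
      proof -
        have "(\<Sum>p<k. of_bool (p = 0) * ((-1) ^ p * S0)) = (\<Sum>p\<in>{0}. of_bool (p = 0) * ((-1) ^ p * S0))"
          by (rule sum.mono_neutral_right) (use k in auto)
        then show ?thesis by simp
      qed
      also have "(\<Sum>p<k. of_bool (Suc p = k) * ((-1) ^ p * S15)) = (-1) ^ (k - 1) * S15"
      proof -
        have "(\<Sum>p<k. of_bool (Suc p = k) * ((-1) ^ p * S15)) = (\<Sum>p\<in>{k - 1}. of_bool (Suc p = k) * ((-1) ^ p * S15))"
          by (rule sum.mono_neutral_right) (use k in auto)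
        then show ?thesis using k by simp
      qed
      also have "(\<Sum>p<k. (-1) ^ p * of_bool (N = {p} \<or> N = {Suc p})) = (0 :: rat)"
      proof (cases "\<exists>l. N = {l}")
        case True
        then obtain l where l: "N = {l}" by blast
        then have "1 \<le> l" "l < k" by (auto simp: N_def)
        then show ?thesis using sum_neighbours[of l k] by (simp add: l)
      next
        case False
        then have "\<not> (N = {p} \<or> N = {Suc p})" for p by blast
        then show ?thesis by simp
      qed
      finally have "\<Lambda> s = - of_bool (N = {}) * (S0 + (-1) ^ (k - 1) * S15)" by simp
      moreover have "S0 + (-1) ^ (k - 1) * S15
        = (\<Sum>t\<in>?MP. (xmat model 0 (core m s) t + (-1) ^ (k - 1) * xmat model 15 (core m s) t) * c t)"
        unfolding S0_def S15_def by (simp add: distrib_right sum.distrib sum_distrib_left mult.assoc)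
      ultimately show ?thesis by (simp add: N)
    qed
    have \<Lambda>_other: "\<Lambda> s = 0" if s: "s \<in> hcells m k j i - xcells m K j i" for s
    proof (cases "fst s \<inter> {6..} = low_col m k")
      case True
      then have "mid m s \<noteq> inner m K" using s by (auto simp: xcells_def hcells_def K_def)
      then show ?thesis using \<Lambda>_low[OF _ True] s by simp
    next
      case False
      show ?thesis
      proof (cases "\<exists>p<k. fst s \<inter> {6..} = up_col m k p")
        case True
        then show ?thesis using \<Lambda>_up s by blast
      next
        case up': False
        have "?M s (xcell m (up_col m k p) t) = 0" if "p < k" "t \<in> ?MP" for p t
          using hcells_col[of s m k j i, OF _ x_up[OF that] that(1) k(2)] s False up' that(1) by blast
        then show ?thesis by (simp add: \<Lambda>_def)
      qed
    qed
    have "(\<Sum>s\<in>hcells m k j i. (z' + f) s * \<Lambda> s) = (\<Sum>s\<in>xcells m K j i. f s * \<Lambda> s)"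
    proof -
      have "(\<Sum>s\<in>hcells m k j i. (z' + f) s * \<Lambda> s) = (\<Sum>s\<in>xcells m K j i. (z' + f) s * \<Lambda> s)"
        by (rule sum.mono_neutral_right) (use \<Lambda>_other sub[of i] in auto)
      also have "\<dots> = (\<Sum>s\<in>xcells m K j i. f s * \<Lambda> s)"
        using z'(1) by (intro sum.cong) (auto simp: supp_on_def)
      finally show ?thesis .
    qed
    also have "\<dots> = (\<Sum>t\<in>model_part False j0 3. g t * \<Lambda> (xcell m K t))" by (rule sum_f)
    also have "\<dots> = (\<Sum>t\<in>model_part False j0 3. g t * - (\<Sum>q\<in>?MP. (xmat model 0 t q + (-1) ^ (k - 1) * xmat model 15 t q) * c q))"
    proof (intro sum.cong refl arg_cong2[where f = times])
      fix t assume "t \<in> model_part False j0 3"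
      then have t: "t \<in> model_part (vert_above K m) j0 3" using K(2) by simp
      note x = xcell_props[OF K(1) t]
      have "xcell m K t \<in> xcells m K j i"
        using bij_betwE[OF bij_xcell[OF K(1), of j j0 i 3]] t K k by (simp add: j i)
      then have "xcell m K t \<in> hcells m k j i" using sub by blast
      then show "\<Lambda> (xcell m K t) = - (\<Sum>q\<in>?MP. (xmat model 0 t q + (-1) ^ (k - 1) * xmat model 15 t q) * c q)"
        using \<Lambda>_low x(2-4) by (simp add: K_def)
    qed
    also have "\<dots> = - (\<Sum>q\<in>?MP. (\<Sum>t\<in>model_part False j0 3. g t * (xmat model 0 t q + (-1) ^ (k - 1) * xmat model 15 t q)) * c q)"
    proof -
      have "(\<Sum>t\<in>model_part False j0 3. g t * - (\<Sum>q\<in>?MP. (xmat model 0 t q + (-1) ^ (k - 1) * xmat model 15 t q) * c q))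
        = - (\<Sum>t\<in>model_part False j0 3. \<Sum>q\<in>?MP. g t * (xmat model 0 t q + (-1) ^ (k - 1) * xmat model 15 t q) * c q)"
        by (simp add: sum_negf sum_distrib_left mult.assoc)
      then show ?thesis by (subst (asm) sum.swap) (simp add: sum_distrib_right)
    qed
    also have "\<dots> = - (\<Sum>q\<in>?MP. (app (xmat model 0) (model_part False j0 3) ?MP g q +
        (-1) ^ (k - 1) * app (xmat model 15) (model_part False j0 3) ?MP g q) * c q)"
      by (simp add: app_def distrib_left sum.distrib sum_distrib_left mult.left_commute)
    finally have "(\<Sum>q\<in>?MP. (app (xmat model 0) (model_part False j0 3) ?MP g q +
        (-1) ^ (k - 1) * app (xmat model 15) (model_part False j0 3) ?MP g q) * c q) = 0"
      using zero by simp
    then show False using gc[of "(-1) ^ (k - 1)"] by (simp add: power_abs)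
  qed
  then show ?thesis using f cyc by blast
qed

abbreviation full_col :: "nat => nat set" where
  "full_col m \<equiv> {6..<6 + m}"

lemma full_col: "vert_above (full_col m) m" "inner m (full_col m) = {}"
  using inner_not_vert_above[of _ m "full_col m"] by (auto simp: vert_above_def)

lemma full_col_iff:
  assumes "s \<in> cells (PD m)"
  shows "fst s \<inter> {6..} = full_col m <-> vert_above (fst s) m"
proof
  assume "fst s \<inter> {6..} = full_col m"
  then show "vert_above (fst s) m" using vert_above_col[of "fst s" m] full_col(1) by simp
next
  assume va: "vert_above (fst s) m"
  have "x \<in> fst s" if "x \<in> full_col m" for x
    using va[unfolded vert_above_def, rule_format, of "x - 6"] that by auto
  then show "fst s \<inter> {6..} = full_col m" using assms by (auto simp: cells_PD)
qed

lemma gcells_split: "gcells (PD m) j i = xcells m (full_col m) j i \<union> hcells m m j i"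
proof (rule set_eqI)
  fix s
  have "mid m s = inner m (full_col m)" if "s \<in> cells (PD m)" "fst s \<inter> {6..} = full_col m"
  proof -
    have "inner m (fst s) = {}" using inner_col[of m "fst s"] full_col(2)[of m] by (simp add: that(2))
    then show ?thesis by (simp add: mid_def full_col)
  qed
  moreover have "vert_below m (fst s) m" by (simp add: vert_below_def)
  ultimately show "s \<in> gcells (PD m) j i <-> s \<in> xcells m (full_col m) j i \<union> hcells m m j i"
    using full_col_iff[of s m] by (auto simp: xcells_def hcells_def gcells_def)
qed

lemma xcells_hcells_disjoint: "xcells m (full_col m) j i \<inter> hcells m k j i = {}"
  using full_col_iff[of _ m] by (auto simp: xcells_def hcells_def gcells_def)

lemma finite_xcells [simp]: "finite (xcells m K j i)"
  by (rule finite_subset[OF _ finite_gcells]) (auto simp: xcells_def)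

lemma dmat_full_hcells:
  assumes "s \<in> xcells m (full_col m) j i" "t \<in> hcells m k j i'"
  shows "dmat (PD m) s t = 0"
proof (rule ccontr)
  assume "dmat (PD m) s t \<noteq> 0"
  then have "fst s \<subseteq> fst t" using dmat_nonzero[of "PD m" "fst s" "snd s" "fst t" "snd t"] by auto
  moreover have "vert_above (fst s) m" using assms(1) full_col_iff[of s m] by (auto simp: xcells_def gcells_def)
  ultimately have "vert_above (fst t) m" by (auto simp: vert_above_def)
  then show False using assms(2) by (simp add: hcells_def)
qed

text \<open>A correction \<open>z\<close> in the vertical part would make the saddle image of the
  cycle a boundary there, contrary to its pairing with the cocycle \<open>e\<close>. The cycle is
  placed in the first layer, where the column has one horizontal crossing and no inner
  circles.\<close>

lemma saddle_not_extends:
  assumes m: "1 \<le> m" and j0: "j0 = 3 \<or> j0 = 5" and j: "j = j0 + int m - 1" and i: "i = int m + 2"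
  shows "\<exists>f\<in>supp_on (hcells m m j i). app (dmat (PD m)) (hcells m m j i) (hcells m m j (i + 1)) f = 0 \<and>
    \<not> extends_to_cycle (dmat (PD m)) (xcells m (full_col m) j) (hcells m m j) i f"
proof -
  let ?M = "dmat (PD m)" and ?K = "low_col m 1" and ?V = "full_col m"
  have K: "?K \<subseteq> {6..<6 + m}" "\<not> vert_above ?K m" "inner m ?K = {}" "card ?K = m - 1"
    using m vert_above_low_col[of 1 m] inner_low_col[of 1 m] by auto
  have V: "?V \<subseteq> {6..<6 + m}" by simp
  from j0 obtain g e where g: "g \<in> supp_on (model_part False j0 3)"
      "app (dmat model) (model_part False j0 3) (model_part False j0 4) g = 0"
    and e: "\<And>t. t \<in> model_part True j0 2 ==> (\<Sum>p\<in>model_part True j0 3. dmat model t p * e p) = 0"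
      "(\<Sum>p\<in>model_part True j0 3. app (dmat model) (model_part False j0 3) (model_part True j0 3) g p * e p) \<noteq> 0"
    by (rule model_cycle) blast
  define f where "f s = (if s \<in> xcells m ?K j i then g (core m s) else 0)" for s
  have sub: "xcells m ?K j i \<subseteq> hcells m m j i" for i using xcells_subset_hcells[of 1 m m j i] m by simp
  have sum_f: "(\<Sum>s\<in>hcells m m j i. f s * h s) = (\<Sum>t\<in>model_part False j0 3. g t * h (xcell m ?K t))" for h
  proof -
    have "(\<Sum>s\<in>hcells m m j i. f s * h s) = (\<Sum>s\<in>xcells m ?K j i. f s * h s)"
      by (rule sum.mono_neutral_right) (use sub in \<open>auto simp: f_def\<close>)
    also have "\<dots> = (\<Sum>s\<in>xcells m ?K j i. g (core m s) * h s)" by (simp add: f_def)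
    also have "\<dots> = (\<Sum>t\<in>model_part (vert_above ?K m) j0 3. g (core m (xcell m ?K t)) * h (xcell m ?K t))"
      by (rule sum_xcells[OF K(1)]) (use K m in \<open>simp_all add: j i\<close>)
    also have "\<dots> = (\<Sum>t\<in>model_part False j0 3. g t * h (xcell m ?K t))"
      using K(2) xcell_props(4)[OF K(1)] by (intro sum.cong) auto
    finally show ?thesis .
  qed
  have f: "f \<in> supp_on (hcells m m j i)" using sub by (auto simp: supp_on_def f_def)
  have bij: "bij_betw (xcell m ?K) (model_part False j0 4) (xcells m ?K j (i + 1))"
    using bij_xcell[OF K(1), of j j0 "i + 1" 4] K m by (simp add: j i)
  have cyc: "app ?M (hcells m m j i) (hcells m m j (i + 1)) f = 0"
  proof
    fix q
    consider "q \<notin> hcells m m j (i + 1)" | "q \<in> xcells m ?K j (i + 1)"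
      | "q \<in> hcells m m j (i + 1)" "q \<notin> xcells m ?K j (i + 1)" by blast
    then show "app ?M (hcells m m j i) (hcells m m j (i + 1)) f q = 0 q"
    proof cases
      case 2
      then obtain q' where q': "q' \<in> model_part False j0 4" "q = xcell m ?K q'"
        using bij_betw_imp_surj_on[OF bij] by (metis imageE)
      have "app ?M (hcells m m j i) (hcells m m j (i + 1)) f q
        = (\<Sum>t\<in>model_part False j0 3. g t * ?M (xcell m ?K t) (xcell m ?K q'))"
        using 2 sub sum_f[of "\<lambda>s. ?M s q"] by (auto simp: app_def q'(2))
      also have "\<dots> = (\<Sum>t\<in>model_part False j0 3. g t * dmat model t q')"
        using K(2) q'(1) by (intro sum.cong refl arg_cong2[where f = times] dmat_xcell[OF K(1)]) auto
      also have "\<dots> = 0" using fun_cong[OF g(2), of q'] q'(1) by (simp add: app_def)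
      finally show ?thesis by simp
    next
      case 3
      \<comment> \<open>From the first layer the only crossing of the column left to change leads to
        the vertical part, outside \<open>hcells\<close>; so the first layer is closed under the
        differential of the horizontal part.\<close>
      have "?M s q = 0" if s: "s \<in> xcells m ?K j i" for s
      proof (rule ccontr)
        assume "?M s q \<noteq> 0"
        then obtain x where x: "fst q = insert x (fst s)"
          using dmat_nonzero[of "PD m" "fst s" "snd s" "fst q" "snd q"] by auto
        have col: "fst s \<inter> {6..} = ?K" using s by (simp add: xcells_def)
        have q: "q \<in> gcells (PD m) j (i + 1)" "q \<in> cells (PD m)" "\<not> vert_above (fst q) m"
          using 3(1) by (auto simp: hcells_def gcells_def)
        have K6: "insert 6 ?K = ?V" using m by auto
        have xle: "x < 6 + m" using q(2) x by (auto simp: cells_PD)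
        have "fst q \<inter> {6..} = ?K"
        proof (cases "x < 6 \<or> x \<in> ?K")
          case True
          then show ?thesis unfolding x using col low_insert[of x "fst s"] by (metis (no_types, lifting) Int_iff insert_absorb)
        next
          case False
          then have "x = 6" using xle by auto
          then have "fst q \<inter> {6..} = insert 6 (fst s \<inter> {6..})" unfolding x by auto
          then have "fst q \<inter> {6..} = ?V" unfolding col K6 .
          then show ?thesis using q(2,3) full_col_iff by blast
        qed
        moreover from this have "inner m (fst q) = {}" using inner_col[of m "fst q"] K(3) by simp
        then have "mid m q = inner m ?K" unfolding K(3) by (simp add: mid_def)
        ultimately show False using q(1) 3(2) by (simp add: xcells_def)
      qed
      then show ?thesis by (auto simp: app_def f_def intro!: sum.neutral)
    qed (simp add: app_def)
  qed
  have "\<not> extends_to_cycle ?M (xcells m ?V j) (hcells m m j) i f"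
  proof
    assume "extends_to_cycle ?M (xcells m ?V j) (hcells m m j) i f"
    then obtain z where z: "z \<in> supp_on (xcells m ?V j i)"
      "app ?M (xcells m ?V j i \<union> hcells m m j i) (xcells m ?V j (i + 1) \<union> hcells m m j (i + 1)) (z + f) = 0"
      by (auto simp: extends_to_cycle_def)
    have bijV: "bij_betw (xcell m ?V) (model_part True j0 (i0 - int m)) (xcells m ?V j i0)" for i0
      using bij_xcell[OF V, of j j0 i0 "i0 - int m"] full_col[of m] by (simp add: j)
    have i2: "i - int m = 2" by (simp add: i)
    \<comment> \<open>The cycle condition for \<open>z + f\<close>, read at the vertical cells:
      boundary of \<open>z\<close> plus saddle of the model cycle.\<close>
    have ev: "(\<Sum>s\<in>xcells m ?V j i. z s * ?M s (xcell m ?V t)) + app (dmat model) (model_part False j0 3) (model_part True j0 3) g t = 0"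
      if t: "t \<in> model_part True j0 3" for t
    proof -
      let ?T = "xcell m ?V t"
      have T: "?T \<in> xcells m ?V j (i + 1)" using bij_betwE[OF bijV[of "i + 1"]] t by (simp add: i)
      have t': "t \<in> model_part (vert_above ?V m) j0 3" using t full_col by simp
      note x = xcell_props[OF V t']
      have "app ?M (xcells m ?V j i) (xcells m ?V j (i + 1) \<union> hcells m m j (i + 1)) z ?T +
        app ?M (hcells m m j i) (xcells m ?V j (i + 1) \<union> hcells m m j (i + 1)) f ?T = 0"
        using fun_cong[OF z(2), of ?T] fun_cong[OF app_Un[OF finite_xcells finite_hcells xcells_hcells_disjoint z(1) f], of ?M _ ?T]
        by (simp add: plus_fun_def)
      moreover have "app ?M (hcells m m j i) (xcells m ?V j (i + 1) \<union> hcells m m j (i + 1)) f ?T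
        = app (dmat model) (model_part False j0 3) (model_part True j0 3) g t"
      proof -
        have "app ?M (hcells m m j i) (xcells m ?V j (i + 1) \<union> hcells m m j (i + 1)) f ?T
          = (\<Sum>q\<in>model_part False j0 3. g q * ?M (xcell m ?K q) ?T)"
          using T sum_f[of "\<lambda>s. ?M s ?T"] by (simp add: app_def)
        also have "\<dots> = (\<Sum>q\<in>model_part False j0 3. g q * dmat model q t)"
        proof (intro sum.cong refl arg_cong2[where f = times])
          fix q assume "q \<in> model_part False j0 3"
          then have "q \<in> model_part (vert_above ?K m) j0 3" using K(2) by simp
          note y = xcell_props[OF K(1) this]
          have "?K = {7..<6 + m}" by auto
          then show "?M (xcell m ?K q) ?T = dmat model q t"
            using dmat_saddle[of m "xcell m ?K q" ?T] m x y by simp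
        qed
        finally show ?thesis using t by (simp add: app_def)
      qed
      ultimately show ?thesis using T by (simp add: app_def)
    qed
    have "(\<Sum>t\<in>model_part True j0 3. (\<Sum>s\<in>xcells m ?V j i. z s * ?M s (xcell m ?V t)) * e t) = 0"
    proof -
      have "(\<Sum>t\<in>model_part True j0 3. (\<Sum>s\<in>xcells m ?V j i. z s * ?M s (xcell m ?V t)) * e t)
        = (\<Sum>s\<in>xcells m ?V j i. z s * (\<Sum>t\<in>model_part True j0 3. ?M s (xcell m ?V t) * e t))"
        by (simp add: sum_distrib_left sum_distrib_right mult.assoc) (rule sum.swap)
      also have "\<dots> = 0"
      proof (rule sum.neutral, rule ballI)
        fix s assume "s \<in> xcells m ?V j i"
        then obtain s' where s': "s' \<in> model_part True j0 2" "s = xcell m ?V s'"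
          using bij_betw_imp_surj_on[OF bijV[of i], unfolded i2] by (metis imageE)
        have "?M s (xcell m ?V t) = dmat model s' t" if "t \<in> model_part True j0 3" for t
          using dmat_xcell[OF V, of s' j0 2 t j0 3] full_col s' that by simp
        then show "z s * (\<Sum>t\<in>model_part True j0 3. ?M s (xcell m ?V t) * e t) = 0" using e(1)[OF s'(1)] by simp
      qed
      finally show ?thesis .
    qed
    moreover have "(\<Sum>s\<in>xcells m ?V j i. z s * ?M s (xcell m ?V t)) * e t
      = - (app (dmat model) (model_part False j0 3) (model_part True j0 3) g t * e t)"
      if "t \<in> model_part True j0 3" for t
    proof -
      have "(\<Sum>s\<in>xcells m ?V j i. z s * ?M s (xcell m ?V t)) = - app (dmat model) (model_part False j0 3) (model_part True j0 3) g t"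
        using ev[OF that] by linarith
      then show ?thesis by simp
    qed
    ultimately show False using e(2) by (simp add: sum_negf)
  qed
  then show ?thesis using f cyc by blast
qed

section \<open>The Betti numbers\<close>

definition count_at :: "(int \<times> int) list => int => int => nat" where
  "count_at L j i = length (filter (\<lambda>p. p = (i, j)) L)"

lemma count_at_simps [simp]:
  "count_at [] j i = 0"
  "count_at ((a, b) # L) j i = of_bool (i = a \<and> j = b) + count_at L j i"
  by (auto simp: count_at_def)

lemma count_at_eq_0: "count_at L j i = 0 <-> (i, j) \<notin> set L"
  by (auto simp: count_at_def filter_empty_conv)

lemma model_betti_int_False: "model_betti_int False j i
    = of_bool (i = 3 \<and> j = 1) + 2 * of_bool (i = 3 \<and> j = 3) + of_bool (i = 3 \<and> j = 5)"
  by (auto simp: model_betti_int_def model_betti_def)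

lemma model_betti_int_True: "model_betti_int True j i = count_at [(0, -3), (1, 1), (2, 1), (3, 3), (3, 3),
    (3, 5), (3, 5), (4, 7), (5, 7), (6, 11)] j i"
  by (simp add: model_betti_int_def model_betti_def)

text \<open>Layer \<open>k\<close> is the homology of the unlink shifted to homological degree
  \<open>3 + m - k\<close>. Each layer loses its upper two classes, of model degrees 5 and 3,
  against those of degrees 3 and 1 in the previous layer. This leaves the upper two classes of the
  first layer and the lower two of the last one.\<close>

definition horizontal_betti :: "nat => nat => (int \<times> int) list" where
  "horizontal_betti m k = [(int m + 2, int m + 4), (int m + 2, int m + 2),
     (3 + int m - int k, int m - 2 * int k + 4), (3 + int m - int k, int m - 2 * int k + 2)]"

lemma betti_bound_horizontal:
  assumes "1 \<le> k" "k \<le> m"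
  shows "betti_bound (dmat (PD m)) (hcells m k j) (count_at (horizontal_betti m k) j)"
  using assms
proof (induction rule: dec_induct)
  case base
  then have m: "1 \<le> m" by simp
  have "hcells m 1 j i = xcells m (low_col m 1) j i" for i
  proof -
    have "hcells m 0 j i = {}" by (auto simp: hcells_def vert_above_def vert_below_def)
    then have "hcells m 1 j i - ncells m 1 0 j i = {}" using hcells_minus_top[of 0 m j i] m by simp
    then show ?thesis using ncells_subset[of 0 1 m j i] ncells_0[of 1 m j i] m by auto
  qed
  moreover have "betti_bound (dmat (PD m)) (xcells m (low_col m 1) j) (count_at (horizontal_betti m 1) j)"
  proof (rule betti_bound_xcells)
    show "low_col m 1 \<subseteq> {6..<6 + m}" by auto
    fix i
    have *: "\<not> vert_above (low_col m 1) m" "inner m (low_col m 1) = {}" "card (low_col m 1) = m - 1"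
      using vert_above_low_col[of 1 m] inner_low_col[of 1 m] m by auto
    obtain a b where ab: "i = a + int m" "j = b + int m" by (metis diff_add_cancel)
    show "count_at (horizontal_betti m 1) j i = model_betti_int (vert_above (low_col m 1) m)
      (j - int (card (low_col m 1)) + of_bool (vert_above (low_col m 1) m) + int (card (inner m (low_col m 1))))
      (i - int (card (low_col m 1)))"
      using m * by (simp add: model_betti_int_False horizontal_betti_def ab of_nat_diff)
  qed
  ultimately show ?case by (simp add: fun_eq_iff[symmetric])
next
  case (step k)
  let ?K = "low_col m (Suc k)"
  define d where "d = int (m - Suc k)"
  have km: "k < m" "int m = d + int k + 1" using step by (simp_all add: d_def of_nat_diff)
  have K: "?K \<subseteq> {6..<6 + m}" "\<not> vert_above ?K m" "card (inner m ?K) = k" "int (card ?K) = d"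
    using vert_above_low_col[of "Suc k" m] inner_low_col[of "Suc k" m] km by (auto simp: d_def)
  \<comment> \<open>The two bidegrees in which the classes of model degrees 5 and 3 of the new layer
    map nontrivially to the previous one.\<close>
  define I where "I = {i. i = 3 + d \<and> (j = 5 + d - int k \<or> j = 3 + d - int k)}"
  have nc: "ncells m (Suc k) 0 j i = xcells m ?K j i" for i using ncells_0[of "Suc k" m j i] km by simp
  have "betti_bound (dmat (PD m)) (\<lambda>i. (hcells m (Suc k) j i - xcells m ?K j i) \<union> xcells m ?K j i)
    (count_at (horizontal_betti m (Suc k)) j)"
  proof (rule betti_bound_Un[where I = I])
    show "betti_bound (dmat (PD m)) (\<lambda>i. hcells m (Suc k) j i - xcells m ?K j i) (count_at (horizontal_betti m k) j)"
      using betti_bound_hcells_minus[of m k j "count_at (horizontal_betti m k) j" 0] step km by (simp add: nc)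
    show "betti_bound (dmat (PD m)) (xcells m ?K j) (\<lambda>i. model_betti_int (vert_above ?K m)
      (j - int (card ?K) + of_bool (vert_above ?K m) + int (card (inner m ?K))) (i - int (card ?K)))"
      by (rule betti_bound_xcells[OF K(1)]) simp
    show "dmat (PD m) p q = 0" if "p \<in> hcells m (Suc k) j i - xcells m ?K j i" "q \<in> xcells m ?K j (i + 1)" for i p q
      using ncells_closed[of "Suc k" m p j i q 0 "i + 1", unfolded nc] that km(1) by (meson DiffD1 DiffD2 Suc_leI)
    show "\<exists>f\<in>supp_on (xcells m ?K j i). app (dmat (PD m)) (xcells m ?K j i) (xcells m ?K j (i + 1)) f = 0 \<and>
      \<not> extends_to_cycle (dmat (PD m)) (\<lambda>i. hcells m (Suc k) j i - xcells m ?K j i) (xcells m ?K j) i f"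
      if "i \<in> I" for i
    proof -
      have "i = 3 + d" "j = 5 + d - int k \<or> j = 3 + d - int k" using that by (auto simp: I_def)
      then obtain j0 where j0: "j0 = 3 \<or> j0 = 5" "j = j0 + d - int k" by auto
      show ?thesis
        using horizontal_not_extends[of "Suc k" m j0 j i] j0 step.hyps \<open>i = 3 + d\<close> km(1) by (simp add: d_def)
    qed
    fix i
    \<comment> \<open>In these coordinates the new layer is the model in homological degree
      \<open>a + 3\<close> and quantum degree \<open>b\<close>.\<close>
    obtain a where a: "i = a + 3 + d" by (metis add.assoc diff_add_cancel)
    obtain b where b: "j = b + d - int k" by (metis add_diff_eq diff_add_cancel)
    define P where "P = count_at [(int m + 2, int m + 4), (int m + 2, int m + 2)] j i"
    have h: "count_at (horizontal_betti m k') j i = P + of_bool (a + d + int k' = int m \<and> b + d + 2 * int k' = int m + int k + 4)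
      + of_bool (a + d + int k' = int m \<and> b + d + 2 * int k' = int m + int k + 2)" for k'
      unfolding horizontal_betti_def P_def count_at_simps a b by (simp add: algebra_simps)
    have I: "i \<in> I <-> a = 0 \<and> (b = 5 \<or> b = 3)" "i - 1 \<in> I <-> a = 1 \<and> (b = 5 \<or> b = 3)"
      by (auto simp: I_def a b)
    have c: "model_betti_int (vert_above ?K m) (j - int (card ?K) + of_bool (vert_above ?K m) + int (card (inner m ?K)))
      (i - int (card ?K)) = of_bool (a = 0 \<and> b = 1) + 2 * of_bool (a = 0 \<and> b = 3) + of_bool (a = 0 \<and> b = 5)"
      using K by (simp add: model_betti_int_False a b)
    have "a + d + int k = int m <-> a = 1" "a + d + int (Suc k) = int m <-> a = 0"
      "b + d + 2 * int k = int m + int k + 4 <-> b = 5" "b + d + 2 * int k = int m + int k + 2 <-> b = 3"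
      "b + d + 2 * int (Suc k) = int m + int k + 4 <-> b = 3" "b + d + 2 * int (Suc k) = int m + int k + 2 <-> b = 1"
      using km(2) by auto
    note h' = this
    show "count_at (horizontal_betti m (Suc k)) j i + of_bool (i \<in> I) + of_bool (i - 1 \<in> I) =
      count_at (horizontal_betti m k) j i + model_betti_int (vert_above ?K m)
      (j - int (card ?K) + of_bool (vert_above ?K m) + int (card (inner m ?K))) (i - int (card ?K))"
      unfolding h c I h' by (cases "a = 0"; cases "b = 5"; cases "b = 3") simp_all
  qed auto
  moreover have "(hcells m (Suc k) j i - xcells m ?K j i) \<union> xcells m ?K j i = hcells m (Suc k) j i" for i
    using xcells_subset_hcells[of "Suc k" "Suc k" m j i] km by auto
  ultimately show ?case by simp
qed

text \<open>Degrees before normalization. The first two entries come from the last horizontal layer;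
  the others are the square knot shifted by \<open>q\<close> and \<open>q - 1\<close>, with one of
  its two classes in each of the model bidegrees (3, 3) and (3, 5) cancelled by the saddle.\<close>

definition pretzel_betti :: "nat => (int \<times> int) list" where
  "pretzel_betti m = (let q = int m in [(3, 4 - q), (3, 2 - q), (q, q - 4), (q + 1, q), (q + 2, q),
     (q + 3, q + 2), (q + 3, q + 4), (q + 4, q + 6), (q + 5, q + 6), (q + 6, q + 10)])"

lemma betti_bound_pretzel:
  assumes m: "1 \<le> m"
  shows "betti_bound (dmat (PD m)) (gcells (PD m) j) (count_at (pretzel_betti m) j)"
proof -
  let ?V = "full_col m"
  \<comment> \<open>The two classes left from the first layer; each cancels a class of the vertical
    part one homological degree higher.\<close>
  define I where "I = {i. i = int m + 2 \<and> (j = int m + 2 \<or> j = int m + 4)}"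
  have "betti_bound (dmat (PD m)) (\<lambda>i. xcells m ?V j i \<union> hcells m m j i) (count_at (pretzel_betti m) j)"
  proof (rule betti_bound_Un[where I = I])
    show "betti_bound (dmat (PD m)) (xcells m ?V j) (\<lambda>i. model_betti_int (vert_above ?V m)
      (j - int (card ?V) + of_bool (vert_above ?V m) + int (card (inner m ?V))) (i - int (card ?V)))"
      by (rule betti_bound_xcells) simp_all
    show "betti_bound (dmat (PD m)) (hcells m m j) (count_at (horizontal_betti m m) j)"
      by (rule betti_bound_horizontal) (use m in simp_all)
    show "dmat (PD m) p q = 0" if "p \<in> xcells m ?V j i" "q \<in> hcells m m j (i + 1)" for i p q
      by (rule dmat_full_hcells[OF that])
    show "\<exists>f\<in>supp_on (hcells m m j i). app (dmat (PD m)) (hcells m m j i) (hcells m m j (i + 1)) f = 0 \<and>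
      \<not> extends_to_cycle (dmat (PD m)) (xcells m ?V j) (hcells m m j) i f" if "i \<in> I" for i
    proof -
      have "i = int m + 2" "j = 3 + int m - 1 \<or> j = 5 + int m - 1" using that by (auto simp: I_def)
      then show ?thesis using saddle_not_extends[OF m, of 3 j i] saddle_not_extends[OF m, of 5 j i] by blast
    qed
    fix i
    obtain a b where ab: "i = a + int m" "j = b + int m" by (metis diff_add_cancel)
    show "count_at (pretzel_betti m) j i + of_bool (i \<in> I) + of_bool (i - 1 \<in> I) =
      model_betti_int (vert_above ?V m) (j - int (card ?V) + of_bool (vert_above ?V m) + int (card (inner m ?V)))
      (i - int (card ?V)) + count_at (horizontal_betti m m) j i"
      using full_col[of m]
      by (simp add: model_betti_int_True horizontal_betti_def pretzel_betti_def Let_def I_def ab) (auto simp: of_bool_def)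
  qed (use xcells_hcells_disjoint in auto)
  then show ?thesis by (simp add: gcells_split[symmetric])
qed

text \<open>Except for two adjacent pairs all classes are isolated in their quantum degree. For each
  pair the lower class is confirmed in the vertical subcomplex, and the upper one then follows by
  \<open>betti_next\<close>.\<close>

lemma betti_pretzel:
  assumes m: "5 \<le> m"
  shows "betti (dmat (PD m)) (gcells (PD m) j) i (count_at (pretzel_betti m) j i)"
proof -
  let ?V = "full_col m" and ?M = "dmat (PD m)" and ?c = "count_at (pretzel_betti m)"
  have b: "betti_bound ?M (gcells (PD m) j) (?c j)" for j by (rule betti_bound_pretzel) (use m in simp)
  have cx: "complex ?M (gcells (PD m) j)" for j by (rule complex_dmat[OF alternating_pretzel])
  \<comment> \<open>The model pairing shows that the class is nonzero in the vertical part. The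
    horizontal quotient has no homology one degree below in this quantum degree, so the class stays
    nonzero in the whole complex.\<close>
  have low: "betti ?M (gcells (PD m) j) i (?c j i)"
    if ij: "i = i0 + int m" "j = j0 + int m - 1" "(i0, j0) = (1, 1) \<or> (i0, j0) = (4, 7)" for i j i0 j0
  proof -
    have bij: "bij_betw (xcell m ?V) (model_part True j0 (i' - int m)) (xcells m ?V j i')" for i'
      using bij_xcell[of ?V m j j0 i' "i' - int m"] full_col[of m] by (simp add: ij)
    have rk: "rk ?M (xcells m ?V j i') (xcells m ?V j i'')
        = rk (dmat model) (model_part True j0 (i' - int m)) (model_part True j0 (i'' - int m))" for i' i''
      by (rule rk_transport[OF finite_model_part finite_model_part bij bij])
         (use dmat_xcell[of ?V m] full_col(1)[of m] in auto)
    have card: "card (xcells m ?V j i) = card (model_part True j0 i0)"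
      using bij_betw_same_card[OF bij[of i]] by (simp add: ij)
    have e: "i - int m = i0" "i + 1 - int m = i0 + 1" "i - 1 - int m = i0 - 1" by (simp_all add: ij)
    have "rk ?M (xcells m ?V j i \<union> hcells m m j i) (xcells m ?V j (i + 1) \<union> hcells m m j (i + 1))
      + rk ?M (xcells m ?V j (i - 1) \<union> hcells m m j (i - 1)) (xcells m ?V j i \<union> hcells m m j i) + 1
      \<le> card (xcells m ?V j i \<union> hcells m m j i)"
    proof (rule betti_lower_sub)
      show "complex ?M (\<lambda>i. xcells m ?V j i \<union> hcells m m j i)" using cx[of j] by (simp add: gcells_split[symmetric])
      show "betti_bound ?M (hcells m m j) (count_at (horizontal_betti m m) j)"
        by (rule betti_bound_horizontal) (use m in simp_all)
      show "count_at (horizontal_betti m m) j (i - 1) = 0"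
        using ij m by (auto simp: count_at_eq_0 horizontal_betti_def)
      show "rk ?M (xcells m ?V j i) (xcells m ?V j (i + 1)) + rk ?M (xcells m ?V j (i - 1)) (xcells m ?V j i) + 1
        \<le> card (xcells m ?V j i)"
        unfolding rk card e by (rule model_lower[OF ij(3)])
    qed (use xcells_hcells_disjoint dmat_full_hcells in auto)
    moreover have "?c j i = 1" using ij m by (auto simp: pretzel_betti_def Let_def)
    ultimately show ?thesis
      by (intro betti_lower_imp_eq[OF b]) (simp add: gcells_split[symmetric])
  qed
  have c0: "?c j i = 0 <-> (i, j) \<notin> set (pretzel_betti m)" for i j by (rule count_at_eq_0)
  consider "i = int m + 1" "j = int m" | "i = int m + 2" "j = int m"
    | "i = int m + 4" "j = int m + 6" | "i = int m + 5" "j = int m + 6"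
    | "(i, j) \<in> {(3, 4 - int m), (3, 2 - int m), (int m, int m - 4), (int m + 3, int m + 2), (int m + 3, int m + 4),
      (int m + 6, int m + 10)}"
    | "(i, j) \<notin> set (pretzel_betti m)"
    unfolding pretzel_betti_def Let_def by auto
  then show ?thesis
  proof cases
    case 1
    then show ?thesis using low[of i 1 j 1] by simp
  next
    case 2
    have "betti ?M (gcells (PD m) j) (int m + 1) (?c j (int m + 1))" using low[of "int m + 1" 1 j 1] 2 by simp
    moreover have "?c j (int m + 1 + 2) = 0" unfolding c0 using 2 m by (auto simp: pretzel_betti_def Let_def)
    ultimately show ?thesis using betti_next[OF b cx, of j "int m + 1"] 2 by (simp add: algebra_simps)
  next
    case 3
    then show ?thesis using low[of i 4 j 7] by simp
  next
    case 4
    have "betti ?M (gcells (PD m) j) (int m + 4) (?c j (int m + 4))" using low[of "int m + 4" 4 j 7] 4 by simp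
    moreover have "?c j (int m + 4 + 2) = 0" unfolding c0 using 4 m by (auto simp: pretzel_betti_def Let_def)
    ultimately show ?thesis using betti_next[OF b cx, of j "int m + 4"] 4 by (simp add: algebra_simps)
  next
    \<comment> \<open>The bound on \<open>m\<close> separates \<open>(3, 4 - m)\<close> from
      \<open>(m, m - 4)\<close>, which for \<open>m = 4\<close> would be adjacent in quantum degree
      0.\<close>
    case 5
    then have "(i - 1, j) \<notin> set (pretzel_betti m)" "(i + 1, j) \<notin> set (pretzel_betti m)"
      using m by (auto simp: pretzel_betti_def Let_def)
    then show ?thesis by (intro betti_isolated[OF b cx]) (simp add: c0)
  next
    case 6
    then show ?thesis by (intro betti_isolated[OF b cx]) (simp add: c0)
  qed
qed

section \<open>Signs of the crossings\<close>

text \<open>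
  Of the two strand ends at a point, every orientation directs one inwards and the other
  outwards, so two orientations agree on both strands or on none of them.
\<close>

lemma orientations_agree:
  assumes \<omega>: "orientation D \<omega>" and \<sigma>: "orientation D \<sigma>"
    and s: "s \<in> strands D" "t \<in> strands D" "s \<noteq> t"
    and e: "strand_ends D s = (a, b)" "strand_ends D t = (c, d)" "a \<noteq> b" "c \<noteq> d" "{a, b} \<inter> {c, d} \<noteq> {}"
  shows "(\<omega> s <-> \<sigma> s) <-> (\<omega> t <-> \<sigma> t)"
proof -
  have "strand_start D \<rho> s \<noteq> strand_start D \<rho> t" "strand_end D \<rho> s \<noteq> strand_end D \<rho> t" if "orientation D \<rho>" for \<rho>
    using that s by (auto simp: orientation_def bij_betw_def inj_on_def)
  from this[OF \<omega>] this[OF \<sigma>] show ?thesis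
    using e by (auto simp: strand_start_def strand_end_def split: if_splits)
qed

lemma strand_ends_PD:
  assumes "k < 6 + m"
  shows "strand_ends (PD m) (Under k) = (if k < 3 then ((0, k, True), (0, Suc k, False))
       else if k < 6 then ((1, k - 3, False), (1, Suc (k - 3), True))
       else ((2, k - 6, True), (2, Suc (k - 6), False)))"
    "strand_ends (PD m) (Over k) = (if k < 3 then ((0, Suc k, True), (0, k, False))
       else if k < 6 then ((1, k - 3, True), (1, Suc (k - 3), False))
       else ((2, Suc (k - 6), True), (2, k - 6, False)))"
  using assms crossings_pretzel_nth[of k m] by (auto simp: pretzel_crossing_def Let_def)

text \<open>\<open>\<tau>\<close> tells where the given orientation agrees with the standard one and
  is constant along strands that share an endpoint. Following the arcs and columns shows that it
  takes the same value on both strands of every crossing, so the sign is the standard one.\<close>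

lemma crossing_sign:
  assumes \<omega>: "orientation (PD m) \<omega>" and m: "1 \<le> m" and k: "k < 6 + m"
  shows "\<omega> (Over k) = \<omega> (Under k) <-> std_orient (even m) (Over k) = std_orient (even m) (Under k)"
proof -
  define \<tau> where "\<tau> s <-> (\<omega> s <-> std_orient (even m) s)" for s
  have agree: "\<tau> s <-> \<tau> t"
    if "s \<in> strands (PD m)" "t \<in> strands (PD m)" "s \<noteq> t" "strand_ends (PD m) s = (a, b)" "strand_ends (PD m) t = (c, d)"
      "a \<noteq> b" "c \<noteq> d" "{a, b} \<inter> {c, d} \<noteq> {}" for s t a b c d
    unfolding \<tau>_def by (rule orientations_agree[OF \<omega> orientation_std_orient that])
  have mem: "Under l \<in> strands (PD m) <-> l < 6 + m" "Over l \<in> strands (PD m) <-> l < 6 + m"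
    "Arc l \<in> strands (PD m) <-> l < 6" for l
    by (auto simp: strands_pretzel)
  have ends: "strand_ends (PD m) (Arc 0) = ((0, 0, True), (1, 0, False))"
     "strand_ends (PD m) (Arc (Suc 0)) = ((1, 0, True), (2, 0, False))"
     "strand_ends (PD m) (Arc 2) = ((2, 0, True), (0, 0, False))"
     "strand_ends (PD m) (Arc 3) = ((0, 3, True), (1, 3, False))"
     "strand_ends (PD m) (Arc 4) = ((1, 3, True), (2, m, False))"
     "strand_ends (PD m) (Arc 5) = ((2, m, True), (0, 3, False))"
    by (simp_all add: pretzel_def)
  have column: "\<tau> (Under l) = \<tau> (Over (Suc l))" "\<tau> (Over l) = \<tau> (Under (Suc l))"
    if "l < 2 \<or> 3 \<le> l \<and> l < 5 \<or> 6 \<le> l \<and> l < 5 + m" for l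
  proof -
    have l: "l < 6 + m" "Suc l < 6 + m" using that by auto
    show "\<tau> (Under l) = \<tau> (Over (Suc l))"
      by (rule agree[OF mem(1)[THEN iffD2, OF l(1)] mem(2)[THEN iffD2, OF l(2)] _ surjective_pairing surjective_pairing])
         (use that in \<open>auto simp: strand_ends_PD[OF l(1)] strand_ends_PD[OF l(2)] Suc_diff_le simp del: strand_ends.simps\<close>)
    show "\<tau> (Over l) = \<tau> (Under (Suc l))"
      by (rule agree[OF mem(2)[THEN iffD2, OF l(1)] mem(1)[THEN iffD2, OF l(2)] _ surjective_pairing surjective_pairing])
         (use that in \<open>auto simp: strand_ends_PD[OF l(1)] strand_ends_PD[OF l(2)] Suc_diff_le simp del: strand_ends.simps\<close>)
  qed
  have arc: "\<tau> s = \<tau> (Arc n)"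
    if "s \<in> strands (PD m)" "n < 6" "s \<noteq> Arc n" "strand_ends (PD m) s = (a, b)" "a \<noteq> b"
      "case strand_ends (PD m) (Arc n) of (c, d) => c \<noteq> d \<and> {a, b} \<inter> {c, d} \<noteq> {}" for s n a b
    using agree[of s "Arc n" a b "fst (strand_ends (PD m) (Arc n))" "snd (strand_ends (PD m) (Arc n))"] that mem(3)
    by (auto simp: case_prod_beta simp del: strand_ends.simps)
  have m0: "0 < m" using m by simp
  note U = strand_ends_PD(1)[of _ m] and O = strand_ends_PD(2)[of _ m]
  have last: "strand_ends (PD m) (Under (5 + m)) = ((2, m - 1, True), (2, m, False))"
    "strand_ends (PD m) (Over (5 + m)) = ((2, m, True), (2, m - 1, False))"
    using m U[of "5 + m"] O[of "5 + m"] by (auto simp del: strand_ends.simps)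
  have "\<tau> (Under 0) = \<tau> (Arc 0)"
    by (rule arc[OF _ _ _ surjective_pairing])
      (use m0 in \<open>auto simp: mem U[of 0] ends simp del: strand_ends.simps\<close>)
  moreover have "\<tau> (Under 3) = \<tau> (Arc 0)"
    by (rule arc[OF _ _ _ surjective_pairing])
      (use m0 in \<open>auto simp: mem U[of 3] ends simp del: strand_ends.simps\<close>)
  moreover have "\<tau> (Over 3) = \<tau> (Arc (Suc 0))"
    by (rule arc[OF _ _ _ surjective_pairing])
      (use m0 in \<open>auto simp: mem O[of 3] ends simp del: strand_ends.simps\<close>)
  moreover have "\<tau> (Over 6) = \<tau> (Arc (Suc 0))"
    by (rule arc[OF _ _ _ surjective_pairing])
      (use m0 in \<open>auto simp: mem O[of 6] ends simp del: strand_ends.simps\<close>)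
  moreover have "\<tau> (Under 6) = \<tau> (Arc 2)"
    by (rule arc[OF _ _ _ surjective_pairing])
      (use m0 in \<open>auto simp: mem U[of 6] ends simp del: strand_ends.simps\<close>)
  moreover have "\<tau> (Over 0) = \<tau> (Arc 2)"
    by (rule arc[OF _ _ _ surjective_pairing])
      (use m0 in \<open>auto simp: mem O[of 0] ends simp del: strand_ends.simps\<close>)
  moreover have "\<tau> (Over 2) = \<tau> (Arc 3)"
    by (rule arc[OF _ _ _ surjective_pairing])
      (use m0 in \<open>auto simp: mem O[of 2] ends simp del: strand_ends.simps\<close>)
  moreover have "\<tau> (Over 5) = \<tau> (Arc 3)"
    by (rule arc[OF _ _ _ surjective_pairing])
      (use m0 in \<open>auto simp: mem O[of 5] ends simp del: strand_ends.simps\<close>)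
  moreover have "\<tau> (Under 5) = \<tau> (Arc 4)"
    by (rule arc[OF _ _ _ surjective_pairing])
      (use m0 in \<open>auto simp: mem U[of 5] ends simp del: strand_ends.simps\<close>)
  moreover have "\<tau> (Under 2) = \<tau> (Arc 5)"
    by (rule arc[OF _ _ _ surjective_pairing])
      (use m0 in \<open>auto simp: mem U[of 2] ends simp del: strand_ends.simps\<close>)
  moreover have "\<tau> (Under (5 + m)) = \<tau> (Arc 4)" "\<tau> (Over (5 + m)) = \<tau> (Arc 5)"
    using arc[OF _ _ _ last(1), of 4] arc[OF _ _ _ last(2), of 5] by (simp_all add: mem ends del: strand_ends.simps)
  ultimately have arcs: "\<tau> (Under 0) = \<tau> (Under 3)" "\<tau> (Over 3) = \<tau> (Over 6)" "\<tau> (Under 6) = \<tau> (Over 0)"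
    "\<tau> (Over 2) = \<tau> (Over 5)" "\<tau> (Under 5) = \<tau> (Under (5 + m))" "\<tau> (Over (5 + m)) = \<tau> (Under 2)"
    by simp_all
  \<comment> \<open>Down the column, each under strand continues as the next over strand and vice
    versa. Equal values at the first crossing therefore persist.\<close>
  have third: "\<tau> (Under (6 + l)) = \<tau> (Over 0) \<and> \<tau> (Over (6 + l)) = \<tau> (Over 3)" if "l < m" "\<tau> (Over 0) = \<tau> (Over 3)" for l
    using that(1)
  proof (induction l)
    case 0
    then show ?case using arcs by simp
  next
    case (Suc l)
    then show ?case using column[of "6 + l"] that(2) by simp
  qed
  have c: "\<tau> (Under 0) = \<tau> (Over 1)" "\<tau> (Over 0) = \<tau> (Under 1)" "\<tau> (Under 1) = \<tau> (Over 2)" "\<tau> (Over 1) = \<tau> (Under 2)"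
    "\<tau> (Under 3) = \<tau> (Over 4)" "\<tau> (Over 3) = \<tau> (Under 4)" "\<tau> (Under 4) = \<tau> (Over 5)" "\<tau> (Over 4) = \<tau> (Under 5)"
    using column[of 0] column[of 1] column[of 3] column[of 4] by (simp_all add: numeral_eq_Suc)
  have o: "\<tau> (Over 0) = \<tau> (Over 3)" using c arcs by simp
  have "5 + m = 6 + (m - 1)" "m - 1 < m" using m by auto
  then have l: "\<tau> (Under (5 + m)) = \<tau> (Over 0)" using third[OF _ o, of "m - 1"] by metis
  have "\<tau> (Over k) = \<tau> (Under k)"
  proof (cases "k < 6")
    case True
    then show ?thesis using less_6_cases[OF True] c arcs o l by (elim disjE) simp_all
  next
    case False
    then have "k = 6 + (k - 6)" "k - 6 < m" using k by auto
    then show ?thesis using third[OF _ o, of "k - 6"] o by metis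
  qed
  then show ?thesis by (auto simp: \<tau>_def)
qed

text \<open>With \<open>crossing_sign\<close> the count can be made for the standard orientation, in
  which exactly one of the first two columns is negative.\<close>

lemma n_neg_n_pos:
  assumes \<omega>: "orientation (PD m) \<omega>" and m: "1 \<le> m"
  shows "n_neg (PD m) \<omega> = 3" "n_pos (PD m) \<omega> = m + 3"
proof -
  \<comment> \<open>The negative crossings: the first column if \<open>m\<close> is even, whose
    strands are parallel then, and the second column if \<open>m\<close> is odd.\<close>
  define N where "N = {if even m then 0 else 3..<(if even m then 3 else 6 :: nat)}"
  have eq: "\<omega> (Over k) = \<omega> (Under k) <-> k \<notin> N" if "k < 6 + m" for k
    unfolding crossing_sign[OF \<omega> m that] by (auto simp: N_def)
  have N: "N \<subseteq> {..<6 + m}" "card N = 3" using m by (auto simp: N_def)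
  have "{k. k < n_crossings (PD m) \<and> \<omega> (Over k) \<noteq> \<omega> (Under k)} = N"
    using eq N(1) unfolding n_crossings_pretzel by blast
  then show "n_neg (PD m) \<omega> = 3" using N by (simp add: n_neg_def)
  have "{k. k < n_crossings (PD m) \<and> \<omega> (Over k) = \<omega> (Under k)} = {..<6 + m} - N"
    using eq unfolding n_crossings_pretzel by blast
  then show "n_pos (PD m) \<omega> = m + 3"
    using N card_Diff_subset[of N "{..<6 + m}"] finite_subset[OF N(1)] by (simp add: n_pos_def)
qed

text \<open>With three negative and \<open>m + 3\<close> positive crossings the normalization shifts
  the homological degree by 3 and the quantum degree by \<open>m - 3\<close>.\<close>

lemma Kh_iso_pretzel:
  assumes \<omega>: "orientation (PD m) \<omega>" and m: "5 \<le> m"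
    and ks: "\<And>j. count_at (pretzel_betti m) (j - int m + 3) (i + 3) = length (filter (\<lambda>x. x = j) ks)"
  shows "Kh_iso (PD m) \<omega> i ks"
proof -
  have n: "n_neg (PD m) \<omega> = 3" "n_pos (PD m) \<omega> = m + 3" using n_neg_n_pos[OF \<omega>] m by auto
  have "quotient_iso (cycles (PD m) (i + 3) (j - int m + 3)) (boundaries (PD m) (i + 3) (j - int m + 3)) (graded_sum ks j)" for j
    by (rule quotient_iso_betti[OF alternating_pretzel])
       (use betti_pretzel[OF m, of "j - int m + 3" "i + 3"] ks[of j] in \<open>simp add: length_filter_conv_card\<close>)
  then show ?thesis by (simp add: Kh_iso_def Let_def n algebra_simps)
qed

theorem theorem1:
  fixes q :: int and \<omega> :: "strand \<Rightarrow> bool"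
  assumes "q \<ge> 5"
    and "orientation (pretzel 3 (-3) q) \<omega>"
  shows "Kh_iso (pretzel 3 (-3) q) \<omega> 0 [-1, 1] \<and>
    (\<forall>i. 0 < i \<and> i \<le> q - 4 \<longrightarrow> Kh_iso (pretzel 3 (-3) q) \<omega> i []) \<and>
    Kh_iso (pretzel 3 (-3) q) \<omega> (q - 3) [1 + 2 * (q - 4)] \<and>
    Kh_iso (pretzel 3 (-3) q) \<omega> (q - 2) [5 + 2 * (q - 4)] \<and>
    Kh_iso (pretzel 3 (-3) q) \<omega> (q - 1) [5 + 2 * (q - 4)] \<and>
    Kh_iso (pretzel 3 (-3) q) \<omega> q [7 + 2 * (q - 4), 9 + 2 * (q - 4)] \<and>
    Kh_iso (pretzel 3 (-3) q) \<omega> (q + 1) [11 + 2 * (q - 4)] \<and>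
    Kh_iso (pretzel 3 (-3) q) \<omega> (q + 2) [11 + 2 * (q - 4)] \<and>
    Kh_iso (pretzel 3 (-3) q) \<omega> (q + 3) [15 + 2 * (q - 4)] \<and>
    (\<forall>j. j < 0 \<or> j > q + 3 \<longrightarrow> Kh_iso (pretzel 3 (-3) q) \<omega> j [])"
proof -
  obtain m where q: "q = int m" using assms(1) by (metis nonneg_int_cases order_trans zero_le_numeral)
  have m: "5 \<le> m" using assms(1) q by simp
  have \<omega>: "orientation (PD m) \<omega>" using assms(2) q by simp
  show ?thesis
    unfolding q
    by (intro conjI allI impI Kh_iso_pretzel[OF \<omega> m]) (use m in \<open>auto simp: pretzel_betti_def Let_def\<close>)
qed

end
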